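(* Let $d\in\{2,3\}$ and let $\xi$ be a white noise on $\mathbb{R}^d$. Let $\mathcal{H}$ be the random self-adjoint operator on $L^2(\mathbb{R}^d,dx)$ obtained as the limit in probability, in the strong resolvent sense, of $\mathcal{H}_\varepsilon=-\Delta+\xi_\varepsilon+C_\varepsilon$ as $\varepsilon\downarrow0$, where $C_\varepsilon$ is the renormalisation constant specified in the context. Then almost surely the spectrum of $\mathcal{H}$ is $\mathbb{R}$.
   Context: Mollification: $\varrho$ is an even smooth function on $\mathbb{R}^d$, compactly supported in the unit ball, integrating to $1$; $\varrho_\varepsilon(x)=\varepsilon^{-d}\varrho(x/\varepsilon)$, $\xi_\varepsilon=\xi*\varrho_\varepsilon$. Almost surely, for every $\varepsilon\in(0,1)$, $-\Delta+\xi_\varepsilon+C_\varepsilon$ is essentially self-adjoint on $C_c^\infty(\mathbb{R}^d)$, and $\mathcal{H}_\varepsilon$ denotes its self-adjoint extension. Convergence in probability in the strong resolvent sense means that for all $z\in\mathbb{C}\setminus\mathbb{R}$ and $f\in L^2$, $(\mathcal{H}_\varepsilon-z)^{-1}f\to(\mathcal{H}-z)^{-1}f$ in $L^2$ in probability. The limit $\mathcal{H}$ (the Anderson Hamiltonian with white noise potential) exists, and is self-adjoint on a dense subset of $L^2$. Renormalisation constant, $d=2$: $C_\varepsilon=\mathbb{E}[|\nabla G*\xi_\varepsilon(0)|^2]$ with $G(x)=-\frac{\log|x|}{2\pi}\chi(x)$, $\chi$ a smooth radial cutoff equal to $1$ on $B(0,1)$ and supported in $B(0,2)$. Renormalisation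 constant, $d=3$: $C_\varepsilon=c_\varepsilon+c^{(1)}_\varepsilon$ where $(c_\varepsilon,c^{(1)}_\varepsilon)\in\mathbb{R}^2$ are deterministic and fixed as follows. Write $p_a(x)=(1+|x|)^a$. Fix a small $\kappa>0$ and $\alpha=-\frac32-\kappa$, $b\in(0,\kappa/4)$. Let $\mathcal{U}=\{\mathbf{1},\ \mathcal{I}(\Xi),\ \mathcal{I}(\Xi\mathcal{I}(\Xi)),\ X_i,\ \mathcal{I}(\Xi\mathcal{I}(\Xi\mathcal{I}(\Xi))),\ \mathcal{I}(\Xi X_i): i=1,2,3\}$ and $\mathcal{F}=\{\Xi\tau:\tau\in\mathcal{U}\}$ (with $\Xi\mathbf 1=\Xi$) be sets of formal symbols; homogeneities are $|\mathbf 1|=0$, $|X_i|=1$, $|\Xi|=\alpha$, $|\Xi\tau|=\alpha+|\tau|$, $|\mathcal{I}(\tau)|=|\tau|+2$. $\mathcal{T}$ is the vector space with basis $\mathcal{U}\cup\mathcal{F}$, $\mathcal{T}_\zeta$ the span of basis elements of homogeneity $\zeta$, $\mathcal{A}$ the set of homogeneities. $\mathcal{G}$ is the group of linear maps $\Gamma$ of $\mathcal{T}$ such that, for some $h\in\mathbb{R}^3$, $\Gamma\mathbf 1=\mathbf 1$, $\Gamma X_i=X_i+h_i\mathbf 1$, $\Gamma(\Xi\tau)=\Xi\,\Gamma\tau$ for $\tau\in\mathcal{U}$, and $\Gamma\mathcal{I}(\sigma)-\mathcal{I}(\Gamma\sigma)$ is a linear combination of $X^k$ with $|k|<|\sigma|+2$.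 Let $\bar K_+$ be a compactly supported kernel, smooth away from $0$, coinciding near $0$ with the Green's function of the Laplacian in dimension $3$. An admissible model $q=(\Pi,\Gamma)$ consists of linear maps $\Pi_x:\mathcal{T}\to\mathcal{D}'(\mathbb{R}^3)$ and $\Gamma_{x,y}\in\mathcal{G}$ with $\Pi_y=\Pi_x\Gamma_{x,y}$, $\Gamma_{x,y}\Gamma_{y,z}=\Gamma_{x,z}$, $\Pi_x\mathbf 1=1$, $\Pi_xX_i(y)=y_i-x_i$, $\Pi_x(\Xi X_i)=(\cdot_i-x_i)\Pi_x\Xi$, and $\Pi_x\mathcal{I}(\sigma)(y)=\langle\Pi_x\sigma,\bar K_+(y-\cdot)\rangle-\sum_{|k|<|\sigma|+2}\frac{(y-x)^k}{k!}\langle\Pi_x\sigma,\partial^k\bar K_+(x-\cdot)\rangle$. With $\mathcal{B}_r$ the set of functions supported in the unit ball with $C^r$-norm at most $1$ ($r$ a fixed integer larger than $|\alpha|$) and $\varphi_x^\lambda(y)=\lambda^{-3}\varphi((y-x)/\lambda)$, admissible models are equipped with the metric $\sup_{x}\sup_{\varphi\in\mathcal{B}_r}\sup_{\lambda\in(0,1]}\sup_{\zeta\in\mathcal{A},\tau\in\mathcal{T}_\zeta}\frac{|\langle\Pi_x\tau-\bar\Pi_x\tau,\varphi_x^\lambda\rangle|}{\lambda^\zeta p_\kappa(x)\|\tau\|}$, and $\mathscr{M}$ is the closure of the models for which all $\Pi_x\tau$ are smooth functions. For a smooth function $h$ growing (with its derivatives) at most like $p_b$ and $(c,c^{(1)})\in\mathbb{R}^2$,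 the renormalised canonical model is the admissible model $\hat\Pi$ with $\hat\Pi_x\Xi=h$, $\hat\Pi_x(\Xi\mathcal{I}(\Xi))=h\,\hat\Pi_x\mathcal{I}(\Xi)-c$, $\hat\Pi_x(\Xi\mathcal{I}(\Xi\mathcal{I}(\Xi)))=h\,\hat\Pi_x\mathcal{I}(\Xi\mathcal{I}(\Xi))-c\,\hat\Pi_x\mathcal{I}(\Xi)$, $\hat\Pi_x(\Xi\mathcal{I}(\Xi\mathcal{I}(\Xi\mathcal{I}(\Xi))))=h\,\hat\Pi_x\mathcal{I}(\Xi\mathcal{I}(\Xi\mathcal{I}(\Xi)))-c\,\hat\Pi_x\mathcal{I}(\Xi\mathcal{I}(\Xi))-c^{(1)}$, $\hat\Pi_x(\Xi\mathcal{I}(\Xi X_i))=h\,\hat\Pi_x\mathcal{I}(\Xi X_i)-c\,\hat\Pi_xX_i$. The deterministic constants $(c_\varepsilon,c_\varepsilon^{(1)})$ are fixed so that the renormalised canonical model $Q_\varepsilon(\xi)$ built from $h=\xi_\varepsilon$ and $(c,c^{(1)})=(c_\varepsilon,c^{(1)}_\varepsilon)$ converges in $\mathscr{M}$, in $L^p(\mathbb{P})$ for every $p>1$, as $\varepsilon\downarrow0$ (such a choice is known to exist by work of Hairer–Pardoux and Hairer–Labbé). *)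

theory Defs
  imports "HOL-Probability.Probability"
begin

section \<open>Smooth functions, test functions and distributions\<close>

definition pd :: "'n::finite \<Rightarrow> (real^'n \<Rightarrow> 'b::real_normed_vector) \<Rightarrow> real^'n \<Rightarrow> 'b" where
  "pd i f x = frechet_derivative f (at x) (axis i 1)"

definition pds :: "'n::finite list \<Rightarrow> (real^'n \<Rightarrow> 'b::real_normed_vector) \<Rightarrow> real^'n \<Rightarrow> 'b" where
  "pds is f = foldr pd is f"

definition grad :: "(real^'n::finite \<Rightarrow> real) \<Rightarrow> real^'n \<Rightarrow> real^'n" where
  "grad f x = (\<chi> i. pd i f x)"

definition laplacian :: "(real^'n::finite \<Rightarrow> 'b::real_normed_vector) \<Rightarrow> real^'n \<Rightarrow> 'b" where
  "laplacian f x = (\<Sum>i\<in>UNIV. pd i (pd i f) x)"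

(* Intended for open S. *)
definition smooth_on :: "(real^'n::finite) set \<Rightarrow> (real^'n \<Rightarrow> 'b::real_normed_vector) \<Rightarrow> bool" where
  "smooth_on S f \<longleftrightarrow> (\<forall>is. \<forall>x\<in>S. pds is f differentiable (at x))"

definition support :: "(real^'n::finite \<Rightarrow> 'b::real_normed_vector) \<Rightarrow> (real^'n) set" where
  "support f = closure {x. f x \<noteq> 0}"

definition test_function :: "(real^'n::finite \<Rightarrow> 'b::real_normed_vector) \<Rightarrow> bool" where
  "test_function f \<longleftrightarrow> smooth_on UNIV f \<and> compact (support f)"

text \<open>Multi-indices are functions \<open>k :: 'n \<Rightarrow> nat\<close>. The order in which \<open>mderiv\<close> takes the partial
  derivatives is unspecified; it does not matter where the function is smooth.\<close>

definition msize :: "('n::finite \<Rightarrow> nat) \<Rightarrow> nat" where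
  "msize k = (\<Sum>i\<in>UNIV. k i)"

definition mfact :: "('n::finite \<Rightarrow> nat) \<Rightarrow> real" where
  "mfact k = (\<Prod>i\<in>UNIV. fact (k i))"

definition mpow :: "real^'n::finite \<Rightarrow> ('n \<Rightarrow> nat) \<Rightarrow> real" where
  "mpow v k = (\<Prod>i\<in>UNIV. (v $ i) ^ k i)"

definition mderiv :: "('n::finite \<Rightarrow> nat) \<Rightarrow> (real^'n \<Rightarrow> real) \<Rightarrow> real^'n \<Rightarrow> real" where
  "mderiv k f = pds (SOME is. \<forall>i. count_list is i = k i) f"

text \<open>Distributions act on real test functions; the value of a distribution on a function
  which is not a test function is irrelevant.\<close>

type_synonym 'n distn = "(real^'n \<Rightarrow> real) \<Rightarrow> real"

definition distribution :: "'n::finite distn \<Rightarrow> bool" where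
  "distribution T \<longleftrightarrow>
     (\<forall>\<phi> \<psi> a b. test_function \<phi> \<longrightarrow> test_function \<psi> \<longrightarrow>
        T (\<lambda>x. a * \<phi> x + b * \<psi> x) = a * T \<phi> + b * T \<psi>) \<and>
     (\<forall>K. compact K \<longrightarrow> (\<exists>A m. \<forall>\<phi> B. test_function \<phi> \<longrightarrow> support \<phi> \<subseteq> K \<longrightarrow>
        (\<forall>is x. length is \<le> m \<longrightarrow> \<bar>pds is \<phi> x\<bar> \<le> B) \<longrightarrow> \<bar>T \<phi>\<bar> \<le> A * B))"

definition dist_of_fun :: "(real^'n::finite \<Rightarrow> real) \<Rightarrow> 'n distn" where
  "dist_of_fun g \<phi> = (LINT y|lborel. g y * \<phi> y)"

definition rescale :: "real \<Rightarrow> (real^'n::finite \<Rightarrow> real) \<Rightarrow> real^'n \<Rightarrow> real" where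
  "rescale l f x = f ((1 / l) *\<^sub>R x) / l ^ CARD('n)"


section \<open>White noise and its mollification\<close>

definition centred_gaussian :: "'w measure \<Rightarrow> ('w \<Rightarrow> real) \<Rightarrow> bool" where
  "centred_gaussian M X \<longleftrightarrow> X \<in> borel_measurable M \<and>
     ((AE \<omega> in M. X \<omega> = 0) \<or> (\<exists>\<sigma>>0. distributed M lborel X (normal_density 0 \<sigma>)))"

text \<open>As each \<open>\<xi> \<omega>\<close> is linear, Gaussianity of the single variables \<open>\<xi> \<phi>\<close> is joint
  Gaussianity of the whole family.\<close>

definition white_noise :: "'w measure \<Rightarrow> ('w \<Rightarrow> 'n::finite distn) \<Rightarrow> bool" where
  "white_noise M \<xi> \<longleftrightarrow>
     (\<forall>\<omega>\<in>space M. distribution (\<xi> \<omega>)) \<and>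
     (\<forall>\<phi>. test_function \<phi> \<longrightarrow> centred_gaussian M (\<lambda>\<omega>. \<xi> \<omega> \<phi>)) \<and>
     (\<forall>\<phi> \<psi>. test_function \<phi> \<longrightarrow> test_function \<psi> \<longrightarrow>
        (LINT \<omega>|M. \<xi> \<omega> \<phi> * \<xi> \<omega> \<psi>) = (LINT x|lborel. \<phi> x * \<psi> x))"

definition mollifier :: "(real^'n::finite \<Rightarrow> real) \<Rightarrow> bool" where
  "mollifier \<rho> \<longleftrightarrow> test_function \<rho> \<and> support \<rho> \<subseteq> cball 0 1 \<and> (\<forall>x. \<rho> (- x) = \<rho> x) \<and>
     (LINT x|lborel. \<rho> x) = 1"

definition mollify :: "(real^'n::finite \<Rightarrow> real) \<Rightarrow> real \<Rightarrow> 'n distn \<Rightarrow> real^'n \<Rightarrow> real" where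
  "mollify \<rho> \<epsilon> T x = T (\<lambda>y. rescale \<epsilon> \<rho> (x - y))"


section \<open>The Hilbert space of square integrable complex functions\<close>

definition square_integrable :: "('a::euclidean_space \<Rightarrow> complex) \<Rightarrow> bool" where
  "square_integrable f \<longleftrightarrow> f \<in> borel_measurable borel \<and> integrable lborel (\<lambda>x. (cmod (f x))\<^sup>2)"

lemma square_integrable_zero: "square_integrable (\<lambda>x. 0)"
  by (simp add: square_integrable_def)

lemma square_integrable_mult:
  assumes "square_integrable f" shows "square_integrable (\<lambda>x. c * f x)"
  using assms by (auto simp: square_integrable_def norm_mult power_mult_distrib)

lemma square_integrable_add:
  assumes "square_integrable f" "square_integrable g"
  shows "square_integrable (\<lambda>x. f x + g x)"
proof -
  have [measurable]: "f \<in> borel_measurable borel" "g \<in> borel_measurable borel"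
    using assms by (auto simp: square_integrable_def)
  have "integrable lborel (\<lambda>x. 2 * (cmod (f x))\<^sup>2 + 2 * (cmod (g x))\<^sup>2)"
    using assms by (auto simp: square_integrable_def)
  then have "integrable lborel (\<lambda>x. (cmod (f x + g x))\<^sup>2)"
  proof (rule Bochner_Integration.integrable_bound)
    show "AE x in lborel. norm ((cmod (f x + g x))\<^sup>2) \<le> norm (2 * (cmod (f x))\<^sup>2 + 2 * (cmod (g x))\<^sup>2)"
    proof (rule AE_I2)
      fix x
      have "(cmod (f x + g x))\<^sup>2 \<le> (cmod (f x) + cmod (g x))\<^sup>2"
        by (intro power_mono norm_triangle_ineq) auto
      also have "\<dots> \<le> 2 * (cmod (f x))\<^sup>2 + 2 * (cmod (g x))\<^sup>2"
        using sum_squares_bound[of "cmod (f x)" "cmod (g x)"] by (simp add: power2_sum)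
      finally show "norm ((cmod (f x + g x))\<^sup>2) \<le> norm (2 * (cmod (f x))\<^sup>2 + 2 * (cmod (g x))\<^sup>2)"
        by simp
    qed
  qed measurable
  then show ?thesis by (simp add: square_integrable_def)
qed

lemma borel_measurable_cnj [measurable]:
  "f \<in> borel_measurable M \<Longrightarrow> (\<lambda>x. cnj (f x)) \<in> borel_measurable M"
  by (rule borel_measurable_continuous_on[OF _ , where f = cnj]) (auto intro!: continuous_intros)

lemma square_integrable_prod:
  assumes "square_integrable f" "square_integrable g"
  shows "integrable lborel (\<lambda>x. f x * cnj (g x))"
proof -
  have [measurable]: "f \<in> borel_measurable borel" "g \<in> borel_measurable borel"
    using assms by (auto simp: square_integrable_def)
  have "integrable lborel (\<lambda>x. (cmod (f x))\<^sup>2 + (cmod (g x))\<^sup>2)"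
    using assms by (auto simp: square_integrable_def)
  then show ?thesis
  proof (rule Bochner_Integration.integrable_bound)
    show "AE x in lborel. norm (f x * cnj (g x)) \<le> norm ((cmod (f x))\<^sup>2 + (cmod (g x))\<^sup>2)"
    proof (rule AE_I2)
      fix x
      have "2 * (cmod (f x) * cmod (g x)) \<le> (cmod (f x))\<^sup>2 + (cmod (g x))\<^sup>2"
        using sum_squares_bound[of "cmod (f x)" "cmod (g x)"] by simp
      moreover have "0 \<le> cmod (f x) * cmod (g x)" by simp
      ultimately have "cmod (f x) * cmod (g x) \<le> (cmod (f x))\<^sup>2 + (cmod (g x))\<^sup>2"
        by linarith
      then show "norm (f x * cnj (g x)) \<le> norm ((cmod (f x))\<^sup>2 + (cmod (g x))\<^sup>2)"
        by (simp add: norm_mult)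
    qed
  qed measurable
qed

quotient_type (overloaded) 'a L2 = "'a::euclidean_space \<Rightarrow> complex" / partial:
  "\<lambda>f g. square_integrable f \<and> square_integrable g \<and> (AE x in lborel. f x = g x)"
proof (rule part_equivpI)
  show "\<exists>f::'a \<Rightarrow> complex. square_integrable f \<and> square_integrable f \<and> (AE x in lborel. f x = f x)"
    using square_integrable_zero by auto
  show "symp (\<lambda>(f::'a \<Rightarrow> complex) g. square_integrable f \<and> square_integrable g \<and> (AE x in lborel. f x = g x))"
    by (rule sympI) (auto elim: AE_mp)
  show "transp (\<lambda>(f::'a \<Rightarrow> complex) g. square_integrable f \<and> square_integrable g \<and> (AE x in lborel. f x = g x))"
    by (rule transpI) auto
qed

lift_definition scaleC :: "complex \<Rightarrow> 'a::euclidean_space L2 \<Rightarrow> 'a L2" is "\<lambda>c f x. c * f x"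
  by (auto intro: square_integrable_mult)

lift_definition cinner :: "'a::euclidean_space L2 \<Rightarrow> 'a L2 \<Rightarrow> complex" is
  "\<lambda>f g. LINT x|lborel. f x * cnj (g x)"
  by (rule integral_cong_AE)
    (auto simp: square_integrable_def intro!: borel_measurable_times borel_measurable_cnj)

instantiation L2 :: (euclidean_space) real_vector
begin

lift_definition zero_L2 :: "'a L2" is "\<lambda>x. 0"
  by (simp add: square_integrable_zero)

lift_definition plus_L2 :: "'a L2 \<Rightarrow> 'a L2 \<Rightarrow> 'a L2" is "\<lambda>f g x. f x + g x"
  by (auto intro: square_integrable_add)

definition uminus_L2 :: "'a L2 \<Rightarrow> 'a L2" where "uminus_L2 f = scaleC (- 1) f"

definition minus_L2 :: "'a L2 \<Rightarrow> 'a L2 \<Rightarrow> 'a L2" where "minus_L2 f g = f + (- g)"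

definition scaleR_L2 :: "real \<Rightarrow> 'a L2 \<Rightarrow> 'a L2" where "scaleR_L2 r f = scaleC (complex_of_real r) f"

instance
proof
  fix a b c :: "'a L2" and r s :: real
  have [simp]: "square_integrable (\<lambda>x. c * f x)" if "square_integrable f" for c and f :: "'a \<Rightarrow> complex"
    using that by (rule square_integrable_mult)
  have [simp]: "square_integrable (\<lambda>x. f x + g x)" if "square_integrable f" "square_integrable g"
    for f g :: "'a \<Rightarrow> complex"
    using that by (rule square_integrable_add)
  have [simp]: "square_integrable (\<lambda>x. - f x)" if "square_integrable f" for f :: "'a \<Rightarrow> complex"
    using square_integrable_mult[OF that, of "-1"] by simp
  show "a + b + c = a + (b + c)"
    by transfer (auto simp: add.assoc)
  show "a + b = b + a"
    by transfer (auto simp: add.commute)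
  show "0 + a = a"
    by transfer auto
  show "- a + a = 0"
    unfolding uminus_L2_def by transfer (auto simp: square_integrable_zero)
  show "a - b = a + - b"
    by (rule minus_L2_def)
  show "r *\<^sub>R (a + b) = r *\<^sub>R a + r *\<^sub>R b"
    unfolding scaleR_L2_def by transfer (auto simp: distrib_left)
  show "(r + s) *\<^sub>R a = r *\<^sub>R a + s *\<^sub>R a"
    unfolding scaleR_L2_def by transfer (auto simp: distrib_right)
  show "r *\<^sub>R s *\<^sub>R a = (r * s) *\<^sub>R a"
    unfolding scaleR_L2_def by transfer (auto simp: mult.assoc)
  show "1 *\<^sub>R a = a"
    unfolding scaleR_L2_def by transfer auto
qed

end

lemma cinner_commute: "cinner f g = cnj (cinner g f)"
proof transfer
  fix f g :: "'a \<Rightarrow> complex"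
  have "cnj (LINT x|lborel. g x * cnj (f x)) = (LINT x|lborel. cnj (g x * cnj (f x)))"
    by (rule Bochner_Integration.integral_cnj[symmetric])
  then show "(LINT x|lborel. f x * cnj (g x)) = cnj (LINT x|lborel. g x * cnj (f x))"
    by (simp add: mult.commute)
qed

lemma cinner_add_left: "cinner (f + g) h = cinner f h + cinner g h"
  by transfer (simp add: square_integrable_prod distrib_right)

lemma cinner_scaleC_left: "cinner (scaleC c f) g = c * cinner f g"
  by transfer (simp add: mult.assoc)

lemma cinner_scaleC_right: "cinner f (scaleC c g) = cnj c * cinner f g"
  by (metis cinner_commute cinner_scaleC_left complex_cnj_mult)

lemma cinner_add_right: "cinner h (f + g) = cinner h f + cinner h g"
  by (metis cinner_add_left cinner_commute complex_cnj_add)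

lemma cinner_self: "cinner f f = of_real (Re (cinner f f))" "0 \<le> Re (cinner f f)"
proof -
  have "cinner f f \<in> \<real> \<and> 0 \<le> Re (cinner f f)"
    by transfer (auto simp flip: complex_norm_square of_real_power)
  then show "cinner f f = of_real (Re (cinner f f))" "0 \<le> Re (cinner f f)"
    by (auto simp: of_real_Re)
qed

lemma cinner_self_eq_0: "Re (cinner f f) = 0 \<longleftrightarrow> f = 0"
proof transfer
  fix f :: "'a \<Rightarrow> complex"
  assume f: "square_integrable f \<and> square_integrable f \<and> (AE x in lborel. f x = f x)"
  have "Re (LINT x|lborel. f x * cnj (f x)) = (LINT x|lborel. (cmod (f x))\<^sup>2)"
    by (simp flip: complex_norm_square of_real_power)
  also have "\<dots> = 0 \<longleftrightarrow> (AE x in lborel. (cmod (f x))\<^sup>2 = 0)"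
    using f by (intro integral_nonneg_eq_0_iff_AE) (auto simp: square_integrable_def)
  finally show "Re (LINT x|lborel. f x * cnj (f x)) = 0 \<longleftrightarrow>
      square_integrable f \<and> square_integrable (\<lambda>x. 0::complex) \<and> (AE x in lborel. f x = 0)"
    using f by (simp add: square_integrable_zero)
qed

instantiation L2 :: (euclidean_space) real_inner
begin

definition inner_L2 :: "'a L2 \<Rightarrow> 'a L2 \<Rightarrow> real" where "inner_L2 f g = Re (cinner f g)"
definition norm_L2 :: "'a L2 \<Rightarrow> real" where "norm_L2 f = sqrt (inner f f)"
definition dist_L2 :: "'a L2 \<Rightarrow> 'a L2 \<Rightarrow> real" where "dist_L2 f g = norm (f - g)"
definition sgn_L2 :: "'a L2 \<Rightarrow> 'a L2" where "sgn_L2 f = f /\<^sub>R norm f"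
definition uniformity_L2 :: "('a L2 \<times> 'a L2) filter" where
  "uniformity_L2 = (INF e\<in>{0 <..}. principal {(f, g). dist f g < e})"
definition open_L2 :: "'a L2 set \<Rightarrow> bool" where
  "open_L2 U = (\<forall>x\<in>U. eventually (\<lambda>(x', y). x' = x \<longrightarrow> y \<in> U) uniformity)"

instance
proof
  fix a b c :: "'a L2" and r :: real
  show "inner a b = inner b a"
    unfolding inner_L2_def by (metis cinner_commute cnj.simps(1))
  show "inner (a + b) c = inner a c + inner b c"
    by (simp add: inner_L2_def cinner_add_left)
  show "inner (r *\<^sub>R a) b = r * inner a b"
    by (simp add: inner_L2_def scaleR_L2_def cinner_scaleC_left)
  show "0 \<le> inner a a" "inner a a = 0 \<longleftrightarrow> a = 0"
    by (simp_all add: inner_L2_def cinner_self(2) cinner_self_eq_0)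
qed (rule norm_L2_def dist_L2_def sgn_L2_def uniformity_L2_def open_L2_def)+

end


section \<open>Unbounded operators, given by their graphs\<close>

type_synonym 'a op = "('a L2 \<times> 'a L2) set"

definition linear_operator :: "'a::euclidean_space op \<Rightarrow> bool" where
  "linear_operator A \<longleftrightarrow>
     (0, 0) \<in> A \<and>
     (\<forall>u v u' v'. (u, v) \<in> A \<longrightarrow> (u', v') \<in> A \<longrightarrow> (u + u', v + v') \<in> A) \<and>
     (\<forall>c u v. (u, v) \<in> A \<longrightarrow> (scaleC c u, scaleC c v) \<in> A) \<and>
     (\<forall>v. (0, v) \<in> A \<longrightarrow> v = 0)"

definition op_adjoint :: "'a::euclidean_space op \<Rightarrow> 'a op" where
  "op_adjoint A = {(g, h). \<forall>(u, v)\<in>A. cinner v g = cinner u h}"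

definition self_adjoint :: "'a::euclidean_space op \<Rightarrow> bool" where
  "self_adjoint A \<longleftrightarrow> linear_operator A \<and> closure (Domain A) = UNIV \<and> op_adjoint A = A"

definition essentially_self_adjoint :: "'a::euclidean_space op \<Rightarrow> bool" where
  "essentially_self_adjoint A \<longleftrightarrow> linear_operator A \<and> closure (Domain A) = UNIV \<and> self_adjoint (closure A)"

definition self_adjoint_extension :: "'a::euclidean_space op \<Rightarrow> 'a op" where
  "self_adjoint_extension A = (THE B. self_adjoint B \<and> A \<subseteq> B)"

definition resolvent_set :: "'a::euclidean_space op \<Rightarrow> complex set" where
  "resolvent_set A = {z. (\<forall>f. \<exists>!u. (u, f + scaleC z u) \<in> A) \<and>
                         (\<exists>B. \<forall>u f. (u, f + scaleC z u) \<in> A \<longrightarrow> norm u \<le> B * norm f)}"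

definition spectrum :: "'a::euclidean_space op \<Rightarrow> complex set" where
  "spectrum A = - resolvent_set A"

(* (A - z)^{-1} f, for z in the resolvent set *)
definition resolvent :: "'a::euclidean_space op \<Rightarrow> complex \<Rightarrow> 'a L2 \<Rightarrow> 'a L2" where
  "resolvent A z f = (THE u. (u, f + scaleC z u) \<in> A)"

definition schrodinger :: "(real^'n::finite \<Rightarrow> real) \<Rightarrow> (real^'n) op" where
  "schrodinger V = {(abs_L2 \<phi>, abs_L2 (\<lambda>x. - laplacian \<phi> x + of_real (V x) * \<phi> x)) | \<phi>. test_function \<phi>}"


lemma cinner_eq_inner: "cinner f g = of_real (inner f g) + \<i> * of_real (inner f (scaleC \<i> g))"
  by (simp add: inner_L2_def cinner_scaleC_right complex_eq_iff)

lemma continuous_on_cinner_left: "continuous_on S f \<Longrightarrow> continuous_on S (\<lambda>x. cinner (f x) g)"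
  unfolding cinner_eq_inner by (intro continuous_intros)

lemma continuous_on_cinner_right:
  assumes "continuous_on S f" shows "continuous_on S (\<lambda>x. cinner g (f x))"
proof -
  have "(\<lambda>x. cinner g (f x)) = (\<lambda>x. cnj (cinner (f x) g))"
    by (rule ext) (rule cinner_commute)
  moreover have "continuous_on S (\<lambda>x. cnj (cinner (f x) g))"
    by (intro continuous_on_cnj continuous_on_cinner_left assms)
  ultimately show ?thesis by metis
qed

lemma closed_op_adjoint: "closed (op_adjoint A)"
proof -
  have eq: "op_adjoint A = (\<Inter>(u, v)\<in>A. {p. cinner v (fst p) = cinner u (snd p)})"
    by (auto simp: op_adjoint_def)
  show ?thesis
    unfolding eq
    by (auto intro!: closed_INT closed_Collect_eq continuous_on_cinner_right continuous_intros)
qed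

lemma self_adjoint_extension_eq:
  assumes "essentially_self_adjoint A"
  shows "self_adjoint_extension A = closure A"
  unfolding self_adjoint_extension_def
proof (rule the_equality)
  have sa: "self_adjoint (closure A)"
    using assms by (simp add: essentially_self_adjoint_def)
  then show "self_adjoint (closure A) \<and> A \<subseteq> closure A"
    by (simp add: closure_subset)
  fix B assume B: "self_adjoint B \<and> A \<subseteq> B"
  then have adj: "op_adjoint B = B"
    by (simp add: self_adjoint_def)
  then have le: "closure A \<subseteq> B"
    using B closed_op_adjoint[of B] by (simp add: closure_minimal)
  then have "op_adjoint B \<subseteq> op_adjoint (closure A)"
    by (force simp: op_adjoint_def)
  with le adj sa show "B = closure A"
    by (auto simp: self_adjoint_def)
qed


section \<open>Convergence of random objects\<close>

text \<open>Measurability of the random objects below is not built in. Outer measures and measurable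
  majorants are used, so that nothing is lost on non-measurable sets and functions; for
  measurable ones these are the usual notions.\<close>

definition tendsto_in_probability ::
    "'w measure \<Rightarrow> ('i \<Rightarrow> 'w \<Rightarrow> 'b::metric_space) \<Rightarrow> ('w \<Rightarrow> 'b) \<Rightarrow> 'i filter \<Rightarrow> bool" where
  "tendsto_in_probability M X Y F \<longleftrightarrow>
     (\<forall>\<delta>>0. ((\<lambda>i. outer_measure_of M {\<omega>\<in>space M. dist (X i \<omega>) (Y \<omega>) > \<delta>}) \<longlongrightarrow> 0) F)"

definition strong_resolvent_limit_in_probability ::
    "'w measure \<Rightarrow> ('i \<Rightarrow> 'w \<Rightarrow> 'a::euclidean_space op) \<Rightarrow> ('w \<Rightarrow> 'a op) \<Rightarrow> 'i filter \<Rightarrow> bool" where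
  "strong_resolvent_limit_in_probability M A H F \<longleftrightarrow>
     (\<forall>z f. z \<notin> \<real> \<longrightarrow>
        tendsto_in_probability M (\<lambda>i \<omega>. resolvent (A i \<omega>) z f) (\<lambda>\<omega>. resolvent (H \<omega>) z f) F)"

definition Lp_tendsto_0 :: "'w measure \<Rightarrow> real \<Rightarrow> ('i \<Rightarrow> 'w \<Rightarrow> ennreal) \<Rightarrow> 'i filter \<Rightarrow> bool" where
  "Lp_tendsto_0 M p D F \<longleftrightarrow> (\<exists>g.
     (\<forall>\<^sub>F i in F. g i \<in> borel_measurable M \<and> (\<forall>\<omega>. 0 \<le> g i \<omega>) \<and> (AE \<omega> in M. D i \<omega> \<le> ennreal (g i \<omega>))) \<and>
     ((\<lambda>i. \<integral>\<^sup>+\<omega>. ennreal (g i \<omega> powr p) \<partial>M) \<longlongrightarrow> 0) F)"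


section \<open>The renormalisation constant in dimension 2\<close>

definition cutoff_2d :: "(real^'n::finite \<Rightarrow> real) \<Rightarrow> bool" where
  "cutoff_2d \<theta> \<longleftrightarrow> smooth_on UNIV \<theta> \<and> (\<forall>x y. norm x = norm y \<longrightarrow> \<theta> x = \<theta> y) \<and>
     (\<forall>x\<in>ball 0 1. \<theta> x = 1) \<and> support \<theta> \<subseteq> cball 0 2"

definition green_2d :: "(real^'n::finite \<Rightarrow> real) \<Rightarrow> real^'n \<Rightarrow> real" where
  "green_2d \<theta> x = - (ln (norm x) / (2 * pi)) * \<theta> x"

definition renorm_const_2d ::
    "'w measure \<Rightarrow> ('w \<Rightarrow> 'n::finite distn) \<Rightarrow> (real^'n \<Rightarrow> real) \<Rightarrow> (real^'n \<Rightarrow> real) \<Rightarrow> real \<Rightarrow> real" where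
  "renorm_const_2d M \<xi> \<rho> \<theta> \<epsilon> =
     (LINT \<omega>|M. (norm (LINT y|lborel. mollify \<rho> \<epsilon> (\<xi> \<omega>) y *\<^sub>R grad (green_2d \<theta>) (0 - y)))\<^sup>2)"


section \<open>The regularity structure in dimension 3\<close>

text \<open>\<open>Noise \<tau>\<close> stands for \<open>\<Xi>\<tau>\<close> and \<open>Integ \<tau>\<close> for \<open>\<I>(\<tau>)\<close>.\<close>

datatype 'n symbol = One | Poly 'n | Noise "'n symbol" | Integ "'n symbol"

abbreviation Xi :: "'n symbol" where
  "Xi \<equiv> Noise One"

primrec hom :: "real \<Rightarrow> 'n symbol \<Rightarrow> real" where
  "hom \<kappa> One = 0"
| "hom \<kappa> (Poly i) = 1"
| "hom \<kappa> (Noise \<tau>) = (- 3 / 2 - \<kappa>) + hom \<kappa> \<tau>"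
| "hom \<kappa> (Integ \<tau>) = hom \<kappa> \<tau> + 2"

definition U_symbols :: "'n symbol set" where
  "U_symbols =
     {One, Integ Xi, Integ (Noise (Integ Xi)), Integ (Noise (Integ (Noise (Integ Xi))))} \<union>
     range Poly \<union> range (\<lambda>i. Integ (Noise (Poly i)))"

definition F_symbols :: "'n symbol set" where
  "F_symbols = Noise ` U_symbols"

text \<open>Vectors are coefficient families on the set of all symbols. The structure space is the span of
  the basis symbols. \<open>mult_noise\<close> and \<open>abs_integ\<close> extend \<open>\<tau> \<mapsto> \<Xi>\<tau>\<close> and \<open>\<tau> \<mapsto> \<I>(\<tau>)\<close> linearly.\<close>

type_synonym 'n svec = "'n symbol \<Rightarrow> real"

definition sym_span :: "'n symbol set \<Rightarrow> 'n svec set" where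
  "sym_span S = {t. \<forall>s. s \<notin> S \<longrightarrow> t s = 0}"

definition basis_symbols :: "'n symbol set" where
  "basis_symbols = U_symbols \<union> F_symbols"

definition structure_space :: "'n svec set" where
  "structure_space = sym_span basis_symbols"

definition sym_unit :: "'n symbol \<Rightarrow> 'n svec" where
  "sym_unit s = (\<lambda>u. if u = s then 1 else 0)"

definition sym_norm :: "'n svec \<Rightarrow> real" where
  "sym_norm t = L2_set t basis_symbols"

definition mult_noise :: "'n svec \<Rightarrow> 'n svec" where
  "mult_noise t = (\<lambda>u. case u of Noise v \<Rightarrow> t v | _ \<Rightarrow> 0)"

definition abs_integ :: "'n svec \<Rightarrow> 'n svec" where
  "abs_integ t = (\<lambda>u. case u of Integ v \<Rightarrow> t v | _ \<Rightarrow> 0)"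

(* hom is the degree |k| on the polynomial symbols X^k; those of degree at least 2 are not in the structure *)
definition poly_below :: "real \<Rightarrow> real \<Rightarrow> 'n symbol set" where
  "poly_below \<kappa> a = {s \<in> insert One (range Poly). hom \<kappa> s < a}"

definition structure_group :: "real \<Rightarrow> ('n::finite svec \<Rightarrow> 'n svec) set" where
  "structure_group \<kappa> = {\<Gamma>.
     (\<forall>t\<in>structure_space. \<Gamma> t \<in> structure_space) \<and>
     (\<forall>s\<in>structure_space. \<forall>t\<in>structure_space. \<forall>a b.
        \<Gamma> (\<lambda>u. a * s u + b * t u) = (\<lambda>u. a * \<Gamma> s u + b * \<Gamma> t u)) \<and>
     (\<exists>h :: real^'n.
        \<Gamma> (sym_unit One) = sym_unit One \<and>
        (\<forall>i. \<Gamma> (sym_unit (Poly i)) = (\<lambda>u. sym_unit (Poly i) u + h $ i * sym_unit One u)) \<and>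
        (\<forall>\<tau>\<in>U_symbols. \<Gamma> (sym_unit (Noise \<tau>)) = mult_noise (\<Gamma> (sym_unit \<tau>))) \<and>
        (\<forall>\<sigma>. Integ \<sigma> \<in> U_symbols \<longrightarrow>
           (\<lambda>u. \<Gamma> (sym_unit (Integ \<sigma>)) u - abs_integ (\<Gamma> (sym_unit \<sigma>)) u)
             \<in> sym_span (poly_below \<kappa> (hom \<kappa> \<sigma> + 2))))}"


section \<open>Admissible models\<close>

record 'n model =
  Pi_map :: "real^'n \<Rightarrow> 'n svec \<Rightarrow> 'n distn"
  Gamma_map :: "real^'n \<Rightarrow> real^'n \<Rightarrow> 'n svec \<Rightarrow> 'n svec"

(* The sign is that of the fundamental solution of minus the Laplacian, as for green_2d. *)
definition kernel_3d :: "(real^'n::finite \<Rightarrow> real) \<Rightarrow> bool" where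
  "kernel_3d K \<longleftrightarrow> compact (support K) \<and> smooth_on (- {0}) K \<and>
     (\<exists>\<delta>>0. \<forall>x. 0 < norm x \<and> norm x < \<delta> \<longrightarrow> K x = 1 / (4 * pi * norm x))"

text \<open>\<open>singular_pairing T K x k l\<close> says that \<open>l\<close> is the value of the formal pairing of \<open>T\<close> with
  \<open>(\<partial>\<^sup>k K) (x - \<cdot>)\<close>. As \<open>K\<close> is singular at the origin this is not a test function, and the
  pairing is the limit obtained by cutting the singularity off, whatever the cutoff.
  The pairing with \<open>K (y - \<cdot>)\<close> as a distribution in \<open>y\<close> needs no limit: testing with \<open>\<phi>\<close> moves the
  kernel to \<open>\<phi>\<close>, see \<open>kernel_conv\<close>.\<close>

definition singular_pairing ::
    "'n::finite distn \<Rightarrow> (real^'n \<Rightarrow> real) \<Rightarrow> real^'n \<Rightarrow> ('n \<Rightarrow> nat) \<Rightarrow> real \<Rightarrow> bool" where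
  "singular_pairing T K x k l \<longleftrightarrow>
     (\<forall>\<eta>. test_function \<eta> \<longrightarrow> (\<exists>\<delta>>0. \<forall>w\<in>ball 0 \<delta>. \<eta> w = 1) \<longrightarrow>
        ((\<lambda>\<delta>. T (\<lambda>z. mderiv k (\<lambda>w. (1 - \<eta> ((1 / \<delta>) *\<^sub>R w)) * K w) (x - z))) \<longlongrightarrow> l) (at_right 0))"

definition kernel_conv :: "(real^'n::finite \<Rightarrow> real) \<Rightarrow> (real^'n \<Rightarrow> real) \<Rightarrow> real^'n \<Rightarrow> real" where
  "kernel_conv K \<phi> z = (LINT y|lborel. K (y - z) * \<phi> y)"

definition admissible :: "real \<Rightarrow> (real^'n::finite \<Rightarrow> real) \<Rightarrow> 'n model \<Rightarrow> bool" where
  "admissible \<kappa> K q \<longleftrightarrow> (let P = Pi_map q; \<Gamma> = Gamma_map q in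
     (\<forall>x. \<forall>\<tau>\<in>structure_space. distribution (P x \<tau>)) \<and>
     (\<forall>x. \<forall>s\<in>structure_space. \<forall>t\<in>structure_space. \<forall>a b \<phi>. test_function \<phi> \<longrightarrow>
        P x (\<lambda>u. a * s u + b * t u) \<phi> = a * P x s \<phi> + b * P x t \<phi>) \<and>
     (\<forall>x y. \<Gamma> x y \<in> structure_group \<kappa>) \<and>
     (\<forall>x y. \<forall>\<tau>\<in>structure_space. \<forall>\<phi>. test_function \<phi> \<longrightarrow> P y \<tau> \<phi> = P x (\<Gamma> x y \<tau>) \<phi>) \<and>
     (\<forall>x y z. \<forall>\<tau>\<in>structure_space. \<Gamma> x y (\<Gamma> y z \<tau>) = \<Gamma> x z \<tau>) \<and>
     (\<forall>x \<phi>. test_function \<phi> \<longrightarrow>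
        P x (sym_unit One) \<phi> = dist_of_fun (\<lambda>y. 1) \<phi> \<and>
        (\<forall>i. P x (sym_unit (Poly i)) \<phi> = dist_of_fun (\<lambda>y. y $ i - x $ i) \<phi>) \<and>
        (\<forall>i. P x (sym_unit (Noise (Poly i))) \<phi> = P x (sym_unit Xi) (\<lambda>y. (y $ i - x $ i) * \<phi> y))) \<and>
     (\<forall>x \<sigma>. Integ \<sigma> \<in> U_symbols \<longrightarrow>
        (let ks = {k. real (msize k) < hom \<kappa> \<sigma> + 2} in
         \<exists>l. (\<forall>k\<in>ks. singular_pairing (P x (sym_unit \<sigma>)) K x k (l k)) \<and>
             (\<forall>\<phi>. test_function \<phi> \<longrightarrow>
                P x (sym_unit (Integ \<sigma>)) \<phi> =
                  P x (sym_unit \<sigma>) (kernel_conv K \<phi>)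
                  - (\<Sum>k\<in>ks. l k * dist_of_fun (\<lambda>y. mpow (y - x) k / mfact k) \<phi>)))))"

definition weight :: "real \<Rightarrow> real^'n::finite \<Rightarrow> real" where
  "weight a x = (1 + norm x) powr a"

definition unit_test_functions :: "nat \<Rightarrow> (real^'n::finite \<Rightarrow> real) set" where
  "unit_test_functions r =
     {\<phi>. test_function \<phi> \<and> support \<phi> \<subseteq> cball 0 1 \<and> (\<forall>is x. length is \<le> r \<longrightarrow> \<bar>pds is \<phi> x\<bar> \<le> 1)}"

definition model_dist :: "real \<Rightarrow> nat \<Rightarrow> 'n::finite model \<Rightarrow> 'n model \<Rightarrow> ennreal" where
  "model_dist \<kappa> r q q' =
     (SUP x. SUP \<phi>\<in>unit_test_functions r. SUP l\<in>{0<..1}. SUP \<zeta>\<in>hom \<kappa> ` (basis_symbols :: 'n symbol set).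
        SUP \<tau>\<in>sym_span {s\<in>basis_symbols. hom \<kappa> s = \<zeta>} - {\<lambda>u. 0}.
          ennreal (\<bar>Pi_map q x \<tau> (\<lambda>y. rescale l \<phi> (y - x)) - Pi_map q' x \<tau> (\<lambda>y. rescale l \<phi> (y - x))\<bar>
                   / (l powr \<zeta> * weight \<kappa> x * sym_norm \<tau>)))"

definition smooth_model :: "'n::finite model \<Rightarrow> bool" where
  "smooth_model q \<longleftrightarrow> (\<forall>x. \<forall>\<tau>\<in>structure_space. \<exists>g. smooth_on UNIV g \<and>
     (\<forall>\<phi>. test_function \<phi> \<longrightarrow> Pi_map q x \<tau> \<phi> = dist_of_fun g \<phi>))"

definition model_space :: "real \<Rightarrow> nat \<Rightarrow> (real^'n::finite \<Rightarrow> real) \<Rightarrow> 'n model set" where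
  "model_space \<kappa> r K = {q. admissible \<kappa> K q \<and>
     (\<forall>\<delta>>0. \<exists>q'. admissible \<kappa> K q' \<and> smooth_model q' \<and> model_dist \<kappa> r q q' < ennreal \<delta>)}"


section \<open>The renormalisation constants in dimension 3\<close>

definition growth_at_most :: "real \<Rightarrow> (real^'n::finite \<Rightarrow> real) \<Rightarrow> bool" where
  "growth_at_most b h \<longleftrightarrow> (\<forall>is. \<exists>B. \<forall>x. \<bar>pds is h x\<bar> \<le> B * weight b x)"

definition renormalised_canonical_model ::
    "real \<Rightarrow> real \<Rightarrow> (real^'n::finite \<Rightarrow> real) \<Rightarrow> (real^'n \<Rightarrow> real) \<Rightarrow> real \<Rightarrow> real \<Rightarrow> 'n model \<Rightarrow> bool" where
  "renormalised_canonical_model \<kappa> b K h c c1 q \<longleftrightarrow>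
     smooth_on UNIV h \<and> growth_at_most b h \<and> admissible \<kappa> K q \<and>
     (\<forall>x \<phi>. test_function \<phi> \<longrightarrow>
       (let P = (\<lambda>\<tau>. Pi_map q x (sym_unit \<tau>)); h\<phi> = (\<lambda>y. h y * \<phi> y) in
        P Xi \<phi> = dist_of_fun h \<phi> \<and>
        P (Noise (Integ Xi)) \<phi> = P (Integ Xi) h\<phi> - dist_of_fun (\<lambda>y. c) \<phi> \<and>
        P (Noise (Integ (Noise (Integ Xi)))) \<phi> =
          P (Integ (Noise (Integ Xi))) h\<phi> - c * P (Integ Xi) \<phi> \<and>
        P (Noise (Integ (Noise (Integ (Noise (Integ Xi)))))) \<phi> =
          P (Integ (Noise (Integ (Noise (Integ Xi))))) h\<phi>
          - c * P (Integ (Noise (Integ Xi))) \<phi> - dist_of_fun (\<lambda>y. c1) \<phi> \<and>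
        (\<forall>i. P (Noise (Integ (Noise (Poly i)))) \<phi> =
          P (Integ (Noise (Poly i))) h\<phi> - c * P (Poly i) \<phi>)))"

definition renorm_consts_3d ::
    "'w measure \<Rightarrow> ('w \<Rightarrow> 'n::finite distn) \<Rightarrow> (real^'n \<Rightarrow> real) \<Rightarrow> real \<Rightarrow> real \<Rightarrow> nat \<Rightarrow>
     (real^'n \<Rightarrow> real) \<Rightarrow> (real \<Rightarrow> real) \<Rightarrow> (real \<Rightarrow> real) \<Rightarrow> bool" where
  "renorm_consts_3d M \<xi> \<rho> \<kappa> b r K c c1 \<longleftrightarrow> (\<exists>Q Q0.
     (\<forall>\<epsilon>\<in>{0<..<1}. AE \<omega> in M.
        renormalised_canonical_model \<kappa> b K (mollify \<rho> \<epsilon> (\<xi> \<omega>)) (c \<epsilon>) (c1 \<epsilon>) (Q \<epsilon> \<omega>) \<and>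
        Q \<epsilon> \<omega> \<in> model_space \<kappa> r K) \<and>
     (AE \<omega> in M. Q0 \<omega> \<in> model_space \<kappa> r K) \<and>
     (\<forall>p>1. Lp_tendsto_0 M p (\<lambda>\<epsilon> \<omega>. model_dist \<kappa> r (Q \<epsilon> \<omega>) (Q0 \<omega>)) (at_right 0)))"

text \<open>\<open>\<kappa> < 1 / 10\<close> makes precise that \<open>\<kappa>\<close> is small: then the elements of \<open>F_symbols\<close> have negative
  homogeneity, the next tree, with five noises, has homogeneity \<open>1 / 2 - 5 * \<kappa> > 0\<close>, and the degrees of
  the Taylor polynomials in \<open>admissible\<close> do not depend on \<open>\<kappa>\<close>.\<close>

definition renormalisation_constant ::
    "'w measure \<Rightarrow> ('w \<Rightarrow> 'n::finite distn) \<Rightarrow> (real^'n \<Rightarrow> real) \<Rightarrow> (real \<Rightarrow> real) \<Rightarrow> bool" where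
  "renormalisation_constant M \<xi> \<rho> C \<longleftrightarrow>
     (CARD('n) = 2 \<longrightarrow>
        (\<exists>\<theta>. cutoff_2d \<theta> \<and> (\<forall>\<epsilon>\<in>{0<..<1}. C \<epsilon> = renorm_const_2d M \<xi> \<rho> \<theta> \<epsilon>))) \<and>
     (CARD('n) = 3 \<longrightarrow>
        (\<exists>\<kappa> b r K c c1. 0 < \<kappa> \<and> \<kappa> < 1 / 10 \<and> 0 < b \<and> b < \<kappa> / 4 \<and> 3 / 2 + \<kappa> < real r \<and>
           kernel_3d K \<and> renorm_consts_3d M \<xi> \<rho> \<kappa> b r K c c1 \<and>
           (\<forall>\<epsilon>\<in>{0<..<1}. C \<epsilon> = c \<epsilon> + c1 \<epsilon>)))"

end

theory Submission imports Defs begin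

text \<open>Fix real numbers \<open>E\<close> and \<open>r > 0\<close>, and say that a self-adjoint operator \<open>H\<close> has a gap if
  \<open>\<parallel>(H - E) u\<parallel> \<ge> r \<parallel>u\<parallel>\<close> on its domain, that is, if the spectrum avoids the interval around \<open>E\<close> of radius
  \<open>r\<close>. The spectrum of a self-adjoint operator is real, so it is all of \<open>\<real>\<close> as soon as there is no gap for
  rational \<open>E\<close> and \<open>r\<close> (\<open>spectrum_eq_Reals\<close>), and it suffices to show that almost surely the limiting
  operator has no gap for fixed \<open>E\<close> and \<open>r\<close>. This follows from two properties of the white noise.

  \<^item> Its translations are ergodic. A translation of the noise conjugates the operators by a unitary, so
    the event that there is a gap is invariant and has probability \<open>0\<close> or \<open>1\<close>
    (\<open>white_noise_zero_one\<close>, \<open>gap_event_translation\<close>).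
  \<^item> By the Cameron-Martin theorem the laws of \<open>\<xi>\<close> and \<open>\<xi> - h\<close> are equivalent for every test function \<open>h\<close>
    (\<open>white_noise_shift\<close>). If the probability were \<open>1\<close>, then almost surely \<open>H - h\<close> would have a gap at
    \<open>E\<close> for countably many \<open>h\<close> at once. Letting \<open>h\<close> tend to a rational constant \<open>q\<close>, one finds a gap of
    \<open>H\<close> at every \<open>E + q\<close>, hence at every real number. But a self-adjoint operator has non-empty spectrum
    (\<open>no_gap_under_all_perturbations\<close>).

  The operator \<open>H\<close> is only known as a limit in probability, so both steps need the gap as a measurable
  property of the noise, and they need to know what \<open>H\<close> becomes when the noise is shifted. Along a
  sequence of scales the resolvents converge almost surely. The approximating operators \<open>H\<^sub>j\<close> are
  essentially self-adjoint on test functions, because the mollified noise grows slowly enough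
  (\<open>growth_white_noise\<close>, \<open>essentially_self_adjoint_schrodinger\<close>); therefore every point \<open>(u, H u)\<close> of the graph
  of \<open>H\<close> is a limit of points \<open>(\<phi>\<^sub>j, H\<^sub>j \<phi>\<^sub>j)\<close> with test functions \<open>\<phi>\<^sub>j\<close> (\<open>graph_limit\<close>). This notion is stable:
  the mollifications of \<open>h\<close> converge to \<open>h\<close> uniformly, so \<open>H - h\<close> is the graph limit of the operators
  built from \<open>\<xi> - h\<close> (\<open>graph_limit_perturb\<close>).

  For the gap, put \<open>z = E + \<i>\<close>. Since \<open>\<parallel>(H - z) u\<parallel>\<^sup>2 = \<parallel>(H - E) u\<parallel>\<^sup>2 + \<parallel>u\<parallel>\<^sup>2\<close>, a gap of \<open>H\<close> is the bound
  \<open>(r\<^sup>2 + 1)\<^sup>1\<^sup>/\<^sup>2 \<parallel>(H - z)\<^sup>-\<^sup>1 f\<parallel> \<le> \<parallel>f\<parallel>\<close>, and \<open>\<parallel>(H - z)\<^sup>-\<^sup>1 f\<parallel>\<close> is the limit of \<open>\<parallel>(H\<^sub>j - z)\<^sup>-\<^sup>1 f\<parallel>\<close>. The latter is an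
  infimum over test functions that can be taken over a countable set, whence it depends on the noise in
  a measurable way (\<open>resolvent_norm_measurable\<close>).\<close>

section \<open>Square integrable functions and their classes\<close>

lemma square_integrable_rep_L2: "square_integrable (rep_L2 f)"
  using Quotient_rep_reflp[OF Quotient_L2, of f] by simp

lemma abs_rep_L2: "abs_L2 (rep_L2 f) = f"
  by (rule Quotient_abs_rep[OF Quotient_L2])

lemma abs_L2_eq_iff:
  assumes "square_integrable f" "square_integrable g"
  shows "abs_L2 f = abs_L2 g \<longleftrightarrow> (AE x in lborel. f x = g x)"
  using Quotient_rel[OF Quotient_L2, of f g] assms by auto

lemma L2_obtain_function:
  obtains f' where "square_integrable f'" "f = abs_L2 f'"
  using square_integrable_rep_L2[of f] abs_rep_L2[of f] by metis

lemma square_integrable_minus: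
  assumes "square_integrable f" "square_integrable g"
  shows "square_integrable (\<lambda>x. f x - g x)"
  using square_integrable_add[OF assms(1) square_integrable_mult[OF assms(2), of "-1"]] by simp

lemma abs_L2_add:
  assumes "square_integrable f" "square_integrable g"
  shows "abs_L2 (\<lambda>x. f x + g x) = abs_L2 f + abs_L2 g"
  using assms by (simp add: plus_L2.abs_eq)

lemma abs_L2_scaleC:
  assumes "square_integrable f"
  shows "abs_L2 (\<lambda>x. c * f x) = scaleC c (abs_L2 f)"
  using assms by (simp add: scaleC.abs_eq)

lemma abs_L2_zero: "abs_L2 (\<lambda>x. 0) = 0"
  by (simp add: zero_L2_def)

lemma scaleC_simps:
  "scaleC c (f + g) = scaleC c f + scaleC c g"
  "scaleC (c + d) f = scaleC c f + scaleC d f"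
  "scaleC c (scaleC d f) = scaleC (c * d) f"
  "scaleC 1 f = f"
  "scaleC (complex_of_real r) f = r *\<^sub>R f"
  subgoal by transfer (auto simp: distrib_left intro!: square_integrable_mult square_integrable_add)
  subgoal by transfer (auto simp: distrib_right intro!: square_integrable_mult square_integrable_add)
  subgoal by transfer (auto simp: mult.assoc intro!: square_integrable_mult square_integrable_add)
  subgoal by transfer (auto intro!: square_integrable_mult square_integrable_add)
  subgoal by (simp add: scaleR_L2_def)
  done

lemma scaleC_zero [simp]: "scaleC 0 f = 0" "scaleC c 0 = 0"
  using scaleC_simps(5)[of 0 f] scaleC_simps(1)[of c 0 0] by auto

lemma scaleC_minus_right: "scaleC c (- f) = - scaleC c f"
  using scaleC_simps(1)[of c "-f" f] by (simp add: eq_neg_iff_add_eq_0)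

lemma scaleC_minus_left: "scaleC (- c) f = - scaleC c f"
  using scaleC_simps(2)[of "-c" c f] by (simp add: eq_neg_iff_add_eq_0)

lemma scaleC_diff_right: "scaleC c (f - g) = scaleC c f - scaleC c g"
  using scaleC_simps(1)[of c f "-g"] by (simp add: scaleC_minus_right)

lemma scaleC_diff_left: "scaleC (c - d) f = scaleC c f - scaleC d f"
  using scaleC_simps(2)[of c "-d" f] by (simp add: scaleC_minus_left)

lemma abs_L2_diff:
  assumes "square_integrable f" "square_integrable g"
  shows "abs_L2 (\<lambda>x. f x - g x) = abs_L2 f - abs_L2 g"
  using abs_L2_add[OF assms(1) square_integrable_mult[OF assms(2), of "-1"]]
    abs_L2_scaleC[OF assms(2), of "-1"] scaleC_minus_left[of 1 "abs_L2 g"]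
  by (simp add: scaleC_simps)

lemma cinner_zero [simp]: "cinner 0 f = 0" "cinner f 0 = 0"
  using cinner_scaleC_left[of 0 0 f] cinner_scaleC_right[of f 0 0] by auto

lemma cinner_minus_left: "cinner (- f) g = - cinner f g"
  using cinner_scaleC_left[of "-1" f g] scaleC_minus_left[of 1 f] by (simp add: scaleC_simps)

lemma cinner_minus_right: "cinner f (- g) = - cinner f g"
  using cinner_scaleC_right[of f "-1" g] scaleC_minus_left[of 1 g] by (simp add: scaleC_simps)

lemma cinner_diff_left: "cinner (f - g) h = cinner f h - cinner g h"
  using cinner_add_left[of f "-g" h] by (simp add: cinner_minus_left)

lemma cinner_diff_right: "cinner h (f - g) = cinner h f - cinner h g"
  using cinner_add_right[of h f "-g"] by (simp add: cinner_minus_right)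

lemma cinner_self_norm: "cinner f f = complex_of_real ((norm f)\<^sup>2)"
  using cinner_self(1)[of f] by (simp add: power2_norm_eq_inner inner_L2_def)

lemma cinner_abs:
  assumes "square_integrable f" "square_integrable g"
  shows "cinner (abs_L2 f) (abs_L2 g) = (LINT x|lborel. f x * cnj (g x))"
  using assms by (simp add: cinner.abs_eq)

lemma norm_abs_L2_sq:
  assumes "square_integrable f"
  shows "(norm (abs_L2 f))\<^sup>2 = (LINT x|lborel. (cmod (f x))\<^sup>2)"
proof -
  have "complex_of_real ((norm (abs_L2 f))\<^sup>2) = (LINT x|lborel. f x * cnj (f x))"
    using cinner_abs[OF assms assms] cinner_self_norm[of "abs_L2 f"] by simp
  also have "\<dots> = complex_of_real (LINT x|lborel. (cmod (f x))\<^sup>2)"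
    by (simp flip: complex_norm_square of_real_power)
  finally show ?thesis by (simp only: of_real_eq_iff)
qed

lemma norm_scaleC: "norm (scaleC c f) = cmod c * norm f"
proof -
  have "complex_of_real ((norm (scaleC c f))\<^sup>2) = c * cnj c * cinner f f"
    by (simp only: cinner_self_norm[symmetric] cinner_scaleC_left cinner_scaleC_right mult_ac)
  also have "\<dots> = complex_of_real ((cmod c * norm f)\<^sup>2)"
    by (simp only: cinner_self_norm power_mult_distrib of_real_mult complex_norm_square)
  finally have "(norm (scaleC c f))\<^sup>2 = (cmod c * norm f)\<^sup>2" by (simp only: of_real_eq_iff)
  then show ?thesis by (simp add: power2_eq_iff_nonneg)
qed

lemma bounded_linear_scaleC: "bounded_linear (scaleC c)"
  by (rule bounded_linear_intro[where K="cmod c"])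
    (simp_all only: scaleC_simps(1,3) scaleC_simps(5)[symmetric] norm_scaleC mult.commute order_refl)

lemmas continuous_scaleC [continuous_intros] =
  bounded_linear.continuous_on[OF bounded_linear_scaleC]
lemmas tendsto_scaleC [tendsto_intros] = bounded_linear.tendsto[OF bounded_linear_scaleC]

lemma tendsto_cinner:
  assumes "(f \<longlongrightarrow> a) F" "(g \<longlongrightarrow> b) F"
  shows "((\<lambda>x. cinner (f x) (g x)) \<longlongrightarrow> cinner a b) F"
  unfolding cinner_eq_inner by (intro tendsto_intros assms)

lemma eq_zero_if_cinner_dense:
  assumes "closure S = UNIV" "\<And>s. s \<in> S \<Longrightarrow> cinner s g = 0"
  shows "g = 0"
proof -
  obtain s where s: "\<And>n::nat. s n \<in> S" "s \<longlonglongrightarrow> g"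
    using assms(1) closure_sequential[of g S] by auto
  have "(\<lambda>n. cinner (s n) g) \<longlonglongrightarrow> cinner g g"
    by (intro tendsto_cinner s tendsto_const)
  then have "cinner g g = 0" using s(1) assms(2) by (simp add: LIMSEQ_const_iff)
  then show ?thesis by (simp add: cinner_self_norm)
qed

lemma nn_integral_norm_sq:
  assumes "square_integrable f"
  shows "(\<integral>\<^sup>+x. ennreal ((cmod (f x))\<^sup>2) \<partial>lborel) = ennreal ((norm (abs_L2 f))\<^sup>2)"
  using assms by (simp add: norm_abs_L2_sq nn_integral_eq_integral square_integrable_def)

lemma ennreal_suminf_term: "f n \<le> (\<Sum>n. f n)" for f :: "nat \<Rightarrow> ennreal"
  using sum_le_suminf[of f "{n}"] by auto

text \<open>Riesz-Fischer. Along a subsequence with \<open>\<parallel>f\<^sub>n\<^sub>+\<^sub>1 - f\<^sub>n\<parallel>\<^sup>2 \<le> 4\<^sup>-\<^sup>n\<close> the integrals of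
  \<open>\<Sum>\<^sub>n 2\<^sup>n \<bar>f\<^sub>n\<^sub>+\<^sub>1 - f\<^sub>n\<bar>\<^sup>2\<close> are finite, so that the increments are almost everywhere summable, and
  Fatou's lemma turns the pointwise limit into a limit in norm.\<close>

lemma L2_fast_Cauchy_convergent:
  fixes X :: "nat \<Rightarrow> 'a::euclidean_space L2"
  assumes fast: "\<And>n m. n \<le> m \<Longrightarrow> norm (X m - X n) \<le> (1/2)^n"
  shows "convergent X"
proof -
  define x where "x n = rep_L2 (X n)" for n
  have sq: "square_integrable (x n)" for n by (simp add: x_def square_integrable_rep_L2)
  have X: "X n = abs_L2 (x n)" for n by (simp add: x_def abs_rep_L2)
  have [measurable]: "x n \<in> borel_measurable borel" for n using sq by (simp add: square_integrable_def)
  have dif: "(\<integral>\<^sup>+t. ennreal ((cmod (x m t - x n t))\<^sup>2) \<partial>lborel) = ennreal ((norm (X m - X n))\<^sup>2)" for m n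
    using nn_integral_norm_sq[OF square_integrable_minus[OF sq sq], of m n]
    by (simp add: abs_L2_diff sq X)
  define S where "S t = (\<Sum>n. ennreal (2^n * (cmod (x (Suc n) t - x n t))\<^sup>2))" for t
  have "(\<integral>\<^sup>+t. S t \<partial>lborel) = (\<Sum>n. \<integral>\<^sup>+t. ennreal (2^n * (cmod (x (Suc n) t - x n t))\<^sup>2) \<partial>lborel)"
    unfolding S_def by (rule nn_integral_suminf) simp
  also have "\<dots> \<le> (\<Sum>n. ennreal ((1/2)^n))"
  proof (rule suminf_le)
    fix n
    have "(\<integral>\<^sup>+t. ennreal (2^n * (cmod (x (Suc n) t - x n t))\<^sup>2) \<partial>lborel)
        = ennreal (2^n) * (\<integral>\<^sup>+t. ennreal ((cmod (x (Suc n) t - x n t))\<^sup>2) \<partial>lborel)"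
      by (subst nn_integral_cmult[symmetric]) (auto simp: ennreal_mult)
    also have "\<dots> = ennreal (2^n * (norm (X (Suc n) - X n))\<^sup>2)"
      by (simp add: dif ennreal_mult)
    also have "\<dots> \<le> ennreal (2^n * ((1/2)^n)\<^sup>2)"
      by (intro ennreal_leI mult_left_mono power_mono fast) auto
    also have "2^n * ((1/2)^n)\<^sup>2 = (1/2::real)^n"
      by (simp add: power2_eq_square power_divide)
    finally show "(\<integral>\<^sup>+t. ennreal (2^n * (cmod (x (Suc n) t - x n t))\<^sup>2) \<partial>lborel) \<le> ennreal ((1/2)^n)" .
  qed auto
  also have "\<dots> = ennreal (\<Sum>n. (1/2)^n)"
    by (rule suminf_ennreal2) auto
  also have "\<dots> < \<infinity>" by simp
  finally have fin: "(\<integral>\<^sup>+t. S t \<partial>lborel) \<noteq> \<infinity>" by simp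
  have Smeas: "S \<in> borel_measurable lborel" unfolding S_def by measurable
  have "AE t in lborel. S t \<noteq> \<infinity>"
    by (rule nn_integral_PInf_AE[OF Smeas fin])
  then have AEc: "AE t in lborel. convergent (\<lambda>n. x n t)"
  proof (rule AE_mp, intro AE_I2 impI)
    fix t assume "S t \<noteq> \<infinity>"
    then obtain M where M: "S t = ennreal M" "0 \<le> M"
      by (metis ennreal_cases infinity_ennreal_def)
    have le: "cmod (x (Suc n) t - x n t) \<le> sqrt M * (sqrt (1/2))^n" for n
    proof -
      have "ennreal (2^n * (cmod (x (Suc n) t - x n t))\<^sup>2) \<le> S t"
        unfolding S_def by (rule ennreal_suminf_term)
      then have "2^n * (cmod (x (Suc n) t - x n t))\<^sup>2 \<le> M"
        unfolding M(1) by (rule ennreal_le_iff[OF M(2), THEN iffD1])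
      then have "(cmod (x (Suc n) t - x n t))\<^sup>2 \<le> M * (1/2)^n"
        by (simp add: field_simps)
      then have "cmod (x (Suc n) t - x n t) \<le> sqrt (M * (1/2)^n)"
        by (rule real_le_rsqrt)
      then show ?thesis by (simp add: real_sqrt_mult real_sqrt_power)
    qed
    have "summable (\<lambda>n. x (Suc n) t - x n t)"
    proof (rule summable_comparison_test)
      show "\<exists>N. \<forall>n\<ge>N. norm (x (Suc n) t - x n t) \<le> sqrt M * (sqrt (1/2))^n" using le by auto
      show "summable (\<lambda>n. sqrt M * (sqrt (1/2))^n)"
        by (intro summable_mult summable_geometric) (simp add: real_less_lsqrt)
    qed
    then have "convergent (\<lambda>n. \<Sum>i<n. x (Suc i) t - x i t)"
      by (simp add: summable_iff_convergent)
    then have "convergent (\<lambda>n. x n t - x 0 t)" by (simp add: sum_lessThan_telescope[of "\<lambda>n. x n t"])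
    then have "convergent (\<lambda>n. (x n t - x 0 t) + x 0 t)"
      by (intro convergent_add convergent_const)
    then show "convergent (\<lambda>n. x n t)" by simp
  qed
  define y where "y t = lim (\<lambda>n. x n t)" for t
  have ymeas[measurable]: "y \<in> borel_measurable borel"
    unfolding y_def by (rule borel_measurable_lim_metric) simp
  have bnd: "(\<integral>\<^sup>+t. ennreal ((cmod (y t - x n t))\<^sup>2) \<partial>lborel) \<le> ennreal (((1/2)^n)\<^sup>2)" for n
  proof -
    have "(\<integral>\<^sup>+t. ennreal ((cmod (y t - x n t))\<^sup>2) \<partial>lborel)
        = (\<integral>\<^sup>+t. liminf (\<lambda>m. ennreal ((cmod (x m t - x n t))\<^sup>2)) \<partial>lborel)"
    proof (rule nn_integral_cong_AE, rule AE_mp[OF AEc], intro AE_I2 impI)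
      fix t assume "convergent (\<lambda>n. x n t)"
      then have "(\<lambda>n. x n t) \<longlonglongrightarrow> y t" by (simp add: y_def convergent_LIMSEQ_iff)
      then have "(\<lambda>m. ennreal ((cmod (x m t - x n t))\<^sup>2)) \<longlonglongrightarrow> ennreal ((cmod (y t - x n t))\<^sup>2)"
        by (intro tendsto_intros tendsto_ennrealI)
      then show "ennreal ((cmod (y t - x n t))\<^sup>2) = liminf (\<lambda>m. ennreal ((cmod (x m t - x n t))\<^sup>2))"
        by (rule lim_imp_Liminf[OF sequentially_bot, symmetric])
    qed
    also have "\<dots> \<le> liminf (\<lambda>m. \<integral>\<^sup>+t. ennreal ((cmod (x m t - x n t))\<^sup>2) \<partial>lborel)"
      by (rule nn_integral_liminf) simp
    also have "\<dots> \<le> ennreal (((1/2)^n)\<^sup>2)"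
      unfolding dif
      by (intro Liminf_le eventually_sequentiallyI[of n] ennreal_leI power_mono fast) auto
    finally show ?thesis .
  qed
  have yx: "square_integrable (\<lambda>t. y t - x n t)" for n
  proof -
    have "(\<integral>\<^sup>+t. ennreal ((cmod (y t - x n t))\<^sup>2) \<partial>lborel) < \<infinity>"
      using bnd[of n] le_less_trans by fastforce
    then show ?thesis unfolding square_integrable_def
      by (intro conjI integrableI_bounded) (auto simp: ymeas)
  qed
  have y: "square_integrable y"
    using square_integrable_add[OF yx[of 0] sq[of 0]] by simp
  have "norm (abs_L2 y - X n) \<le> (1/2)^n" for n
  proof -
    have "ennreal ((norm (abs_L2 y - X n))\<^sup>2) \<le> ennreal (((1/2)^n)\<^sup>2)"
      using bnd[of n] nn_integral_norm_sq[OF yx[of n]] by (simp add: X abs_L2_diff y sq)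
    then have "(norm (abs_L2 y - X n))\<^sup>2 \<le> ((1/2)^n)\<^sup>2" by (simp add: ennreal_le_iff)
    then show ?thesis by (rule power2_le_imp_le) simp
  qed
  then have "\<forall>\<^sub>F n in sequentially. norm (X n - abs_L2 y) \<le> (1/2)^n"
    by (simp add: norm_minus_commute)
  then have "(\<lambda>n. X n - abs_L2 y) \<longlonglongrightarrow> 0"
    by (rule Lim_null_comparison) (intro LIMSEQ_power_zero, simp)
  then have "X \<longlonglongrightarrow> abs_L2 y" by (simp add: LIM_zero_iff)
  then show ?thesis by (rule convergentI)
qed

lemma L2_Cauchy_convergent:
  fixes X :: "nat \<Rightarrow> 'a::euclidean_space L2"
  assumes "Cauchy X" shows "convergent X"
proof -
  have "\<forall>k. \<exists>N. \<forall>m\<ge>N. \<forall>n\<ge>N. norm (X m - X n) < (1/2)^k"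
    using assms by (simp add: Cauchy_iff)
  then obtain N where N: "\<And>k m n. m \<ge> N k \<Longrightarrow> n \<ge> N k \<Longrightarrow> norm (X m - X n) < (1/2)^k"
    by metis
  define s where "s k = (\<Sum>i\<le>k. N i) + k" for k
  have sN: "N k \<le> s m" if "k \<le> m" for k m
  proof -
    have "N k \<le> (\<Sum>i\<le>m. N i)" using that by (intro member_le_sum) auto
    then show ?thesis by (simp add: s_def)
  qed
  have s: "strict_mono s" by (rule strict_monoI_Suc) (simp add: s_def)
  have "convergent (X \<circ> s)"
    by (rule L2_fast_Cauchy_convergent) (auto intro!: less_imp_le N sN)
  then obtain l where "(X \<circ> s) \<longlonglongrightarrow> l" by (auto simp: convergent_def)
  then show ?thesis using Cauchy_converges_subseq[OF assms s] by (auto simp: convergent_def)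
qed

section \<open>Orthogonal complements and self-adjoint operators\<close>

lemma norm_diff_scaleR_sq:
  "(norm (a - c *\<^sub>R x))\<^sup>2 = (norm a)\<^sup>2 - 2 * c * inner a x + c\<^sup>2 * (norm x)\<^sup>2" for a x :: "'b::real_inner"
  unfolding power2_norm_eq_inner
  by (simp add: inner_diff_left inner_diff_right inner_commute[of x a] algebra_simps power2_eq_square)

text \<open>The projection theorem: a sequence in \<open>S\<close> minimising the distance to \<open>x\<close> is Cauchy by the
  parallelogram identity, and \<open>x\<close> minus its limit is orthogonal to \<open>S\<close>.\<close>

lemma closed_subspace_eq_UNIV:
  fixes S :: "'a::euclidean_space L2 set"
  assumes S: "closed S" "0 \<in> S" "\<And>u v. u \<in> S \<Longrightarrow> v \<in> S \<Longrightarrow> u + v \<in> S" "\<And>c u. u \<in> S \<Longrightarrow> scaleC c u \<in> S"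
    and ortho: "\<And>g. (\<And>s. s \<in> S \<Longrightarrow> cinner s g = 0) \<Longrightarrow> g = 0"
  shows "S = UNIV"
proof (rule ccontr)
  assume "S \<noteq> UNIV"
  then obtain x where x: "x \<notin> S" by auto
  define d where "d = infdist x S"
  have scR: "r *\<^sub>R u \<in> S" if "u \<in> S" for r u
    using S(4)[OF that, of "complex_of_real r"] by (simp add: scaleC_simps)
  have dle: "d \<le> norm (x - s)" if "s \<in> S" for s
    using infdist_le[OF that, of x] by (simp add: d_def dist_norm)
  have "\<exists>s\<in>S. norm (x - s) < d + inverse (real (Suc n))" for n
  proof (rule ccontr)
    assume "\<not> ?thesis"
    then have "\<And>s. s \<in> S \<Longrightarrow> d + inverse (real (Suc n)) \<le> dist x s" by (auto simp: dist_norm)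
    then have "d + inverse (real (Suc n)) \<le> infdist x S"
      using S(2) by (subst infdist_notempty) (auto intro!: cINF_greatest)
    then have "inverse (real (Suc n)) \<le> 0" by (simp add: d_def)
    then show False by simp
  qed
  then obtain s where s: "\<And>n. s n \<in> S" "\<And>n. norm (x - s n) < d + inverse (real (Suc n))"
    by metis
  have d0: "0 \<le> d" by (simp add: d_def infdist_nonneg)
  have ns: "(\<lambda>n. norm (x - s n)) \<longlonglongrightarrow> d"
  proof (rule tendsto_sandwich[OF _ _ tendsto_const])
    show "\<forall>\<^sub>F n in sequentially. d \<le> norm (x - s n)" using dle s(1) by simp
    show "\<forall>\<^sub>F n in sequentially. norm (x - s n) \<le> d + inverse (real (Suc n))"
      using s(2) by (simp add: less_imp_le)
    show "(\<lambda>n. d + inverse (real (Suc n))) \<longlonglongrightarrow> d"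
      by (rule LIMSEQ_inverse_real_of_nat_add)
  qed
  have par: "(norm (s n - s m))\<^sup>2 \<le> 2 * (norm (x - s n))\<^sup>2 + 2 * (norm (x - s m))\<^sup>2 - 4 * d\<^sup>2" for n m
  proof -
    have "(1/2) *\<^sub>R (s n + s m) \<in> S" using S(3) scR s(1) by blast
    then have "d \<le> norm (x - (1/2) *\<^sub>R (s n + s m))" by (rule dle)
    then have "d\<^sup>2 \<le> (norm (x - (1/2) *\<^sub>R (s n + s m)))\<^sup>2" using d0 by (intro power_mono) auto
    moreover have "4 * (norm (x - (1/2) *\<^sub>R (s n + s m)))\<^sup>2 =
        2 * (norm (x - s n))\<^sup>2 + 2 * (norm (x - s m))\<^sup>2 - (norm (s n - s m))\<^sup>2"
      unfolding power2_norm_eq_inner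
      by (simp add: inner_diff_left inner_diff_right inner_add_left inner_add_right inner_commute algebra_simps)
    ultimately show ?thesis by linarith
  qed
  have "Cauchy s"
    unfolding Cauchy_altdef2 Cauchy_def
  proof (intro allI impI)
    fix e :: real assume e: "0 < e"
    have "(\<lambda>n. (norm (x - s n))\<^sup>2) \<longlonglongrightarrow> d\<^sup>2" by (intro tendsto_intros ns)
    then have "\<forall>\<^sub>F n in sequentially. (norm (x - s n))\<^sup>2 < d\<^sup>2 + e\<^sup>2 / 4"
      using e by (intro order_tendstoD(2)) auto
    then obtain N where N: "\<And>n. n \<ge> N \<Longrightarrow> (norm (x - s n))\<^sup>2 < d\<^sup>2 + e\<^sup>2 / 4"
      by (auto simp: eventually_sequentially)
    have "dist (s m) (s n) < e" if "m \<ge> N" "n \<ge> N" for m n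
    proof -
      have "(norm (s m - s n))\<^sup>2 < e\<^sup>2"
        using par[of m n] N[OF that(1)] N[OF that(2)] by simp
      then show ?thesis using e by (simp add: dist_norm power2_less_imp_less)
    qed
    then show "\<exists>N. \<forall>n\<ge>N. dist (s n) (s N) < e" by auto
  qed
  then obtain l where l: "s \<longlonglongrightarrow> l"
    using L2_Cauchy_convergent by (auto simp: convergent_def)
  have lS: "l \<in> S" using closed_sequentially[OF S(1) _ l] s(1) by auto
  have nl: "norm (x - l) = d"
    by (rule LIMSEQ_unique[OF tendsto_norm[OF tendsto_diff[OF tendsto_const l]] ns])
  have real_ortho: "inner t (x - l) = 0" if t: "t \<in> S" for t
  proof (cases "t = 0")
    case False
    define a where "a = inner t (x - l) / (norm t)\<^sup>2"
    have "l + a *\<^sub>R t \<in> S" using S(3) lS scR t by blast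
    then have "d \<le> norm (x - (l + a *\<^sub>R t))" by (rule dle)
    then have "d\<^sup>2 \<le> (norm (x - (l + a *\<^sub>R t)))\<^sup>2" using d0 by (intro power_mono) auto
    also have "(norm (x - (l + a *\<^sub>R t)))\<^sup>2 = (norm (x - l))\<^sup>2 - 2 * a * inner t (x - l) + a\<^sup>2 * (norm t)\<^sup>2"
      unfolding power2_norm_eq_inner
      by (simp add: inner_diff_left inner_diff_right inner_add_left inner_add_right inner_commute
          algebra_simps power2_eq_square)
    also have "\<dots> = d\<^sup>2 - (inner t (x - l))\<^sup>2 / (norm t)\<^sup>2"
      using False by (simp add: a_def nl power2_eq_square field_simps)
    finally have "(inner t (x - l))\<^sup>2 / (norm t)\<^sup>2 \<le> 0" by simp
    then have "(inner t (x - l))\<^sup>2 \<le> 0" using False by (simp add: divide_le_0_iff)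
    then show ?thesis by simp
  qed simp
  have "x - l = 0"
  proof (rule ortho)
    fix t assume t: "t \<in> S"
    have "inner (scaleC (- \<i>) t) (x - l) = 0" using real_ortho[OF S(4)[OF t]] .
    then show "cinner t (x - l) = 0"
      using real_ortho[OF t] by (simp add: inner_L2_def cinner_scaleC_left complex_eq_iff)
  qed
  then show False using x lS by simp
qed

definition symmetric_op :: "'a::euclidean_space op \<Rightarrow> bool" where
  "symmetric_op A \<longleftrightarrow> (\<forall>(u, v)\<in>A. \<forall>(u', v')\<in>A. cinner v u' = cinner u v')"

lemma self_adjointD:
  assumes "self_adjoint A"
  shows "linear_operator A" "closed A" "symmetric_op A" "closure (Domain A) = UNIV"
proof -
  have eq: "op_adjoint A = A" using assms by (simp add: self_adjoint_def)
  show "linear_operator A" "closure (Domain A) = UNIV" using assms by (simp_all add: self_adjoint_def)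
  show "closed A" using closed_op_adjoint[of A] eq by simp
  have "\<And>p. p \<in> A \<Longrightarrow> p \<in> op_adjoint A" using eq by simp
  then show "symmetric_op A" by (fastforce simp: symmetric_op_def op_adjoint_def)
qed

lemma linear_operator_diff:
  assumes "linear_operator A" "(u, v) \<in> A" "(u', v') \<in> A"
  shows "(u - u', v - v') \<in> A"
proof -
  have "(scaleC (-1) u', scaleC (-1) v') \<in> A" using assms unfolding linear_operator_def by blast
  then have "(u + scaleC (-1) u', v + scaleC (-1) v') \<in> A"
    using assms unfolding linear_operator_def by blast
  then show ?thesis using scaleC_minus_left[of 1 u'] scaleC_minus_left[of 1 v'] by (simp add: scaleC_simps)
qed

text \<open>The inner product of \<open>v\<close> and \<open>u\<close> is real, so \<open>v - Re z u\<close> and \<open>\<i> Im z u\<close> are orthogonal for the real inner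
  product.\<close>

lemma symmetric_op_norm_sq:
  assumes "symmetric_op A" "(u, v) \<in> A"
  shows "(norm (v - scaleC z u))\<^sup>2 = (norm (v - Re z *\<^sub>R u))\<^sup>2 + (Im z)\<^sup>2 * (norm u)\<^sup>2"
proof -
  define w where "w = v - Re z *\<^sub>R u"
  have vu: "cinner v u = cinner u v" using assms by (auto simp: symmetric_op_def)
  have "cinner v u = cnj (cinner v u)" using vu cinner_commute[of v u] by simp
  then have "Im (cinner v u) = 0" by (metis Reals_cnj_iff complex_is_Real_iff)
  then have im: "Im (cinner w u) = 0"
    by (simp add: w_def cinner_diff_left cinner_scaleC_left cinner_self_norm flip: scaleC_simps(5))
  have "v - scaleC z u = w - scaleC (\<i> * Im z) u"
    by (subst complex_eq) (simp add: w_def scaleC_simps)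
  then have "(norm (v - scaleC z u))\<^sup>2 = (norm w)\<^sup>2 - 2 * inner w (scaleC (\<i> * Im z) u) + (norm (scaleC (\<i> * Im z) u))\<^sup>2"
    by (simp add: power2_norm_eq_inner inner_diff_left inner_diff_right inner_commute)
  also have "inner w (scaleC (\<i> * Im z) u) = 0"
    using im by (simp add: inner_L2_def cinner_scaleC_right)
  finally show ?thesis by (simp add: w_def norm_scaleC norm_mult power_mult_distrib)
qed

lemma symmetric_op_lower_bound:
  assumes "symmetric_op A" "(u, v) \<in> A"
  shows "\<bar>Im z\<bar> * norm u \<le> norm (v - scaleC z u)"
proof (rule power2_le_imp_le)
  show "(\<bar>Im z\<bar> * norm u)\<^sup>2 \<le> (norm (v - scaleC z u))\<^sup>2"
    unfolding symmetric_op_norm_sq[OF assms] by (simp add: power_mult_distrib)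
qed simp

text \<open>The lower bound makes the range closed: if the images converge, so do the preimages.\<close>

lemma range_eq_UNIV:
  fixes B :: "'a::euclidean_space op"
  assumes lin: "linear_operator B" and cl: "closed B" and c: "0 < c"
    and low: "\<And>u v. (u, v) \<in> B \<Longrightarrow> c * norm u \<le> norm (v - scaleC z u)"
    and ortho: "\<And>g. (\<And>u v. (u, v) \<in> B \<Longrightarrow> cinner (v - scaleC z u) g = 0) \<Longrightarrow> g = 0"
  shows "\<exists>u. (u, f + scaleC z u) \<in> B"
proof -
  define S where "S = (\<lambda>(u, v). v - scaleC z u) ` B"
  have "S = UNIV"
  proof (rule closed_subspace_eq_UNIV)
    have B: "(0, 0) \<in> B" "\<And>u v u' v'. (u, v) \<in> B \<Longrightarrow> (u', v') \<in> B \<Longrightarrow> (u + u', v + v') \<in> B"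
      "\<And>c u v. (u, v) \<in> B \<Longrightarrow> (scaleC c u, scaleC c v) \<in> B"
      using lin unfolding linear_operator_def by blast+
    show "0 \<in> S" unfolding S_def by (rule image_eqI[OF _ B(1)]) simp
    fix s t and a :: complex assume "s \<in> S"
    then obtain u v where s: "s = v - scaleC z u" "(u, v) \<in> B" by (auto simp: S_def)
    show "scaleC a s \<in> S" unfolding S_def
      by (rule image_eqI[OF _ B(3)[OF s(2), of a]])
        (simp add: s scaleC_diff_right scaleC_simps(3) mult.commute)
    assume "t \<in> S"
    then obtain u' v' where t: "t = v' - scaleC z u'" "(u', v') \<in> B" by (auto simp: S_def)
    show "s + t \<in> S" unfolding S_def
      by (rule image_eqI[OF _ B(2)[OF s(2) t(2)]]) (simp add: s t scaleC_simps)
  next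
    fix g assume "\<And>s. s \<in> S \<Longrightarrow> cinner s g = 0"
    then show "g = 0" by (intro ortho) (auto simp: S_def)
  next
    show "closed S"
      unfolding closed_sequential_limits
    proof (intro allI impI, elim conjE)
      fix X l assume X: "\<forall>n. X n \<in> S" and Xl: "X \<longlonglongrightarrow> l"
      have "\<forall>n. \<exists>u. (u, X n + scaleC z u) \<in> B"
      proof
        fix n
        obtain u v where "(u, v) \<in> B" "X n = v - scaleC z u" using X unfolding S_def by fast
        then show "\<exists>u. (u, X n + scaleC z u) \<in> B" by (intro exI[of _ u]) simp
      qed
      then obtain u where u: "\<And>n. (u n, X n + scaleC z (u n)) \<in> B" by metis
      have du: "c * norm (u n - u m) \<le> norm (X n - X m)" for n m
        using low[OF linear_operator_diff[OF lin u[of n] u[of m]]]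
        by (simp add: scaleC_diff_right algebra_simps)
      have "Cauchy u"
        unfolding Cauchy_iff
      proof (intro allI impI)
        fix e :: real assume e: "0 < e"
        obtain N where N: "\<And>m n. m \<ge> N \<Longrightarrow> n \<ge> N \<Longrightarrow> norm (X m - X n) < c * e"
          using LIMSEQ_imp_Cauchy[OF Xl] c e by (auto simp: Cauchy_iff) (metis mult_pos_pos)
        have "norm (u m - u n) < e" if "m \<ge> N" "n \<ge> N" for m n
          using le_less_trans[OF du N[OF that]] c by simp
        then show "\<exists>M. \<forall>m\<ge>M. \<forall>n\<ge>M. norm (u m - u n) < e" by blast
      qed
      then obtain w where w: "u \<longlonglongrightarrow> w" using L2_Cauchy_convergent by (auto simp: convergent_def)
      have "(\<lambda>n. (u n, X n + scaleC z (u n))) \<longlonglongrightarrow> (w, l + scaleC z w)"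
        by (intro tendsto_intros w Xl)
      then have "(w, l + scaleC z w) \<in> B"
        using closed_sequentially[OF cl, of "\<lambda>n. (u n, X n + scaleC z (u n))"] u by blast
      then show "l \<in> S" unfolding S_def by (intro image_eqI[where x="(w, l + scaleC z w)"]) auto
    qed
  qed
  then have "f \<in> S" by simp
  then obtain u v where "(u, v) \<in> B" "f = v - scaleC z u" by (auto simp: S_def)
  then show ?thesis by (intro exI[of _ u]) simp
qed

text \<open>A vector orthogonal to the range of \<open>H - z\<close> lies in the kernel of the adjoint \<open>H - cnj z\<close>, which
  is trivial by the second bound.\<close>

lemma self_adjoint_range:
  assumes sa: "self_adjoint H" and c: "0 < c"
    and low: "\<And>u v. (u, v) \<in> H \<Longrightarrow> c * norm u \<le> norm (v - scaleC z u)"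
      "\<And>u v. (u, v) \<in> H \<Longrightarrow> c * norm u \<le> norm (v - scaleC (cnj z) u)"
  shows "\<exists>u. (u, f + scaleC z u) \<in> H"
proof (rule range_eq_UNIV[OF self_adjointD(1)[OF sa] self_adjointD(2)[OF sa] c low(1)])
  fix g assume g: "\<And>u v. (u, v) \<in> H \<Longrightarrow> cinner (v - scaleC z u) g = 0"
  then have "(g, scaleC (cnj z) g) \<in> op_adjoint H"
    by (auto simp: op_adjoint_def cinner_diff_left cinner_scaleC_left cinner_scaleC_right)
  then have "(g, scaleC (cnj z) g) \<in> H" using sa by (simp add: self_adjoint_def)
  from low(2)[OF this] c show "g = 0" by (simp add: mult_le_0_iff)
qed

lemma self_adjoint_range_nonreal:
  assumes "self_adjoint H" "Im z \<noteq> 0"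
  shows "\<exists>u. (u, f + scaleC z u) \<in> H"
  using assms symmetric_op_lower_bound[OF self_adjointD(3)[OF assms(1)], of _ _ z]
    symmetric_op_lower_bound[OF self_adjointD(3)[OF assms(1)], of _ _ "cnj z"]
  by (intro self_adjoint_range[where c="\<bar>Im z\<bar>"]) auto

lemma symmetric_op_unique:
  assumes "linear_operator H" "symmetric_op H" "Im z \<noteq> 0"
    "(u, f + scaleC z u) \<in> H" "(u', f + scaleC z u') \<in> H"
  shows "u = u'"
  using symmetric_op_lower_bound[OF assms(2) linear_operator_diff[OF assms(1,4,5)], of z] assms(3)
  by (simp add: scaleC_diff_right mult_le_0_iff)

lemma resolvent_eq:
  assumes "linear_operator H" "symmetric_op H" "Im z \<noteq> 0" "(u, f + scaleC z u) \<in> H"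
  shows "resolvent H z f = u"
  unfolding resolvent_def using assms symmetric_op_unique[OF assms(1-3)] by blast

lemma spectrum_self_adjoint_subset:
  assumes "self_adjoint H" shows "spectrum H \<subseteq> \<real>"
proof
  fix z assume z: "z \<in> spectrum H"
  show "z \<in> \<real>"
  proof (rule ccontr)
    assume "z \<notin> \<real>"
    then have im: "Im z \<noteq> 0" by (simp add: complex_is_Real_iff)
    note H = self_adjointD[OF assms]
    have "\<exists>!u. (u, f + scaleC z u) \<in> H" for f
      using self_adjoint_range_nonreal[OF assms im] symmetric_op_unique[OF H(1,3) im] by blast
    moreover have "norm u \<le> (1 / \<bar>Im z\<bar>) * norm f" if "(u, f + scaleC z u) \<in> H" for u f
      using symmetric_op_lower_bound[OF H(3) that, of z] im by (simp add: field_simps)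
    ultimately have "z \<in> resolvent_set H" unfolding resolvent_set_def by blast
    then show False using z by (simp add: spectrum_def)
  qed
qed

text \<open>The spectrum is not empty, unless the space is trivial. If all real numbers had distance at least \<open>r\<close>
  from the spectrum, the inverse \<open>T\<close> of \<open>H\<close> would be a bounded symmetric operator for which both \<open>T - m\<close>
  and \<open>T + m\<close>, \<open>m = \<parallel>T\<parallel>\<close>, are bounded below; but
  \<open>\<parallel>(T\<^sup>2 - m\<^sup>2) x\<parallel>\<^sup>2 \<le> m\<^sup>2 (m\<^sup>2 \<parallel>x\<parallel>\<^sup>2 - \<parallel>T x\<parallel>\<^sup>2)\<close>, so that then \<open>\<parallel>T\<parallel> < m\<close>.\<close>

lemma self_adjoint_not_bounded_below_everywhere:
  fixes H :: "'a::euclidean_space op"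
  assumes sa: "self_adjoint H" and r: "0 < r"
    and low: "\<And>u v (l::real). (u, v) \<in> H \<Longrightarrow> r * norm u \<le> norm (v - l *\<^sub>R u)"
  shows "(f :: 'a L2) = 0"
proof (rule ccontr)
  assume f: "f \<noteq> 0"
  note lin = self_adjointD(1)[OF sa] and sym = self_adjointD(3)[OF sa]
  have low0: "r * norm u \<le> norm v" if "(u, v) \<in> H" for u v
    using low[OF that, of 0] by simp
  have "\<exists>u. (u, g) \<in> H" for g
    using self_adjoint_range[OF sa r, of 0 g] low0 by simp
  then obtain T where T: "\<And>g. (T g, g) \<in> H" by metis
  have Tu: "u = T g" if "(u, g) \<in> H" for u g
    using low0[OF linear_operator_diff[OF lin that T[of g]]] r by (simp add: mult_le_0_iff)
  have Tadd: "T (g + h) = T g + T h" for g h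
    using T[of g] T[of h] lin unfolding linear_operator_def by (metis Tu)
  have TC: "T (scaleC a g) = scaleC a (T g)" for a g
    using T[of g] lin unfolding linear_operator_def by (metis Tu)
  have TR: "T (a *\<^sub>R g) = a *\<^sub>R T g" for a g
    using TC[of "complex_of_real a" g] by (simp add: scaleC_simps)
  have Tb: "norm (T g) \<le> norm g * (1 / r)" for g
    using low0[OF T[of g]] r by (simp add: field_simps)
  have bl: "bounded_linear T" by (rule bounded_linear_intro[OF Tadd TR Tb])
  have Tsym: "inner (T g) h = inner g (T h)" for g h
    using sym T[of g] T[of h] by (fastforce simp: symmetric_op_def inner_L2_def)
  define m where "m = onorm T"
  have Tm: "norm (T g) \<le> m * norm g" for g using onorm[OF bl, of g] by (simp add: m_def)
  have "T f \<noteq> 0"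
  proof
    assume "T f = 0"
    then have "(0, f) \<in> H" using T[of f] by simp
    then show False using lin f by (auto simp: linear_operator_def)
  qed
  then have m: "0 < m" using onorm_pos_lt[OF bl] by (auto simp: m_def)
  (* The gap of H at 1 / b, where b is m or -m, gives |T y| <= |T y - b y| / (m r); so
     m |y| <= |T y| + |T y - b y| <= (1 + 1 / (m r)) |T y - b y|. *)
  define k where "k = m / (1 + 1 / (m * r))"
  have k: "0 < k" using m r by (simp add: k_def add_pos_pos)
  have shift: "k * norm y \<le> norm (T y - b *\<^sub>R y)" if b: "\<bar>b\<bar> = m" for y b
  proof -
    have b0: "b \<noteq> 0" using b m by auto
    have "T y - b *\<^sub>R y = (- b) *\<^sub>R (y - (1 / b) *\<^sub>R T y)"
      using b0 by (simp add: scaleR_diff_right)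
    then have "norm (T y - b *\<^sub>R y) = m * norm (y - (1 / b) *\<^sub>R T y)" using b by simp
    also have "\<dots> \<ge> m * (r * norm (T y))" using low[OF T[of y], of "1 / b"] m by simp
    finally have 1: "norm (T y) \<le> norm (T y - b *\<^sub>R y) / (m * r)"
      using m r by (simp add: field_simps)
    have "m * norm y = norm (T y - (T y - b *\<^sub>R y))" using b by simp
    also have "\<dots> \<le> norm (T y) + norm (T y - b *\<^sub>R y)" by (rule norm_triangle_ineq4)
    also have "\<dots> \<le> norm (T y - b *\<^sub>R y) * (1 + 1 / (m * r))"
      using 1 by (simp add: algebra_simps)
    finally show ?thesis using m r by (simp add: k_def field_simps add_pos_pos)
  qed
  have both: "k\<^sup>2 * norm x \<le> norm (T (T x) - m\<^sup>2 *\<^sub>R x)" for x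
  proof -
    define y where "y = T x - (- m) *\<^sub>R x"
    have "T y - m *\<^sub>R y = T (T x) - m\<^sup>2 *\<^sub>R x"
      by (simp add: y_def Tadd TR scaleR_add_right power2_eq_square)
    then have "k * norm y \<le> norm (T (T x) - m\<^sup>2 *\<^sub>R x)" using shift[of m y] m by simp
    moreover have "k * norm x \<le> norm y" using shift[of "- m" x] m by (simp add: y_def)
    then have "k * (k * norm x) \<le> k * norm y" using k by simp
    ultimately show ?thesis by (simp add: power2_eq_square mult.assoc)
  qed
  have "(norm (T x))\<^sup>2 \<le> (m\<^sup>2 - (k\<^sup>2)\<^sup>2 / m\<^sup>2) * (norm x)\<^sup>2" for x
  proof -
    have "(k\<^sup>2)\<^sup>2 * (norm x)\<^sup>2 \<le> (norm (T (T x) - m\<^sup>2 *\<^sub>R x))\<^sup>2"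
      using power_mono[OF both[of x], of 2] by (simp add: power_mult_distrib)
    also have "\<dots> = (norm (T (T x)))\<^sup>2 - 2 * m\<^sup>2 * (norm (T x))\<^sup>2 + m^4 * (norm x)\<^sup>2"
      by (simp add: norm_diff_scaleR_sq Tsym[of "T x" x] flip: power2_norm_eq_inner)
    also have "(norm (T (T x)))\<^sup>2 \<le> m\<^sup>2 * (norm (T x))\<^sup>2"
      using power_mono[OF Tm[of "T x"], of 2] by (simp add: power_mult_distrib)
    finally have "(k\<^sup>2)\<^sup>2 * (norm x)\<^sup>2 + m\<^sup>2 * (norm (T x))\<^sup>2 \<le> m^4 * (norm x)\<^sup>2" by simp
    then have "m\<^sup>2 * (norm (T x))\<^sup>2 \<le> m\<^sup>2 * ((m\<^sup>2 - (k\<^sup>2)\<^sup>2 / m\<^sup>2) * (norm x)\<^sup>2)"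
      using m by (simp add: left_diff_distrib right_diff_distrib power2_eq_square power4_eq_xxxx)
    then show ?thesis using m by simp
  qed
  note ** = this
  have nonneg: "0 \<le> m\<^sup>2 - (k\<^sup>2)\<^sup>2 / m\<^sup>2"
  proof (rule ccontr)
    assume "\<not> ?thesis"
    then have "(m\<^sup>2 - (k\<^sup>2)\<^sup>2 / m\<^sup>2) * (norm f)\<^sup>2 < 0" using f by (simp add: mult_less_0_iff)
    then show False using **[of f] by (smt (verit) zero_le_power2)
  qed
  have "norm (T x) \<le> sqrt (m\<^sup>2 - (k\<^sup>2)\<^sup>2 / m\<^sup>2) * norm x" for x
    using real_sqrt_le_mono[OF **[of x]] by (simp add: real_sqrt_mult)
  then have "m \<le> sqrt (m\<^sup>2 - (k\<^sup>2)\<^sup>2 / m\<^sup>2)"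
    unfolding m_def using nonneg by (intro onorm_bound) (auto simp: m_def)
  also have "\<dots> < sqrt (m\<^sup>2)" using m k by (intro real_sqrt_less_mono) simp
  finally show False using m by simp
qed

text \<open>The basic criterion: deficiency spaces at \<open>\<plusminus>\<i>\<close> vanish.\<close>

lemma essentially_self_adjointI:
  fixes A :: "'a::euclidean_space op"
  assumes add: "(0, 0) \<in> A" "\<And>u v u' v'. (u, v) \<in> A \<Longrightarrow> (u', v') \<in> A \<Longrightarrow> (u + u', v + v') \<in> A"
      "\<And>c u v. (u, v) \<in> A \<Longrightarrow> (scaleC c u, scaleC c v) \<in> A"
    and dense: "closure (Domain A) = UNIV" and sym: "symmetric_op A"
    and ortho: "\<And>g z. z = \<i> \<or> z = - \<i> \<Longrightarrow> (\<And>u v. (u, v) \<in> A \<Longrightarrow> cinner (v - scaleC z u) g = 0) \<Longrightarrow> g = 0"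
  shows "essentially_self_adjoint A"
proof -
  define B where "B = closure A"
  have AB: "A \<subseteq> B" by (simp add: B_def closure_subset)
  have lim: "\<exists>s. (\<forall>n::nat. (fst (s n), snd (s n)) \<in> A) \<and> (\<lambda>n. fst (s n)) \<longlonglongrightarrow> fst p \<and> (\<lambda>n. snd (s n)) \<longlonglongrightarrow> snd p"
    if "p \<in> B" for p
  proof -
    have "\<exists>s. (\<forall>n::nat. s n \<in> A) \<and> s \<longlonglongrightarrow> p"
      using that unfolding B_def by (rule closure_sequential[THEN iffD1])
    then obtain s where "\<forall>n::nat. s n \<in> A" "s \<longlonglongrightarrow> p" by blast
    then show ?thesis by (intro exI[of _ s]) (auto intro: tendsto_fst tendsto_snd)
  qed
  have BI: "(u, v) \<in> B" if "\<And>n::nat. (a n, b n) \<in> A" "a \<longlonglongrightarrow> u" "b \<longlonglongrightarrow> v" for a b u v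
    unfolding B_def closure_sequential using that by (intro exI[of _ "\<lambda>n. (a n, b n)"]) (auto intro: tendsto_Pair)
  have symB: "symmetric_op B"
    unfolding symmetric_op_def
  proof (intro ballI, clarify)
    fix u v u' v' assume "(u, v) \<in> B" "(u', v') \<in> B"
    from lim[OF this(1)] lim[OF this(2)] obtain s t where
      s: "\<And>n. (fst (s n), snd (s n)) \<in> A" "(\<lambda>n. fst (s n)) \<longlonglongrightarrow> u" "(\<lambda>n. snd (s n)) \<longlonglongrightarrow> v" and
      t: "\<And>n. (fst (t n), snd (t n)) \<in> A" "(\<lambda>n. fst (t n)) \<longlonglongrightarrow> u'" "(\<lambda>n. snd (t n)) \<longlonglongrightarrow> v'"
      by auto
    have "(\<lambda>n. cinner (snd (s n)) (fst (t n))) \<longlonglongrightarrow> cinner v u'" by (intro tendsto_cinner s t)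
    moreover have "(\<lambda>n. cinner (snd (s n)) (fst (t n))) = (\<lambda>n. cinner (fst (s n)) (snd (t n)))"
      using sym s(1) t(1) unfolding symmetric_op_def by fast
    moreover have "(\<lambda>n. cinner (fst (s n)) (snd (t n))) \<longlonglongrightarrow> cinner u v'" by (intro tendsto_cinner s t)
    ultimately show "cinner v u' = cinner u v'" using LIMSEQ_unique by metis
  qed
  have dB: "closure (Domain B) = UNIV"
    using closure_mono[OF Domain_mono[OF AB]] dense by auto
  have linB: "linear_operator B"
    unfolding linear_operator_def
  proof (intro conjI allI impI)
    show "(0, 0) \<in> B" using AB add(1) by auto
    fix u v assume uv: "(u, v) \<in> B"
    from lim[OF this] obtain s where
      s: "\<And>n. (fst (s n), snd (s n)) \<in> A" "(\<lambda>n. fst (s n)) \<longlonglongrightarrow> u" "(\<lambda>n. snd (s n)) \<longlonglongrightarrow> v"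
      by auto
    show "(scaleC c u, scaleC c v) \<in> B" for c
      by (rule BI[of "\<lambda>n. scaleC c (fst (s n))" "\<lambda>n. scaleC c (snd (s n))"])
        (intro add(3) s tendsto_intros)+
    fix u' v' assume "(u', v') \<in> B"
    from lim[OF this] obtain t where
      t: "\<And>n. (fst (t n), snd (t n)) \<in> A" "(\<lambda>n. fst (t n)) \<longlonglongrightarrow> u'" "(\<lambda>n. snd (t n)) \<longlonglongrightarrow> v'"
      by auto
    show "(u + u', v + v') \<in> B"
      by (rule BI[of "\<lambda>n. fst (s n) + fst (t n)" "\<lambda>n. snd (s n) + snd (t n)"])
        (intro add(2) s t tendsto_intros)+
  next
    fix v assume v: "(0, v) \<in> B"
    show "v = 0"
    proof (rule eq_zero_if_cinner_dense[OF dB])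
      fix s assume "s \<in> Domain B"
      then obtain t where "(s, t) \<in> B" by auto
      then have "cinner t 0 = cinner s v" using symB v unfolding symmetric_op_def by fast
      then show "cinner s v = 0" by simp
    qed
  qed
  have closedB: "closed B" by (simp add: B_def)
  have onto: "\<exists>u. (u, f + scaleC z u) \<in> B" if "z = \<i> \<or> z = - \<i>" for f z
  proof (rule range_eq_UNIV[OF linB closedB, of 1])
    show "1 * norm u \<le> norm (v - scaleC z u)" if "(u, v) \<in> B" for u v
      using symmetric_op_lower_bound[OF symB that, of z] \<open>z = \<i> \<or> z = - \<i>\<close> by auto
    fix g assume g: "\<And>u v. (u, v) \<in> B \<Longrightarrow> cinner (v - scaleC z u) g = 0"
    show "g = 0" by (rule ortho[OF that]) (use g AB in auto)
  qed simp
  have "op_adjoint B = B"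
  proof
    show "B \<subseteq> op_adjoint B" using symB by (fastforce simp: op_adjoint_def symmetric_op_def)
    show "op_adjoint B \<subseteq> B"
    proof clarify
      fix g h assume gh: "(g, h) \<in> op_adjoint B"
      obtain u where u: "(u, (h - scaleC \<i> g) + scaleC \<i> u) \<in> B" using onto[of \<i>] by auto
      have adj: "cinner y (g - u) = cinner x (scaleC \<i> (g - u))" if xy: "(x, y) \<in> B" for x y
      proof -
        have 1: "cinner y g = cinner x h" using gh xy by (auto simp: op_adjoint_def)
        have 2: "cinner y u = cinner x ((h - scaleC \<i> g) + scaleC \<i> u)"
          using symB xy u unfolding symmetric_op_def by fast
        have "cinner y (g - u) = cinner x (h - ((h - scaleC \<i> g) + scaleC \<i> u))"
          by (simp only: cinner_diff_right 1 2)
        also have "h - ((h - scaleC \<i> g) + scaleC \<i> u) = scaleC \<i> (g - u)"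
          by (simp add: scaleC_diff_right)
        finally show ?thesis .
      qed
      have "g - u = 0"
      proof (rule ortho[of "- \<i>"])
        fix x y assume "(x, y) \<in> A"
        then show "cinner (y - scaleC (- \<i>) x) (g - u) = 0"
          using adj[of x y] AB by (auto simp: cinner_diff_left[of y] cinner_scaleC_left cinner_scaleC_right)
      qed simp
      then show "(g, h) \<in> B" using u by simp
    qed
  qed
  then have "self_adjoint B" using linB dB by (simp add: self_adjoint_def)
  moreover have "linear_operator A"
  proof -
    have "\<And>v. (0, v) \<in> A \<Longrightarrow> v = 0" using linB AB unfolding linear_operator_def by blast
    then show ?thesis unfolding linear_operator_def
      by (intro conjI allI impI) (rule add | assumption)+
  qed
  ultimately show ?thesis using dense by (simp add: essentially_self_adjoint_def B_def)
qed

section \<open>Calculus of smooth functions\<close>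

lemma pds_Nil [simp]: "pds [] f = f" by (simp add: pds_def fun_eq_iff)

lemma pds_Cons [simp]: "pds (i # is) f = pd i (pds is f)" by (simp add: pds_def fun_eq_iff)

lemma pds_append: "pds (is @ js) f = pds is (pds js f)"
  by (induction "is") auto

lemma smooth_pds: "smooth_on UNIV f \<Longrightarrow> smooth_on UNIV (pds js f)"
  unfolding smooth_on_def by (metis pds_append)

lemma smooth_pd: "smooth_on UNIV f \<Longrightarrow> smooth_on UNIV (pd i f)"
  using smooth_pds[of f "[i]"] by simp

lemma smooth_differentiable: "smooth_on UNIV f \<Longrightarrow> f differentiable (at x)"
  unfolding smooth_on_def by (metis pds_Nil UNIV_I)

lemma smooth_pds_differentiable: "smooth_on UNIV f \<Longrightarrow> pds is f differentiable (at x)"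
  unfolding smooth_on_def by blast

lemma smooth_continuous: "smooth_on UNIV f \<Longrightarrow> continuous_on S f"
  by (meson continuous_at_imp_continuous_on differentiable_imp_continuous_within smooth_differentiable)

lemma smooth_measurable: "smooth_on UNIV f \<Longrightarrow> f \<in> borel_measurable borel"
  by (rule borel_measurable_continuous_onI[OF smooth_continuous])

lemma pd_eq:
  assumes "(f has_derivative f') (at x)" shows "pd i f x = f' (axis i 1)"
  using frechet_derivative_at[OF assms] by (simp add: pd_def)

lemma has_derivative_pd:
  fixes f :: "real^'n::finite \<Rightarrow> 'b::real_normed_vector"
  assumes "f differentiable (at x)"
  shows "(f has_derivative (\<lambda>h. \<Sum>i\<in>UNIV. h $ i *\<^sub>R pd i f x)) (at x)"
proof -
  have d: "(f has_derivative frechet_derivative f (at x)) (at x)"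
    using assms by (simp add: frechet_derivative_works)
  have lin: "linear (frechet_derivative f (at x))" by (rule has_derivative_linear[OF d])
  have "frechet_derivative f (at x) h = (\<Sum>i\<in>UNIV. h $ i *\<^sub>R pd i f x)" for h
  proof -
    have "h = (\<Sum>i\<in>UNIV. h $ i *\<^sub>R axis i 1)"
      by (simp add: vec_eq_iff sum_component axis_def if_distrib cong: if_cong)
    then have "frechet_derivative f (at x) h = frechet_derivative f (at x) (\<Sum>i\<in>UNIV. h $ i *\<^sub>R axis i 1)"
      by simp
    also have "\<dots> = (\<Sum>i\<in>UNIV. h $ i *\<^sub>R pd i f x)"
      by (simp add: linear_sum[OF lin] linear_cmul[OF lin] pd_def)
    finally show ?thesis .
  qed
  then have "frechet_derivative f (at x) = (\<lambda>h. \<Sum>i\<in>UNIV. h $ i *\<^sub>R pd i f x)" by (rule ext)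
  then show ?thesis using d by simp
qed

lemma has_vector_derivative_pd:
  fixes f :: "real^'n::finite \<Rightarrow> 'b::real_normed_vector"
  assumes "f differentiable (at x)"
  shows "((\<lambda>t. f (x + t *\<^sub>R axis i 1)) has_vector_derivative pd i f x) (at 0)"
proof -
  have 1: "((\<lambda>t. x + t *\<^sub>R axis i (1::real)) has_derivative (\<lambda>t. t *\<^sub>R axis i 1)) (at 0)"
    by (auto intro!: derivative_eq_intros)
  have 2: "(f has_derivative (\<lambda>h. \<Sum>i\<in>UNIV. h $ i *\<^sub>R pd i f x)) (at (x + 0 *\<^sub>R axis i 1))"
    using has_derivative_pd[OF assms] by simp
  have "(\<Sum>j\<in>UNIV. (t *\<^sub>R axis i 1 :: real^'n) $ j *\<^sub>R pd j f x) = t *\<^sub>R pd i f x" for t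
    by (simp add: axis_def if_distrib if_distribR cong: if_cong)
  then show ?thesis
    unfolding has_vector_derivative_def using has_derivative_compose[OF 1 2] by simp
qed

lemma pds_bounded_linear:
  fixes f :: "real^'n::finite \<Rightarrow> 'b::real_normed_vector"
  assumes L: "bounded_linear L" and f: "smooth_on UNIV f"
  shows "pds is (\<lambda>x. L (f x)) = (\<lambda>x. L (pds is f x))"
proof (induction "is")
  case (Cons i "is")
  have "pd i (\<lambda>x. L (pds is f x)) x = L (pd i (pds is f) x)" for x
    using pd_eq[OF bounded_linear.has_derivative[OF L has_derivative_pd[OF smooth_pds_differentiable[OF f]]], of i]
    by (simp add: axis_def if_distribR if_distrib cong: if_cong)
  then show ?case by (simp add: Cons.IH fun_eq_iff)
qed simp

lemma smooth_bounded_linear: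
  assumes L: "bounded_linear L" and f: "smooth_on UNIV (f :: real^'n::finite \<Rightarrow> 'b::real_normed_vector)"
  shows "smooth_on UNIV (\<lambda>x. L (f x))"
  unfolding smooth_on_def pds_bounded_linear[OF assms]
  using bounded_linear.has_derivative[OF L has_derivative_pd[OF smooth_pds_differentiable[OF f]]]
  unfolding differentiable_def by blast

lemma pds_add:
  fixes f g :: "real^'n::finite \<Rightarrow> 'b::real_normed_vector"
  assumes f: "smooth_on UNIV f" and g: "smooth_on UNIV g"
  shows "pds is (\<lambda>x. f x + g x) = (\<lambda>x. pds is f x + pds is g x)"
proof (induction "is")
  case (Cons i "is")
  have "pd i (\<lambda>x. pds is f x + pds is g x) x = pd i (pds is f) x + pd i (pds is g) x" for x
    using pd_eq[OF has_derivative_add[OF has_derivative_pd[OF smooth_pds_differentiable[OF f]]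
        has_derivative_pd[OF smooth_pds_differentiable[OF g]]], of i]
    by (simp add: axis_def if_distribR if_distrib cong: if_cong)
  then show ?case by (simp add: Cons.IH fun_eq_iff)
qed simp

lemma smooth_add:
  assumes "smooth_on UNIV f" "smooth_on UNIV g"
  shows "smooth_on UNIV (\<lambda>x. f x + g x)"
  unfolding smooth_on_def pds_add[OF assms]
  by (intro allI ballI differentiable_add smooth_pds_differentiable assms)

text \<open>Translations, reflections and dilations in one statement.\<close>

lemma pds_affine:
  fixes f :: "real^'n::finite \<Rightarrow> 'b::real_normed_vector"
  assumes f: "smooth_on UNIV f"
  shows "pds is (\<lambda>x. f (c + a *\<^sub>R x)) = (\<lambda>x. a ^ length is *\<^sub>R pds is f (c + a *\<^sub>R x))"
proof (induction "is")
  case (Cons i "is")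
  have "pd i (\<lambda>x. a ^ length is *\<^sub>R pds is f (c + a *\<^sub>R x)) x = a ^ length is *\<^sub>R a *\<^sub>R pd i (pds is f) (c + a *\<^sub>R x)" for x
  proof -
    have 1: "((\<lambda>x. c + a *\<^sub>R x) has_derivative (\<lambda>h. a *\<^sub>R h)) (at x)"
      by (auto intro!: derivative_eq_intros)
    show ?thesis
      using pd_eq[OF has_derivative_scaleR_right[OF has_derivative_compose[OF 1
          has_derivative_pd[OF smooth_pds_differentiable[OF f]]], of "a ^ length is"], of i]
      by (simp add: axis_def if_distribR if_distrib cong: if_cong)
  qed
  then show ?case by (simp add: Cons.IH fun_eq_iff mult.commute)
qed simp

lemma smooth_affine:
  fixes f :: "real^'n::finite \<Rightarrow> 'b::real_normed_vector"
  assumes f: "smooth_on UNIV f"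
  shows "smooth_on UNIV (\<lambda>x. f (c + a *\<^sub>R x))"
  unfolding smooth_on_def pds_affine[OF f]
proof (intro allI ballI)
  fix "is" x
  have 1: "((\<lambda>x. c + a *\<^sub>R x) has_derivative (\<lambda>h. a *\<^sub>R h)) (at x)"
    by (auto intro!: derivative_eq_intros)
  show "(\<lambda>x. a ^ length is *\<^sub>R pds is f (c + a *\<^sub>R x)) differentiable at x"
    using has_derivative_scaleR_right[OF has_derivative_compose[OF 1
          has_derivative_pd[OF smooth_pds_differentiable[OF f]]]] unfolding differentiable_def by blast
qed

lemma smooth_zero: "smooth_on UNIV ((\<lambda>x. 0) :: real^'n::finite \<Rightarrow> 'b::real_normed_vector)"
proof -
  have "pd i ((\<lambda>x. 0) :: real^'n \<Rightarrow> 'b) = (\<lambda>x. 0)" for i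
    using pd_eq[OF has_derivative_const[of "0::'b"]] by (intro ext) blast
  then have "pds is ((\<lambda>x. 0) :: real^'n \<Rightarrow> 'b) = (\<lambda>x. 0)" for "is"
    by (induction "is") auto
  then show ?thesis by (simp add: smooth_on_def)
qed

section \<open>Test functions\<close>

lemma closed_support: "closed (support f)" by (simp add: support_def)

lemma not_in_support: "x \<notin> support f \<Longrightarrow> f x = 0"
  using closure_subset[of "{x. f x \<noteq> 0}"] by (auto simp: support_def)

lemma support_subsetI: "closed S \<Longrightarrow> (\<And>x. x \<notin> S \<Longrightarrow> f x = 0) \<Longrightarrow> support f \<subseteq> S"
  unfolding support_def by (rule closure_minimal) auto

lemma test_function_iff:
  "test_function f \<longleftrightarrow> smooth_on UNIV f \<and> (\<exists>r. \<forall>x. norm x > r \<longrightarrow> f x = 0)"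
proof
  assume f: "test_function f"
  then have "bounded (support f)" by (simp add: test_function_def compact_imp_bounded)
  then obtain r where "\<forall>x\<in>support f. norm x \<le> r" by (auto simp: bounded_iff)
  then have "\<forall>x. norm x > r \<longrightarrow> f x = 0" using not_in_support by (metis not_le)
  then show "smooth_on UNIV f \<and> (\<exists>r. \<forall>x. norm x > r \<longrightarrow> f x = 0)"
    using f by (auto simp: test_function_def)
next
  assume "smooth_on UNIV f \<and> (\<exists>r. \<forall>x. norm x > r \<longrightarrow> f x = 0)"
  then obtain r where r: "smooth_on UNIV f" "\<And>x. norm x > r \<Longrightarrow> f x = 0" by auto
  have "support f \<subseteq> cball 0 r" using r(2) by (intro support_subsetI) (auto simp: not_le)
  then have "compact (support f)" using closed_support compact_cball
    by (metis closed_Int_compact inf.absorb1)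
  then show "test_function f" using r by (simp add: test_function_def)
qed

lemma test_smooth: "test_function f \<Longrightarrow> smooth_on UNIV f" by (simp add: test_function_def)

lemma test_radius:
  assumes "test_function f" obtains r where "0 < r" "\<And>x. norm x > r \<Longrightarrow> f x = 0"
proof -
  obtain r where "\<forall>x. norm x > r \<longrightarrow> f x = 0" using assms by (auto simp: test_function_iff)
  then show ?thesis by (intro that[of "max r 1"]) auto
qed

lemma pd_eq_0_outside:
  assumes "\<And>x. norm x > r \<Longrightarrow> f x = 0" "norm x > r"
  shows "pd i f x = 0"
proof -
  have "(f has_derivative (\<lambda>h. 0)) (at x)"
  proof (rule has_derivative_transform_within_open[of "\<lambda>x. 0" "\<lambda>h. 0" x UNIV "- cball 0 r"])
    show "0 = f y" if "y \<in> - cball 0 r" for y using assms(1)[of y] that by auto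
  qed (use assms in auto)
  then show ?thesis by (simp add: pd_eq)
qed

lemma pds_eq_0_outside:
  assumes "\<And>x. norm x > r \<Longrightarrow> f x = 0" "norm x > r"
  shows "pds is f x = 0"
  using assms(2)
proof (induction "is" arbitrary: x)
  case (Cons i "is")
  then show ?case using pd_eq_0_outside[of r "pds is f"] by simp
qed (use assms in auto)

lemma test_pds: "test_function f \<Longrightarrow> test_function (pds is f)"
  unfolding test_function_iff by (metis pds_eq_0_outside smooth_pds)

lemma test_pd: "test_function f \<Longrightarrow> test_function (pd i f)"
  using test_pds[of f "[i]"] by simp

lemma test_add:
  fixes f g :: "real^'a::finite \<Rightarrow> 'b::real_normed_vector"
  shows "test_function f \<Longrightarrow> test_function g \<Longrightarrow> test_function (\<lambda>x. f x + g x)"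
  unfolding test_function_iff
proof (elim conjE exE, intro conjI smooth_add exI allI impI)
  fix r s :: real and x :: "real^'a" assume "\<forall>x. r < norm x \<longrightarrow> f x = 0" "\<forall>x. s < norm x \<longrightarrow> g x = 0" "norm x > max r s"
  then show "f x + g x = 0" by auto
qed

lemma test_bounded_linear:
  assumes "bounded_linear L" "test_function f" shows "test_function (\<lambda>x. L (f x))"
  using assms linear_0[OF bounded_linear.linear[OF assms(1)]] unfolding test_function_iff
  by (metis smooth_bounded_linear)

lemma test_affine:
  assumes "test_function f" "a \<noteq> 0" shows "test_function (\<lambda>x. f (c + a *\<^sub>R x))"
proof -
  obtain r where r: "0 < r" "\<And>x. norm x > r \<Longrightarrow> f x = 0" using test_radius[OF assms(1)] by metis
  have "f (c + a *\<^sub>R x) = 0" if "norm x > (r + norm c) / \<bar>a\<bar>" for x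
  proof (rule r(2))
    have "r + norm c < norm (a *\<^sub>R x)" using that assms(2) by (simp add: field_simps)
    then show "r < norm (c + a *\<^sub>R x)" using norm_triangle_ineq4[of "c + a *\<^sub>R x" c] by simp
  qed
  then show ?thesis using smooth_affine[OF test_smooth[OF assms(1)]] unfolding test_function_iff by blast
qed

lemma test_translate: "test_function f \<Longrightarrow> test_function (\<lambda>x. f (x - c))"
  using test_affine[of f 1 "-c"] by simp

lemma test_reflect: "test_function f \<Longrightarrow> test_function (\<lambda>x. f (c - x))"
  using test_affine[of f "-1" c] by simp

lemma test_cmult: "test_function (f :: _ \<Rightarrow> 'b::real_normed_algebra) \<Longrightarrow> test_function (\<lambda>x. c * f x)"
  by (rule test_bounded_linear[OF bounded_linear_mult_right])

lemma test_diff: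
  fixes f g :: "_ \<Rightarrow> 'b::real_normed_algebra_1"
  shows "test_function f \<Longrightarrow> test_function g \<Longrightarrow> test_function (\<lambda>x. f x - g x)"
  using test_add[of f "\<lambda>x. (-1) * g x"] test_cmult[of g "-1"] by simp

lemma test_zero: "test_function (\<lambda>x. 0)"
  by (simp add: test_function_iff smooth_zero)

lemma test_of_real: "test_function f \<Longrightarrow> test_function (\<lambda>x. complex_of_real (f x))"
  by (rule test_bounded_linear[OF bounded_linear_of_real])

lemma bounded_on_cball:
  fixes f :: "'a::euclidean_space \<Rightarrow> 'b::real_normed_vector"
  assumes "continuous_on UNIV f"
  obtains B where "0 \<le> B" "\<And>x. norm x \<le> r \<Longrightarrow> norm (f x) \<le> B"
proof -
  have "bounded (f ` cball 0 r)"
    by (intro compact_imp_bounded compact_continuous_image continuous_on_subset[OF assms] compact_cball) auto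
  then obtain B where B: "\<forall>y\<in>f ` cball 0 r. norm y \<le> B" unfolding bounded_iff by blast
  have "norm (f x) \<le> max B 0" if "norm x \<le> r" for x
    using B that by (auto intro: max.coboundedI1)
  then show ?thesis by (intro that[of "max B 0"]) auto
qed

lemma test_bounded:
  fixes f :: "real^'n::finite \<Rightarrow> 'b::real_normed_vector"
  assumes "test_function f" obtains B where "0 < B" "\<And>x. norm (f x) \<le> B"
proof -
  obtain r where r: "0 < r" "\<And>x. norm x > r \<Longrightarrow> f x = 0" using test_radius[OF assms(1)] by metis
  obtain B where B: "\<And>x. norm x \<le> r \<Longrightarrow> norm (f x) \<le> B"
    using bounded_on_cball[OF smooth_continuous[OF test_smooth[OF assms]], where r=r] by metis
  have "norm (f x) \<le> max B 1" for x
    using B[of x] r(2)[of x] by (cases "norm x \<le> r") auto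
  then show ?thesis by (intro that[of "max B 1"]) auto
qed

lemma onorm_sum_component:
  fixes c :: "'n::finite \<Rightarrow> 'b::real_normed_vector"
  shows "onorm (\<lambda>h::real^'n. \<Sum>i\<in>UNIV. h $ i *\<^sub>R c i) \<le> (\<Sum>i\<in>UNIV. norm (c i))"
proof (rule onorm_bound)
  fix h :: "real^'n"
  have "norm (\<Sum>i\<in>UNIV. h $ i *\<^sub>R c i) \<le> (\<Sum>i\<in>UNIV. norm (h $ i *\<^sub>R c i))" by (rule norm_sum)
  also have "\<dots> \<le> (\<Sum>i\<in>UNIV. norm (c i) * norm h)"
    by (intro sum_mono) (metis component_le_norm_cart mult.commute mult_right_mono norm_ge_zero norm_scaleR)
  finally show "norm (\<Sum>i\<in>UNIV. h $ i *\<^sub>R c i) \<le> (\<Sum>i\<in>UNIV. norm (c i)) * norm h"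
    by (simp add: sum_distrib_right)
qed (simp add: sum_nonneg)

lemma test_Lipschitz:
  fixes f :: "real^'n::finite \<Rightarrow> 'b::real_normed_vector"
  assumes "test_function f" obtains L where "0 < L" "\<And>x y. norm (f x - f y) \<le> L * norm (x - y)"
proof -
  have "\<forall>i. \<exists>B>0. \<forall>x. norm (pd i f x) \<le> B" using test_bounded[OF test_pd[OF assms]] by metis
  then obtain B where B: "\<And>i. B i > 0" "\<And>i x. norm (pd i f x) \<le> B i" by metis
  have "norm (f x - f y) \<le> (\<Sum>i\<in>UNIV. B i) * norm (x - y)" for x y
  proof (rule differentiable_bound[of UNIV f "\<lambda>x h. \<Sum>i\<in>UNIV. h $ i *\<^sub>R pd i f x"])
    show "(f has_derivative (\<lambda>h. \<Sum>i\<in>UNIV. h $ i *\<^sub>R pd i f x)) (at x)" for x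
      by (intro has_derivative_pd smooth_differentiable test_smooth assms)
    show "onorm (\<lambda>h. \<Sum>i\<in>UNIV. h $ i *\<^sub>R pd i f x) \<le> (\<Sum>i\<in>UNIV. B i)" for x
      by (rule order_trans[OF onorm_sum_component]) (intro sum_mono B)
  qed auto
  moreover have "0 < (\<Sum>i\<in>UNIV. B i)" using B(1) by (intro sum_pos) auto
  ultimately show ?thesis using that by blast
qed

text \<open>Uniformity in \<open>x\<close> is what allows differentiation under the integral of a convolution.\<close>

lemma test_Taylor:
  fixes f :: "real^'n::finite \<Rightarrow> 'b::real_normed_vector"
  assumes "test_function f"
  obtains L where "0 < L" "\<And>x h. norm (f (x + h) - f x - (\<Sum>i\<in>UNIV. h $ i *\<^sub>R pd i f x)) \<le> L * (norm h)\<^sup>2"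
proof -
  have "\<forall>i. \<exists>B>0. \<forall>x y. norm (pd i f x - pd i f y) \<le> B * norm (x - y)"
    using test_Lipschitz[OF test_pd[OF assms]] by metis
  then obtain B where B: "\<And>i. B i > 0" "\<And>i x y. norm (pd i f x - pd i f y) \<le> B i * norm (x - y)" by metis
  have "norm (f (x + h) - f x - (\<Sum>i\<in>UNIV. h $ i *\<^sub>R pd i f x)) \<le> (\<Sum>i\<in>UNIV. B i) * (norm h)\<^sup>2" for x h
  proof -
    have "norm (f (x + h) - f x - (\<Sum>i\<in>UNIV. (x + h - x) $ i *\<^sub>R pd i f x)) \<le> norm (x + h - x) * ((\<Sum>i\<in>UNIV. B i) * norm h)"
    proof (rule differentiable_bound_linearization[of x "x + h" "cball x (norm h)" f
          "\<lambda>x h. \<Sum>i\<in>UNIV. h $ i *\<^sub>R pd i f x" x])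
      show "x + t *\<^sub>R (x + h - x) \<in> cball x (norm h)" if "t \<in> {0..1}" for t
        using that by (auto simp: dist_norm mult_left_le_one_le)
      show "(f has_derivative (\<lambda>h. \<Sum>i\<in>UNIV. h $ i *\<^sub>R pd i f x)) (at x within cball z (norm h))" for x z
        by (rule has_derivative_at_withinI[OF has_derivative_pd[OF smooth_differentiable[OF test_smooth[OF assms]]]])
      fix y assume y: "y \<in> cball x (norm h)"
      have eq: "(\<lambda>h. \<Sum>i\<in>UNIV. h $ i *\<^sub>R pd i f y) - (\<lambda>h. \<Sum>i\<in>UNIV. h $ i *\<^sub>R pd i f x)
          = (\<lambda>h. \<Sum>i\<in>UNIV. h $ i *\<^sub>R (pd i f y - pd i f x))"
        by (simp add: fun_eq_iff sum_subtractf scaleR_diff_right)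
      have "onorm ((\<lambda>h. \<Sum>i\<in>UNIV. h $ i *\<^sub>R pd i f y) - (\<lambda>h. \<Sum>i\<in>UNIV. h $ i *\<^sub>R pd i f x))
          \<le> (\<Sum>i\<in>UNIV. norm (pd i f y - pd i f x))"
        unfolding eq by (rule onorm_sum_component)
      also have "\<dots> \<le> (\<Sum>i\<in>UNIV. B i * norm (y - x))" by (intro sum_mono B)
      also have "\<dots> \<le> (\<Sum>i\<in>UNIV. B i * norm h)"
        using y B(1) by (intro sum_mono mult_left_mono) (auto simp: dist_norm norm_minus_commute less_imp_le)
      finally show "onorm ((\<lambda>h. \<Sum>i\<in>UNIV. h $ i *\<^sub>R pd i f y) - (\<lambda>h. \<Sum>i\<in>UNIV. h $ i *\<^sub>R pd i f x))
          \<le> (\<Sum>i\<in>UNIV. B i) * norm h" by (simp add: sum_distrib_right)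
    qed auto
    then show ?thesis by (simp add: power2_eq_square mult_ac)
  qed
  moreover have "0 < (\<Sum>i\<in>UNIV. B i)" using B(1) by (intro sum_pos) auto
  ultimately show ?thesis using that by blast
qed

section \<open>Integration over the whole space\<close>

lemma lborel_integral_affine:
  fixes f :: "'a::euclidean_space \<Rightarrow> 'b::{banach, second_countable_topology}"
  assumes [measurable]: "f \<in> borel_measurable borel" and c: "c \<noteq> 0"
  shows "(LINT x|lborel. f x) = \<bar>c\<bar> ^ DIM('a) *\<^sub>R (LINT x|lborel. f (t + c *\<^sub>R x))"
    and "integrable lborel f \<longleftrightarrow> integrable lborel (\<lambda>x. f (t + c *\<^sub>R x))"
proof -
  have eq: "lborel = density (distr lborel borel (\<lambda>x. t + c *\<^sub>R x)) (\<lambda>_. ennreal (\<bar>c\<bar> ^ DIM('a)))"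
    using lborel_affine[OF c, of t] by simp
  show "(LINT x|lborel. f x) = \<bar>c\<bar> ^ DIM('a) *\<^sub>R (LINT x|lborel. f (t + c *\<^sub>R x))"
    by (subst eq, subst integral_density) (auto simp: integral_distr)
  show "integrable lborel f \<longleftrightarrow> integrable lborel (\<lambda>x. f (t + c *\<^sub>R x))"
  proof -
    have "integrable lborel f \<longleftrightarrow> integrable lborel (\<lambda>x. \<bar>c\<bar> ^ DIM('a) *\<^sub>R f (t + c *\<^sub>R x))"
      by (subst eq, subst integrable_density) (auto simp: integrable_distr_eq)
    also have "\<dots> \<longleftrightarrow> integrable lborel (\<lambda>x. f (t + c *\<^sub>R x))"
    proof
      assume "integrable lborel (\<lambda>x. \<bar>c\<bar> ^ DIM('a) *\<^sub>R f (t + c *\<^sub>R x))"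
      then have "integrable lborel (\<lambda>x. inverse (\<bar>c\<bar> ^ DIM('a)) *\<^sub>R (\<bar>c\<bar> ^ DIM('a) *\<^sub>R f (t + c *\<^sub>R x)))"
        by (rule integrable_scaleR_right)
      then show "integrable lborel (\<lambda>x. f (t + c *\<^sub>R x))" using c by simp
    qed (rule integrable_scaleR_right)
    finally show ?thesis .
  qed
qed

lemma lborel_integral_translate:
  fixes f :: "'a::euclidean_space \<Rightarrow> 'b::{banach, second_countable_topology}"
  assumes "f \<in> borel_measurable borel"
  shows "(LINT x|lborel. f (x + c)) = (LINT x|lborel. f x)"
  using lborel_integral_affine(1)[OF assms, of 1 c] by (simp add: add.commute)

lemma lborel_integral_reflect:
  fixes f :: "'a::euclidean_space \<Rightarrow> 'b::{banach, second_countable_topology}"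
  assumes "f \<in> borel_measurable borel"
  shows "(LINT x|lborel. f (c - x)) = (LINT x|lborel. f x)"
  using lborel_integral_affine(1)[OF assms, of "-1" c] by simp

lemma integrable_bounded_support:
  fixes f :: "'a::euclidean_space \<Rightarrow> 'b::{banach, second_countable_topology}"
  assumes "f \<in> borel_measurable borel" "\<And>x. norm (f x) \<le> B" "\<And>x. norm (x - c) > r \<Longrightarrow> f x = 0"
  shows "integrable lborel f"
proof (rule Bochner_Integration.integrable_bound[where f="\<lambda>x. B * indicator (cball c r) x"])
  show "integrable lborel (\<lambda>x. B * indicator (cball c r) x)"
    using emeasure_lborel_cball_finite[of c r] by (intro integrable_mult_right integrable_real_indicator) auto
  show "AE x in lborel. norm (f x) \<le> norm (B * indicator (cball c r) x)"
  proof (rule AE_I2)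
    fix x
    have "0 \<le> B" using assms(2)[of x] norm_ge_zero order_trans by blast
    then show "norm (f x) \<le> norm (B * indicator (cball c r) x)"
      using assms(2)[of x] assms(3)[of x]
      by (cases "norm (x - c) > r") (auto simp: indicator_def dist_norm norm_minus_commute)
  qed
qed (use assms in auto)

lemma integrable_continuous_support:
  fixes f :: "'a::euclidean_space \<Rightarrow> 'b::{banach, second_countable_topology}"
  assumes f: "continuous_on UNIV f" and r: "\<And>x. norm x > r \<Longrightarrow> f x = 0"
  shows "integrable lborel f"
proof -
  obtain B where B: "\<And>x. norm x \<le> r \<Longrightarrow> norm (f x) \<le> B"
    using bounded_on_cball[OF f, where r=r] by metis
  have "norm (f x) \<le> max B 0" for x
    using B[of x] r[of x] by (cases "norm x \<le> r") auto
  then show ?thesis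
    using r borel_measurable_continuous_onI[OF f] by (intro integrable_bounded_support[of f "max B 0" r 0]) auto
qed

text \<open>Integration by parts without boundary terms: the difference quotients of \<open>F\<close> have integral zero by
  translation invariance, and they converge boundedly to \<open>F'\<close>.\<close>

lemma integral_derivative_zero:
  fixes F F' :: "real^'n::finite \<Rightarrow> 'b::{banach, second_countable_topology}"
  assumes d: "\<And>x. ((\<lambda>t. F (x + t *\<^sub>R axis i 1)) has_vector_derivative F' x) (at 0)"
    and cF: "continuous_on UNIV F" and cF': "continuous_on UNIV F'"
    and r: "\<And>x. norm x > r \<Longrightarrow> F x = 0" "\<And>x. norm x > r \<Longrightarrow> F' x = 0"
  shows "(LINT x|lborel. F' x) = 0"
proof -
  let ?e = "axis i 1 :: real^'n"
  have ne: "norm ?e = 1" by simp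
  obtain B0 where B0: "\<And>x. norm x \<le> r \<Longrightarrow> norm (F' x) \<le> B0"
    using bounded_on_cball[OF cF', where r=r] by metis
  define B where "B = max B0 0"
  have B: "norm (F' x) \<le> B" for x
    using B0[of x] r(2)[of x] by (cases "norm x \<le> r") (auto simp: B_def)
  have B_nn: "0 \<le> B" by (simp add: B_def)
  have d': "((\<lambda>t. F (x + t *\<^sub>R ?e)) has_vector_derivative F' (x + s *\<^sub>R ?e)) (at s)" for x s
  proof -
    have "((\<lambda>t. F (x + s *\<^sub>R ?e + t *\<^sub>R ?e)) has_vector_derivative F' (x + s *\<^sub>R ?e)) (at (s - s))"
      using d[of "x + s *\<^sub>R ?e"] by simp
    from vector_diff_chain_at[of "\<lambda>t. t - s" 1 s, OF _ this]
    have "((\<lambda>t. t - s) has_vector_derivative 1) (at s) \<Longrightarrow> (((\<lambda>t. F (x + s *\<^sub>R ?e + t *\<^sub>R ?e)) \<circ> (\<lambda>t. t - s)) has_vector_derivative F' (x + s *\<^sub>R ?e)) (at s)"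
      by simp
    moreover have "((\<lambda>t. t - s) has_vector_derivative 1) (at s)"
      by (auto intro!: derivative_eq_intros)
    ultimately have "(((\<lambda>t. F (x + s *\<^sub>R ?e + t *\<^sub>R ?e)) \<circ> (\<lambda>t. t - s)) has_vector_derivative F' (x + s *\<^sub>R ?e)) (at s)"
      by blast
    moreover have "((\<lambda>t. F (x + s *\<^sub>R ?e + t *\<^sub>R ?e)) \<circ> (\<lambda>t. t - s)) = (\<lambda>t. F (x + t *\<^sub>R ?e))"
      by (simp add: fun_eq_iff scaleR_diff_left)
    ultimately show ?thesis by simp
  qed
  have inc: "norm (F (x + t *\<^sub>R ?e) - F x) \<le> B * \<bar>t\<bar>" for x t
  proof -
    have "norm (F (x + t *\<^sub>R ?e) - F (x + 0 *\<^sub>R ?e)) \<le> B * norm (t - 0)"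
    proof (rule differentiable_bound[of UNIV "\<lambda>t. F (x + t *\<^sub>R ?e)" "\<lambda>s h. h *\<^sub>R F' (x + s *\<^sub>R ?e)"])
      show "((\<lambda>t. F (x + t *\<^sub>R ?e)) has_derivative (\<lambda>h. h *\<^sub>R F' (x + s *\<^sub>R ?e))) (at s)" for s
        using d' by (simp add: has_vector_derivative_def)
      show "onorm (\<lambda>h. h *\<^sub>R F' (x + s *\<^sub>R ?e)) \<le> B" for s
        by (rule onorm_le) (metis B abs_ge_zero mult.commute mult_left_mono norm_scaleR real_norm_def)
    qed auto
    then show ?thesis by simp
  qed
  have [measurable]: "F \<in> borel_measurable borel" "F' \<in> borel_measurable borel"
    using cF cF' by (auto intro: borel_measurable_continuous_onI)
  have iF: "integrable lborel F" by (rule integrable_continuous_support[OF cF r(1)])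
  define t where "t n = inverse (real (Suc n))" for n
  have t: "0 < t n" "t n \<le> 1" for n by (auto simp: t_def inverse_le_1_iff)
  have t0: "t \<longlonglongrightarrow> 0" unfolding t_def by (rule LIMSEQ_inverse_real_of_nat)
  define q where "q n x = inverse (t n) *\<^sub>R (F (x + t n *\<^sub>R ?e) - F x)" for n x
  have [measurable]: "q n \<in> borel_measurable borel" for n unfolding q_def by measurable
  have q0: "(LINT x|lborel. q n x) = 0" for n
  proof -
    have "integrable lborel (\<lambda>x. F (x + t n *\<^sub>R ?e))"
      using lborel_integral_affine(2)[of F 1 "t n *\<^sub>R ?e"] iF by (simp add: add.commute)
    then show ?thesis unfolding q_def using iF lborel_integral_translate[of F "t n *\<^sub>R ?e"]
      by simp
  qed
  have "(\<lambda>n. LINT x|lborel. q n x) \<longlonglongrightarrow> (LINT x|lborel. F' x)"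
  proof (rule integral_dominated_convergence[where w="\<lambda>x. B * indicator (cball 0 (r + 1)) x"])
    show "integrable lborel (\<lambda>x. B * indicator (cball 0 (r + 1)) x :: real)"
      using emeasure_lborel_cball_finite[of 0 "r+1"]
      by (intro integrable_mult_right integrable_real_indicator) auto
    show "AE x in lborel. (\<lambda>n. q n x) \<longlonglongrightarrow> F' x"
    proof (rule AE_I2)
      fix x
      have "((\<lambda>h. norm (F (x + (0 + h) *\<^sub>R ?e) - F (x + 0 *\<^sub>R ?e) - h *\<^sub>R F' x) / norm h) \<longlongrightarrow> 0) (at 0)"
        using d[of x] unfolding has_vector_derivative_def has_derivative_at by blast
      then have lim: "(\<lambda>n. norm (F (x + (0 + t n) *\<^sub>R ?e) - F (x + 0 *\<^sub>R ?e) - t n *\<^sub>R F' x) / norm (t n)) \<longlonglongrightarrow> 0"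
        by (rule filterlim_compose) (use t t0 in \<open>auto simp: filterlim_at less_imp_neq[THEN not_sym]\<close>)
      have "norm (F (x + (0 + t n) *\<^sub>R ?e) - F (x + 0 *\<^sub>R ?e) - t n *\<^sub>R F' x) / norm (t n) = norm (q n x - F' x)" for n
      proof -
        have "q n x - F' x = inverse (t n) *\<^sub>R (F (x + t n *\<^sub>R ?e) - F x - t n *\<^sub>R F' x)"
          using t[of n] by (simp add: q_def scaleR_diff_right)
        then show ?thesis using t[of n] by (simp add: divide_inverse mult.commute)
      qed
      then have "(\<lambda>n. norm (q n x - F' x)) \<longlonglongrightarrow> 0" using lim by simp
      then have "(\<lambda>n. q n x) \<longlonglongrightarrow> F' x" by (simp add: tendsto_norm_zero_iff LIM_zero_iff)
      then show "(\<lambda>n. q n x) \<longlonglongrightarrow> F' x" by (simp add: q_def)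
    qed
    show "AE x in lborel. norm (q n x) \<le> B * indicator (cball 0 (r + 1)) x" for n
    proof (rule AE_I2)
      fix x
      show "norm (q n x) \<le> B * indicator (cball 0 (r + 1)) x"
      proof (cases "norm x \<le> r + 1")
        case True
        have "norm (q n x) = inverse (t n) * norm (F (x + t n *\<^sub>R ?e) - F x)"
          using t[of n] by (simp add: q_def)
        also have "\<dots> \<le> inverse (t n) * (B * \<bar>t n\<bar>)" using t[of n] by (intro mult_left_mono inc) auto
        also have "\<dots> = B" using t[of n] by simp
        finally show ?thesis using True by simp
      next
        case False
        have "norm x \<le> norm (x + t n *\<^sub>R ?e) + norm (t n *\<^sub>R ?e)" by (metis add_diff_cancel norm_triangle_ineq4)
        then have "norm (x + t n *\<^sub>R ?e) > r" using False t[of n] ne by simp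
        then have "q n x = 0" using r(1) False by (simp add: q_def)
        then show ?thesis using B_nn by simp
      qed
    qed
  qed auto
  then show ?thesis using q0 by (simp add: LIMSEQ_const_iff)
qed

section \<open>Convolution\<close>

definition loc_integrable :: "('a::euclidean_space \<Rightarrow> 'b::{banach, second_countable_topology}) \<Rightarrow> bool" where
  "loc_integrable u \<longleftrightarrow> u \<in> borel_measurable borel \<and> (\<forall>R. integrable lborel (\<lambda>y. indicator (cball 0 R) y *\<^sub>R u y))"

definition conv :: "(real^'n::finite \<Rightarrow> 'b::{banach, second_countable_topology}) \<Rightarrow> (real^'n \<Rightarrow> real) \<Rightarrow> real^'n \<Rightarrow> 'b" where
  "conv u \<phi> x = (LINT y|lborel. \<phi> (x - y) *\<^sub>R u y)"

lemma square_integrable_loc_integrable: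
  assumes "square_integrable u" shows "loc_integrable u"
  unfolding loc_integrable_def
proof (intro conjI allI)
  show [measurable]: "u \<in> borel_measurable borel" using assms by (simp add: square_integrable_def)
  fix R
  have "integrable lborel (\<lambda>y. indicator (cball 0 R) y + (cmod (u y))\<^sup>2)"
    using assms emeasure_lborel_cball_finite[of 0 R]
    by (intro Bochner_Integration.integrable_add integrable_real_indicator) (auto simp: square_integrable_def)
  then show "integrable lborel (\<lambda>y. indicator (cball 0 R) y *\<^sub>R u y)"
  proof (rule Bochner_Integration.integrable_bound)
    show "AE y in lborel. norm (indicator (cball 0 R) y *\<^sub>R u y) \<le> norm (indicator (cball 0 R) y + (cmod (u y))\<^sup>2 :: real)"
    proof (rule AE_I2)
      fix y
      have "2 * cmod (u y) \<le> 1 + (cmod (u y))\<^sup>2"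
        using sum_squares_bound[of "1::real" "cmod (u y)"] by simp
      then have "cmod (u y) \<le> 1 + (cmod (u y))\<^sup>2"
        using norm_ge_zero[of "u y"] by linarith
      then show "norm (indicator (cball 0 R) y *\<^sub>R u y) \<le> norm (indicator (cball 0 R) y + (cmod (u y))\<^sup>2 :: real)"
        by (auto simp: indicator_def)
    qed
  qed (auto intro!: borel_measurable_scaleR borel_measurable_indicator)
qed

lemma loc_integrable_integral_bound:
  fixes \<psi> :: "'a::euclidean_space \<Rightarrow> real"
  assumes u: "loc_integrable u" and [measurable]: "\<psi> \<in> borel_measurable borel"
    and B: "\<And>y. \<bar>\<psi> y\<bar> \<le> B" "\<And>y. norm y > R \<Longrightarrow> \<psi> y = 0"
  shows "integrable lborel (\<lambda>y. \<psi> y *\<^sub>R u y)"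
    and "norm (LINT y|lborel. \<psi> y *\<^sub>R u y) \<le> B * (LINT y|lborel. norm (indicator (cball 0 R) y *\<^sub>R u y))"
proof -
  have [measurable]: "u \<in> borel_measurable borel" and iu: "integrable lborel (\<lambda>y. indicator (cball 0 R) y *\<^sub>R u y)"
    using u by (auto simp: loc_integrable_def)
  have le: "norm (\<psi> y *\<^sub>R u y) \<le> B * norm (indicator (cball 0 R) y *\<^sub>R u y)" for y
    using B[of y] by (auto simp: indicator_def intro: mult_right_mono)
  show i: "integrable lborel (\<lambda>y. \<psi> y *\<^sub>R u y)"
  proof (rule Bochner_Integration.integrable_bound)
    show "integrable lborel (\<lambda>y. B * norm (indicator (cball 0 R) y *\<^sub>R u y))"
      by (intro integrable_mult_right integrable_norm iu)
    show "AE y in lborel. norm (\<psi> y *\<^sub>R u y) \<le> norm (B * norm (indicator (cball 0 R) y *\<^sub>R u y))"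
      using le by (intro AE_I2) (metis abs_ge_self order_trans real_norm_def)
  qed measurable
  have "norm (LINT y|lborel. \<psi> y *\<^sub>R u y) \<le> (LINT y|lborel. norm (\<psi> y *\<^sub>R u y))"
    by (rule integral_norm_bound)
  also have "\<dots> \<le> (LINT y|lborel. B * norm (indicator (cball 0 R) y *\<^sub>R u y))"
    by (intro integral_mono integrable_norm i integrable_mult_right iu le)
  finally show "norm (LINT y|lborel. \<psi> y *\<^sub>R u y) \<le> B * (LINT y|lborel. norm (indicator (cball 0 R) y *\<^sub>R u y))"
    by simp
qed

lemma test_measurable [measurable_dest]: "test_function f \<Longrightarrow> f \<in> borel_measurable borel"
  by (rule smooth_measurable[OF test_smooth])

lemma conv_integrable:
  assumes u: "loc_integrable u" and \<phi>: "test_function \<phi>"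
  shows "integrable lborel (\<lambda>y. \<phi> (x - y) *\<^sub>R u y)"
proof -
  obtain r where r: "0 < r" "\<And>x. norm x > r \<Longrightarrow> \<phi> x = 0" using test_radius[OF \<phi>] by metis
  obtain B where B: "0 < B" "\<And>x. norm (\<phi> x) \<le> B" using test_bounded[OF \<phi>] by metis
  have [measurable]: "\<phi> \<in> borel_measurable borel" using \<phi> by measurable
  show ?thesis
  proof (rule loc_integrable_integral_bound(1)[OF u, of _ B "norm x + r"])
    show "norm y > norm x + r \<Longrightarrow> \<phi> (x - y) = 0" for y
      using r(2)[of "x - y"] norm_triangle_ineq2[of y x] by (simp add: norm_minus_commute)
  qed (use B in auto)
qed

lemma conv_has_derivative:
  fixes u :: "real^'n::finite \<Rightarrow> 'b::{banach, second_countable_topology}"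
  assumes u: "loc_integrable u" and \<phi>: "test_function \<phi>"
  shows "(conv u \<phi> has_derivative (\<lambda>h. \<Sum>i\<in>UNIV. h $ i *\<^sub>R conv u (pd i \<phi>) x)) (at x)"
  unfolding has_derivative_at
proof
  have bl: "bounded_linear (\<lambda>h::real^'n. h $ i *\<^sub>R c)" for i and c :: 'b
    by (rule bounded_linear_compose[OF bounded_linear_scaleR_left bounded_linear_vec_nth])
  then show "bounded_linear (\<lambda>h. \<Sum>i\<in>UNIV. h $ i *\<^sub>R conv u (pd i \<phi>) x)"
    by (intro bounded_linear_sum) auto
  obtain r where r: "0 < r" "\<And>x. norm x > r \<Longrightarrow> \<phi> x = 0" using test_radius[OF \<phi>] by metis
  obtain L where L: "0 < L" "\<And>x h. norm (\<phi> (x + h) - \<phi> x - (\<Sum>i\<in>UNIV. h $ i *\<^sub>R pd i \<phi> x)) \<le> L * (norm h)\<^sup>2"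
    using test_Taylor[OF \<phi>] by metis
  have [measurable]: "\<phi> \<in> borel_measurable borel" "\<And>i. pd i \<phi> \<in> borel_measurable borel"
    using \<phi> test_pd[OF \<phi>] by measurable
  define R where "R = norm x + r + 1"
  define C where "C = L * (LINT y|lborel. norm (indicator (cball 0 R) y *\<^sub>R u y))"
  have le: "norm (conv u \<phi> (x + h) - conv u \<phi> x - (\<Sum>i\<in>UNIV. h $ i *\<^sub>R conv u (pd i \<phi>) x)) \<le> C * (norm h)\<^sup>2"
    if h: "norm h \<le> 1" for h
  proof -
    let ?q = "\<lambda>y. \<phi> (x + h - y) - \<phi> (x - y) - (\<Sum>i\<in>UNIV. h $ i * pd i \<phi> (x - y))"
    have i: "integrable lborel (\<lambda>y. \<phi> (x + h - y) *\<^sub>R u y)" "integrable lborel (\<lambda>y. \<phi> (x - y) *\<^sub>R u y)"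
      "\<And>i. integrable lborel (\<lambda>y. pd i \<phi> (x - y) *\<^sub>R u y)"
      by (intro conv_integrable u \<phi> test_pd)+
    have "conv u \<phi> (x + h) - conv u \<phi> x - (\<Sum>i\<in>UNIV. h $ i *\<^sub>R conv u (pd i \<phi>) x) = (LINT y|lborel. ?q y *\<^sub>R u y)"
      using i by (simp add: conv_def scaleR_diff_left scaleR_sum_left flip: scaleR_scaleR)
    also have "norm \<dots> \<le> (L * (norm h)\<^sup>2) * (LINT y|lborel. norm (indicator (cball 0 R) y *\<^sub>R u y))"
    proof (rule loc_integrable_integral_bound(2)[OF u])
      show "\<bar>?q y\<bar> \<le> L * (norm h)\<^sup>2" for y
        using L(2)[of "x - y" h] by (simp add: algebra_simps)
      fix y :: "real^'n" assume y: "norm y > R"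
      have "norm y \<le> norm (x + h - y) + norm (x + h)"
        using norm_triangle_ineq4[of "x + h" "x + h - y"] by simp
      moreover have "norm (x + h) \<le> norm x + norm h" by (rule norm_triangle_ineq)
      ultimately have 1: "norm (x + h - y) > r" using y h by (simp add: R_def)
      have "norm y \<le> norm (x - y) + norm x"
        using norm_triangle_ineq4[of x "x - y"] by simp
      then have 2: "norm (x - y) > r" using y by (simp add: R_def)
      show "?q y = 0" using r(2)[OF 1] r(2)[OF 2] pd_eq_0_outside[of r \<phi>, OF r(2) 2] by simp
    qed measurable
    finally show ?thesis by (simp add: C_def mult_ac)
  qed
  show "(\<lambda>h. norm (conv u \<phi> (x + h) - conv u \<phi> x - (\<Sum>i\<in>UNIV. h $ i *\<^sub>R conv u (pd i \<phi>) x)) / norm h) \<midarrow>0\<rightarrow> 0"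
  proof (rule Lim_null_comparison)
    show "\<forall>\<^sub>F h in at 0. norm (norm (conv u \<phi> (x + h) - conv u \<phi> x - (\<Sum>i\<in>UNIV. h $ i *\<^sub>R conv u (pd i \<phi>) x)) / norm h) \<le> C * norm h"
      unfolding eventually_at
    proof (intro exI[of _ 1] conjI ballI impI)
      fix h :: "real^'n" assume h: "h \<noteq> 0 \<and> dist h 0 < 1"
      show "norm (norm (conv u \<phi> (x + h) - conv u \<phi> x - (\<Sum>i\<in>UNIV. h $ i *\<^sub>R conv u (pd i \<phi>) x)) / norm h) \<le> C * norm h"
        using le[of h] h by (simp add: divide_le_eq power2_eq_square mult.assoc)
    qed simp
    show "((\<lambda>h. C * norm h) \<longlongrightarrow> 0) (at 0)"
      by (rule tendsto_eq_intros refl | simp)+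
  qed
qed

lemma pds_conv:
  assumes "loc_integrable u" "test_function \<phi>"
  shows "pds is (conv u \<phi>) = conv u (pds is \<phi>)"
proof (induction "is")
  case (Cons i "is")
  have "pd i (conv u (pds is \<phi>)) = conv u (pd i (pds is \<phi>))"
    using pd_eq[OF conv_has_derivative[OF assms(1) test_pds[OF assms(2)]], of i]
    by (simp add: fun_eq_iff axis_def if_distribR if_distrib cong: if_cong)
  then show ?case using Cons.IH by simp
qed simp

lemma smooth_conv:
  assumes "loc_integrable u" "test_function \<phi>"
  shows "smooth_on UNIV (conv u \<phi>)"
  unfolding smooth_on_def pds_conv[OF assms] differentiable_def
  using conv_has_derivative[OF assms(1) test_pds[OF assms(2)]] by blast

lemma conv_eq_0_outside:
  assumes "\<And>y. norm y > s \<Longrightarrow> u y = 0" "\<And>y. norm y > r \<Longrightarrow> \<phi> y = 0" "norm x > s + r"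
  shows "conv u \<phi> x = 0"
proof -
  have "\<phi> (x - y) *\<^sub>R u y = 0" for y
    using assms(1)[of y] assms(2)[of "x - y"] assms(3) norm_triangle_ineq2[of x y]
    by (cases "norm y > s") auto
  then have "(\<lambda>y. \<phi> (x - y) *\<^sub>R u y) = (\<lambda>y. 0)" by (rule ext)
  then show ?thesis unfolding conv_def by simp
qed

lemma test_conv:
  assumes "loc_integrable u" "test_function \<phi>" "\<And>y. norm y > s \<Longrightarrow> u y = 0"
  shows "test_function (conv u \<phi>)"
proof -
  obtain r where r: "0 < r" "\<And>x. norm x > r \<Longrightarrow> \<phi> x = 0" using test_radius[OF assms(2)] by metis
  then show ?thesis unfolding test_function_iff
    using smooth_conv[OF assms(1,2)] conv_eq_0_outside[of s u r \<phi>, OF assms(3) r(2)] by blast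
qed

text \<open>Young's inequality: Cauchy-Schwarz for the weight \<open>\<bar>\<phi> (x - y)\<bar> dy\<close>, followed by Tonelli.\<close>

lemma conv_square_integrable:
  fixes u :: "real^'n::finite \<Rightarrow> complex"
  assumes u: "square_integrable u" and \<phi>: "test_function \<phi>"
  shows "square_integrable (conv u \<phi>)"
    and "norm (abs_L2 (conv u \<phi>)) \<le> (LINT y|lborel. \<bar>\<phi> y\<bar>) * norm (abs_L2 u)"
proof -
  have [measurable]: "\<phi> \<in> borel_measurable borel" "u \<in> borel_measurable borel"
    using \<phi> u by (auto simp: square_integrable_def)
  note lu = square_integrable_loc_integrable[OF u]
  define K where "K = (LINT y|lborel. \<bar>\<phi> y\<bar>)"
  have K0: "0 \<le> K" by (simp add: K_def)
  obtain r where r: "\<And>x. norm x > r \<Longrightarrow> \<phi> x = 0" using test_radius[OF \<phi>] by metis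
  have i\<phi>: "integrable lborel \<phi>"
    by (rule integrable_continuous_support[OF smooth_continuous[OF test_smooth[OF \<phi>]] r])
  have K: "(\<integral>\<^sup>+y. ennreal \<bar>\<phi> (x - y)\<bar> \<partial>lborel) = ennreal K" for x
  proof -
    have "integrable lborel (\<lambda>y. \<phi> (x - y))"
      using lborel_integral_affine(2)[of \<phi> "-1" x] i\<phi> by simp
    then show ?thesis
      using lborel_integral_reflect[of "\<lambda>y. \<bar>\<phi> y\<bar>" x] by (subst nn_integral_eq_integral) (auto simp: K_def)
  qed
  have K': "(\<integral>\<^sup>+x. ennreal \<bar>\<phi> (x - y)\<bar> \<partial>lborel) = ennreal K" for y
  proof -
    have "integrable lborel (\<lambda>x. \<phi> (x - y))"
      using lborel_integral_affine(2)[of \<phi> 1 "-y"] i\<phi> by simp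
    then show ?thesis
      using lborel_integral_translate[of "\<lambda>y. \<bar>\<phi> y\<bar>" "-y"] by (subst nn_integral_eq_integral) (auto simp: K_def)
  qed
  have pt: "ennreal ((cmod (conv u \<phi> x))\<^sup>2) \<le> ennreal K * (\<integral>\<^sup>+y. ennreal (\<bar>\<phi> (x - y)\<bar> * (cmod (u y))\<^sup>2) \<partial>lborel)" for x
  proof -
    have "ennreal (cmod (conv u \<phi> x)) \<le> (\<integral>\<^sup>+y. ennreal (norm (\<phi> (x - y) *\<^sub>R u y)) \<partial>lborel)"
      unfolding conv_def by (rule integral_norm_bound_ennreal[OF conv_integrable[OF lu \<phi>]])
    also have "\<dots> = (\<integral>\<^sup>+y. ennreal (sqrt \<bar>\<phi> (x - y)\<bar>) * ennreal (sqrt \<bar>\<phi> (x - y)\<bar> * cmod (u y)) \<partial>lborel)"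
      by (intro nn_integral_cong) (simp add: ennreal_mult[symmetric] flip: mult.assoc)
    finally have "(ennreal (cmod (conv u \<phi> x)))\<^sup>2 \<le> (\<integral>\<^sup>+y. ennreal (sqrt \<bar>\<phi> (x - y)\<bar>) * ennreal (sqrt \<bar>\<phi> (x - y)\<bar> * cmod (u y)) \<partial>lborel)\<^sup>2"
      by (rule power_mono) simp
    also have "\<dots> \<le> (\<integral>\<^sup>+y. (ennreal (sqrt \<bar>\<phi> (x - y)\<bar>))\<^sup>2 \<partial>lborel) * (\<integral>\<^sup>+y. (ennreal (sqrt \<bar>\<phi> (x - y)\<bar> * cmod (u y)))\<^sup>2 \<partial>lborel)"
      by (rule Cauchy_Schwarz_nn_integral) measurable
    finally show ?thesis
      using K[of x] by (simp add: ennreal_power power_mult_distrib)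
  qed
  have mw[measurable]: "conv u \<phi> \<in> borel_measurable borel"
    by (rule smooth_measurable[OF smooth_conv[OF lu \<phi>]])
  have "(\<integral>\<^sup>+x. ennreal ((cmod (conv u \<phi> x))\<^sup>2) \<partial>lborel)
      \<le> (\<integral>\<^sup>+x. ennreal K * (\<integral>\<^sup>+y. ennreal (\<bar>\<phi> (x - y)\<bar> * (cmod (u y))\<^sup>2) \<partial>lborel) \<partial>lborel)"
    by (intro nn_integral_mono pt)
  also have "\<dots> = ennreal K * (\<integral>\<^sup>+x. (\<integral>\<^sup>+y. ennreal (\<bar>\<phi> (x - y)\<bar> * (cmod (u y))\<^sup>2) \<partial>lborel) \<partial>lborel)"
    by (rule nn_integral_cmult) measurable
  also have "(\<integral>\<^sup>+x. (\<integral>\<^sup>+y. ennreal (\<bar>\<phi> (x - y)\<bar> * (cmod (u y))\<^sup>2) \<partial>lborel) \<partial>lborel)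
      = (\<integral>\<^sup>+y. (\<integral>\<^sup>+x. ennreal (\<bar>\<phi> (x - y)\<bar> * (cmod (u y))\<^sup>2) \<partial>lborel) \<partial>lborel)"
    by (rule lborel_pair.Fubini'[symmetric]) measurable
  also have "\<dots> = (\<integral>\<^sup>+y. ennreal K * ennreal ((cmod (u y))\<^sup>2) \<partial>lborel)"
    by (intro nn_integral_cong) (simp add: ennreal_mult nn_integral_multc K')
  also have "\<dots> = ennreal K * ennreal ((norm (abs_L2 u))\<^sup>2)"
    by (simp add: nn_integral_cmult nn_integral_norm_sq[OF u])
  finally have fin: "(\<integral>\<^sup>+x. ennreal ((cmod (conv u \<phi> x))\<^sup>2) \<partial>lborel) \<le> ennreal ((K * norm (abs_L2 u))\<^sup>2)"
    using K0 by (simp add: ennreal_mult[symmetric] power_mult_distrib power2_eq_square mult_ac)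
  show sw: "square_integrable (conv u \<phi>)"
    unfolding square_integrable_def
    by (intro conjI mw integrableI_bounded) (use fin le_less_trans in \<open>fastforce+\<close>)
  have "(norm (abs_L2 (conv u \<phi>)))\<^sup>2 \<le> (K * norm (abs_L2 u))\<^sup>2"
    using fin unfolding nn_integral_norm_sq[OF sw] by (simp add: ennreal_le_iff)
  then show "norm (abs_L2 (conv u \<phi>)) \<le> (LINT y|lborel. \<bar>\<phi> y\<bar>) * norm (abs_L2 u)"
    unfolding K_def[symmetric] by (rule power2_le_imp_le) (simp add: K0)
qed

section \<open>Approximate identities, density and separability\<close>

lemma mollifier_rescale:
  fixes \<rho> :: "real^'n::finite \<Rightarrow> real"
  assumes \<rho>: "mollifier \<rho>" and d: "0 < \<delta>"
  shows "test_function (rescale \<delta> \<rho>)" "\<And>x. norm x > \<delta> \<Longrightarrow> rescale \<delta> \<rho> x = 0"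
    "(LINT x|lborel. rescale \<delta> \<rho> x) = 1"
    "(LINT x|lborel. \<bar>rescale \<delta> \<rho> x\<bar>) = (LINT x|lborel. \<bar>\<rho> x\<bar>)"
proof -
  have t: "test_function \<rho>" and s: "support \<rho> \<subseteq> cball 0 1" and i: "(LINT x|lborel. \<rho> x) = 1"
    using \<rho> by (auto simp: mollifier_def)
  have [measurable]: "\<rho> \<in> borel_measurable borel" using t by measurable
  have eq: "rescale \<delta> \<rho> = (\<lambda>x. (1 / \<delta> ^ CARD('n)) * \<rho> (0 + (1 / \<delta>) *\<^sub>R x))"
    by (simp add: rescale_def fun_eq_iff)
  show "test_function (rescale \<delta> \<rho>)" unfolding eq
    using d by (intro test_cmult test_affine t) auto
  show "rescale \<delta> \<rho> x = 0" if "norm x > \<delta>" for x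
  proof -
    have "norm ((1 / \<delta>) *\<^sub>R x) > 1" using that d by simp
    then have "(1 / \<delta>) *\<^sub>R x \<notin> support \<rho>" using s by auto
    then show ?thesis by (simp add: rescale_def not_in_support)
  qed
  have *: "(LINT x|lborel. f x) = (1 / \<delta> ^ CARD('n)) * (LINT x|lborel. f (0 + (1 / \<delta>) *\<^sub>R x))"
    if [measurable]: "f \<in> borel_measurable borel" for f :: "real^'n \<Rightarrow> real"
    using lborel_integral_affine(1)[OF that, of "1 / \<delta>" 0] d by (simp add: power_one_over)
  show "(LINT x|lborel. rescale \<delta> \<rho> x) = 1"
  proof -
    have "(LINT x|lborel. rescale \<delta> \<rho> x) = (1 / \<delta> ^ CARD('n)) * (LINT x|lborel. \<rho> (0 + (1 / \<delta>) *\<^sub>R x))"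
      by (simp add: rescale_def)
    also have "\<dots> = 1" by (subst *[symmetric]) (simp_all add: i)
    finally show ?thesis .
  qed
  show "(LINT x|lborel. \<bar>rescale \<delta> \<rho> x\<bar>) = (LINT x|lborel. \<bar>\<rho> x\<bar>)"
    using *[of "\<lambda>x. \<bar>\<rho> x\<bar>"] d by (simp add: rescale_def abs_mult)
qed

text \<open>A countable generator of the Borel sets which is closed under intersection and has bounded members.
  Indicators of its members replace the simple functions in the density arguments below.\<close>

definition rational_boxes_vec :: "(real^'n::finite) set set" where
  "rational_boxes_vec = {box a b | a b. (\<forall>i. a $ i \<in> \<rat>) \<and> (\<forall>i. b $ i \<in> \<rat>)}"

lemma countable_rational_boxes: "countable (rational_boxes_vec :: (real^'n::finite) set set)"
proof -
  have "{a :: real^'n. \<forall>i. a $ i \<in> \<rat>} \<subseteq> range (\<lambda>p::'n \<Rightarrow> rat. \<chi> i. of_rat (p i))"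
  proof
    fix a :: "real^'n" assume "a \<in> {a. \<forall>i. a $ i \<in> \<rat>}"
    then have "\<forall>i. \<exists>q. a $ i = of_rat q" by (auto simp: Rats_def)
    then obtain p where "\<And>i. a $ i = of_rat (p i)" by metis
    then have "a = (\<chi> i. of_rat (p i))" by (simp add: vec_eq_iff)
    then show "a \<in> range (\<lambda>p::'n \<Rightarrow> rat. \<chi> i. of_rat (p i))" by auto
  qed
  then have c: "countable {a :: real^'n. \<forall>i. a $ i \<in> \<rat>}"
    by (rule countable_subset) simp
  have eq: "rational_boxes_vec = (\<lambda>(a, b). box a b) ` ({a :: real^'n. \<forall>i. a $ i \<in> \<rat>} \<times> {a. \<forall>i. a $ i \<in> \<rat>})"
    by (auto simp: rational_boxes_vec_def)
  show ?thesis unfolding eq by (intro countable_image countable_SIGMA c)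
qed

lemma sets_borel_rational_boxes:
  "sets (borel :: (real^'n::finite) measure) = sigma_sets UNIV rational_boxes_vec"
proof
  show "sigma_sets UNIV rational_boxes_vec \<subseteq> sets (borel :: (real^'n) measure)"
  proof -
    have "(rational_boxes_vec :: (real^'n) set set) \<subseteq> sets borel"
      by (auto simp: rational_boxes_vec_def)
    from sets.sigma_sets_subset[OF this] show ?thesis by simp
  qed
  have "S \<in> sigma_sets UNIV rational_boxes_vec" if S: "open S" for S :: "(real^'n) set"
  proof -
    have "S = \<Union>{B \<in> rational_boxes_vec. B \<subseteq> S}"
    proof (intro equalityI subsetI)
      fix x assume "x \<in> S"
      then obtain e where e: "e > 0" "ball x e \<subseteq> S" using S openE by blast
      obtain a b where ab: "\<forall>i\<in>Basis. a \<bullet> i \<in> \<rat> \<and> b \<bullet> i \<in> \<rat>" "x \<in> box a b" "box a b \<subseteq> ball x e"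
        using rational_boxes[OF e(1), of x] by auto
      have "\<forall>i. a $ i \<in> \<rat>" "\<forall>i. b $ i \<in> \<rat>"
        using ab(1) by (auto simp: Basis_vec_def cart_eq_inner_axis)
      then have "box a b \<in> rational_boxes_vec"
        unfolding rational_boxes_vec_def by blast
      then show "x \<in> \<Union>{B \<in> rational_boxes_vec. B \<subseteq> S}" using ab e by blast
    qed auto
    moreover have "\<Union>{B \<in> rational_boxes_vec. B \<subseteq> S} \<in> sigma_sets UNIV rational_boxes_vec"
      by (rule sigma_sets_UNION) (auto intro: countable_subset[OF _ countable_rational_boxes])
    ultimately show ?thesis by simp
  qed
  then show "sets (borel :: (real^'n) measure) \<subseteq> sigma_sets UNIV rational_boxes_vec"
    unfolding borel_def by (subst sets_measure_of) (auto intro!: sigma_sets_mono)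
qed

lemma Int_stable_rational_boxes: "Int_stable (rational_boxes_vec :: (real^'n::finite) set set)"
  unfolding Int_stable_def
proof (intro ballI)
  fix A B :: "(real^'n) set" assume "A \<in> rational_boxes_vec" "B \<in> rational_boxes_vec"
  then obtain a b a' b' where ab: "A = box a b" "B = box a' b'"
    "\<And>i. a $ i \<in> \<rat>" "\<And>i. b $ i \<in> \<rat>" "\<And>i. a' $ i \<in> \<rat>" "\<And>i. b' $ i \<in> \<rat>"
    unfolding rational_boxes_vec_def by auto
  have "A \<inter> B = box (\<chi> i. max (a $ i) (a' $ i)) (\<chi> i. min (b $ i) (b' $ i))"
    by (auto simp: ab mem_box_cart)
  moreover have "\<forall>i. (\<chi> i. max (a $ i) (a' $ i)) $ i \<in> \<rat>" "\<forall>i. (\<chi> i. min (b $ i) (b' $ i)) $ i \<in> \<rat>"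
    using ab(3-6) by (auto simp: max_def min_def)
  ultimately show "A \<inter> B \<in> rational_boxes_vec"
    unfolding rational_boxes_vec_def by blast
qed

lemma bounded_in_cball: "bounded S \<Longrightarrow> \<exists>R. S \<subseteq> cball 0 R" for S :: "'a::real_normed_vector set"
  by (auto simp: bounded_iff subset_eq)

text \<open>The positive and the negative part of \<open>h\<close> are densities of two measures that agree on boxes.\<close>

lemma AE_zero_if_box_integrals_zero:
  fixes h :: "real^'n::finite \<Rightarrow> real"
  assumes h: "loc_integrable h"
    and z: "\<And>B. B \<in> rational_boxes_vec \<Longrightarrow> (LINT x|lborel. indicator B x * h x) = 0"
  shows "AE x in lborel. h x = 0"
proof -
  have [measurable]: "h \<in> borel_measurable borel" using h by (simp add: loc_integrable_def)
  have em: "emeasure (density lborel (\<lambda>x. ennreal (s * h x))) B = ennreal (LINT x|lborel. indicator B x * max 0 (s * h x))"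
      and ib: "integrable lborel (\<lambda>x. indicator B x * h x)"
    if BB: "B \<in> rational_boxes_vec" for B and s :: real
  proof -
    obtain a b where B: "B = box a b" using BB by (auto simp: rational_boxes_vec_def)
    obtain R where R: "B \<subseteq> cball 0 R" using bounded_in_cball[OF bounded_box[of a b]] B by metis
    have [measurable]: "B \<in> sets borel" using B by simp
    have "integrable lborel (\<lambda>x. indicator B x *\<^sub>R h x)"
      by (rule loc_integrable_integral_bound(1)[OF h, of _ 1 R]) (use R in \<open>auto simp: indicator_def\<close>)
    then show i: "integrable lborel (\<lambda>x. indicator B x * h x)" by simp
    have "integrable lborel (\<lambda>x. max 0 (s * (indicator B x * h x)))"
      using i by (intro integrable_max integrable_mult_right) auto
    then have "integrable lborel (\<lambda>x. indicator B x * max 0 (s * h x))"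
      by (rule back_subst[of "integrable lborel"]) (auto simp: indicator_def fun_eq_iff)
    moreover have "emeasure (density lborel (\<lambda>x. ennreal (s * h x))) B = (\<integral>\<^sup>+x. ennreal (indicator B x * max 0 (s * h x)) \<partial>lborel)"
      by (subst emeasure_density) (auto simp: indicator_def ennreal_neg max_def intro!: nn_integral_cong)
    ultimately show "emeasure (density lborel (\<lambda>x. ennreal (s * h x))) B = ennreal (LINT x|lborel. indicator B x * max 0 (s * h x))"
      by (simp add: nn_integral_eq_integral)
  qed
  have "density lborel (\<lambda>x. ennreal (1 * h x)) = density lborel (\<lambda>x. ennreal ((-1) * h x))"
  proof (rule measure_eqI_generator_eq[OF Int_stable_rational_boxes, of UNIV])
    fix B :: "(real^'n) set" assume B: "B \<in> rational_boxes_vec"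
    have [measurable]: "B \<in> sets borel" using B by (auto simp: rational_boxes_vec_def)
    have i: "integrable lborel (\<lambda>x. indicator B x * max 0 (s * h x))" for s
    proof -
      have "integrable lborel (\<lambda>x. max 0 (s * (indicator B x * h x)))"
        using ib[OF B] by (intro integrable_max integrable_mult_right) auto
      then show ?thesis
        by (rule back_subst[of "integrable lborel"]) (auto simp: indicator_def fun_eq_iff)
    qed
    have "(LINT x|lborel. indicator B x * max 0 (1 * h x)) - (LINT x|lborel. indicator B x * max 0 ((-1) * h x))
        = (LINT x|lborel. indicator B x * h x)"
      by (subst Bochner_Integration.integral_diff[symmetric, OF i i])
        (auto intro!: Bochner_Integration.integral_cong simp: max_def indicator_def)
    then show "emeasure (density lborel (\<lambda>x. ennreal (1 * h x))) B = emeasure (density lborel (\<lambda>x. ennreal ((-1) * h x))) B"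
      using z[OF B] by (simp only: em[OF B]) simp
  next
    show "range (\<lambda>n::nat. box (\<chi> i. - real n) (\<chi> i. real n)) \<subseteq> (rational_boxes_vec :: (real^'n) set set)"
      by (force simp: rational_boxes_vec_def)
    show "(\<Union>n. box (\<chi> i. - real n) (\<chi> i. real n)) = (UNIV :: (real^'n) set)"
    proof (intro equalityI subsetI)
      fix x :: "real^'n"
      obtain n where n: "norm x < real n" using reals_Archimedean2 by blast
      have "\<bar>x $ i\<bar> < real n" for i using component_le_norm_cart[of x i] n by linarith
      then have "x \<in> box (\<chi> i. - real n) (\<chi> i. real n)" by (simp add: mem_box_cart abs_less_iff minus_less_iff)
      then show "x \<in> (\<Union>n. box (\<chi> i. - real n) (\<chi> i. real n))" by blast
    qed simp
    show "emeasure (density lborel (\<lambda>x. ennreal (1 * h x))) (box (\<chi> i. - real n) (\<chi> i. real n)) \<noteq> \<infinity>" for n :: nat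
      by (subst em) (force simp: rational_boxes_vec_def)+
  qed (auto simp: sets_borel_rational_boxes)
  then have "AE x in lborel. ennreal (1 * h x) = ennreal ((-1) * h x)"
    by (intro sigma_finite_measure.density_unique[OF lborel.sigma_finite_measure_axioms]) auto
  then show ?thesis
  proof (rule AE_mp, intro AE_I2 impI)
    fix x assume "ennreal (1 * h x) = ennreal ((-1) * h x)"
    then show "h x = 0"
      by (cases "h x \<ge> 0") (auto simp: ennreal_neg ennreal_eq_0_iff)
  qed
qed

lemma square_integrable_indicator_box:
  assumes "B \<in> rational_boxes_vec"
  shows "square_integrable (indicator B :: real^'n::finite \<Rightarrow> complex)"
proof -
  obtain a b where B: "B = box a b" using assms by (auto simp: rational_boxes_vec_def)
  have "(\<lambda>x. (cmod (indicator B x))\<^sup>2) = indicator B" by (auto simp: indicator_def)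
  then show ?thesis using emeasure_lborel_box_finite[of a b]
    by (auto simp: square_integrable_def B intro!: integrable_real_indicator)
qed

lemma L2_zero_if_orthogonal_boxes:
  assumes "\<And>B. B \<in> rational_boxes_vec \<Longrightarrow> cinner (abs_L2 (indicator B)) g = 0"
  shows "g = (0 :: (real^'n::finite) L2)"
proof -
  obtain g' where g': "square_integrable g'" "g = abs_L2 g'" using L2_obtain_function by metis
  have [measurable]: "g' \<in> borel_measurable borel" using g' by (simp add: square_integrable_def)
  have l: "loc_integrable g'" by (rule square_integrable_loc_integrable[OF g'(1)])
  have part: "AE x in lborel. L (g' x) = 0" if L: "bounded_linear L" "L = Re \<or> L = Im" for L :: "complex \<Rightarrow> real"
  proof (rule AE_zero_if_box_integrals_zero)
    have [measurable]: "L \<in> borel_measurable borel" using L(2) by auto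
    show "loc_integrable (\<lambda>x. L (g' x))"
      unfolding loc_integrable_def
    proof (intro conjI allI)
      fix R
      have "integrable lborel (\<lambda>y. L (indicator (cball 0 R) y *\<^sub>R g' y))"
        using l by (intro integrable_bounded_linear[OF L(1)]) (simp add: loc_integrable_def)
      then show "integrable lborel (\<lambda>y. indicator (cball 0 R) y *\<^sub>R L (g' y))"
        using L(2) by auto
    qed measurable
    fix B :: "(real^'n) set" assume B: "B \<in> rational_boxes_vec"
    note sB = square_integrable_indicator_box[OF B]
    have i: "integrable lborel (\<lambda>x. indicator B x * cnj (g' x))"
      using square_integrable_prod[OF sB g'(1)] .
    have z: "(LINT x|lborel. indicator B x * cnj (g' x)) = 0"
      using assms[OF B] cinner_abs[OF sB g'(1)] by (simp add: g'(2))
    have "(LINT x|lborel. L (indicator B x * cnj (g' x))) = L (LINT x|lborel. indicator B x * cnj (g' x))"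
      by (rule integral_bounded_linear[OF L(1) i])
    also have "\<dots> = 0" using z L(2) by auto
    finally have "(LINT x|lborel. L (indicator B x * cnj (g' x))) = 0" .
    moreover have "(\<lambda>x. L (indicator B x * cnj (g' x))) = (if L = Re then (\<lambda>x. indicator B x * L (g' x)) else (\<lambda>x. - (indicator B x * L (g' x))))"
      using L(2) by (auto simp: indicator_def fun_eq_iff)
    ultimately show "(LINT x|lborel. indicator B x * L (g' x)) = 0" by (simp split: if_splits)
  qed
  have "AE x in lborel. g' x = 0"
    using part[OF bounded_linear_Re disjI1[OF refl]] part[OF bounded_linear_Im disjI2[OF refl]]
    by eventually_elim (auto simp: complex_eq_iff)
  then show ?thesis
    using g' abs_L2_eq_iff[OF g'(1) square_integrable_zero] by (simp add: abs_L2_zero)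
qed

lemma L2_dominated_convergence:
  fixes f :: "nat \<Rightarrow> 'a::euclidean_space \<Rightarrow> complex" and w :: "'a \<Rightarrow> real"
  assumes [measurable]: "\<And>n. f n \<in> borel_measurable borel" "g \<in> borel_measurable borel" "w \<in> borel_measurable borel"
    and w: "integrable lborel (\<lambda>x. (w x)\<^sup>2)" "\<And>n x. cmod (f n x) \<le> w x"
    and lim: "AE x in lborel. (\<lambda>n. f n x) \<longlonglongrightarrow> g x"
  shows "\<And>n. square_integrable (f n)" "square_integrable g" "(\<lambda>n. abs_L2 (f n)) \<longlonglongrightarrow> abs_L2 g"
proof -
  have w0: "0 \<le> w x" for x using w(2)[of 0 x] norm_ge_zero order_trans by blast
  show sf: "square_integrable (f n)" for n
    unfolding square_integrable_def
  proof
    show "integrable lborel (\<lambda>x. (cmod (f n x))\<^sup>2)"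
      by (rule Bochner_Integration.integrable_bound[OF w(1)]) (auto intro!: power_mono w)
  qed measurable
  have gw: "AE x in lborel. cmod (g x) \<le> w x"
    using lim
  proof eventually_elim
    case (elim x)
    then show ?case using w(2) by (intro Lim_bounded[OF tendsto_norm[OF elim]]) auto
  qed
  show sg: "square_integrable g"
    unfolding square_integrable_def
  proof
    show "integrable lborel (\<lambda>x. (cmod (g x))\<^sup>2)"
    proof (rule Bochner_Integration.integrable_bound[OF w(1)])
      show "AE x in lborel. norm ((cmod (g x))\<^sup>2) \<le> norm ((w x)\<^sup>2)"
        using gw by eventually_elim (auto intro: power_mono)
    qed measurable
  qed measurable
  have "(\<lambda>n. LINT x|lborel. (cmod (f n x - g x))\<^sup>2) \<longlonglongrightarrow> (LINT x|(lborel::'a measure). 0)"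
  proof (rule integral_dominated_convergence[where w="\<lambda>x. 4 * (w x)\<^sup>2"])
    show "integrable lborel (\<lambda>x. 4 * (w x)\<^sup>2)" using w(1) by simp
    show "AE x in lborel. (\<lambda>n. (cmod (f n x - g x))\<^sup>2) \<longlonglongrightarrow> 0"
      using lim
    proof eventually_elim
      case (elim x)
      have "(\<lambda>n. (cmod (f n x - g x))\<^sup>2) \<longlonglongrightarrow> (cmod (g x - g x))\<^sup>2" by (intro tendsto_intros elim)
      then show ?case by simp
    qed
    show "AE x in lborel. norm ((cmod (f n x - g x))\<^sup>2) \<le> 4 * (w x)\<^sup>2" for n
      using gw
    proof eventually_elim
      case (elim x)
      have "cmod (f n x - g x) \<le> 2 * w x"
        using norm_triangle_ineq4[of "f n x" "g x"] w(2)[of n x] elim by linarith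
      then have "(cmod (f n x - g x))\<^sup>2 \<le> (2 * w x)\<^sup>2" by (rule power_mono) simp
      then show ?case by (simp add: power_mult_distrib)
    qed
  qed measurable
  then have "(\<lambda>n. (norm (abs_L2 (f n) - abs_L2 g))\<^sup>2) \<longlonglongrightarrow> 0"
    using norm_abs_L2_sq[OF square_integrable_minus[OF sf sg]] by (simp add: abs_L2_diff sf sg)
  then have "(\<lambda>n. sqrt ((norm (abs_L2 (f n) - abs_L2 g))\<^sup>2)) \<longlonglongrightarrow> sqrt 0" by (rule tendsto_real_sqrt)
  then show "(\<lambda>n. abs_L2 (f n)) \<longlonglongrightarrow> abs_L2 g"
    by (simp add: tendsto_norm_zero_iff LIM_zero_iff)
qed

definition moll :: "(real^'n::finite \<Rightarrow> real) \<Rightarrow> nat \<Rightarrow> real^'n \<Rightarrow> real" where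
  "moll \<rho> n = rescale (inverse (real (Suc n))) \<rho>"

lemma moll:
  assumes "mollifier \<rho>"
  shows "test_function (moll \<rho> n)" "\<And>x. norm x > inverse (real (Suc n)) \<Longrightarrow> moll \<rho> n x = 0"
    "(LINT x|lborel. moll \<rho> n x) = 1"
    "(LINT x|lborel. \<bar>moll \<rho> n x\<bar>) = (LINT x|lborel. \<bar>\<rho> x\<bar>)"
  using mollifier_rescale[OF assms, of "inverse (real (Suc n))"] unfolding moll_def by auto

lemma conv_moll_const:
  fixes u :: "real^'n::finite \<Rightarrow> 'b::{banach, second_countable_topology}"
  assumes \<rho>: "mollifier \<rho>" and d: "0 < \<delta>" and c: "\<And>y. dist x y \<le> \<delta> \<Longrightarrow> u y = c"
  shows "conv u (rescale \<delta> \<rho>) x = c"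
proof -
  note m = mollifier_rescale[OF \<rho> d]
  have [measurable]: "rescale \<delta> \<rho> \<in> borel_measurable borel" using m(1) by measurable
  have eq: "rescale \<delta> \<rho> (x - y) *\<^sub>R u y = rescale \<delta> \<rho> (x - y) *\<^sub>R c" for y
    using m(2)[of "x - y"] c[of y] by (cases "dist x y \<le> \<delta>") (auto simp: dist_norm)
  have "integrable lborel (rescale \<delta> \<rho>)"
    using m(3) not_integrable_integral_eq by fastforce
  then have "integrable lborel (\<lambda>y. rescale \<delta> \<rho> (x - y))"
    using lborel_integral_affine(2)[of "rescale \<delta> \<rho>" "-1" x] by simp
  then have "conv u (rescale \<delta> \<rho>) x = (LINT y|lborel. rescale \<delta> \<rho> (x - y)) *\<^sub>R c"
    unfolding conv_def eq by simp
  also have "(LINT y|lborel. rescale \<delta> \<rho> (x - y)) = 1"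
    using m(3) lborel_integral_reflect[of "rescale \<delta> \<rho>" x] by simp
  finally show ?thesis by simp
qed

lemma conv_bounded:
  fixes u :: "real^'n::finite \<Rightarrow> 'b::{banach, second_countable_topology}"
  assumes \<phi>: "test_function \<phi>" and u: "loc_integrable u" "\<And>y. norm (u y) \<le> 1"
  shows "norm (conv u \<phi> x) \<le> (LINT y|lborel. \<bar>\<phi> y\<bar>)"
proof -
  have [measurable]: "\<phi> \<in> borel_measurable borel" using \<phi> by measurable
  obtain r where r: "\<And>x. norm x > r \<Longrightarrow> \<phi> x = 0" using test_radius[OF \<phi>] by metis
  have i\<phi>: "integrable lborel \<phi>"
    by (rule integrable_continuous_support[OF smooth_continuous[OF test_smooth[OF \<phi>]] r])
  then have "integrable lborel (\<lambda>y. \<phi> (x - y))"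
    using lborel_integral_affine(2)[of \<phi> "-1" x] by simp
  then have i: "integrable lborel (\<lambda>y. \<bar>\<phi> (x - y)\<bar>)" by simp
  have "norm (conv u \<phi> x) \<le> (LINT y|lborel. norm (\<phi> (x - y) *\<^sub>R u y))"
    unfolding conv_def by (rule integral_norm_bound)
  also have "\<dots> \<le> (LINT y|lborel. \<bar>\<phi> (x - y)\<bar>)"
    using u(2) by (intro integral_mono i integrable_norm conv_integrable u(1) \<phi>) (auto intro: mult_left_le)
  also have "\<dots> = (LINT y|lborel. \<bar>\<phi> y\<bar>)"
    using lborel_integral_reflect[of "\<lambda>y. \<bar>\<phi> y\<bar>" x] by simp
  finally show ?thesis .
qed

text \<open>Off the boundary of the box, a null set, the mollified indicators are eventually constant.\<close>

lemma conv_moll_box_tendsto: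
  fixes B :: "(real^'n::finite) set"
  assumes \<rho>: "mollifier \<rho>" and B: "B \<in> rational_boxes_vec"
  shows "(\<lambda>n. abs_L2 (conv (indicator B) (moll \<rho> n))) \<longlonglongrightarrow> abs_L2 (indicator B)"
    and "test_function (conv (indicator B :: real^'n \<Rightarrow> complex) (moll \<rho> n))"
proof -
  obtain a b where Bab: "B = box a b" using B by (auto simp: rational_boxes_vec_def)
  obtain R where R: "B \<subseteq> cball 0 R" using bounded_in_cball[OF bounded_box[of a b]] Bab by metis
  note sB = square_integrable_indicator_box[OF B]
  note lB = square_integrable_loc_integrable[OF sB]
  define K where "K = (LINT x|lborel. \<bar>\<rho> x\<bar>)"
  have out: "norm y > R \<Longrightarrow> indicator B y = (0::complex)" for y using R by (auto simp: indicator_def)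
  show t: "test_function (conv (indicator B :: real^'n \<Rightarrow> complex) (moll \<rho> n))" for n
    by (rule test_conv[OF lB moll(1)[OF \<rho>] out])
  have K: "cmod (conv (indicator B) (moll \<rho> n) x) \<le> K" for n x
    using conv_bounded[OF moll(1)[OF \<rho>] lB, of n x] moll(4)[OF \<rho>, of n]
    by (simp add: K_def indicator_def)
  show "(\<lambda>n. abs_L2 (conv (indicator B) (moll \<rho> n))) \<longlonglongrightarrow> abs_L2 (indicator B)"
  proof (rule L2_dominated_convergence(3)[where w="\<lambda>x. K * indicator (cball 0 (R + 1)) x"])
    show "conv (indicator B :: real^'n \<Rightarrow> complex) (moll \<rho> n) \<in> borel_measurable borel" for n
      by (rule test_measurable[OF t])
    show "(indicator B :: real^'n \<Rightarrow> complex) \<in> borel_measurable borel" using Bab by auto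
    have "(\<lambda>x. (K * indicator (cball 0 (R + 1)) x)\<^sup>2) = (\<lambda>x::real^'n. K\<^sup>2 * indicator (cball 0 (R + 1)) x)"
      by (auto simp: indicator_def)
    then show "integrable lborel (\<lambda>x::real^'n. (K * indicator (cball 0 (R + 1)) x)\<^sup>2)"
      using emeasure_lborel_cball_finite[of "0::real^'n" "R+1"] by simp
    show "cmod (conv (indicator B) (moll \<rho> n) x) \<le> K * indicator (cball 0 (R + 1)) x" for n x
    proof (cases "norm x \<le> R + 1")
      case False
      have "inverse (real (Suc n)) \<le> 1" by (simp add: inverse_le_1_iff)
      then have "conv (indicator B :: real^'n \<Rightarrow> complex) (moll \<rho> n) x = 0"
        using False by (intro conv_eq_0_outside[OF out moll(2)[OF \<rho>]]) auto
      then show ?thesis using False by simp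
    qed (use K in auto)
    have null: "cbox a b - box a b \<in> null_sets lborel"
      by (auto simp: emeasure_Diff emeasure_lborel_box_eq emeasure_lborel_cbox_eq null_setsI subset_box)
    have "AE x in lborel. x \<notin> cbox a b - box a b" by (rule AE_not_in[OF null])
    then show "AE x in lborel. (\<lambda>n. conv (indicator B) (moll \<rho> n) x) \<longlonglongrightarrow> (indicator B x :: complex)"
    proof eventually_elim
      case (elim x)
      define Q where "Q = (if x \<in> B then B else - cbox a b)"
      have "open Q" "x \<in> Q" using elim by (auto simp: Q_def Bab)
      then obtain e where e: "e > 0" "ball x e \<subseteq> Q" using openE by blast
      have const: "indicator B y = (indicator B x :: complex)" if "y \<in> Q" for y
        using that box_subset_cbox[of a b] by (auto simp: Q_def indicator_def Bab split: if_splits)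
      obtain N where N: "inverse (real (Suc N)) < e" using reals_Archimedean[OF e(1)] by auto
      have "conv (indicator B) (moll \<rho> n) x = (indicator B x :: complex)" if n: "n \<ge> N" for n
        unfolding moll_def
      proof (rule conv_moll_const[OF \<rho>])
        fix y assume "dist x y \<le> inverse (real (Suc n))"
        also have "\<dots> \<le> inverse (real (Suc N))" using n by (intro le_imp_inverse_le) auto
        finally have "y \<in> ball x e" using N by simp
        then show "indicator B y = (indicator B x :: complex)" using const e by blast
      qed simp
      then show ?case by (intro tendsto_eventually eventually_sequentiallyI) auto
    qed
  qed (intro borel_measurable_times borel_measurable_const borel_measurable_indicator borel_closed closed_cball)
qed

lemma closure_add:
  fixes S :: "'b::real_normed_vector set"
  assumes "\<And>u v. u \<in> S \<Longrightarrow> v \<in> S \<Longrightarrow> u + v \<in> S" "u \<in> closure S" "v \<in> closure S"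
  shows "u + v \<in> closure S"
proof -
  obtain a b where "\<forall>n::nat. a n \<in> S" "a \<longlonglongrightarrow> u" "\<forall>n::nat. b n \<in> S" "b \<longlonglongrightarrow> v"
    using assms(2,3) unfolding closure_sequential by metis
  then show ?thesis using assms(1) unfolding closure_sequential
    by (intro exI[of _ "\<lambda>n. a n + b n"]) (auto intro: tendsto_add)
qed

lemma closure_scaleC:
  fixes S :: "'a::euclidean_space L2 set"
  assumes "\<And>u. u \<in> S \<Longrightarrow> scaleC c u \<in> closure S" "u \<in> closure S"
  shows "scaleC c u \<in> closure S"
proof -
  obtain a where a: "\<forall>n::nat. a n \<in> S" "a \<longlonglongrightarrow> u"
    using assms(2) unfolding closure_sequential by metis
  have "(\<lambda>n. scaleC c (a n)) \<longlonglongrightarrow> scaleC c u" by (intro tendsto_intros a)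
  then show ?thesis using closed_sequentially[OF closed_closure, of "\<lambda>n. scaleC c (a n)"] assms(1) a(1) by blast
qed

lemma test_square_integrable:
  fixes f :: "real^'n::finite \<Rightarrow> complex"
  assumes "test_function f" shows "square_integrable f"
proof -
  obtain r where r: "\<And>x. norm x > r \<Longrightarrow> f x = 0" using test_radius[OF assms] by metis
  have "continuous_on UNIV (\<lambda>x. (cmod (f x))\<^sup>2)"
    by (intro continuous_intros smooth_continuous test_smooth assms)
  then show ?thesis
    using assms integrable_continuous_support[of "\<lambda>x. (cmod (f x))\<^sup>2" r] r
    by (auto simp: square_integrable_def)
qed

text \<open>By \<open>conv_moll_box_tendsto\<close> the closure contains the indicators of boxes, and these have no orthogonal vector.\<close>

lemma test_functions_dense:
  assumes \<rho>: "mollifier (\<rho> :: real^'n::finite \<Rightarrow> real)"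
  shows "closure {abs_L2 \<phi> | \<phi> :: real^'n \<Rightarrow> complex. test_function \<phi>} = UNIV"
    (is "closure ?S = _")
proof (rule closed_subspace_eq_UNIV)
  have add: "u + v \<in> ?S" if uv: "u \<in> ?S" "v \<in> ?S" for u v
  proof -
    obtain \<phi> \<psi> where "u = abs_L2 \<phi>" "test_function \<phi>" "v = abs_L2 \<psi>" "test_function \<psi>"
      using uv by auto
    then have "u + v = abs_L2 (\<lambda>x. \<phi> x + \<psi> x)" "test_function (\<lambda>x. \<phi> x + \<psi> x)"
      by (simp_all add: test_add abs_L2_add test_square_integrable)
    then show ?thesis by blast
  qed
  show "u + v \<in> closure ?S" if "u \<in> closure ?S" "v \<in> closure ?S" for u v
    by (rule closure_add[OF add that])
  show "scaleC c u \<in> closure ?S" if "u \<in> closure ?S" for c u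
  proof (rule closure_scaleC[OF _ that])
    fix u assume "u \<in> ?S"
    then obtain \<phi> where "u = abs_L2 \<phi>" "test_function \<phi>" by auto
    then have "scaleC c u = abs_L2 (\<lambda>x. c * \<phi> x)" "test_function (\<lambda>x. c * \<phi> x)"
      by (simp_all add: abs_L2_scaleC test_square_integrable test_cmult)
    then have "scaleC c u \<in> ?S" by blast
    then show "scaleC c u \<in> closure ?S" by (rule subsetD[OF closure_subset])
  qed
  have "0 \<in> ?S"
    unfolding mem_Collect_eq by (intro exI[of _ "\<lambda>x. 0"] conjI test_zero abs_L2_zero[symmetric])
  then show "0 \<in> closure ?S" by (rule subsetD[OF closure_subset])
  fix g :: "(real^'n) L2" assume g: "\<And>s. s \<in> closure ?S \<Longrightarrow> cinner s g = 0"
  show "g = 0"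
  proof (rule L2_zero_if_orthogonal_boxes)
    fix B :: "(real^'n) set" assume B: "B \<in> rational_boxes_vec"
    have "abs_L2 (indicator B) \<in> closure ?S"
      unfolding closure_sequential using conv_moll_box_tendsto[OF \<rho> B]
      by (intro exI[of _ "\<lambda>n. abs_L2 (conv (indicator B) (moll \<rho> n))"]) auto
    then show "cinner (abs_L2 (indicator B)) g = 0" by (rule g)
  qed
qed simp

text \<open>The combinations of indicators of rational boxes with coefficients in \<open>\<rat> + \<i> \<rat>\<close> are dense.\<close>

lemma L2_separable: "\<exists>D :: (real^'n::finite) L2 set. countable D \<and> closure D = UNIV"
proof -
  define I where "I = (UNIV :: (rat \<times> rat) set) \<times> (rational_boxes_vec :: (real^'n) set set)"
  define T where "T p = (case p of ((a, b), B) \<Rightarrow> scaleC (Complex (of_rat a) (of_rat b)) (abs_L2 (indicator B)))"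
    for p :: "(rat \<times> rat) \<times> (real^'n) set"
  define D where "D = (\<lambda>l. \<Sum>p\<leftarrow>l. T p) ` lists I"
  have cD: "countable D"
    unfolding D_def I_def by (intro countable_image countable_lists countable_SIGMA countable_rational_boxes) simp_all
  have add: "u + v \<in> D" if uv: "u \<in> D" "v \<in> D" for u v
  proof -
    obtain k l where "k \<in> lists I" "l \<in> lists I" "u = (\<Sum>p\<leftarrow>k. T p)" "v = (\<Sum>p\<leftarrow>l. T p)"
      using uv by (auto simp: D_def)
    then show ?thesis unfolding D_def by (intro image_eqI[of _ _ "k @ l"]) auto
  qed
  have scale: "scaleC (Complex (of_rat a) (of_rat b)) u \<in> D" if u: "u \<in> D" for a b u
  proof -
    obtain l where l: "l \<in> lists I" "u = (\<Sum>p\<leftarrow>l. T p)" using u by (auto simp: D_def)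
    define f where "f = (\<lambda>((a', b'), B :: (real^'n) set). ((a * a' - b * b', a * b' + b * a'), B))"
    have T: "scaleC (Complex (of_rat a) (of_rat b)) (T p) = T (f p)" for p
      by (auto simp: T_def f_def scaleC_simps of_rat_mult of_rat_add of_rat_diff complex_eq_iff split: prod.splits
          intro!: arg_cong2[where f=scaleC])
    have "scaleC (Complex (of_rat a) (of_rat b)) (\<Sum>p\<leftarrow>k. T p) = (\<Sum>p\<leftarrow>map f k. T p)" for k
      by (induction k) (auto simp: scaleC_simps T)
    moreover have "map f l \<in> lists I" using l(1) by (auto simp: I_def f_def)
    ultimately show ?thesis unfolding D_def l(2) by blast
  qed
  have "closure D = UNIV"
  proof (rule closed_subspace_eq_UNIV)
    show "u + v \<in> closure D" if "u \<in> closure D" "v \<in> closure D" for u v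
      by (rule closure_add[OF add that])
    show "scaleC c u \<in> closure D" if "u \<in> closure D" for c u
    proof (rule closure_scaleC[OF _ that])
      fix u assume u: "u \<in> D"
      have "\<exists>q::nat \<Rightarrow> rat. (\<lambda>n. real_of_rat (q n)) \<longlonglongrightarrow> x" for x :: real
      proof -
        have "\<exists>q. x < real_of_rat q \<and> real_of_rat q < x + inverse (real (Suc n))" for n
          by (rule of_rat_dense) simp
        then obtain q where q: "\<And>n. x < real_of_rat (q n)" "\<And>n. real_of_rat (q n) < x + inverse (real (Suc n))" by metis
        show ?thesis
          by (rule exI[of _ q], rule tendsto_sandwich[OF _ _ tendsto_const LIMSEQ_inverse_real_of_nat_add])
            (intro always_eventually allI less_imp_le q)+
      qed
      then obtain p q where "(\<lambda>n. real_of_rat (p n)) \<longlonglongrightarrow> Re c" "(\<lambda>n. real_of_rat (q n)) \<longlonglongrightarrow> Im c" by metis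
      then have c: "(\<lambda>n. Complex (of_rat (p n)) (of_rat (q n))) \<longlonglongrightarrow> c"
        using tendsto_Complex by fastforce
      have "(\<lambda>n. norm (scaleC (Complex (of_rat (p n)) (of_rat (q n))) u - scaleC c u)) \<longlonglongrightarrow> 0"
      proof -
        have "(\<lambda>n. cmod (Complex (of_rat (p n)) (of_rat (q n)) - c) * norm u) \<longlonglongrightarrow> cmod (c - c) * norm u"
          by (intro tendsto_intros c)
        then show ?thesis by (simp flip: scaleC_diff_left norm_scaleC)
      qed
      then have "(\<lambda>n. scaleC (Complex (of_rat (p n)) (of_rat (q n))) u) \<longlonglongrightarrow> scaleC c u"
        by (simp add: tendsto_norm_zero_iff LIM_zero_iff)
      then show "scaleC c u \<in> closure D"
        unfolding closure_sequential using scale[OF u]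
        by (intro exI[of _ "\<lambda>n. scaleC (Complex (of_rat (p n)) (of_rat (q n))) u"]) auto
    qed
    have "0 \<in> D" unfolding D_def by (intro image_eqI[of _ _ "[]"]) auto
    then show "0 \<in> closure D" by (rule subsetD[OF closure_subset])
    fix g :: "(real^'n) L2" assume g: "\<And>s. s \<in> closure D \<Longrightarrow> cinner s g = 0"
    show "g = 0"
    proof (rule L2_zero_if_orthogonal_boxes)
      fix B :: "(real^'n) set" assume B: "B \<in> rational_boxes_vec"
      have "T ((1, 0), B) = abs_L2 (indicator B)"
        using scaleC_simps(4)[of "abs_L2 (indicator B)"] by (simp add: T_def one_complex.code flip: one_complex.code)
      then have "abs_L2 (indicator B) \<in> D" unfolding D_def
        using B by (intro image_eqI[of _ _ "[((1, 0), B)]"]) (auto simp: I_def)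
      then show "cinner (abs_L2 (indicator B)) g = 0" using g closure_subset by blast
    qed
  qed simp
  then show ?thesis using cD by blast
qed

lemma countable_dense_subset:
  fixes S D :: "'b::metric_space set"
  assumes D: "countable D" "closure D = UNIV"
  shows "\<exists>C\<subseteq>S. countable C \<and> S \<subseteq> closure C"
proof -
  define I where "I = {(d, n::nat). d \<in> D \<and> (\<exists>s\<in>S. dist d s < inverse (real (Suc n)))}"
  define c where "c p = (case p of (d, n) \<Rightarrow> SOME s. s \<in> S \<and> dist d s < inverse (real (Suc n)))" for p
  have c: "c (d, n) \<in> S \<and> dist d (c (d, n)) < inverse (real (Suc n))" if "(d, n) \<in> I" for d n
    using that unfolding I_def c_def by (auto intro: someI2_ex)
  have "countable (D \<times> (UNIV::nat set))" using D(1) by simp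
  then have "countable I" by (rule countable_subset[rotated]) (auto simp: I_def)
  moreover have "c ` I \<subseteq> S" using c by auto
  moreover have "S \<subseteq> closure (c ` I)"
  proof
    fix s assume s: "s \<in> S"
    show "s \<in> closure (c ` I)"
      unfolding closure_approachable
    proof (intro allI impI)
      fix e :: real assume "0 < e"
      then obtain n where n: "inverse (real (Suc n)) < e / 2" using reals_Archimedean[of "e/2"] by auto
      have "s \<in> closure D" using D(2) by simp
      then obtain d where d: "d \<in> D" "dist d s < inverse (real (Suc n))"
        unfolding closure_approachable by (metis inverse_positive_iff_positive of_nat_0_less_iff zero_less_Suc)
      have I: "(d, n) \<in> I" using d s by (auto simp: I_def)
      have "dist (c (d, n)) s \<le> dist d (c (d, n)) + dist d s"
        by (rule dist_triangle3)
      then have "dist (c (d, n)) s < e" using c[OF I] d(2) n by linarith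
      then show "\<exists>y\<in>c ` I. dist y s < e" using I by blast
    qed
  qed
  ultimately show ?thesis by (intro exI[of _ "c ` I"]) simp
qed

lemma conv_cong_AE:
  assumes "AE y in lborel. u y = u' y" and [measurable]: "u \<in> borel_measurable borel" "u' \<in> borel_measurable borel"
    "\<phi> \<in> borel_measurable borel"
  shows "conv u \<phi> x = conv u' \<phi> x"
  unfolding conv_def by (rule integral_cong_AE) (use assms in auto)

text \<open>Mollification converges strongly in \<open>L\<^sup>2\<close>: the operators are uniformly bounded and converge
  on indicators of boxes.\<close>

lemma conv_moll_tendsto:
  fixes u :: "real^'n::finite \<Rightarrow> complex"
  assumes \<rho>: "mollifier \<rho>" and u: "square_integrable u"
  shows "(\<lambda>n. abs_L2 (conv u (moll \<rho> n))) \<longlonglongrightarrow> abs_L2 u"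
proof -
  define J where "J n f = abs_L2 (conv (rep_L2 f) (moll \<rho> n))" for n and f :: "(real^'n) L2"
  define K where "K = (LINT x|lborel. \<bar>\<rho> x\<bar>)"
  have K0: "0 \<le> K" by (simp add: K_def)
  have mm[measurable]: "moll \<rho> n \<in> borel_measurable borel" for n using moll(1)[OF \<rho>] by measurable
  have J: "J n (abs_L2 v) = abs_L2 (conv v (moll \<rho> n))" if v: "square_integrable v" for n v
  proof -
    have "AE x in lborel. rep_L2 (abs_L2 v) x = v x"
      using abs_L2_eq_iff[OF square_integrable_rep_L2 v] abs_rep_L2 by blast
    then have "conv (rep_L2 (abs_L2 v)) (moll \<rho> n) = conv v (moll \<rho> n)"
      using v square_integrable_rep_L2 unfolding square_integrable_def
      by (intro ext conv_cong_AE mm) auto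
    then show ?thesis by (simp add: J_def)
  qed
  have Jn: "norm (J n f) \<le> K * norm f" for n f
    using conv_square_integrable(2)[OF square_integrable_rep_L2 moll(1)[OF \<rho>], of f n] moll(4)[OF \<rho>, of n]
    by (simp add: J_def abs_rep_L2 K_def)
  have Jadd: "J n (f + g) = J n f + J n g" for n f g
  proof -
    obtain f' g' where fg: "square_integrable f'" "f = abs_L2 f'" "square_integrable g'" "g = abs_L2 g'"
      using L2_obtain_function by metis
    have "conv (\<lambda>x. f' x + g' x) (moll \<rho> n) x = conv f' (moll \<rho> n) x + conv g' (moll \<rho> n) x" for x
      unfolding conv_def
      by (simp add: scaleR_add_right conv_integrable square_integrable_loc_integrable fg moll(1)[OF \<rho>])
    then have "conv (\<lambda>x. f' x + g' x) (moll \<rho> n) = (\<lambda>x. conv f' (moll \<rho> n) x + conv g' (moll \<rho> n) x)" ..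
    then show ?thesis
      by (simp add: fg(2,4) J fg(1,3) square_integrable_add flip: abs_L2_add)
        (simp add: abs_L2_add fg conv_square_integrable(1) moll(1)[OF \<rho>])
  qed
  have JC: "J n (scaleC c f) = scaleC c (J n f)" for n f c
  proof -
    obtain f' where f: "square_integrable f'" "f = abs_L2 f'" using L2_obtain_function by metis
    have "conv (\<lambda>x. c * f' x) (moll \<rho> n) x = c * conv f' (moll \<rho> n) x" for x
      unfolding conv_def by (simp flip: mult_scaleR_right)
    then have "conv (\<lambda>x. c * f' x) (moll \<rho> n) = (\<lambda>x. c * conv f' (moll \<rho> n) x)" ..
    then show ?thesis
      by (simp add: f(2) J f(1) square_integrable_mult flip: abs_L2_scaleC)
        (simp add: abs_L2_scaleC f conv_square_integrable(1) moll(1)[OF \<rho>])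
  qed
  have Jdiff: "J n (f - g) = J n f - J n g" for n f g
    using Jadd[of n "f - g" g] by simp
  define S where "S = {f. (\<lambda>n. J n f) \<longlonglongrightarrow> f}"
  have "S = UNIV"
  proof (rule closed_subspace_eq_UNIV)
    show "0 \<in> S" using Jdiff[of _ 0 0] by (simp add: S_def)
    show "f + g \<in> S" if "f \<in> S" "g \<in> S" for f g
      using that by (auto simp: S_def Jadd intro: tendsto_add)
    show "scaleC c f \<in> S" if "f \<in> S" for c f
      using that by (auto simp: S_def JC intro: tendsto_intros)
    show "closed S"
      unfolding closed_sequential_limits
    proof (intro allI impI, elim conjE)
      fix F f assume F: "\<forall>k. F k \<in> S" and Ff: "F \<longlonglongrightarrow> f"
      have "(\<lambda>n. J n f) \<longlonglongrightarrow> f"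
        unfolding LIMSEQ_iff
      proof (intro allI impI)
        fix e :: real assume e: "0 < e"
        define d where "d = e / 2 / (K + 2)"
        have d: "0 < d" using e K0 by (simp add: d_def)
        obtain k where k: "norm (F k - f) < d" using Ff d unfolding LIMSEQ_iff by blast
        have "(\<lambda>n. J n (F k)) \<longlonglongrightarrow> F k" using F by (simp add: S_def)
        then obtain N where N: "\<And>n. n \<ge> N \<Longrightarrow> norm (J n (F k) - F k) < d" using d unfolding LIMSEQ_iff by blast
        have "norm (J n f - f) < e" if n: "n \<ge> N" for n
        proof -
          have "J n f - f = J n (f - F k) + (J n (F k) - F k) + (F k - f)" by (simp add: Jdiff)
          then have "norm (J n f - f) \<le> norm (J n (f - F k)) + norm (J n (F k) - F k) + norm (F k - f)"
            by (metis norm_triangle_le norm_triangle_ineq add_mono_thms_linordered_semiring(3))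
          also have "\<dots> \<le> K * d + d + d"
            using Jn[of n "f - F k"] mult_left_mono[OF less_imp_le[OF k] K0] N[OF n] k
            by (simp add: norm_minus_commute)
          also have "\<dots> < e"
          proof -
            have "K * d + d + d = (K + 2) * d" by (simp add: algebra_simps)
            also have "\<dots> = e / 2"
            proof -
              have "K + 2 \<noteq> 0" using K0 by linarith
              then show ?thesis unfolding d_def by (metis nonzero_mult_div_cancel_left times_divide_eq_right)
            qed
            finally show ?thesis using e by simp
          qed
          finally show ?thesis .
        qed
        then show "\<exists>N. \<forall>n\<ge>N. norm (J n f - f) < e" by blast
      qed
      then show "f \<in> S" by (simp add: S_def)
    qed
    fix g :: "(real^'n) L2" assume g: "\<And>s. s \<in> S \<Longrightarrow> cinner s g = 0"
    show "g = 0"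
    proof (rule L2_zero_if_orthogonal_boxes)
      fix B :: "(real^'n) set" assume B: "B \<in> rational_boxes_vec"
      have "abs_L2 (indicator B) \<in> S"
        using conv_moll_box_tendsto(1)[OF \<rho> B] J[OF square_integrable_indicator_box[OF B]] by (simp add: S_def)
      then show "cinner (abs_L2 (indicator B)) g = 0" by (rule g)
    qed
  qed
  then have "abs_L2 u \<in> S" by simp
  then show ?thesis using J[OF u] by (simp add: S_def)
qed

section \<open>Multiplication and translation operators\<close>

definition mult_L2 :: "('a::euclidean_space \<Rightarrow> real) \<Rightarrow> 'a L2 \<Rightarrow> 'a L2" where
  "mult_L2 W f = abs_L2 (\<lambda>x. of_real (W x) * rep_L2 f x)"

lemma square_integrable_bounded_mult:
  assumes f: "square_integrable f" and [measurable]: "W \<in> borel_measurable borel" and B: "\<And>x. \<bar>W x\<bar> \<le> B"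
  shows "square_integrable (\<lambda>x. complex_of_real (W x) * f x)"
    and "norm (abs_L2 (\<lambda>x. complex_of_real (W x) * f x)) \<le> B * norm (abs_L2 f)"
proof -
  have [measurable]: "f \<in> borel_measurable borel" using f by (simp add: square_integrable_def)
  have B0: "0 \<le> B" using B[of 0] by linarith
  have le: "(cmod (complex_of_real (W x) * f x))\<^sup>2 \<le> B\<^sup>2 * (cmod (f x))\<^sup>2" for x
    using power_mono[OF mult_right_mono[OF B norm_ge_zero[of "f x"]], of x 2]
    by (simp add: norm_mult power_mult_distrib)
  have i: "integrable lborel (\<lambda>x. B\<^sup>2 * (cmod (f x))\<^sup>2)" using f by (simp add: square_integrable_def)
  show s: "square_integrable (\<lambda>x. complex_of_real (W x) * f x)"
    unfolding square_integrable_def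
  proof
    show "integrable lborel (\<lambda>x. (cmod (complex_of_real (W x) * f x))\<^sup>2)"
      by (rule Bochner_Integration.integrable_bound[OF i]) (use le in \<open>auto simp: abs_mult\<close>)
  qed measurable
  have "(norm (abs_L2 (\<lambda>x. complex_of_real (W x) * f x)))\<^sup>2 \<le> (LINT x|lborel. B\<^sup>2 * (cmod (f x))\<^sup>2)"
    unfolding norm_abs_L2_sq[OF s] using s by (intro integral_mono i le) (simp add: square_integrable_def)
  also have "\<dots> = (B * norm (abs_L2 f))\<^sup>2" by (simp add: norm_abs_L2_sq[OF f] power_mult_distrib)
  finally show "norm (abs_L2 (\<lambda>x. complex_of_real (W x) * f x)) \<le> B * norm (abs_L2 f)"
    by (rule power2_le_imp_le) (simp add: B0)
qed

lemma mult_L2_abs: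
  assumes f: "square_integrable f" and W: "W \<in> borel_measurable borel" "\<And>x. \<bar>W x\<bar> \<le> B"
  shows "mult_L2 W (abs_L2 f) = abs_L2 (\<lambda>x. of_real (W x) * f x)"
proof -
  have "AE x in lborel. rep_L2 (abs_L2 f) x = f x"
    using abs_L2_eq_iff[OF square_integrable_rep_L2 f] abs_rep_L2 by blast
  then show ?thesis unfolding mult_L2_def
    by (subst abs_L2_eq_iff) (auto intro!: square_integrable_bounded_mult[OF _ W] square_integrable_rep_L2 f)
qed

lemma norm_mult_L2:
  assumes W: "W \<in> borel_measurable borel" "\<And>x. \<bar>W x\<bar> \<le> B"
  shows "norm (mult_L2 W f) \<le> B * norm f"
  using square_integrable_bounded_mult(2)[OF square_integrable_rep_L2 W, of f]
  by (simp add: mult_L2_def abs_rep_L2)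

lemma mult_L2_diff:
  assumes W: "W \<in> borel_measurable borel" "\<And>x. \<bar>W x\<bar> \<le> B"
  shows "mult_L2 W (f - g) = mult_L2 W f - mult_L2 W g"
proof -
  obtain f' g' where fg: "square_integrable f'" "f = abs_L2 f'" "square_integrable g'" "g = abs_L2 g'"
    using L2_obtain_function by metis
  have "mult_L2 W (f - g) = mult_L2 W (abs_L2 (\<lambda>x. f' x - g' x))" by (simp add: fg abs_L2_diff)
  also have "\<dots> = abs_L2 (\<lambda>x. of_real (W x) * f' x - of_real (W x) * g' x)"
    by (subst mult_L2_abs[OF _ W]) (auto simp: fg square_integrable_minus right_diff_distrib)
  also have "\<dots> = mult_L2 W f - mult_L2 W g"
    by (subst abs_L2_diff) (auto simp: fg mult_L2_abs[OF _ W] intro!: square_integrable_bounded_mult[OF _ W])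
  finally show ?thesis .
qed

lemma cinner_mult_L2:
  assumes W: "W \<in> borel_measurable borel" "\<And>x. \<bar>W x\<bar> \<le> B"
  shows "cinner (mult_L2 W f) g = cinner f (mult_L2 W g)"
proof -
  obtain f' g' where fg: "square_integrable f'" "f = abs_L2 f'" "square_integrable g'" "g = abs_L2 g'"
    using L2_obtain_function by metis
  show ?thesis
    by (simp add: fg mult_L2_abs[OF _ W] cinner_abs square_integrable_bounded_mult[OF _ W]) (simp add: mult_ac)
qed

definition translate_L2 :: "'a \<Rightarrow> 'a::euclidean_space L2 \<Rightarrow> 'a L2" where
  "translate_L2 c f = abs_L2 (\<lambda>x. rep_L2 f (x - c))"

lemma square_integrable_translate:
  assumes f: "square_integrable f" shows "square_integrable (\<lambda>x. f (x - c))"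
proof -
  have [measurable]: "f \<in> borel_measurable borel" using f by (simp add: square_integrable_def)
  show ?thesis
    using f lborel_integral_affine(2)[of "\<lambda>x. (cmod (f x))\<^sup>2" 1 "-c"] by (simp add: square_integrable_def)
qed

lemma translate_L2_abs:
  assumes f: "square_integrable f"
  shows "translate_L2 c (abs_L2 f) = abs_L2 (\<lambda>x. f (x - c))"
proof -
  have [measurable]: "f \<in> borel_measurable borel" "rep_L2 (abs_L2 f) \<in> borel_measurable borel"
    using f square_integrable_rep_L2[of "abs_L2 f"] by (auto simp: square_integrable_def)
  have "AE x in lborel. rep_L2 (abs_L2 f) x = f x"
    using abs_L2_eq_iff[OF square_integrable_rep_L2 f] abs_rep_L2 by blast
  then have "AE x in distr lborel borel ((+) (- c)). rep_L2 (abs_L2 f) x = f x"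
    unfolding lborel_distr_plus .
  then have "AE x in lborel. rep_L2 (abs_L2 f) (x - c) = f (x - c)"
    by (subst (asm) AE_distr_iff) auto
  then show ?thesis unfolding translate_L2_def
    by (subst abs_L2_eq_iff) (auto intro!: square_integrable_translate square_integrable_rep_L2 f)
qed

lemma norm_translate_L2: "norm (translate_L2 c f) = norm f"
proof -
  obtain f' where f: "square_integrable f'" "f = abs_L2 f'" using L2_obtain_function by metis
  have [measurable]: "f' \<in> borel_measurable borel" using f by (simp add: square_integrable_def)
  have "(norm (translate_L2 c f))\<^sup>2 = (norm f)\<^sup>2"
    using lborel_integral_translate[of "\<lambda>x. (cmod (f' x))\<^sup>2" "-c"]
    by (simp add: f(2) translate_L2_abs f(1) norm_abs_L2_sq square_integrable_translate)
  then show ?thesis by (simp add: power2_eq_iff_nonneg)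
qed

section \<open>Schroedinger operators on test functions\<close>

lemma test_sum:
  fixes f :: "'i \<Rightarrow> real^'n::finite \<Rightarrow> 'b::real_normed_vector"
  assumes "finite A" "\<And>i. i \<in> A \<Longrightarrow> test_function (f i)"
  shows "test_function (\<lambda>x. \<Sum>i\<in>A. f i x)"
  using assms by (induction A rule: finite_induct) (auto intro: test_zero test_add)

lemma test_laplacian: "test_function f \<Longrightarrow> test_function (laplacian f)"
proof -
  assume f: "test_function f"
  have "laplacian f = (\<lambda>x. \<Sum>i\<in>UNIV. pd i (pd i f) x)" by (simp add: laplacian_def fun_eq_iff)
  then show ?thesis by (simp add: test_sum test_pd f)
qed

lemma laplacian_pds: "laplacian f x = (\<Sum>i\<in>UNIV. pds [i, i] f x)"
  by (simp add: laplacian_def)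

lemma laplacian_add:
  fixes f g :: "real^'n::finite \<Rightarrow> 'b::real_normed_vector"
  assumes "smooth_on UNIV f" "smooth_on UNIV g"
  shows "laplacian (\<lambda>x. f x + g x) x = laplacian f x + laplacian g x"
  unfolding laplacian_pds pds_add[OF assms] by (simp add: sum.distrib)

lemma laplacian_bounded_linear:
  fixes f :: "real^'n::finite \<Rightarrow> 'b::real_normed_vector"
  assumes "bounded_linear L" "smooth_on UNIV f"
  shows "laplacian (\<lambda>x. L (f x)) x = L (laplacian f x)"
  unfolding laplacian_pds pds_bounded_linear[OF assms]
  by (simp add: bounded_linear.linear[OF assms(1)] linear_sum)

lemma laplacian_affine:
  fixes f :: "real^'n::finite \<Rightarrow> 'b::real_normed_vector"
  assumes "smooth_on UNIV f"
  shows "laplacian (\<lambda>x. f (c + a *\<^sub>R x)) x = a\<^sup>2 *\<^sub>R laplacian f (c + a *\<^sub>R x)"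
  unfolding laplacian_pds pds_affine[OF assms] by (simp add: scaleR_sum_right power2_eq_square)

lemma laplacian_cmult:
  fixes f :: "real^'n::finite \<Rightarrow> complex"
  shows "smooth_on UNIV f \<Longrightarrow> laplacian (\<lambda>x. c * f x) x = c * laplacian f x"
  by (rule laplacian_bounded_linear[OF bounded_linear_mult_right])

definition schro :: "(real^'n::finite \<Rightarrow> real) \<Rightarrow> (real^'n \<Rightarrow> complex) \<Rightarrow> real^'n \<Rightarrow> complex" where
  "schro V \<phi> x = - laplacian \<phi> x + of_real (V x) * \<phi> x"

lemma schrodinger_eq: "schrodinger V = {(abs_L2 \<phi>, abs_L2 (schro V \<phi>)) | \<phi>. test_function \<phi>}"
  by (simp add: schrodinger_def schro_def[abs_def])

lemma square_integrable_continuous_support: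
  fixes f :: "real^'n::finite \<Rightarrow> complex"
  assumes "continuous_on UNIV f" and r: "\<And>x. norm x > r \<Longrightarrow> f x = 0"
  shows "square_integrable f"
proof -
  have "continuous_on UNIV (\<lambda>x. (cmod (f x))\<^sup>2)" by (intro continuous_intros assms)
  then show ?thesis
    using assms integrable_continuous_support[of "\<lambda>x. (cmod (f x))\<^sup>2" r] borel_measurable_continuous_onI[OF assms(1)]
    by (auto simp: square_integrable_def)
qed

lemma test_continuous: "test_function f \<Longrightarrow> continuous_on S f"
  by (rule smooth_continuous[OF test_smooth])

lemma schro_continuous:
  assumes "continuous_on UNIV V" "test_function \<phi>"
  shows "continuous_on UNIV (schro V \<phi>)"
  unfolding schro_def by (intro continuous_intros test_continuous test_laplacian assms)

lemma schro_outside: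
  assumes "\<And>x. norm x > r \<Longrightarrow> \<phi> x = 0" "norm x > r"
  shows "schro V \<phi> x = 0"
  using pds_eq_0_outside[of r \<phi>, OF assms] by (simp add: schro_def laplacian_pds assms del: pds_Cons)

lemma schro_square_integrable:
  assumes "continuous_on UNIV V" "test_function \<phi>"
  shows "square_integrable (schro V \<phi>)"
proof -
  obtain r where "\<And>x. norm x > r \<Longrightarrow> \<phi> x = 0" using test_radius[OF assms(2)] by metis
  then show ?thesis
    using square_integrable_continuous_support[OF schro_continuous[OF assms], of r] schro_outside by blast
qed

lemma schro_add: "test_function \<phi> \<Longrightarrow> test_function \<psi> \<Longrightarrow> schro V (\<lambda>x. \<phi> x + \<psi> x) = (\<lambda>x. schro V \<phi> x + schro V \<psi> x)"
  by (simp add: schro_def fun_eq_iff laplacian_add test_smooth algebra_simps)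

lemma schro_cmult: "test_function \<phi> \<Longrightarrow> schro V (\<lambda>x. c * \<phi> x) = (\<lambda>x. c * schro V \<phi> x)"
  by (simp add: schro_def fun_eq_iff laplacian_cmult test_smooth algebra_simps)

lemma pd_line:
  fixes f :: "real^'n::finite \<Rightarrow> 'b::real_normed_vector"
  assumes "smooth_on UNIV f"
  shows "((\<lambda>t. f (x + t *\<^sub>R axis i 1)) has_vector_derivative pd i f x) (at 0)"
  by (rule has_vector_derivative_pd[OF smooth_differentiable[OF assms]])

lemmas has_vector_derivative_cnj = bounded_linear.has_vector_derivative[OF bounded_linear_cnj]

lemma laplacian_symmetric:
  fixes \<phi> \<psi> :: "real^'n::finite \<Rightarrow> complex"
  assumes \<phi>: "test_function \<phi>" and \<psi>: "test_function \<psi>"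
  shows "(LINT x|lborel. laplacian \<phi> x * cnj (\<psi> x)) = (LINT x|lborel. \<phi> x * cnj (laplacian \<psi> x))"
proof -
  obtain r where r: "\<And>x. norm x > r \<Longrightarrow> \<phi> x = 0" using test_radius[OF \<phi>] by metis
  note s = test_smooth[OF \<phi>] test_smooth[OF \<psi>]
  note c = test_continuous[OF \<phi>] test_continuous[OF \<psi>] smooth_continuous[OF smooth_pd[OF s(1)]]
    smooth_continuous[OF smooth_pd[OF s(2)]] smooth_continuous[OF smooth_pd[OF smooth_pd[OF s(1)]]]
    smooth_continuous[OF smooth_pd[OF smooth_pd[OF s(2)]]]
  have out: "norm x > r \<Longrightarrow> pd i \<phi> x = 0" "norm x > r \<Longrightarrow> pd i (pd i \<phi>) x = 0" for i x
    using pds_eq_0_outside[of r \<phi> _ "[i]", OF r] pds_eq_0_outside[of r \<phi> _ "[i,i]", OF r] by auto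
  have z: "(LINT x|lborel. pd i (pd i \<phi>) x * cnj (\<psi> x) - \<phi> x * cnj (pd i (pd i \<psi>) x)) = 0" for i
  proof (rule integral_derivative_zero[where F="\<lambda>x. pd i \<phi> x * cnj (\<psi> x) - \<phi> x * cnj (pd i \<psi> x)" and r=r and i=i])
    fix x
    note d = pd_line[OF s(1), of x i] pd_line[OF s(2), of x i] pd_line[OF smooth_pd[OF s(1)], of i x i]
      pd_line[OF smooth_pd[OF s(2)], of i x i]
    show "((\<lambda>t. pd i \<phi> (x + t *\<^sub>R axis i 1) * cnj (\<psi> (x + t *\<^sub>R axis i 1)) - \<phi> (x + t *\<^sub>R axis i 1) * cnj (pd i \<psi> (x + t *\<^sub>R axis i 1)))
      has_vector_derivative (pd i (pd i \<phi>) x * cnj (\<psi> x) - \<phi> x * cnj (pd i (pd i \<psi>) x))) (at 0)"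
      using has_vector_derivative_diff[OF has_vector_derivative_mult[OF d(3) has_vector_derivative_cnj[OF d(2)]]
          has_vector_derivative_mult[OF d(1) has_vector_derivative_cnj[OF d(4)]]]
      by (simp add: algebra_simps)
  qed (use r out in \<open>auto intro!: continuous_intros c\<close>)
  have i1: "integrable lborel (\<lambda>x. pd i (pd i \<phi>) x * cnj (\<psi> x))" for i
    by (rule integrable_continuous_support[where r=r]) (use r out in \<open>auto intro!: continuous_intros c\<close>)
  have i2: "integrable lborel (\<lambda>x. \<phi> x * cnj (pd i (pd i \<psi>) x))" for i
    by (rule integrable_continuous_support[where r=r]) (use r out in \<open>auto intro!: continuous_intros c\<close>)
  have "(LINT x|lborel. laplacian \<phi> x * cnj (\<psi> x)) = (\<Sum>i\<in>UNIV. LINT x|lborel. pd i (pd i \<phi>) x * cnj (\<psi> x))"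
    unfolding laplacian_def sum_distrib_right by (rule Bochner_Integration.integral_sum) (rule i1)
  also have "\<dots> = (\<Sum>i\<in>UNIV. LINT x|lborel. \<phi> x * cnj (pd i (pd i \<psi>) x))"
    using z by (intro sum.cong refl) (simp add: Bochner_Integration.integral_diff i1 i2)
  also have "\<dots> = (LINT x|lborel. \<phi> x * cnj (laplacian \<psi> x))"
    unfolding laplacian_def cnj_sum sum_distrib_left by (rule Bochner_Integration.integral_sum[symmetric]) (rule i2)
  finally show ?thesis .
qed

lemma schro_symmetric:
  assumes V: "continuous_on UNIV V" and \<phi>: "test_function \<phi>" and \<psi>: "test_function \<psi>"
  shows "cinner (abs_L2 (schro V \<phi>)) (abs_L2 \<psi>) = cinner (abs_L2 \<phi>) (abs_L2 (schro V \<psi>))"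
proof -
  obtain r where r: "\<And>x. norm x > r \<Longrightarrow> \<phi> x = 0" using test_radius[OF \<phi>] by metis
  have i: "integrable lborel (\<lambda>x. laplacian \<phi> x * cnj (\<psi> x))"
    using square_integrable_prod[OF test_square_integrable[OF test_laplacian[OF \<phi>]] test_square_integrable[OF \<psi>]] .
  have i': "integrable lborel (\<lambda>x. \<phi> x * cnj (laplacian \<psi> x))"
    using square_integrable_prod[OF test_square_integrable[OF \<phi>] test_square_integrable[OF test_laplacian[OF \<psi>]]] .
  have iV: "integrable lborel (\<lambda>x. of_real (V x) * \<phi> x * cnj (\<psi> x))"
    by (rule integrable_continuous_support[where r=r])
      (use r in \<open>auto intro!: continuous_intros V test_continuous[OF \<phi>] test_continuous[OF \<psi>]\<close>)
  have "(LINT x|lborel. schro V \<phi> x * cnj (\<psi> x)) = (LINT x|lborel. of_real (V x) * \<phi> x * cnj (\<psi> x)) - (LINT x|lborel. laplacian \<phi> x * cnj (\<psi> x))"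
    by (subst Bochner_Integration.integral_diff[symmetric, OF iV i]) (simp add: schro_def algebra_simps)
  also have "\<dots> = (LINT x|lborel. of_real (V x) * \<phi> x * cnj (\<psi> x)) - (LINT x|lborel. \<phi> x * cnj (laplacian \<psi> x))"
    by (simp add: laplacian_symmetric[OF \<phi> \<psi>])
  also have "\<dots> = (LINT x|lborel. \<phi> x * cnj (schro V \<psi> x))"
    by (subst Bochner_Integration.integral_diff[symmetric, OF iV i']) (simp add: schro_def algebra_simps)
  finally show ?thesis
    by (simp add: cinner_abs schro_square_integrable V \<phi> \<psi> test_square_integrable)
qed

lemma symmetric_schrodinger: "continuous_on UNIV V \<Longrightarrow> symmetric_op (schrodinger V)"
  by (auto simp: symmetric_op_def schrodinger_eq schro_symmetric)

section \<open>Essential self-adjointness\<close>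

text \<open>The energy identity: integrating the divergence of \<open>\<eta>\<^sup>2 cnj w \<nabla>w\<close> gives \<open>X + P + Y = 0\<close>, where
  \<open>X = \<parallel>\<eta> \<nabla>w\<parallel>\<^sup>2\<close> is real and \<open>Y\<close> is the cross term with \<open>\<nabla>\<eta>\<close>. Hence \<open>Im P\<close> comes from \<open>Y\<close> alone, which is bounded
  by \<open>t X + b / t\<close> for every \<open>t > 0\<close>. Taking \<open>t = 1 / 2\<close> controls \<open>X\<close> by \<open>P\<close> and \<open>b\<close>; taking \<open>t = \<theta>\<close> then gives the
  claim.\<close>

lemma energy_estimate:
  fixes w :: "real^'n::finite \<Rightarrow> complex" and \<eta> :: "real^'n \<Rightarrow> real"
  assumes w: "smooth_on UNIV w" and \<eta>: "test_function \<eta>" and \<theta>: "0 < \<theta>"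
  defines "P \<equiv> (LINT x|lborel. of_real ((\<eta> x)\<^sup>2) * (cnj (w x) * laplacian w x))"
    and "b \<equiv> (LINT x|lborel. (\<Sum>i\<in>UNIV. (pd i \<eta> x)\<^sup>2) * (cmod (w x))\<^sup>2)"
  shows "\<bar>Im P\<bar> \<le> \<theta> * (2 * cmod P + 4 * b) + b / \<theta>"
proof -
  obtain r where r: "\<And>x. norm x > r \<Longrightarrow> \<eta> x = 0" using test_radius[OF \<eta>] by metis
  have r': "norm x > r \<Longrightarrow> pd i \<eta> x = 0" for i x using pds_eq_0_outside[of r \<eta> _ "[i]", OF r] by simp
  note s = test_smooth[OF \<eta>]
  note c = smooth_continuous[OF w] smooth_continuous[OF s] smooth_continuous[OF smooth_pd[OF w]]
    smooth_continuous[OF smooth_pd[OF s]] smooth_continuous[OF smooth_pd[OF smooth_pd[OF w]]]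
  let ?X = "\<lambda>i x. (\<eta> x)\<^sup>2 * (cmod (pd i w x))\<^sup>2"
  let ?Y = "\<lambda>i x. of_real (2 * \<eta> x * pd i \<eta> x) * (cnj (w x) * pd i w x)"
  let ?Z = "\<lambda>i x. of_real ((\<eta> x)\<^sup>2) * (cnj (w x) * pd i (pd i w) x)"
  let ?B = "\<lambda>i x. (pd i \<eta> x)\<^sup>2 * (cmod (w x))\<^sup>2"
  have iX: "integrable lborel (?X i)" for i
    by (rule integrable_continuous_support[where r=r]) (use r in \<open>auto intro!: continuous_intros c\<close>)
  have iXc: "integrable lborel (\<lambda>x. complex_of_real (?X i x))" for i
    by (intro integrable_of_real iX)
  have iY: "integrable lborel (?Y i)" for i
    by (rule integrable_continuous_support[where r=r]) (use r in \<open>auto intro!: continuous_intros c\<close>)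
  have iZ: "integrable lborel (?Z i)" for i
    by (rule integrable_continuous_support[where r=r]) (use r in \<open>auto intro!: continuous_intros c\<close>)
  have iB: "integrable lborel (?B i)" for i
    by (rule integrable_continuous_support[where r=r]) (use r r' in \<open>auto intro!: continuous_intros c\<close>)
  have z: "of_real (LINT x|lborel. ?X i x) + (LINT x|lborel. ?Z i x) + (LINT x|lborel. ?Y i x) = 0" for i
  proof -
    have "(LINT x|lborel. of_real (?X i x) + ?Z i x + ?Y i x) = 0"
    proof (rule integral_derivative_zero[where F="\<lambda>x. of_real ((\<eta> x)\<^sup>2) * (cnj (w x) * pd i w x)" and r=r and i=i])
      fix x
      note d = pd_line[OF s, of x i] pd_line[OF w, of x i] pd_line[OF smooth_pd[OF w], of i x i]
      have e: "((\<lambda>t. of_real ((\<eta> (x + t *\<^sub>R axis i 1))\<^sup>2)) has_vector_derivative complex_of_real (2 * \<eta> x * pd i \<eta> x)) (at 0)"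
        using bounded_linear.has_vector_derivative[OF bounded_linear_of_real[where 'a=complex] has_vector_derivative_mult[OF d(1) d(1)]]
        by (simp add: power2_eq_square mult_ac)
      have eq: "complex_of_real (?X i x) = of_real ((\<eta> x)\<^sup>2) * (pd i w x * cnj (pd i w x))"
        by (simp only: of_real_mult complex_norm_square)
      show "((\<lambda>t. of_real ((\<eta> (x + t *\<^sub>R axis i 1))\<^sup>2) * (cnj (w (x + t *\<^sub>R axis i 1)) * pd i w (x + t *\<^sub>R axis i 1)))
        has_vector_derivative (of_real (?X i x) + ?Z i x + ?Y i x)) (at 0)"
        using has_vector_derivative_mult[OF e has_vector_derivative_mult[OF has_vector_derivative_cnj[OF d(2)] d(3)]]
        unfolding eq by (simp add: algebra_simps)
    qed (use r in \<open>auto intro!: continuous_intros c\<close>)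
    then show ?thesis
      by (simp only: Bochner_Integration.integral_add[OF Bochner_Integration.integrable_add[OF iXc iZ] iY]
          Bochner_Integration.integral_add[OF iXc iZ] integral_complex_of_real)
  qed
  define X where "X = (\<Sum>i\<in>UNIV. LINT x|lborel. ?X i x)"
  define Y where "Y = (\<Sum>i\<in>UNIV. LINT x|lborel. ?Y i x)"
  have P: "P = (\<Sum>i\<in>UNIV. LINT x|lborel. ?Z i x)"
    unfolding P_def laplacian_def sum_distrib_left by (rule Bochner_Integration.integral_sum) (rule iZ)
  have b: "b = (\<Sum>i\<in>UNIV. LINT x|lborel. ?B i x)"
    unfolding b_def sum_distrib_right by (rule Bochner_Integration.integral_sum) (rule iB)
  have XPY: "of_real X + P + Y = 0"
    using z by (simp add: X_def P Y_def flip: sum.distrib)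
  have X0: "0 \<le> X" unfolding X_def by (intro sum_nonneg Bochner_Integration.integral_nonneg) simp
  have b0: "0 \<le> b" unfolding b by (intro sum_nonneg Bochner_Integration.integral_nonneg) simp
  have Y: "cmod Y \<le> t * X + b / t" if t: "0 < t" for t
  proof -
    have pt: "cmod (?Y i x) \<le> t * ?X i x + ?B i x / t" for i x
    proof -
      define p where "p = \<bar>\<eta> x\<bar> * cmod (pd i w x)"
      define q where "q = \<bar>pd i \<eta> x\<bar> * cmod (w x)"
      have "0 \<le> (t * p - q)\<^sup>2 / t" using t by simp
      also have "(t * p - q)\<^sup>2 / t = t * p\<^sup>2 + q\<^sup>2 / t - 2 * p * q"
        using t by (simp add: field_simps power2_eq_square)
      finally have "2 * p * q \<le> t * p\<^sup>2 + q\<^sup>2 / t" by simp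
      then show ?thesis by (simp add: p_def q_def norm_mult abs_mult power_mult_distrib mult_ac)
    qed
    have "cmod Y \<le> (\<Sum>i\<in>UNIV. cmod (LINT x|lborel. ?Y i x))" unfolding Y_def by (rule norm_sum)
    also have "\<dots> \<le> (\<Sum>i\<in>UNIV. LINT x|lborel. cmod (?Y i x))" by (intro sum_mono integral_norm_bound)
    also have "\<dots> \<le> (\<Sum>i\<in>UNIV. LINT x|lborel. t * ?X i x + ?B i x / t)"
      by (intro sum_mono integral_mono integrable_norm iY Bochner_Integration.integrable_add integrable_mult_right
          integrable_divide iX iB pt)
    also have "\<dots> = (\<Sum>i\<in>UNIV. t * (LINT x|lborel. ?X i x) + (LINT x|lborel. ?B i x) / t)"
      using iX iB by (intro sum.cong refl) (simp add: Bochner_Integration.integral_add)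
    also have "\<dots> = t * X + b / t"
      by (simp add: X_def b sum.distrib sum_distrib_left sum_divide_distrib)
    finally show ?thesis .
  qed
  have "X = - Re P - Re Y" using XPY by (auto simp: complex_eq_iff)
  also have "\<dots> \<le> cmod P + cmod Y"
    using abs_Re_le_cmod[of P] abs_Re_le_cmod[of Y] by linarith
  also have "cmod Y \<le> X / 2 + 2 * b" using Y[of "1/2"] by simp
  finally have X: "X \<le> 2 * cmod P + 4 * b" by linarith
  have "\<bar>Im P\<bar> = \<bar>Im Y\<bar>" using XPY by (auto simp: complex_eq_iff)
  also have "\<dots> \<le> cmod Y" by (rule abs_Im_le_cmod)
  also have "\<dots> \<le> \<theta> * X + b / \<theta>" by (rule Y[OF \<theta>])
  also have "\<dots> \<le> \<theta> * (2 * cmod P + 4 * b) + b / \<theta>" using X \<theta> by simp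
  finally show ?thesis .
qed

text \<open>On suitable balls of arbitrarily large radius, the potential is small compared with the square of the
  radius. A cutoff at radius \<open>R\<close> costs a factor \<open>1 / R\<^sup>2\<close> in the energy estimate and the potential enters it
  with its supremum; the proof of essential self-adjointness needs the product of the two to be small.\<close>

definition subquadratic_growth :: "(real^'n::finite \<Rightarrow> real) \<Rightarrow> bool" where
  "subquadratic_growth V \<longleftrightarrow> (\<forall>s\<ge>1. \<forall>R0. \<exists>R\<ge>R0. \<forall>x. norm x \<le> 4 * R \<longrightarrow> \<bar>V x\<bar> \<le> R\<^sup>2 / s\<^sup>2)"

lemma cutoff_exists:
  assumes \<rho>: "mollifier (\<rho> :: real^'n::finite \<Rightarrow> real)"
  obtains \<eta> :: "real^'n \<Rightarrow> real" where "test_function \<eta>" "\<And>x. norm x \<le> 1 \<Longrightarrow> \<eta> x = 1" "\<And>x. norm x > 3 \<Longrightarrow> \<eta> x = 0"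
proof -
  let ?u = "indicator (cball 0 2) :: real^'n \<Rightarrow> real"
  have l: "loc_integrable ?u"
    unfolding loc_integrable_def
  proof (intro conjI allI)
    fix R
    have "(\<lambda>y. indicator (cball 0 R) y *\<^sub>R ?u y) = indicator (cball 0 R \<inter> cball 0 2)" by (auto simp: indicator_def)
    moreover have "emeasure lborel (cball (0::real^'n) R \<inter> cball 0 2) < \<infinity>"
      using emeasure_mono[of "cball (0::real^'n) R \<inter> cball 0 2" "cball 0 2" lborel] emeasure_lborel_cball_finite[of "0::real^'n" 2]
      by (auto simp: le_less_trans)
    ultimately show "integrable lborel (\<lambda>y. indicator (cball 0 R) y *\<^sub>R ?u y)" by simp
  qed (intro borel_measurable_indicator borel_closed closed_cball)
  note m = mollifier_rescale[OF \<rho>, of 1]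
  show ?thesis
  proof (rule that)
    show "test_function (conv ?u (rescale 1 \<rho>))"
      by (rule test_conv[OF l m(1), of 2]) (auto simp: indicator_def)
    show "conv ?u (rescale 1 \<rho>) x = 1" if "norm x \<le> 1" for x
    proof (rule conv_moll_const[OF \<rho>])
      fix y assume "dist x y \<le> 1"
      then have "norm y \<le> 2" using that norm_triangle_ineq4[of x "x - y"] by (simp add: dist_norm)
      then show "?u y = 1" by simp
    qed simp
    show "conv ?u (rescale 1 \<rho>) x = 0" if "norm x > 3" for x
      by (rule conv_eq_0_outside[of 2 _ 1]) (use that m(2) in \<open>auto simp: indicator_def\<close>)
  qed
qed

lemma tendsto_mult_L2:
  assumes W: "W \<in> borel_measurable borel" "\<And>x. \<bar>W x\<bar> \<le> B" and f: "(f \<longlongrightarrow> a) F"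
  shows "((\<lambda>n. mult_L2 W (f n)) \<longlongrightarrow> mult_L2 W a) F"
proof -
  have "((\<lambda>n. mult_L2 W (f n) - mult_L2 W a) \<longlongrightarrow> 0) F"
  proof (rule Lim_null_comparison)
    show "\<forall>\<^sub>F n in F. norm (mult_L2 W (f n) - mult_L2 W a) \<le> B * norm (f n - a)"
      using norm_mult_L2[OF W] by (simp add: mult_L2_diff[OF W, symmetric])
    have "((\<lambda>n. B * norm (f n - a)) \<longlongrightarrow> B * norm (a - a)) F" by (intro tendsto_intros f)
    then show "((\<lambda>n. B * norm (f n - a)) \<longlongrightarrow> 0) F" by simp
  qed
  then show ?thesis by (simp add: LIM_zero_iff)
qed

lemma laplacian_conv:
  fixes u :: "real^'n::finite \<Rightarrow> complex"
  assumes "loc_integrable u" "test_function \<phi>"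
  shows "laplacian (conv u \<phi>) x = conv u (laplacian \<phi>) x"
proof -
  have "laplacian (conv u \<phi>) x = (\<Sum>i\<in>UNIV. conv u (pds [i, i] \<phi>) x)"
    unfolding laplacian_pds pds_conv[OF assms] ..
  also have "\<dots> = (LINT y|lborel. (\<Sum>i\<in>UNIV. pds [i, i] \<phi> (x - y) *\<^sub>R u y))"
    unfolding conv_def
    by (rule Bochner_Integration.integral_sum[symmetric]) (rule conv_integrable[OF assms(1) test_pds[OF assms(2)]])
  also have "\<dots> = conv u (laplacian \<phi>) x"
    unfolding conv_def laplacian_pds scaleR_sum_left ..
  finally show ?thesis .
qed

text \<open>The weak solution \<open>u\<close> of \<open>-\<Delta>u + V u = z u\<close> has no regularity, so the energy estimate is applied to its
  mollifications \<open>w\<^sub>n\<close>. As \<open>n\<close> grows, \<open>P\<^sub>n\<close> tends to the integral of \<open>\<eta>\<^sup>2 (V - z) \<bar>u\<bar>\<^sup>2\<close>, whose imaginary part is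
  \<open>-Im z D\<close> since \<open>V\<close> is real.\<close>

lemma weak_solution_local_bound:
  fixes u :: "real^'n::finite \<Rightarrow> complex" and \<eta> :: "real^'n \<Rightarrow> real"
  assumes \<rho>: "mollifier (\<rho> :: real^'n \<Rightarrow> real)" and V: "continuous_on UNIV V"
    and u: "square_integrable u"
    and weak: "\<And>\<phi>. test_function \<phi> \<Longrightarrow> (LINT x|lborel. (schro V \<phi> x - z * \<phi> x) * u x) = 0"
    and \<eta>: "test_function \<eta>" "\<And>x. norm x > 3 \<Longrightarrow> \<eta> x = 0"
    and K: "\<And>x. \<bar>\<eta> x\<bar> \<le> K" and B: "\<And>i x. \<bar>pd i \<eta> x\<bar> \<le> B i"
    and R: "1 \<le> R" and Vb: "\<And>x. norm x \<le> 4 * R \<Longrightarrow> \<bar>V x\<bar> \<le> M" and \<theta>: "0 < \<theta>"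
  defines "b \<equiv> (\<Sum>i\<in>UNIV. (B i)\<^sup>2) / R\<^sup>2 * (norm (abs_L2 u))\<^sup>2"
    and "D \<equiv> (LINT x|lborel. (\<eta> ((1 / R) *\<^sub>R x))\<^sup>2 * (cmod (u x))\<^sup>2)"
  shows "\<bar>Im z\<bar> * D \<le> \<theta> * (2 * (K\<^sup>2 * (M + cmod z) * (norm (abs_L2 u))\<^sup>2) + 4 * b) + b / \<theta>"
proof -
  have R0: "0 < R" using R by simp
  define U where "U = (norm (abs_L2 u))\<^sup>2"
  define h where "h x = \<eta> (0 + (1 / R) *\<^sub>R x)" for x
  have h: "test_function h" unfolding h_def using R0 by (intro test_affine \<eta>) simp
  have hm: "h \<in> borel_measurable borel" by (rule test_measurable[OF h])
  have hK: "\<bar>h x\<bar> \<le> K" for x using K by (simp add: h_def)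
  have h0: "h x = 0" if "norm x > 3 * R" for x
    using \<eta>(2)[of "(1 / R) *\<^sub>R x"] that R0 by (simp add: h_def field_simps)
  have pdh: "\<bar>pd i h x\<bar> \<le> B i / R" for i x
  proof -
    have "pds [i] h x = (1 / R) * pd i \<eta> ((1 / R) *\<^sub>R x)"
      unfolding h_def[abs_def] pds_affine[OF test_smooth[OF \<eta>(1)]] by simp
    then show ?thesis using B[of i "(1 / R) *\<^sub>R x"] R0 by (simp add: abs_mult divide_right_mono)
  qed
  (* The cutoff lives in the ball of radius 3 R and the mollifiers have radius at most 1 <= R, so nothing
     changes when V is replaced by its bounded truncation W to the ball of radius 4 R. *)
  define I where "I = (indicator (cball 0 (4 * R)) :: real^'n \<Rightarrow> real)"
  define W where "W x = I x * V x" for x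
  have Im: "I \<in> borel_measurable borel"
    unfolding I_def by (intro borel_measurable_indicator borel_closed closed_cball)
  have Vm: "V \<in> borel_measurable borel" by (rule borel_measurable_continuous_onI[OF V])
  have Wm: "W \<in> borel_measurable borel" unfolding W_def using Im Vm by measurable
  have M0: "0 \<le> M" using Vb[of 0] R0 by simp
  have IB: "\<bar>I x\<bar> \<le> 1" for x by (simp add: I_def indicator_def)
  have WB: "\<bar>W x\<bar> \<le> M" for x using Vb[of x] M0 by (auto simp: W_def I_def indicator_def)
  have hI: "h x * I x = h x" for x using h0[of x] R0 by (cases "norm x \<le> 3 * R") (auto simp: I_def indicator_def)
  note sW = square_integrable_bounded_mult(1)[OF u Wm WB]
  note sI = square_integrable_bounded_mult(1)[OF u Im IB]
  define q where "q x = of_real (W x) * u x - z * (of_real (I x) * u x)" for x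
  have sq: "square_integrable q"
    unfolding q_def by (intro square_integrable_minus square_integrable_mult sW sI)
  have lu: "loc_integrable u" by (rule square_integrable_loc_integrable[OF u])
  define w where "w n = conv u (moll \<rho> n)" for n
  note mt = moll(1)[OF \<rho>]
  have sw: "square_integrable (w n)" for n unfolding w_def by (rule conv_square_integrable(1)[OF u mt])
  have scq: "square_integrable (conv q (moll \<rho> n))" for n by (rule conv_square_integrable(1)[OF sq mt])
  have ws: "smooth_on UNIV (w n)" for n unfolding w_def by (rule smooth_conv[OF lu mt])
  have lap: "laplacian (w n) x = conv q (moll \<rho> n) x" if x: "norm x \<le> 3 * R" for n x
  proof -
    let ?m = "moll \<rho> n"
    let ?\<phi> = "\<lambda>y. complex_of_real (?m (x - y))"
    have t: "test_function ?\<phi>" by (intro test_of_real test_reflect mt)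
    have lm: "laplacian ?\<phi> y = of_real (laplacian ?m (x - y))" for y
    proof -
      have "smooth_on UNIV (\<lambda>y. ?m (x + (-1) *\<^sub>R y))" by (intro smooth_affine test_smooth mt)
      then have "laplacian ?\<phi> y = of_real (laplacian (\<lambda>y. ?m (x + (-1) *\<^sub>R y)) y)"
        using laplacian_bounded_linear[OF bounded_linear_of_real, of "\<lambda>y. ?m (x + (-1) *\<^sub>R y)" y] by simp
      also have "\<dots> = of_real (laplacian ?m (x - y))"
        by (subst laplacian_affine[OF test_smooth[OF mt]]) simp
      finally show ?thesis .
    qed
    have i1: "integrable lborel (\<lambda>y. laplacian ?m (x - y) *\<^sub>R u y)"
      by (rule conv_integrable[OF lu test_laplacian[OF mt]])
    have i2: "integrable lborel (\<lambda>y. ?m (x - y) *\<^sub>R q y)"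
      by (rule conv_integrable[OF square_integrable_loc_integrable[OF sq] mt])
    have pt: "(schro V ?\<phi> y - z * ?\<phi> y) * u y = ?m (x - y) *\<^sub>R q y - laplacian ?m (x - y) *\<^sub>R u y" for y
    proof (cases "norm y \<le> 4 * R")
      case True
      then show ?thesis
        by (simp add: schro_def lm q_def W_def I_def scaleR_conv_of_real algebra_simps)
    next
      case False
      have "inverse (real (Suc n)) \<le> 1" by (simp add: inverse_le_1_iff)
      moreover have "norm y \<le> norm x + norm (x - y)" using norm_triangle_ineq4[of x "x - y"] by simp
      ultimately have "norm (x - y) > inverse (real (Suc n))" using False x R by simp
      then have "?m (x - y) = 0" by (rule moll(2)[OF \<rho>])
      then show ?thesis by (simp add: schro_def lm scaleR_conv_of_real)
    qed
    have "0 = (LINT y|lborel. ?m (x - y) *\<^sub>R q y - laplacian ?m (x - y) *\<^sub>R u y)"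
      using weak[OF t] by (simp only: pt)
    also have "\<dots> = conv q ?m x - conv u (laplacian ?m) x"
      unfolding conv_def by (rule Bochner_Integration.integral_diff[OF i2 i1])
    also have "conv u (laplacian ?m) x = laplacian (w n) x"
      unfolding w_def by (rule laplacian_conv[OF lu mt, symmetric])
    finally show ?thesis by simp
  qed
  define P where "P n = (LINT x|lborel. of_real ((h x)\<^sup>2) * (cnj (w n x) * laplacian (w n) x))" for n
  define b' where "b' n = (LINT x|lborel. (\<Sum>i\<in>UNIV. (pd i h x)\<^sup>2) * (cmod (w n x))\<^sup>2)" for n
  define L where "L = (\<Sum>i\<in>UNIV. (B i)\<^sup>2) / R\<^sup>2"
  have L0: "0 \<le> L" unfolding L_def by (intro divide_nonneg_nonneg sum_nonneg) auto
  have b': "b' n \<le> L * (norm (abs_L2 (w n)))\<^sup>2" for n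
  proof -
    have pt: "(\<Sum>i\<in>UNIV. (pd i h x)\<^sup>2) \<le> L" for x
    proof -
      have "(\<Sum>i\<in>UNIV. (pd i h x)\<^sup>2) \<le> (\<Sum>i\<in>UNIV. (B i / R)\<^sup>2)"
        by (intro sum_mono) (metis abs_le_square_iff abs_of_nonneg abs_ge_zero order_trans pdh)
      also have "\<dots> = L" by (simp add: L_def power_divide sum_divide_distrib)
      finally show ?thesis .
    qed
    have i: "integrable lborel (\<lambda>x. L * (cmod (w n x))\<^sup>2)" using sw[of n] by (simp add: square_integrable_def)
    have "b' n \<le> (LINT x|lborel. L * (cmod (w n x))\<^sup>2)"
      unfolding b'_def
    proof (rule integral_mono[OF _ i])
      show "(\<Sum>i\<in>UNIV. (pd i h x)\<^sup>2) * (cmod (w n x))\<^sup>2 \<le> L * (cmod (w n x))\<^sup>2" for x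
        by (intro mult_right_mono pt) simp
      have hpm: "(\<lambda>x. pd i h x) \<in> borel_measurable borel" for i by (rule test_measurable[OF test_pd[OF h]])
      have wm: "w n \<in> borel_measurable borel" using sw[of n] by (simp add: square_integrable_def)
      show "integrable lborel (\<lambda>x. (\<Sum>i\<in>UNIV. (pd i h x)\<^sup>2) * (cmod (w n x))\<^sup>2)"
      proof (rule Bochner_Integration.integrable_bound[OF i])
        show "(\<lambda>x. (\<Sum>i\<in>UNIV. (pd i h x)\<^sup>2) * (cmod (w n x))\<^sup>2) \<in> borel_measurable lborel"
          using hpm wm by measurable
        show "AE x in lborel. norm ((\<Sum>i\<in>UNIV. (pd i h x)\<^sup>2) * (cmod (w n x))\<^sup>2) \<le> norm (L * (cmod (w n x))\<^sup>2)"
          using pt L0 by (intro AE_I2) (simp add: abs_mult sum_nonneg mult_right_mono)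
      qed
    qed
    then show ?thesis by (simp add: norm_abs_L2_sq[OF sw])
  qed
  have est: "\<bar>Im (P n)\<bar> \<le> \<theta> * (2 * cmod (P n) + 4 * (L * (norm (abs_L2 (w n)))\<^sup>2)) + L * (norm (abs_L2 (w n)))\<^sup>2 / \<theta>" for n
  proof -
    have "\<bar>Im (P n)\<bar> \<le> \<theta> * (2 * cmod (P n) + 4 * b' n) + b' n / \<theta>"
      unfolding P_def b'_def by (rule energy_estimate[OF ws h \<theta>])
    also have "\<dots> \<le> \<theta> * (2 * cmod (P n) + 4 * (L * (norm (abs_L2 (w n)))\<^sup>2)) + L * (norm (abs_L2 (w n)))\<^sup>2 / \<theta>"
      using b'[of n] \<theta> by (intro add_mono mult_left_mono divide_right_mono) auto
    finally show ?thesis .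
  qed
  have P: "P n = cinner (mult_L2 h (abs_L2 (conv q (moll \<rho> n)))) (mult_L2 h (abs_L2 (w n)))" for n
  proof -
    have "of_real ((h x)\<^sup>2) * (cnj (w n x) * laplacian (w n) x) = of_real (h x) * conv q (moll \<rho> n) x * cnj (of_real (h x) * w n x)" for x
      using lap[of x n] h0[of x] by (cases "norm x \<le> 3 * R") (auto simp: power2_eq_square)
    then have "P n = (LINT x|lborel. of_real (h x) * conv q (moll \<rho> n) x * cnj (of_real (h x) * w n x))"
      unfolding P_def by (simp only:)
    then show ?thesis
      by (simp add: mult_L2_abs[OF _ hm hK] scq sw cinner_abs square_integrable_bounded_mult(1)[OF _ hm hK])
  qed
  define Q where "Q = cinner (mult_L2 h (abs_L2 q)) (mult_L2 h (abs_L2 u))"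
  have wlim: "(\<lambda>n. abs_L2 (w n)) \<longlonglongrightarrow> abs_L2 u" unfolding w_def by (rule conv_moll_tendsto[OF \<rho> u])
  have Plim: "P \<longlonglongrightarrow> Q"
    unfolding P Q_def by (intro tendsto_cinner tendsto_mult_L2[OF hm hK] wlim conv_moll_tendsto[OF \<rho> sq])
  have lim: "\<bar>Im Q\<bar> \<le> \<theta> * (2 * cmod Q + 4 * (L * U)) + L * U / \<theta>"
  proof -
    have 1: "(\<lambda>n. \<bar>Im (P n)\<bar>) \<longlonglongrightarrow> \<bar>Im Q\<bar>" by (intro tendsto_intros Plim)
    have 2: "(\<lambda>n. \<theta> * (2 * cmod (P n) + 4 * (L * (norm (abs_L2 (w n)))\<^sup>2)) + L * (norm (abs_L2 (w n)))\<^sup>2 / \<theta>)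
      \<longlonglongrightarrow> \<theta> * (2 * cmod Q + 4 * (L * U)) + L * U / \<theta>"
      unfolding U_def by (intro tendsto_intros Plim wlim) (use \<theta> in simp)
    show ?thesis by (rule LIMSEQ_le[OF 1 2]) (use est in blast)
  qed
  define A where "A = (LINT x|lborel. (h x)\<^sup>2 * W x * (cmod (u x))\<^sup>2)"
  have iu: "integrable lborel (\<lambda>x. (cmod (u x))\<^sup>2)" and um: "u \<in> borel_measurable borel"
    using u by (auto simp: square_integrable_def)
  have h2: "(h x)\<^sup>2 \<le> K\<^sup>2" for x using hK[of x] by (metis abs_ge_zero abs_le_square_iff abs_of_nonneg order_trans)
  have leA: "\<bar>(h x)\<^sup>2 * W x * (cmod (u x))\<^sup>2\<bar> \<le> K\<^sup>2 * M * (cmod (u x))\<^sup>2" for x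
    unfolding abs_mult using h2[of x] WB[of x] by (intro mult_mono) auto
  have iA: "integrable lborel (\<lambda>x. (h x)\<^sup>2 * W x * (cmod (u x))\<^sup>2)"
    by (rule Bochner_Integration.integrable_bound[OF integrable_mult_right[OF iu, of "K\<^sup>2 * M"]])
      (use hm Wm um leA M0 in \<open>auto simp: abs_mult\<close>)
  have leD: "\<bar>(h x)\<^sup>2 * (cmod (u x))\<^sup>2\<bar> \<le> K\<^sup>2 * (cmod (u x))\<^sup>2" for x
    unfolding abs_mult using h2[of x] by (intro mult_mono) auto
  have iD: "integrable lborel (\<lambda>x. (h x)\<^sup>2 * (cmod (u x))\<^sup>2)"
    by (rule Bochner_Integration.integrable_bound[OF integrable_mult_right[OF iu, of "K\<^sup>2"]])
      (use hm um leD in \<open>auto simp: abs_mult\<close>)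
  have D: "D = (LINT x|lborel. (h x)\<^sup>2 * (cmod (u x))\<^sup>2)" by (simp add: D_def h_def)
  have Q: "Q = of_real A - z * of_real D"
  proof -
    have "of_real (h x) * q x * cnj (of_real (h x) * u x) = of_real ((h x)\<^sup>2 * W x * (cmod (u x))\<^sup>2) - z * of_real ((h x)\<^sup>2 * (cmod (u x))\<^sup>2)" for x
    proof -
      have 1: "complex_of_real (h x) * of_real (I x) = of_real (h x)" by (simp flip: of_real_mult add: hI)
      have "of_real (h x) * q x * cnj (of_real (h x) * u x) = of_real (h x) * of_real (h x) * of_real (W x) * (u x * cnj (u x))
        - z * ((complex_of_real (h x) * of_real (I x)) * of_real (h x) * (u x * cnj (u x)))"
        by (simp add: q_def algebra_simps)
      then show ?thesis unfolding 1 by (simp add: complex_norm_square[symmetric] power2_eq_square mult_ac)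
    qed
    then have "Q = (LINT x|lborel. of_real ((h x)\<^sup>2 * W x * (cmod (u x))\<^sup>2) - z * of_real ((h x)\<^sup>2 * (cmod (u x))\<^sup>2))"
      by (simp add: Q_def mult_L2_abs[OF _ hm hK] sq u cinner_abs square_integrable_bounded_mult(1)[OF _ hm hK])
    also have "\<dots> = of_real A - z * of_real D"
      unfolding A_def D by (subst Bochner_Integration.integral_diff)
        (use iA iD in \<open>auto simp del: of_real_mult of_real_power\<close>)
    finally show ?thesis .
  qed
  have U: "U = (LINT x|lborel. (cmod (u x))\<^sup>2)" by (simp add: U_def norm_abs_L2_sq[OF u])
  have A: "\<bar>A\<bar> \<le> K\<^sup>2 * M * U"
  proof -
    have "\<bar>A\<bar> \<le> (LINT x|lborel. \<bar>(h x)\<^sup>2 * W x * (cmod (u x))\<^sup>2\<bar>)" unfolding A_def by (rule integral_abs_bound)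
    also have "\<dots> \<le> (LINT x|lborel. K\<^sup>2 * M * (cmod (u x))\<^sup>2)"
      by (intro integral_mono integrable_abs iA integrable_mult_right iu leA)
    finally show ?thesis by (simp add: U)
  qed
  have D0: "0 \<le> D" unfolding D_def by (intro Bochner_Integration.integral_nonneg) simp
  have DU: "D \<le> K\<^sup>2 * U"
  proof -
    have "D \<le> (LINT x|lborel. K\<^sup>2 * (cmod (u x))\<^sup>2)"
      unfolding D using leD by (intro integral_mono iD integrable_mult_right iu) auto
    then show ?thesis by (simp add: U)
  qed
  have "cmod Q \<le> \<bar>A\<bar> + cmod z * D"
    unfolding Q using norm_triangle_ineq4[of "of_real A" "z * of_real D"] D0 by (simp add: norm_mult)
  also have "\<dots> \<le> K\<^sup>2 * M * U + cmod z * (K\<^sup>2 * U)" using A DU by (intro add_mono mult_left_mono) auto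
  finally have cQ: "cmod Q \<le> K\<^sup>2 * (M + cmod z) * U" by (simp add: algebra_simps)
  have "\<bar>Im z\<bar> * D = \<bar>Im Q\<bar>" unfolding Q using D0 by (simp add: abs_mult)
  also have "\<dots> \<le> \<theta> * (2 * cmod Q + 4 * (L * U)) + L * U / \<theta>" by (rule lim)
  also have "\<dots> \<le> \<theta> * (2 * (K\<^sup>2 * (M + cmod z) * U) + 4 * (L * U)) + L * U / \<theta>"
  proof -
    have "2 * cmod Q + 4 * (L * U) \<le> 2 * (K\<^sup>2 * (M + cmod z) * U) + 4 * (L * U)" using cQ by linarith
    then show ?thesis using mult_left_mono[OF _ less_imp_le[OF \<theta>]] by (intro add_right_mono) blast
  qed
  finally show ?thesis by (simp add: b_def L_def U_def)
qed

text \<open>In \<open>weak_solution_local_bound\<close> let \<open>\<bar>V\<bar> \<le> M = R\<^sup>2 / s\<^sup>2\<close> on the ball of radius \<open>4 R\<close>; also \<open>b\<close> is of order \<open>1 / R\<^sup>2\<close>.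
  With \<open>\<theta> = s / R\<^sup>2\<close> both \<open>\<theta> M\<close> and \<open>b / \<theta>\<close> are of order \<open>1 / s\<close>, and \<open>s\<close> is arbitrary.\<close>

lemma weak_solution_zero:
  fixes u :: "real^'n::finite \<Rightarrow> complex"
  assumes \<rho>: "mollifier (\<rho> :: real^'n \<Rightarrow> real)" and V: "continuous_on UNIV V" and g: "subquadratic_growth V"
    and z: "Im z \<noteq> 0" and u: "square_integrable u"
    and weak: "\<And>\<phi>. test_function \<phi> \<Longrightarrow> (LINT x|lborel. (schro V \<phi> x - z * \<phi> x) * u x) = 0"
  shows "abs_L2 u = 0"
proof -
  obtain \<eta> :: "real^'n \<Rightarrow> real" where \<eta>: "test_function \<eta>" "\<And>x. norm x \<le> 1 \<Longrightarrow> \<eta> x = 1" "\<And>x. norm x > 3 \<Longrightarrow> \<eta> x = 0"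
    using cutoff_exists[OF \<rho>] by metis
  obtain K where K: "0 < K" "\<And>x. \<bar>\<eta> x\<bar> \<le> K" using test_bounded[OF \<eta>(1)] by (metis real_norm_def)
  have "\<forall>i. \<exists>B. \<forall>x. \<bar>pd i \<eta> x\<bar> \<le> B" using test_bounded[OF test_pd[OF \<eta>(1)]] by (metis real_norm_def)
  then obtain B where B: "\<And>i x. \<bar>pd i \<eta> x\<bar> \<le> B i" by metis
  define L where "L = (\<Sum>i\<in>UNIV. (B i)\<^sup>2)"
  have L0: "0 \<le> L" unfolding L_def by (intro sum_nonneg) simp
  define U where "U = (norm (abs_L2 u))\<^sup>2"
  define C where "C = 2 * K\<^sup>2 + 2 * K\<^sup>2 * cmod z + 5 * L"
  have iu: "integrable lborel (\<lambda>x. (cmod (u x))\<^sup>2)" and um: "u \<in> borel_measurable borel"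
    using u by (auto simp: square_integrable_def)
  have bound: "\<bar>Im z\<bar> * (LINT x|lborel. indicator (cball 0 s) x * (cmod (u x))\<^sup>2) \<le> C * U * inverse s"
    if s: "1 \<le> s" for s
  proof -
    obtain R where R: "R \<ge> s" "\<And>x. norm x \<le> 4 * R \<Longrightarrow> \<bar>V x\<bar> \<le> R\<^sup>2 / s\<^sup>2"
      using g s unfolding subquadratic_growth_def by blast
    have R1: "1 \<le> R" using R(1) s by simp
    define \<theta> where "\<theta> = s / R\<^sup>2"
    have \<theta>: "0 < \<theta>" using s R1 by (simp add: \<theta>_def)
    define D where "D = (LINT x|lborel. (\<eta> ((1 / R) *\<^sub>R x))\<^sup>2 * (cmod (u x))\<^sup>2)"
    have est: "\<bar>Im z\<bar> * D \<le> \<theta> * (2 * (K\<^sup>2 * (R\<^sup>2 / s\<^sup>2 + cmod z) * U) + 4 * (L / R\<^sup>2 * U)) + (L / R\<^sup>2 * U) / \<theta>"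
      unfolding D_def U_def L_def
      by (rule weak_solution_local_bound[OF \<rho> V u weak \<eta>(1,3) K(2) B R1 R(2) \<theta>])
    have s2: "s\<^sup>2 \<le> R\<^sup>2" using R(1) s by (intro power_mono) auto
    have th: "\<theta> \<le> inverse s"
      using s2 s R1 by (simp add: \<theta>_def field_simps power2_eq_square)
    have R2: "1 \<le> R\<^sup>2" using R1 by simp
    have e1: "\<theta> * (R\<^sup>2 / s\<^sup>2) = inverse s" using s R1 by (simp add: \<theta>_def field_simps power2_eq_square)
    have e2: "(L / R\<^sup>2 * U) / \<theta> = L * U * inverse s" using s R1 by (simp add: \<theta>_def field_simps)
    have U0: "0 \<le> U" by (simp add: U_def)
    have e3: "\<theta> * (4 * (L / R\<^sup>2 * U)) \<le> inverse s * (4 * (L * U))"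
    proof (rule mult_mono[OF th])
      have "L / R\<^sup>2 \<le> L" using R2 L0 by (simp add: divide_le_eq mult_le_cancel_left1)
      then have "L / R\<^sup>2 * U \<le> L * U" by (rule mult_right_mono[OF _ U0])
      then show "4 * (L / R\<^sup>2 * U) \<le> 4 * (L * U)" by (rule mult_left_mono) simp
    qed (use s L0 U0 in auto)
    have e4: "\<theta> * (2 * (K\<^sup>2 * (R\<^sup>2 / s\<^sup>2 + cmod z) * U)) \<le> inverse s * (2 * K\<^sup>2 * U + 2 * K\<^sup>2 * cmod z * U)"
    proof -
      have "\<theta> * (2 * (K\<^sup>2 * (R\<^sup>2 / s\<^sup>2 + cmod z) * U)) = (\<theta> * (R\<^sup>2 / s\<^sup>2)) * (2 * K\<^sup>2 * U) + \<theta> * (2 * K\<^sup>2 * cmod z * U)"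
        by (simp add: algebra_simps)
      also have "\<dots> \<le> inverse s * (2 * K\<^sup>2 * U) + inverse s * (2 * K\<^sup>2 * cmod z * U)"
        unfolding e1 using th U0 by (intro add_mono order_refl mult_right_mono) auto
      finally show ?thesis by (simp add: algebra_simps)
    qed
    have "\<bar>Im z\<bar> * D \<le> \<theta> * (2 * (K\<^sup>2 * (R\<^sup>2 / s\<^sup>2 + cmod z) * U)) + \<theta> * (4 * (L / R\<^sup>2 * U)) + L * U * inverse s"
      using est unfolding e2 by (simp add: algebra_simps)
    also have "\<dots> \<le> inverse s * (2 * K\<^sup>2 * U + 2 * K\<^sup>2 * cmod z * U) + inverse s * (4 * (L * U)) + L * U * inverse s"
      by (intro add_mono e3 e4 order_refl)
    also have "\<dots> = C * U * inverse s" by (simp add: C_def algebra_simps)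
    finally have DC: "\<bar>Im z\<bar> * D \<le> C * U * inverse s" .
    have "(LINT x|lborel. indicator (cball 0 s) x * (cmod (u x))\<^sup>2) \<le> D"
      unfolding D_def
    proof (rule integral_mono)
      show "integrable lborel (\<lambda>x. indicator (cball 0 s) x * (cmod (u x))\<^sup>2)"
        by (rule Bochner_Integration.integrable_bound[OF iu]) (use um in \<open>auto simp: indicator_def\<close>)
      have hm: "(\<lambda>x. \<eta> ((1 / R) *\<^sub>R x)) \<in> borel_measurable borel"
        using test_measurable[OF test_affine[OF \<eta>(1), of "1 / R" 0]] R1 by simp
      have "\<bar>(\<eta> ((1 / R) *\<^sub>R x))\<^sup>2 * (cmod (u x))\<^sup>2\<bar> \<le> K\<^sup>2 * (cmod (u x))\<^sup>2" for x
      proof -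
        have "(\<eta> ((1 / R) *\<^sub>R x))\<^sup>2 \<le> K\<^sup>2" using K(2)[of "(1 / R) *\<^sub>R x"] K(1) by (metis abs_le_square_iff abs_of_pos)
        then show ?thesis unfolding abs_mult by (intro mult_mono) auto
      qed
      then show "integrable lborel (\<lambda>x. (\<eta> ((1 / R) *\<^sub>R x))\<^sup>2 * (cmod (u x))\<^sup>2)"
        by (intro Bochner_Integration.integrable_bound[OF integrable_mult_right[OF iu, of "K\<^sup>2"]])
          (use hm um in \<open>auto simp: abs_mult\<close>)
      show "indicator (cball 0 s) x * (cmod (u x))\<^sup>2 \<le> (\<eta> ((1 / R) *\<^sub>R x))\<^sup>2 * (cmod (u x))\<^sup>2" for x
        using \<eta>(2)[of "(1 / R) *\<^sub>R x"] R(1) R1 by (auto simp: indicator_def)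
    qed
    then have "\<bar>Im z\<bar> * (LINT x|lborel. indicator (cball 0 s) x * (cmod (u x))\<^sup>2) \<le> \<bar>Im z\<bar> * D"
      by (intro mult_left_mono) auto
    then show ?thesis using DC by linarith
  qed
  have "(\<lambda>n. LINT x|lborel. indicator (cball 0 (real (Suc n))) x * (cmod (u x))\<^sup>2) \<longlonglongrightarrow> (LINT x|lborel. (cmod (u x))\<^sup>2)"
  proof (rule integral_dominated_convergence[OF _ _ iu])
    show "AE x in lborel. (\<lambda>n. indicator (cball 0 (real (Suc n))) x * (cmod (u x))\<^sup>2) \<longlonglongrightarrow> (cmod (u x))\<^sup>2"
    proof (rule AE_I2)
      fix x :: "real^'n"
      obtain N where N: "norm x \<le> real N" using real_arch_simple by blast
      have "indicator (cball 0 (real (Suc n))) x * (cmod (u x))\<^sup>2 = (cmod (u x))\<^sup>2" if "n \<ge> N" for n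
        using N that by (simp add: indicator_def)
      then show "(\<lambda>n. indicator (cball 0 (real (Suc n))) x * (cmod (u x))\<^sup>2) \<longlonglongrightarrow> (cmod (u x))\<^sup>2"
        by (intro tendsto_eventually eventually_sequentiallyI) auto
    qed
  qed (use um in \<open>auto simp: indicator_def\<close>)
  then have "(\<lambda>n. \<bar>Im z\<bar> * (LINT x|lborel. indicator (cball 0 (real (Suc n))) x * (cmod (u x))\<^sup>2)) \<longlonglongrightarrow> \<bar>Im z\<bar> * U"
    unfolding U_def norm_abs_L2_sq[OF u] by (intro tendsto_intros)
  moreover have "(\<lambda>n. C * U * inverse (real (Suc n))) \<longlonglongrightarrow> C * U * 0"
    by (intro tendsto_intros LIMSEQ_inverse_real_of_nat)
  ultimately have "\<bar>Im z\<bar> * U \<le> C * U * 0"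
    by (rule LIMSEQ_le) (intro exI[of _ 0] allI impI bound, simp)
  then have "\<bar>Im z\<bar> * U \<le> 0" by simp
  then have "U \<le> 0" using z by (simp add: mult_le_0_iff)
  then show ?thesis by (simp add: U_def)
qed

text \<open>The complex conjugate of a vector in a deficiency space is a weak solution.\<close>

theorem essentially_self_adjoint_schrodinger:
  fixes V :: "real^'n::finite \<Rightarrow> real"
  assumes \<rho>: "mollifier (\<rho> :: real^'n \<Rightarrow> real)" and V: "continuous_on UNIV V" and g: "subquadratic_growth V"
  shows "essentially_self_adjoint (schrodinger V)"
proof (rule essentially_self_adjointI)
  show "(0, 0) \<in> schrodinger V"
  proof -
    have "schro V (\<lambda>x. 0) = (\<lambda>x. 0)" using schro_cmult[OF test_zero, of V 0] by simp
    then have "(abs_L2 (\<lambda>x. 0), abs_L2 (schro V (\<lambda>x. 0))) = (0, 0)" by (simp add: abs_L2_zero)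
    then show ?thesis unfolding schrodinger_eq using test_zero by (metis (mono_tags, lifting) mem_Collect_eq)
  qed
  fix u v u' v' assume 1: "(u, v) \<in> schrodinger V"
  then obtain \<phi> where \<phi>: "test_function \<phi>" "u = abs_L2 \<phi>" "v = abs_L2 (schro V \<phi>)"
    by (auto simp: schrodinger_eq)
  show "(scaleC c u, scaleC c v) \<in> schrodinger V" for c
    unfolding schrodinger_eq mem_Collect_eq
    by (intro exI[of _ "\<lambda>x. c * \<phi> x"])
      (simp add: \<phi> test_cmult schro_cmult abs_L2_scaleC test_square_integrable schro_square_integrable V)
  assume 2: "(u', v') \<in> schrodinger V"
  then obtain \<psi> where \<psi>: "test_function \<psi>" "u' = abs_L2 \<psi>" "v' = abs_L2 (schro V \<psi>)"
    by (auto simp: schrodinger_eq)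
  show "(u + u', v + v') \<in> schrodinger V"
    unfolding schrodinger_eq mem_Collect_eq
    by (intro exI[of _ "\<lambda>x. \<phi> x + \<psi> x"])
      (simp add: \<phi> \<psi> test_add schro_add abs_L2_add test_square_integrable schro_square_integrable V)
next
  have "Domain (schrodinger V) = {abs_L2 \<phi> | \<phi> :: real^'n \<Rightarrow> complex. test_function \<phi>}"
    by (auto simp: schrodinger_eq)
  then show "closure (Domain (schrodinger V)) = UNIV" using test_functions_dense[OF \<rho>] by simp
  show "symmetric_op (schrodinger V)" by (rule symmetric_schrodinger[OF V])
next
  fix g :: "(real^'n) L2" and z
  assume z: "z = \<i> \<or> z = - \<i>" and o: "\<And>u v. (u, v) \<in> schrodinger V \<Longrightarrow> cinner (v - scaleC z u) g = 0"
  obtain g' where g': "square_integrable g'" "g = abs_L2 g'" using L2_obtain_function by metis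
  have c: "square_integrable (\<lambda>x. cnj (g' x))"
    using g'(1) by (auto simp: square_integrable_def)
  have "abs_L2 (\<lambda>x. cnj (g' x)) = 0"
  proof (rule weak_solution_zero[OF \<rho> V g _ c])
    show "Im z \<noteq> 0" using z by auto
    fix \<phi> :: "real^'n \<Rightarrow> complex" assume \<phi>: "test_function \<phi>"
    have "cinner (abs_L2 (schro V \<phi>) - scaleC z (abs_L2 \<phi>)) g = 0"
      by (rule o) (use \<phi> in \<open>auto simp: schrodinger_eq\<close>)
    moreover have "abs_L2 (schro V \<phi>) - scaleC z (abs_L2 \<phi>) = abs_L2 (\<lambda>x. schro V \<phi> x - z * \<phi> x)"
      by (simp add: abs_L2_diff abs_L2_scaleC square_integrable_mult test_square_integrable schro_square_integrable V \<phi>)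
    ultimately show "(LINT x|lborel. (schro V \<phi> x - z * \<phi> x) * cnj (g' x)) = 0"
      using cinner_abs[OF square_integrable_minus[OF schro_square_integrable[OF V \<phi>] square_integrable_mult[OF test_square_integrable[OF \<phi>]]] g'(1), of z]
      by (simp add: g'(2))
  qed
  then have "AE x in lborel. cnj (g' x) = 0"
    using abs_L2_eq_iff[OF c square_integrable_zero] by (simp add: abs_L2_zero)
  then have "AE x in lborel. g' x = 0" by simp
  then show "g = 0" using abs_L2_eq_iff[OF g'(1) square_integrable_zero] by (simp add: g'(2) abs_L2_zero)
qed

section \<open>Characteristic functions and uniqueness of laws\<close>

lemma cis_eq_iexp: "cis x = iexp x"
  by (simp add: cis_conv_exp)

lemma measurable_cis [measurable]: "cis \<in> borel_measurable borel"
  by (intro borel_measurable_continuous_onI continuous_on_cis continuous_on_id)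

lemma (in prob_space) centred_gaussian_moments:
  assumes X: "centred_gaussian M X" and v: "v = expectation (\<lambda>\<omega>. (X \<omega>)\<^sup>2)"
  shows "expectation (\<lambda>\<omega>. cis (X \<omega>)) = complex_of_real (exp (- v / 2))"
    "integrable M (\<lambda>\<omega>. (X \<omega>)\<^sup>2)" "integrable M (\<lambda>\<omega>. (X \<omega>)^4)" "expectation (\<lambda>\<omega>. (X \<omega>)^4) = 3 * v\<^sup>2"
    "v = 0 \<Longrightarrow> AE \<omega> in M. X \<omega> = 0"
    "v > 0 \<Longrightarrow> distributed M lborel X (normal_density 0 (sqrt v))"
proof -
  have [measurable]: "X \<in> borel_measurable M" using X by (simp add: centred_gaussian_def)
  consider (0) "AE \<omega> in M. X \<omega> = 0" | (pos) \<sigma> where "\<sigma> > 0" "distributed M lborel X (normal_density 0 \<sigma>)"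
    using X by (auto simp: centred_gaussian_def)
  then have "expectation (\<lambda>\<omega>. cis (X \<omega>)) = complex_of_real (exp (- v / 2)) \<and>
    integrable M (\<lambda>\<omega>. (X \<omega>)\<^sup>2) \<and> integrable M (\<lambda>\<omega>. (X \<omega>)^4) \<and> expectation (\<lambda>\<omega>. (X \<omega>)^4) = 3 * v\<^sup>2 \<and>
    (v = 0 \<longrightarrow> (AE \<omega> in M. X \<omega> = 0)) \<and> (v > 0 \<longrightarrow> distributed M lborel X (normal_density 0 (sqrt v)))"
  proof cases
    case 0
    have 2: "v = 0" unfolding v by (subst integral_cong_AE[where g="\<lambda>_. 0"]) (use 0 in auto)
    have 1: "expectation (\<lambda>\<omega>. cis (X \<omega>)) = expectation (\<lambda>\<omega>. 1)"
      by (rule integral_cong_AE) (use 0 in auto)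
    have 3: "integrable M (\<lambda>\<omega>. (X \<omega>)\<^sup>2)" "integrable M (\<lambda>\<omega>. (X \<omega>)^4)"
      by (subst integrable_cong_AE[where g="\<lambda>_. 0"], use 0 in auto)+
    have 4: "expectation (\<lambda>\<omega>. (X \<omega>)^4) = expectation (\<lambda>\<omega>. 0)"
      by (rule integral_cong_AE) (use 0 in auto)
    show ?thesis using 0 1 2 3 4 by (simp add: prob_space)
  next
    case pos
    note D = pos(2)
    have m2: "has_bochner_integral lborel (\<lambda>x. normal_density 0 \<sigma> x * x\<^sup>2) (\<sigma>\<^sup>2)"
      using normal_moment_even[of \<sigma> 0 1] pos(1) by simp
    have m4: "has_bochner_integral lborel (\<lambda>x. normal_density 0 \<sigma> x * x^4) (3 * (\<sigma>\<^sup>2)\<^sup>2)"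
      using normal_moment_even[of \<sigma> 0 2] pos(1) by (simp add: fact_numeral power_divide field_simps)
    have v2: "v = \<sigma>\<^sup>2"
      unfolding v using distributed_integral[OF D, of "\<lambda>x. x\<^sup>2"] m2 by (simp add: has_bochner_integral_iff)
    have i2: "integrable M (\<lambda>\<omega>. (X \<omega>)\<^sup>2)"
      using distributed_integrable[OF D, of "\<lambda>x. x\<^sup>2"] m2 by (simp add: has_bochner_integral_iff)
    have i4: "integrable M (\<lambda>\<omega>. (X \<omega>)^4)"
      using distributed_integrable[OF D, of "\<lambda>x. x^4"] m4 by (simp add: has_bochner_integral_iff)
    have e4: "expectation (\<lambda>\<omega>. (X \<omega>)^4) = 3 * v\<^sup>2"
      unfolding v2 using distributed_integral[OF D, of "\<lambda>x. x^4"] m4 by (simp add: has_bochner_integral_iff)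
    have "distributed M lborel (\<lambda>\<omega>. (X \<omega> - 0) / \<sigma>) std_normal_density"
      using D normal_standard_normal_convert[OF pos(1)] by blast
    then have "distr M lborel (\<lambda>\<omega>. X \<omega> / \<sigma>) = std_normal_distribution"
      by (simp add: distributed_distr_eq_density)
    then have "char std_normal_distribution \<sigma> = (CLINT x|distr M lborel (\<lambda>\<omega>. X \<omega> / \<sigma>). iexp (\<sigma> * x))"
      by (simp add: char_def)
    also have "\<dots> = expectation (\<lambda>\<omega>. cis (X \<omega>))"
      using pos(1) by (subst integral_distr) (auto simp: cis_eq_iexp)
    finally have "expectation (\<lambda>\<omega>. cis (X \<omega>)) = complex_of_real (exp (- v / 2))"
      by (simp add: char_std_normal_distribution v2)
    then show ?thesis using i2 i4 e4 pos v2 by simp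
  qed
  then show "expectation (\<lambda>\<omega>. cis (X \<omega>)) = complex_of_real (exp (- v / 2))"
    "integrable M (\<lambda>\<omega>. (X \<omega>)\<^sup>2)" "integrable M (\<lambda>\<omega>. (X \<omega>)^4)" "expectation (\<lambda>\<omega>. (X \<omega>)^4) = 3 * v\<^sup>2"
    "v = 0 \<Longrightarrow> AE \<omega> in M. X \<omega> = 0"
    "v > 0 \<Longrightarrow> distributed M lborel X (normal_density 0 (sqrt v))" by auto
qed

text \<open>Two weighted laws on the line with the same Fourier transform agree; this is Levy's uniqueness
  theorem, normalised by the common total mass.\<close>

lemma weighted_char_unique:
  fixes Y :: "'a \<Rightarrow> real" and Y' :: "'b \<Rightarrow> real" and g :: "real \<Rightarrow> 'c::{banach, second_countable_topology}"
  assumes Xm[measurable]: "X \<in> borel_measurable M" "X' \<in> borel_measurable M'"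
    and i: "integrable M Y" "integrable M' Y'" and pos: "\<And>x. 0 \<le> Y x" "\<And>x. 0 \<le> Y' x"
    and eq: "\<And>t. (LINT x|M. of_real (Y x) * cis (t * X x)) = (LINT x|M'. of_real (Y' x) * cis (t * X' x))"
    and g[measurable]: "g \<in> borel_measurable borel"
  shows "(LINT x|M. Y x *\<^sub>R g (X x)) = (LINT x|M'. Y' x *\<^sub>R g (X' x))"
proof -
  have [measurable]: "Y \<in> borel_measurable M" "Y' \<in> borel_measurable M'" using i by auto
  define m where "m = (LINT x|M. Y x)"
  have m': "(LINT x|M'. Y' x) = m" using eq[of 0] by (simp add: m_def)
  have m0: "0 \<le> m" unfolding m_def by (rule Bochner_Integration.integral_nonneg) (rule pos)
  show ?thesis
  proof (cases "m = 0")
    case True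
    have "AE x in M. Y x = 0"
      using integral_nonneg_eq_0_iff_AE[OF i(1)] pos True by (simp add: m_def)
    then have 1: "(LINT x|M. Y x *\<^sub>R g (X x)) = (LINT x|M. 0)"
      by (intro integral_cong_AE) auto
    have "AE x in M'. Y' x = 0"
      using integral_nonneg_eq_0_iff_AE[OF i(2)] pos True m' by simp
    then have 2: "(LINT x|M'. Y' x *\<^sub>R g (X' x)) = (LINT x|M'. 0)"
      by (intro integral_cong_AE) auto
    show ?thesis using 1 2 by simp
  next
    case False
    then have mp: "0 < m" using m0 by simp
    define P where "P = distr (density M (\<lambda>x. ennreal (Y x / m))) borel X"
    define P' where "P' = distr (density M' (\<lambda>x. ennreal (Y' x / m))) borel X'"
    have em: "emeasure P UNIV = 1"
    proof -
      have "emeasure P UNIV = (\<integral>\<^sup>+x. ennreal (Y x / m) \<partial>M)"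
        by (simp add: P_def emeasure_distr emeasure_density)
      also have "\<dots> = ennreal (LINT x|M. Y x / m)"
        by (rule nn_integral_eq_integral) (use i pos mp in auto)
      finally show ?thesis using mp by (simp add: m_def[symmetric])
    qed
    have em': "emeasure P' UNIV = 1"
    proof -
      have "emeasure P' UNIV = (\<integral>\<^sup>+x. ennreal (Y' x / m) \<partial>M')"
        by (simp add: P'_def emeasure_distr emeasure_density)
      also have "\<dots> = ennreal (LINT x|M'. Y' x / m)"
        by (rule nn_integral_eq_integral) (use i pos mp in auto)
      finally show ?thesis using mp by (simp add: m')
    qed
    have int: "(LINT x|P. f x) = (LINT x|M. (Y x / m) *\<^sub>R f (X x))" if [measurable]: "f \<in> borel_measurable borel"
      for f :: "real \<Rightarrow> 'd::{banach, second_countable_topology}"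
      unfolding P_def using pos mp by (simp add: integral_distr integral_density)
    have int': "(LINT x|P'. f x) = (LINT x|M'. (Y' x / m) *\<^sub>R f (X' x))" if [measurable]: "f \<in> borel_measurable borel"
      for f :: "real \<Rightarrow> 'd::{banach, second_countable_topology}"
      unfolding P'_def using pos mp by (simp add: integral_distr integral_density)
    have "P = P'"
    proof (rule Levy_uniqueness)
      show "real_distribution P" "real_distribution P'"
        by (auto simp: real_distribution_def real_distribution_axioms_def P_def P'_def intro!: prob_spaceI)
          (use em em' in \<open>auto simp: P_def P'_def\<close>)
      have "char P t = char P' t" for t
      proof -
        have 1: "char P t = (LINT x|M. (1 / m) *\<^sub>R (of_real (Y x) * cis (t * X x)))"
          unfolding char_def by (subst int) (auto simp: cis_eq_iexp scaleR_conv_of_real)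
        have 2: "char P' t = (LINT x|M'. (1 / m) *\<^sub>R (of_real (Y' x) * cis (t * X' x)))"
          unfolding char_def by (subst int') (auto simp: cis_eq_iexp scaleR_conv_of_real)
        show ?thesis unfolding 1 2 integral_scaleR_right eq ..
      qed
      then show "char P = char P'" ..
    qed
    then have e: "(LINT x|M. (Y x / m) *\<^sub>R g (X x)) = (LINT x|M'. (Y' x / m) *\<^sub>R g (X' x))"
      using int[OF g] int'[OF g] by simp
    have "(LINT x|M. (Y x / m) *\<^sub>R g (X x)) = (1 / m) *\<^sub>R (LINT x|M. Y x *\<^sub>R g (X x))"
      "(LINT x|M'. (Y' x / m) *\<^sub>R g (X' x)) = (1 / m) *\<^sub>R (LINT x|M'. Y' x *\<^sub>R g (X' x))"
      by (subst integral_scaleR_right[symmetric], simp)+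
    then show ?thesis using e mp by simp
  qed
qed

section \<open>The space of distributions\<close>

definition cylinder :: "((real^'n::finite \<Rightarrow> real) \<times> real set) list \<Rightarrow> 'n distn set" where
  "cylinder l = {T. distribution T \<and> (\<forall>(\<phi>, A)\<in>set l. T \<phi> \<in> A)}"

definition cylinders :: "'n::finite distn set set" where
  "cylinders = cylinder ` lists ({\<phi>. test_function \<phi>} \<times> sets borel)"

text \<open>The sigma-algebra of the evaluations at test functions; the cylinders form a generator that is closed
  under intersections.\<close>

definition dspace :: "('n::finite distn) measure" where
  "dspace = sigma {T. distribution T} cylinders"

lemma cylinders_subset: "cylinders \<subseteq> Pow {T. distribution T}"
  by (auto simp: cylinders_def cylinder_def)

lemma space_dspace [simp]: "space dspace = {T. distribution T}"
  unfolding dspace_def by (rule space_measure_of[OF cylinders_subset])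

lemma sets_dspace: "sets dspace = sigma_sets {T. distribution T} cylinders"
  unfolding dspace_def by (rule sets_measure_of[OF cylinders_subset])

lemma cylinder_Int: "cylinder k \<inter> cylinder l = cylinder (k @ l)"
  by (auto simp: cylinder_def)

lemma Int_stable_cylinders: "Int_stable cylinders"
  by (auto simp: Int_stable_def cylinders_def cylinder_Int intro!: imageI)

lemma eval_measurable [measurable]:
  assumes "test_function \<phi>" shows "(\<lambda>T. T \<phi>) \<in> borel_measurable dspace"
proof (rule measurableI)
  fix A :: "real set" assume A: "A \<in> sets borel"
  have "(\<lambda>T. T \<phi>) -` A \<inter> space dspace = cylinder [(\<phi>, A)]" by (auto simp: cylinder_def)
  also have "\<dots> \<in> cylinders" unfolding cylinders_def using assms A by (intro imageI) auto
  finally show "(\<lambda>T. T \<phi>) -` A \<inter> space dspace \<in> sets dspace" by (simp add: sets_dspace)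
qed simp

lemma measurable_dspaceI:
  assumes D: "\<And>\<omega>. \<omega> \<in> space M \<Longrightarrow> distribution (f \<omega>)"
    and f: "\<And>\<phi>. test_function \<phi> \<Longrightarrow> (\<lambda>\<omega>. f \<omega> \<phi>) \<in> borel_measurable M"
  shows "f \<in> measurable M dspace"
  unfolding dspace_def
proof (rule measurable_measure_of[OF cylinders_subset])
  fix C assume "C \<in> (cylinders :: 'b distn set set)"
  then obtain l where l: "C = cylinder l" "set l \<subseteq> {\<phi>. test_function \<phi>} \<times> sets borel"
    by (auto simp: cylinders_def)
  have "f -` cylinder l \<inter> space M = {\<omega>\<in>space M. \<forall>p\<in>set l. f \<omega> (fst p) \<in> snd p}"
    using D by (auto simp: cylinder_def)
  also have "\<dots> \<in> sets M"
  proof (rule sets.sets_Collect_finite_All)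
    fix p assume "p \<in> set l"
    then have p: "test_function (fst p)" "snd p \<in> sets borel" using l(2) by auto
    have "{\<omega>\<in>space M. f \<omega> (fst p) \<in> snd p} = (\<lambda>\<omega>. f \<omega> (fst p)) -` snd p \<inter> space M" by auto
    then show "{\<omega>\<in>space M. f \<omega> (fst p) \<in> snd p} \<in> sets M"
      using measurable_sets[OF f[OF p(1)] p(2)] by simp
  qed simp
  finally show "f -` C \<inter> space M \<in> sets M" using l(1) by simp
qed (use D in auto)

lemma distribution_linear:
  assumes "distribution T" "test_function \<phi>" "test_function \<psi>"
  shows "T (\<lambda>x. a * \<phi> x + b * \<psi> x) = a * T \<phi> + b * T \<psi>"
  using assms unfolding distribution_def by blast

lemma test_lincomb:
  fixes \<phi> \<psi> :: "real^'n::finite \<Rightarrow> real"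
  shows "test_function \<phi> \<Longrightarrow> test_function \<psi> \<Longrightarrow> test_function (\<lambda>x. a * \<phi> x + b * \<psi> x)"
  by (intro test_add test_cmult)

lemma distribution_zero: "distribution T \<Longrightarrow> T (\<lambda>x. 0) = 0"
  using distribution_linear[of T "\<lambda>x. 0" "\<lambda>x. 0" 0 0] test_zero by simp

text \<open>The law of a random distribution is determined by its characteristic functional. The indicators of
  the conditions \<open>T \<phi> \<in> A\<close> are inserted one at a time; to keep the weights non-negative, the
  exponential is replaced by \<open>1 + cos\<close> and \<open>1 + sin\<close>.\<close>

lemma dspace_measure_unique:
  fixes \<mu> \<nu> :: "('n::finite distn) measure"
  assumes fin: "finite_measure \<mu>" "finite_measure \<nu>" and sets: "sets \<mu> = sets dspace" "sets \<nu> = sets dspace"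
    and char: "\<And>\<phi>. test_function \<phi> \<Longrightarrow> (LINT T|\<mu>. cis (T \<phi>)) = (LINT T|\<nu>. cis (T \<phi>))"
  shows "\<mu> = \<nu>"
proof -
  interpret \<mu>: finite_measure \<mu> by (rule fin)
  interpret \<nu>: finite_measure \<nu> by (rule fin)
  have sp: "space \<mu> = {T. distribution T}" "space \<nu> = {T. distribution T}"
    using sets_eq_imp_space_eq[OF sets(1)] sets_eq_imp_space_eq[OF sets(2)] by auto
  have ev\<mu>: "(\<lambda>T. T \<phi>) \<in> borel_measurable \<mu>" and ev\<nu>: "(\<lambda>T. T \<phi>) \<in> borel_measurable \<nu>" if "test_function \<phi>" for \<phi>
    using eval_measurable[OF that] by (simp_all add: measurable_cong_sets[OF sets(1) refl] measurable_cong_sets[OF sets(2) refl])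
  define good where "good Y \<longleftrightarrow> Y \<in> borel_measurable \<mu> \<and> Y \<in> borel_measurable \<nu> \<and> (\<forall>T. 0 \<le> Y T \<and> Y T \<le> 1) \<and>
      (\<forall>\<phi>. test_function \<phi> \<longrightarrow> (LINT T|\<mu>. of_real (Y T) * cis (T \<phi>)) = (LINT T|\<nu>. of_real (Y T) * cis (T \<phi>)))"
    for Y :: "'n distn \<Rightarrow> real"
  have step: "good (\<lambda>T. Y T * indicator A (T \<psi>))"
    if Y: "good Y" and \<psi>: "test_function \<psi>" and A: "A \<in> sets borel" for Y \<psi> A
  proof -
    have Ym: "Y \<in> borel_measurable \<mu>" "Y \<in> borel_measurable \<nu>" and Yb: "\<And>T. 0 \<le> Y T" "\<And>T. Y T \<le> 1"
      and Yc: "\<And>\<phi>. test_function \<phi> \<Longrightarrow> (LINT T|\<mu>. of_real (Y T) * cis (T \<phi>)) = (LINT T|\<nu>. of_real (Y T) * cis (T \<phi>))"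
      using Y by (auto simp: good_def)
    have i\<mu>: "integrable \<mu> (\<lambda>T. of_real (Y T) * cis (T \<phi>))" "integrable \<mu> (\<lambda>T. Y T * cos (T \<phi>))" "integrable \<mu> (\<lambda>T. Y T * sin (T \<phi>))"
      "integrable \<mu> Y" if "test_function \<phi>" for \<phi>
      by (rule \<mu>.integrable_const_bound[where B=1];
          use Ym ev\<mu>[OF that] Yb in \<open>auto simp: norm_mult abs_mult intro!: mult_le_one\<close>)+
    have i\<nu>: "integrable \<nu> (\<lambda>T. of_real (Y T) * cis (T \<phi>))" "integrable \<nu> (\<lambda>T. Y T * cos (T \<phi>))" "integrable \<nu> (\<lambda>T. Y T * sin (T \<phi>))"
      "integrable \<nu> Y" if "test_function \<phi>" for \<phi>
      by (rule \<nu>.integrable_const_bound[where B=1];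
          use Ym ev\<nu>[OF that] Yb in \<open>auto simp: norm_mult abs_mult intro!: mult_le_one\<close>)+
    have lin: "T (\<lambda>x. t * \<psi> x + s * \<phi> x) = t * T \<psi> + s * T \<phi>" if "distribution T" "test_function \<phi>" for T t s \<phi>
      by (rule distribution_linear[OF that(1) \<psi> that(2)])
    have shift: "(LINT T|\<mu>. of_real (Y T) * cis (t * T \<psi> + s * T \<phi>)) = (LINT T|\<nu>. of_real (Y T) * cis (t * T \<psi> + s * T \<phi>))"
      if \<phi>: "test_function \<phi>" for t s \<phi>
    proof -
      have "(LINT T|\<mu>. of_real (Y T) * cis (t * T \<psi> + s * T \<phi>)) = (LINT T|\<mu>. of_real (Y T) * cis (T (\<lambda>x. t * \<psi> x + s * \<phi> x)))"
        by (rule Bochner_Integration.integral_cong) (use lin \<phi> sp in auto)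
      also have "\<dots> = (LINT T|\<nu>. of_real (Y T) * cis (T (\<lambda>x. t * \<psi> x + s * \<phi> x)))"
        by (rule Yc[OF test_lincomb[OF \<psi> \<phi>]])
      also have "\<dots> = (LINT T|\<nu>. of_real (Y T) * cis (t * T \<psi> + s * T \<phi>))"
        by (rule Bochner_Integration.integral_cong) (use lin \<phi> sp in auto)
      finally show ?thesis .
    qed
    have ci: "integrable \<mu> (\<lambda>T. of_real (Y T) * cis (t * T \<psi> + s * T \<phi>))"
       "integrable \<nu> (\<lambda>T. of_real (Y T) * cis (t * T \<psi> + s * T \<phi>))" if \<phi>: "test_function \<phi>" for t s \<phi>
      by (rule \<mu>.integrable_const_bound[where B=1] \<nu>.integrable_const_bound[where B=1];
          use Ym ev\<mu>[OF \<phi>] ev\<nu>[OF \<phi>] ev\<mu>[OF \<psi>] ev\<nu>[OF \<psi>] Yb in \<open>auto simp: norm_mult\<close>)+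
    (* cos and sin of T \<phi> are combinations of the exponentials of T \<phi> and - T \<phi>; hence the weights
       Y (1 + cos (T \<phi>)) and Y (1 + sin (T \<phi>)) have the same Fourier transforms under \<mu> and \<nu>. *)
    have comb: "(LINT T|\<mu>. of_real (Y T) * cis (t * T \<psi> + 0 * T \<phi>)
          + a * (of_real (Y T) * cis (t * T \<psi> + 1 * T \<phi>)) + b * (of_real (Y T) * cis (t * T \<psi> + (-1) * T \<phi>)))
        = (LINT T|\<nu>. of_real (Y T) * cis (t * T \<psi> + 0 * T \<phi>)
          + a * (of_real (Y T) * cis (t * T \<psi> + 1 * T \<phi>)) + b * (of_real (Y T) * cis (t * T \<psi> + (-1) * T \<phi>)))"
      if \<phi>: "test_function \<phi>" for \<phi> t a b
    proof -
      define F where "F s T = of_real (Y T) * cis (t * T \<psi> + s * T \<phi>)" for s T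
      have "integrable \<mu> (F s)" "integrable \<nu> (F s)" "(LINT T|\<mu>. F s T) = (LINT T|\<nu>. F s T)" for s
        unfolding F_def by (rule ci[OF \<phi>] shift[OF \<phi>])+
      then have "(LINT T|\<mu>. F 0 T + a * F 1 T + b * F (-1) T) = (LINT T|\<nu>. F 0 T + a * F 1 T + b * F (-1) T)"
        by simp
      then show ?thesis unfolding F_def .
    qed
    let ?I = "\<lambda>T. indicator A (T \<psi>) :: real"
    have base: "(LINT T|\<mu>. Y T *\<^sub>R (indicator A (T \<psi>) :: real)) = (LINT T|\<nu>. Y T *\<^sub>R indicator A (T \<psi>))"
      by (rule weighted_char_unique[OF ev\<mu>[OF \<psi>] ev\<nu>[OF \<psi>] i\<mu>(4)[OF \<psi>] i\<nu>(4)[OF \<psi>] Yb(1) Yb(1)])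
        (use shift[OF \<psi>, of _ 0] A in auto)
    have c: "(LINT T|\<mu>. Y T * (1 + cos (T \<phi>)) *\<^sub>R (indicator A (T \<psi>) :: real)) = (LINT T|\<nu>. Y T * (1 + cos (T \<phi>)) *\<^sub>R indicator A (T \<psi>))"
      if \<phi>: "test_function \<phi>" for \<phi>
    proof -
      have eq: "of_real (Y T * (1 + cos (T \<phi>))) * cis (t * T \<psi>) = of_real (Y T) * cis (t * T \<psi> + 0 * T \<phi>)
          + (1/2) * (of_real (Y T) * cis (t * T \<psi> + 1 * T \<phi>)) + (1/2) * (of_real (Y T) * cis (t * T \<psi> + (-1) * T \<phi>))" for T t
        by (simp add: complex_eq_iff cos_add sin_add cos_diff sin_diff algebra_simps add_divide_distrib diff_divide_distrib)
      have "(LINT T|\<mu>. (Y T * (1 + cos (T \<phi>))) *\<^sub>R (indicator A (T \<psi>) :: real)) = (LINT T|\<nu>. (Y T * (1 + cos (T \<phi>))) *\<^sub>R indicator A (T \<psi>))"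
      proof (rule weighted_char_unique[OF ev\<mu>[OF \<psi>] ev\<nu>[OF \<psi>]])
        show "integrable \<mu> (\<lambda>T. Y T * (1 + cos (T \<phi>)))" "integrable \<nu> (\<lambda>T. Y T * (1 + cos (T \<phi>)))"
          unfolding distrib_left using i\<mu>[OF \<phi>] i\<nu>[OF \<phi>] by simp_all
        show "0 \<le> Y T * (1 + cos (T \<phi>))" "0 \<le> Y T * (1 + cos (T \<phi>))" for T
          using Yb(1)[of T] cos_ge_minus_one[of "T \<phi>"] by (intro mult_nonneg_nonneg; linarith)+
        show "(LINT T|\<mu>. of_real (Y T * (1 + cos (T \<phi>))) * cis (t * T \<psi>)) = (LINT T|\<nu>. of_real (Y T * (1 + cos (T \<phi>))) * cis (t * T \<psi>))" for t
          unfolding eq by (rule comb[OF \<phi>])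
      qed (use A in simp)
      then show ?thesis by (simp add: mult.assoc)
    qed
    have sn: "(LINT T|\<mu>. Y T * (1 + sin (T \<phi>)) *\<^sub>R (indicator A (T \<psi>) :: real)) = (LINT T|\<nu>. Y T * (1 + sin (T \<phi>)) *\<^sub>R indicator A (T \<psi>))"
      if \<phi>: "test_function \<phi>" for \<phi>
    proof -
      have eq: "of_real (Y T * (1 + sin (T \<phi>))) * cis (t * T \<psi>) = of_real (Y T) * cis (t * T \<psi> + 0 * T \<phi>)
          + (- \<i>/2) * (of_real (Y T) * cis (t * T \<psi> + 1 * T \<phi>)) + (\<i>/2) * (of_real (Y T) * cis (t * T \<psi> + (-1) * T \<phi>))" for T t
        by (simp add: complex_eq_iff cos_add sin_add cos_diff sin_diff algebra_simps add_divide_distrib diff_divide_distrib)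
      have "(LINT T|\<mu>. (Y T * (1 + sin (T \<phi>))) *\<^sub>R (indicator A (T \<psi>) :: real)) = (LINT T|\<nu>. (Y T * (1 + sin (T \<phi>))) *\<^sub>R indicator A (T \<psi>))"
      proof (rule weighted_char_unique[OF ev\<mu>[OF \<psi>] ev\<nu>[OF \<psi>]])
        show "integrable \<mu> (\<lambda>T. Y T * (1 + sin (T \<phi>)))" "integrable \<nu> (\<lambda>T. Y T * (1 + sin (T \<phi>)))"
          unfolding distrib_left using i\<mu>[OF \<phi>] i\<nu>[OF \<phi>] by simp_all
        show "0 \<le> Y T * (1 + sin (T \<phi>))" "0 \<le> Y T * (1 + sin (T \<phi>))" for T
          using Yb(1)[of T] sin_ge_minus_one[of "T \<phi>"] by (intro mult_nonneg_nonneg; linarith)+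
        show "(LINT T|\<mu>. of_real (Y T * (1 + sin (T \<phi>))) * cis (t * T \<psi>)) = (LINT T|\<nu>. of_real (Y T * (1 + sin (T \<phi>))) * cis (t * T \<psi>))" for t
          unfolding eq by (rule comb[OF \<phi>])
      qed (use A in simp)
      then show ?thesis by (simp add: mult.assoc)
    qed
    have im: "(\<lambda>T. ?I T) \<in> borel_measurable \<mu>" "(\<lambda>T. ?I T) \<in> borel_measurable \<nu>"
      using ev\<mu>[OF \<psi>] ev\<nu>[OF \<psi>] A by measurable
    show ?thesis
      unfolding good_def
    proof (intro conjI allI impI)
      show "(\<lambda>T. Y T * ?I T) \<in> borel_measurable \<mu>" "(\<lambda>T. Y T * ?I T) \<in> borel_measurable \<nu>"
        using Ym im by measurable
      show "0 \<le> Y T * ?I T" "Y T * ?I T \<le> 1" for T using Yb[of T] by (auto simp: indicator_def)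
      fix \<phi> :: "real^'n \<Rightarrow> real" assume \<phi>: "test_function \<phi>"
      have j\<mu>: "integrable \<mu> (\<lambda>T. Y T * ?I T)" "integrable \<mu> (\<lambda>T. Y T * ?I T * cos (T \<phi>))" "integrable \<mu> (\<lambda>T. Y T * ?I T * sin (T \<phi>))"
        by (rule \<mu>.integrable_const_bound[where B=1];
          use Ym im ev\<mu>[OF \<phi>] Yb in \<open>auto simp: abs_mult indicator_def intro!: mult_le_one\<close>)+
      have j\<nu>: "integrable \<nu> (\<lambda>T. Y T * ?I T)" "integrable \<nu> (\<lambda>T. Y T * ?I T * cos (T \<phi>))" "integrable \<nu> (\<lambda>T. Y T * ?I T * sin (T \<phi>))"
        by (rule \<nu>.integrable_const_bound[where B=1];
          use Ym im ev\<nu>[OF \<phi>] Yb in \<open>auto simp: abs_mult indicator_def intro!: mult_le_one\<close>)+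
      have cc: "(LINT T|\<mu>. Y T * ?I T * cos (T \<phi>)) = (LINT T|\<nu>. Y T * ?I T * cos (T \<phi>))"
      proof -
        have e: "Y T * (1 + cos (T \<phi>)) *\<^sub>R ?I T = Y T * ?I T + Y T * ?I T * cos (T \<phi>)" for T by (simp add: algebra_simps)
        show ?thesis using c[OF \<phi>] base unfolding e using j\<mu> j\<nu> by simp
      qed
      have ss: "(LINT T|\<mu>. Y T * ?I T * sin (T \<phi>)) = (LINT T|\<nu>. Y T * ?I T * sin (T \<phi>))"
      proof -
        have e: "Y T * (1 + sin (T \<phi>)) *\<^sub>R ?I T = Y T * ?I T + Y T * ?I T * sin (T \<phi>)" for T by (simp add: algebra_simps)
        show ?thesis using sn[OF \<phi>] base unfolding e using j\<mu> j\<nu> by simp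
      qed
      have e: "of_real (Y T * ?I T) * cis (T \<phi>) = complex_of_real (Y T * ?I T * cos (T \<phi>)) + \<i> * complex_of_real (Y T * ?I T * sin (T \<phi>))" for T
        by (simp add: complex_eq_iff)
      show "(LINT T|\<mu>. of_real (Y T * ?I T) * cis (T \<phi>)) = (LINT T|\<nu>. of_real (Y T * ?I T) * cis (T \<phi>))"
        unfolding e using j\<mu> j\<nu> cc ss
        by (subst (1 2) Bochner_Integration.integral_add) (auto simp del: of_real_mult)
    qed
  qed
  define Yl where "Yl l T = (\<Prod>p\<leftarrow>l. indicator (snd p) (T (fst p)) :: real)" for l and T :: "'n distn"
  have gl: "good (Yl l)" if "l \<in> lists ({\<phi>. test_function \<phi>} \<times> sets borel)" for l
    using that
  proof (induction l)
    case Nil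
    then show ?case using char by (simp add: good_def Yl_def[abs_def])
  next
    case (Cons p l)
    have "Yl (p # l) = (\<lambda>T. Yl l T * indicator (snd p) (T (fst p)))" by (simp add: Yl_def fun_eq_iff)
    then show ?case using step[OF Cons.IH, of "fst p" "snd p"] Cons.hyps by auto
  qed
  show ?thesis
  proof (rule measure_eqI_generator_eq[OF Int_stable_cylinders cylinders_subset])
    fix C assume "C \<in> (cylinders :: 'n distn set set)"
    then obtain l where l: "l \<in> lists ({\<phi>. test_function \<phi>} \<times> sets borel)" "C = cylinder l"
      by (auto simp: cylinders_def)
    have CS: "C \<in> sets \<mu>" "C \<in> sets \<nu>" using \<open>C \<in> cylinders\<close> by (auto simp: sets sets_dspace)
    have Yi: "Yl l T = indicator C T" if "distribution T" for T
      unfolding l(2) Yl_def using that by (induction l) (auto simp: cylinder_def indicator_def)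
    have cz: "cis (T (\<lambda>x. 0)) = 1" if "distribution T" for T :: "'n distn"
      unfolding distribution_zero[OF that] by simp
    have "of_real (LINT T|\<mu>. Yl l T) = (of_real (LINT T|\<nu>. Yl l T) :: complex)"
    proof -
      have "(LINT T|\<mu>. of_real (Yl l T) * cis (T (\<lambda>x. 0))) = (LINT T|\<nu>. of_real (Yl l T) * cis (T (\<lambda>x. 0)))"
        using gl[OF l(1)] test_zero unfolding good_def by blast
      moreover have "(LINT T|\<mu>. of_real (Yl l T) * cis (T (\<lambda>x. 0))) = (LINT T|\<mu>. of_real (Yl l T))"
        "(LINT T|\<nu>. of_real (Yl l T) * cis (T (\<lambda>x. 0))) = (LINT T|\<nu>. of_real (Yl l T))"
        by (rule Bochner_Integration.integral_cong; simp add: sp cz)+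
      ultimately show ?thesis by simp
    qed
    then have "(LINT T|\<mu>. Yl l T) = (LINT T|\<nu>. Yl l T)" by (simp only: of_real_eq_iff)
    moreover have "(LINT T|\<mu>. Yl l T) = (LINT T|\<mu>. indicator C T)" "(LINT T|\<nu>. Yl l T) = (LINT T|\<nu>. indicator C T)"
      by (rule Bochner_Integration.integral_cong; use sp Yi in auto)+
    ultimately have "measure \<mu> C = measure \<nu> C" using CS sets.sets_into_space[OF CS(1)] sets.sets_into_space[OF CS(2)]
      by (simp add: Int_absorb1 Int_absorb2)
    then show "emeasure \<mu> C = emeasure \<nu> C" by (simp add: \<mu>.emeasure_eq_measure \<nu>.emeasure_eq_measure)
  next
    show "range (\<lambda>_::nat. {T. distribution T}) \<subseteq> (cylinders :: 'n distn set set)"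
      unfolding cylinders_def by (auto simp: cylinder_def intro!: image_eqI[of _ _ "[]"])
  qed (auto simp: sets sets_dspace)
qed

section \<open>White noise: translations and shifts\<close>

abbreviation ip :: "(real^'n::finite \<Rightarrow> real) \<Rightarrow> (real^'n \<Rightarrow> real) \<Rightarrow> real" where
  "ip \<phi> \<psi> \<equiv> (LINT x|lborel. \<phi> x * \<psi> x)"

lemma ip_integrable:
  fixes \<phi> \<psi> :: "real^'n::finite \<Rightarrow> real"
  assumes "test_function \<phi>" "test_function \<psi>"
  shows "integrable lborel (\<lambda>x. \<phi> x * \<psi> x)"
proof -
  obtain r where r: "\<And>x. norm x > r \<Longrightarrow> \<phi> x = 0" using test_radius[OF assms(1)] by metis
  show ?thesis
    by (rule integrable_continuous_support[where r=r])
      (use r in \<open>auto intro!: continuous_intros test_continuous[OF assms(1)] test_continuous[OF assms(2)]\<close>)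
qed

lemma test_integrable:
  fixes \<phi> :: "real^'n::finite \<Rightarrow> real"
  assumes "test_function \<phi>" shows "integrable lborel \<phi>"
proof -
  obtain r where r: "\<And>x. norm x > r \<Longrightarrow> \<phi> x = 0" using test_radius[OF assms(1)] by metis
  show ?thesis
    by (rule integrable_continuous_support[where r=r, OF test_continuous[OF assms]]) (rule r)
qed

lemma ip_lincomb:
  assumes "test_function \<phi>" "test_function \<psi>" "test_function \<zeta>"
  shows "ip (\<lambda>x. a * \<phi> x + b * \<psi> x) \<zeta> = a * ip \<phi> \<zeta> + b * ip \<psi> \<zeta>"
    and "ip \<zeta> (\<lambda>x. a * \<phi> x + b * \<psi> x) = a * ip \<zeta> \<phi> + b * ip \<zeta> \<psi>"
  using ip_integrable[OF assms(1,3)] ip_integrable[OF assms(2,3)] ip_integrable[OF assms(3,1)] ip_integrable[OF assms(3,2)]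
  by (simp_all add: distrib_left distrib_right mult.assoc mult.left_commute)

lemma ip_commute: "ip \<phi> \<psi> = ip \<psi> \<phi>" by (simp add: mult.commute)

lemma ip_lincomb_self:
  assumes "test_function \<phi>" "test_function \<psi>"
  shows "ip (\<lambda>x. a * \<phi> x + b * \<psi> x) (\<lambda>x. a * \<phi> x + b * \<psi> x) = a\<^sup>2 * ip \<phi> \<phi> + 2 * a * b * ip \<phi> \<psi> + b\<^sup>2 * ip \<psi> \<psi>"
proof -
  have "ip (\<lambda>x. a * \<phi> x + b * \<psi> x) (\<lambda>x. a * \<phi> x + b * \<psi> x)
    = a * (a * ip \<phi> \<phi> + b * ip \<phi> \<psi>) + b * (a * ip \<psi> \<phi> + b * ip \<psi> \<psi>)"
    by (simp only: ip_lincomb[OF assms test_lincomb[OF assms]] ip_lincomb[OF assms assms(1)] ip_lincomb[OF assms assms(2)])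
  then show ?thesis by (simp add: ip_commute[of \<psi> \<phi>] algebra_simps power2_eq_square)
qed

text \<open>For the distribution of a function \<open>g\<close> this is the distribution of \<open>g (\<cdot> - c)\<close>.\<close>

definition distn_translate :: "real^'n::finite \<Rightarrow> 'n distn \<Rightarrow> 'n distn" where
  "distn_translate c T \<phi> = T (\<lambda>x. \<phi> (x + c))"

definition distn_minus :: "(real^'n::finite \<Rightarrow> real) \<Rightarrow> 'n distn \<Rightarrow> 'n distn" where
  "distn_minus h T \<phi> = T \<phi> - ip h \<phi>"

lemma test_translate_plus: "test_function \<phi> \<Longrightarrow> test_function (\<lambda>x. \<phi> (x + c))"
  using test_translate[of \<phi> "-c"] by simp

lemma pds_translate:
  "test_function \<phi> \<Longrightarrow> pds is (\<lambda>x. \<phi> (x + c)) x = pds is \<phi> (x + c)"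
  using pds_affine[OF test_smooth, of \<phi> "is" c 1] by (simp add: add.commute)

lemma distribution_distn_translate:
  assumes T: "distribution T" shows "distribution (distn_translate c T)"
  unfolding distribution_def
proof (intro conjI allI impI)
  fix \<phi> \<psi> :: "real^'a \<Rightarrow> real" and a b assume "test_function \<phi>" "test_function \<psi>"
  then show "distn_translate c T (\<lambda>x. a * \<phi> x + b * \<psi> x) = a * distn_translate c T \<phi> + b * distn_translate c T \<psi>"
    unfolding distn_translate_def by (intro distribution_linear[OF T] test_translate_plus)
next
  fix K :: "(real^'a) set" assume K: "compact K"
  define K' where "K' = (\<lambda>x. x - c) ` K"
  have K': "compact K'" unfolding K'_def by (intro compact_continuous_image K continuous_intros)
  obtain A m where A: "\<And>\<phi> B. test_function \<phi> \<Longrightarrow> support \<phi> \<subseteq> K' \<Longrightarrow>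
        (\<forall>is x. length is \<le> m \<longrightarrow> \<bar>pds is \<phi> x\<bar> \<le> B) \<Longrightarrow> \<bar>T \<phi>\<bar> \<le> A * B"
    using T K' unfolding distribution_def by metis
  show "\<exists>A m. \<forall>\<phi> B. test_function \<phi> \<longrightarrow> support \<phi> \<subseteq> K \<longrightarrow>
        (\<forall>is x. length is \<le> m \<longrightarrow> \<bar>pds is \<phi> x\<bar> \<le> B) \<longrightarrow> \<bar>distn_translate c T \<phi>\<bar> \<le> A * B"
  proof (intro exI[of _ A] exI[of _ m] allI impI)
    fix \<phi> :: "real^'a \<Rightarrow> real" and B assume \<phi>: "test_function \<phi>" "support \<phi> \<subseteq> K" "\<forall>is x. length is \<le> m \<longrightarrow> \<bar>pds is \<phi> x\<bar> \<le> B"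
    show "\<bar>distn_translate c T \<phi>\<bar> \<le> A * B"
      unfolding distn_translate_def
    proof (rule A)
      show "support (\<lambda>x. \<phi> (x + c)) \<subseteq> K'"
      proof (rule support_subsetI[OF compact_imp_closed[OF K']])
        fix x assume "x \<notin> K'"
        then have "x + c \<notin> K" unfolding K'_def by (metis add_diff_cancel image_eqI)
        then show "\<phi> (x + c) = 0" using \<phi>(2) by (intro not_in_support) auto
      qed
    qed (use \<phi> in \<open>auto simp: pds_translate intro: test_translate_plus\<close>)
  qed
qed

lemma distribution_distn_minus:
  assumes T: "distribution T" and h: "test_function h" shows "distribution (distn_minus h T)"
  unfolding distribution_def
proof (intro conjI allI impI)
  fix \<phi> \<psi> :: "real^'a \<Rightarrow> real" and a b assume t: "test_function \<phi>" "test_function \<psi>"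
  show "distn_minus h T (\<lambda>x. a * \<phi> x + b * \<psi> x) = a * distn_minus h T \<phi> + b * distn_minus h T \<psi>"
    unfolding distn_minus_def distribution_linear[OF T t] ip_lincomb(2)[OF t h] by (simp only: algebra_simps)
next
  fix K :: "(real^'a) set" assume K: "compact K"
  obtain A m where A: "\<And>\<phi> B. test_function \<phi> \<Longrightarrow> support \<phi> \<subseteq> K \<Longrightarrow>
        (\<forall>is x. length is \<le> m \<longrightarrow> \<bar>pds is \<phi> x\<bar> \<le> B) \<Longrightarrow> \<bar>T \<phi>\<bar> \<le> A * B"
    using T K unfolding distribution_def by metis
  show "\<exists>A m. \<forall>\<phi> B. test_function \<phi> \<longrightarrow> support \<phi> \<subseteq> K \<longrightarrow>
        (\<forall>is x. length is \<le> m \<longrightarrow> \<bar>pds is \<phi> x\<bar> \<le> B) \<longrightarrow> \<bar>distn_minus h T \<phi>\<bar> \<le> A * B"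
  proof (intro exI[of _ "A + (LINT x|lborel. \<bar>h x\<bar>)"] exI[of _ m] allI impI)
    fix \<phi> :: "real^'a \<Rightarrow> real" and B assume \<phi>: "test_function \<phi>" "support \<phi> \<subseteq> K" "\<forall>is x. length is \<le> m \<longrightarrow> \<bar>pds is \<phi> x\<bar> \<le> B"
    have b: "\<bar>\<phi> x\<bar> \<le> B" for x using \<phi>(3)[rule_format, of "[]" x] by simp
    have "\<bar>ip h \<phi>\<bar> \<le> (LINT x|lborel. \<bar>h x * \<phi> x\<bar>)" by (rule integral_abs_bound)
    also have "\<dots> \<le> (LINT x|lborel. \<bar>h x\<bar> * B)"
      by (intro integral_mono integrable_abs ip_integrable h \<phi> integrable_mult_left test_integrable)
        (simp add: abs_mult mult_left_mono b)
    finally have "\<bar>ip h \<phi>\<bar> \<le> (LINT x|lborel. \<bar>h x\<bar>) * B" by simp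
    moreover have "\<bar>T \<phi>\<bar> \<le> A * B" by (rule A[OF \<phi>])
    ultimately show "\<bar>distn_minus h T \<phi>\<bar> \<le> (A + (LINT x|lborel. \<bar>h x\<bar>)) * B"
      unfolding distn_minus_def distrib_right by linarith
  qed
qed

lemma white_noiseD:
  assumes "white_noise M \<xi>"
  shows "\<And>\<omega>. \<omega> \<in> space M \<Longrightarrow> distribution (\<xi> \<omega>)"
    "\<And>\<phi>. test_function \<phi> \<Longrightarrow> (\<lambda>\<omega>. \<xi> \<omega> \<phi>) \<in> borel_measurable M"
    "\<And>\<phi>. test_function \<phi> \<Longrightarrow> centred_gaussian M (\<lambda>\<omega>. \<xi> \<omega> \<phi>)"
    "\<And>\<phi>. test_function \<phi> \<Longrightarrow> (LINT \<omega>|M. (\<xi> \<omega> \<phi>)\<^sup>2) = ip \<phi> \<phi>"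
    "\<xi> \<in> measurable M dspace"
proof -
  show 1: "\<And>\<omega>. \<omega> \<in> space M \<Longrightarrow> distribution (\<xi> \<omega>)"
    and 3: "\<And>\<phi>. test_function \<phi> \<Longrightarrow> centred_gaussian M (\<lambda>\<omega>. \<xi> \<omega> \<phi>)"
    and "\<And>\<phi>. test_function \<phi> \<Longrightarrow> (LINT \<omega>|M. (\<xi> \<omega> \<phi>)\<^sup>2) = ip \<phi> \<phi>"
    using assms by (simp_all add: white_noise_def power2_eq_square)
  show 2: "\<And>\<phi>. test_function \<phi> \<Longrightarrow> (\<lambda>\<omega>. \<xi> \<omega> \<phi>) \<in> borel_measurable M"
    using 3 by (simp add: centred_gaussian_def)
  show "\<xi> \<in> measurable M dspace" by (rule measurable_dspaceI[OF 1 2])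
qed

lemma (in prob_space) white_noise_char:
  assumes "white_noise M \<xi>" "test_function \<phi>"
  shows "expectation (\<lambda>\<omega>. cis (\<xi> \<omega> \<phi>)) = complex_of_real (exp (- ip \<phi> \<phi> / 2))"
  using centred_gaussian_moments(1)[OF white_noiseD(3)[OF assms] white_noiseD(4)[OF assms, symmetric]] .

lemma white_noise_law_unique:
  fixes \<xi> :: "'w \<Rightarrow> 'n::finite distn"
  assumes M: "prob_space M" "white_noise M \<xi>" and K: "prob_space K" and f: "f \<in> measurable K dspace"
    and char: "\<And>\<phi>. test_function \<phi> \<Longrightarrow> (LINT \<omega>|K. cis (f \<omega> \<phi>)) = complex_of_real (exp (- ip \<phi> \<phi> / 2))"
  shows "distr K dspace f = distr M dspace \<xi>"
proof (rule dspace_measure_unique)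
  show "finite_measure (distr K dspace f)" "finite_measure (distr M dspace \<xi>)"
    using prob_space.prob_space_distr[OF K f] prob_space.prob_space_distr[OF M(1) white_noiseD(5)[OF M(2)]]
    by (auto simp: prob_space_def)
  fix \<phi> :: "real^'n \<Rightarrow> real" assume \<phi>: "test_function \<phi>"
  have [measurable]: "(\<lambda>T. T \<phi>) \<in> borel_measurable dspace" using \<phi> by measurable
  show "(LINT T|distr K dspace f. cis (T \<phi>)) = (LINT T|distr M dspace \<xi>. cis (T \<phi>))"
    using char[OF \<phi>] prob_space.white_noise_char[OF M \<phi>] by (simp add: integral_distr f white_noiseD(5)[OF M(2)])
qed auto

lemma cis_diff_eq: "cis (a - b) = cis a * cnj (cis b)"
  by (simp add: complex_eq_iff cos_diff sin_diff)

text \<open>Ergodicity under translations. For far apart translates \<open>\<phi>\<^sub>n\<close> of a test function the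
  variables \<open>exp (i \<xi>(\<phi>\<^sub>n)) - E exp (i \<xi>(\<phi>))\<close> are orthogonal and bounded, and an invariant event has
  the same covariance with each of them; so these covariances vanish, the law of the noise
  conditioned on the event is the unconditioned one, and the event is independent of itself.\<close>

theorem (in prob_space) white_noise_zero_one:
  fixes \<xi> :: "'a \<Rightarrow> 'n::finite distn"
  assumes wn: "white_noise M \<xi>" and G[measurable]: "G \<in> sets dspace"
    and inv: "\<And>T c. distribution T \<Longrightarrow> distn_translate c T \<in> G \<longleftrightarrow> T \<in> G"
  shows "prob {\<omega>\<in>space M. \<xi> \<omega> \<in> G} = 0 \<or> prob {\<omega>\<in>space M. \<xi> \<omega> \<in> G} = 1"
proof -
  note D = white_noiseD[OF wn]
  have \<xi>m[measurable]: "\<xi> \<in> measurable M dspace" by (rule D(5))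
  define p where "p = prob {\<omega>\<in>space M. \<xi> \<omega> \<in> G}"
  have Gm: "{\<omega>\<in>space M. \<xi> \<omega> \<in> G} \<in> events" by measurable
  have tm[measurable]: "(\<lambda>\<omega>. distn_translate c (\<xi> \<omega>)) \<in> measurable M dspace" for c
  proof (rule measurable_dspaceI)
    show "distribution (distn_translate c (\<xi> \<omega>))" if "\<omega> \<in> space M" for \<omega> by (rule distribution_distn_translate[OF D(1)[OF that]])
    show "(\<lambda>\<omega>. distn_translate c (\<xi> \<omega>) \<phi>) \<in> borel_measurable M" if "test_function \<phi>" for \<phi>
      unfolding distn_translate_def by (rule D(2)[OF test_translate_plus[OF that]])
  qed
  have ipt: "ip (\<lambda>x. \<phi> (x + c)) (\<lambda>x. \<phi> (x + c)) = ip \<phi> \<phi>" if \<phi>: "test_function \<phi>" for \<phi> :: "real^'n \<Rightarrow> real" and c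
    using lborel_integral_translate[of "\<lambda>x. \<phi> x * \<phi> x" c] test_measurable[OF \<phi>] by simp
  have law: "distr M dspace (\<lambda>\<omega>. distn_translate c (\<xi> \<omega>)) = distr M dspace \<xi>" for c
  proof (rule white_noise_law_unique[OF prob_space_axioms wn prob_space_axioms tm])
    fix \<phi> :: "real^'n \<Rightarrow> real" assume \<phi>: "test_function \<phi>"
    show "(LINT \<omega>|M. cis (distn_translate c (\<xi> \<omega>) \<phi>)) = complex_of_real (exp (- ip \<phi> \<phi> / 2))"
      unfolding distn_translate_def using white_noise_char[OF wn test_translate_plus[OF \<phi>, of c]] ipt[OF \<phi>] by simp
  qed
  have key: "expectation (\<lambda>\<omega>. indicator G (\<xi> \<omega>) * cis (\<xi> \<omega> \<phi>)) = of_real p * of_real (exp (- ip \<phi> \<phi> / 2))"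
    if \<phi>: "test_function \<phi>" for \<phi>
  proof -
    have ev[measurable]: "(\<lambda>T. T \<phi>) \<in> borel_measurable dspace" using \<phi> by measurable
    define \<kappa> where "\<kappa> = exp (- ip \<phi> \<phi> / 2)"
    have same: "expectation (\<lambda>\<omega>. indicator G (\<xi> \<omega>) * cis (\<xi> \<omega> \<phi>)) = expectation (\<lambda>\<omega>. indicator G (\<xi> \<omega>) * cis (\<xi> \<omega> (\<lambda>x. \<phi> (x + c))))" for c
    proof -
      have "expectation (\<lambda>\<omega>. indicator G (\<xi> \<omega>) * cis (\<xi> \<omega> \<phi>)) = (LINT T|distr M dspace \<xi>. indicator G T * cis (T \<phi>))"
        by (subst integral_distr) auto
      also have "\<dots> = expectation (\<lambda>\<omega>. indicator G (distn_translate c (\<xi> \<omega>)) * cis (distn_translate c (\<xi> \<omega>) \<phi>))"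
        unfolding law[of c, symmetric] by (subst integral_distr) auto
      also have "\<dots> = expectation (\<lambda>\<omega>. indicator G (\<xi> \<omega>) * cis (\<xi> \<omega> (\<lambda>x. \<phi> (x + c))))"
        by (rule Bochner_Integration.integral_cong) (use inv[OF D(1)] in \<open>auto simp: indicator_def distn_translate_def\<close>)
      finally show ?thesis .
    qed
    obtain r where r: "0 < r" "\<And>x. norm x > r \<Longrightarrow> \<phi> x = 0" using test_radius[OF \<phi>] by metis
    (* Translates of \<phi> by distinct multiples of e have disjoint supports. Any unit vector does. *)
    define e :: "real^'n" where "e = (2 * r + 1) *\<^sub>R axis undefined 1"
    have ne: "norm e = 2 * r + 1" using r(1) by (simp add: e_def)
    define f where "f n x = \<phi> (x + real n *\<^sub>R e)" for n x
    have tf: "test_function (f n)" for n unfolding f_def by (rule test_translate_plus[OF \<phi>])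
    have ff: "ip (f n) (f n) = ip \<phi> \<phi>" for n unfolding f_def by (rule ipt[OF \<phi>])
    have fo: "ip (f n) (f m) = 0" if nm: "n \<noteq> m" for n m
    proof -
      have "f n x * f m x = 0" for x
      proof (rule ccontr)
        assume "f n x * f m x \<noteq> 0"
        then have "norm (x + real n *\<^sub>R e) \<le> r" "norm (x + real m *\<^sub>R e) \<le> r"
          using r(2) by (auto simp: f_def not_less[symmetric])
        then have "norm ((x + real n *\<^sub>R e) - (x + real m *\<^sub>R e)) \<le> 2 * r" using norm_triangle_ineq4 by (smt (verit))
        then have "\<bar>real n - real m\<bar> * (2 * r + 1) \<le> 2 * r" by (simp add: ne flip: scaleR_diff_left)
        moreover have "1 \<le> \<bar>real n - real m\<bar>" using nm by linarith
        then have "1 * (2 * r + 1) \<le> \<bar>real n - real m\<bar> * (2 * r + 1)" using r(1) by (intro mult_right_mono) auto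
        ultimately show False by simp
      qed
      then have "(\<lambda>x. f n x * f m x) = (\<lambda>x. 0)" by (rule ext)
      then show ?thesis by (simp only: Bochner_Integration.integral_zero)
    qed
    define Y where "Y n \<omega> = cis (\<xi> \<omega> (f n)) - of_real \<kappa>" for n \<omega>
    have fm[measurable]: "(\<lambda>\<omega>. \<xi> \<omega> (f n)) \<in> borel_measurable M" for n by (rule D(2)[OF tf])
    have Ym[measurable]: "Y n \<in> borel_measurable M" for n unfolding Y_def by measurable
    have k01: "0 \<le> \<kappa>" "\<kappa> \<le> 1" by (auto simp: \<kappa>_def)
    have Yb: "cmod (Y n \<omega>) \<le> 2" for n \<omega>
      unfolding Y_def using norm_triangle_ineq4[of "cis (\<xi> \<omega> (f n))" "of_real \<kappa>"] k01 by simp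
    have iY: "integrable M (Y n)" for n by (rule integrable_const_bound[where B=2]) (use Yb in auto)
    have iYY: "integrable M (\<lambda>\<omega>. Y n \<omega> * cnj (Y m \<omega>))" for n m
    proof (rule integrable_const_bound[where B=4])
      show "AE \<omega> in M. cmod (Y n \<omega> * cnj (Y m \<omega>)) \<le> 4"
        using mult_mono[OF Yb Yb] by (intro AE_I2) (force simp: norm_mult)
    qed measurable
    have cov: "expectation (\<lambda>\<omega>. Y n \<omega> * cnj (Y m \<omega>)) = (if n = m then of_real (1 - \<kappa>\<^sup>2) else 0)" for n m
    proof -
      have ce: "expectation (\<lambda>\<omega>. cis (\<xi> \<omega> (f n))) = of_real \<kappa>" for n
        using white_noise_char[OF wn tf[of n]] by (simp add: ff \<kappa>_def)
      have ic: "integrable M (\<lambda>\<omega>. cis (\<xi> \<omega> (f n)))" for n by (rule integrable_const_bound[where B=1]) auto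
      have tl: "test_function (\<lambda>x. 1 * f n x + (-1) * f m x)" by (intro test_lincomb tf)
      have "\<xi> \<omega> (\<lambda>x. 1 * f n x + (-1) * f m x) = \<xi> \<omega> (f n) - \<xi> \<omega> (f m)" if "\<omega> \<in> space M" for \<omega>
        using distribution_linear[OF D(1)[OF that] tf tf, of 1 n "-1" m] by simp
      then have "expectation (\<lambda>\<omega>. cis (\<xi> \<omega> (f n) - \<xi> \<omega> (f m))) = expectation (\<lambda>\<omega>. cis (\<xi> \<omega> (\<lambda>x. 1 * f n x + (-1) * f m x)))"
        by (intro Bochner_Integration.integral_cong refl) auto
      also have "\<dots> = complex_of_real (exp (- ip (\<lambda>x. 1 * f n x + (-1) * f m x) (\<lambda>x. 1 * f n x + (-1) * f m x) / 2))"
        by (rule white_noise_char[OF wn tl])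
      also have "ip (\<lambda>x. 1 * f n x + (-1) * f m x) (\<lambda>x. 1 * f n x + (-1) * f m x) = (if n = m then 0 else 2 * ip \<phi> \<phi>)"
        unfolding ip_lincomb_self[OF tf tf] using fo[of n m] by (auto simp: ff)
      also have "exp (- (if n = m then 0 else 2 * ip \<phi> \<phi>) / 2) = (if n = m then 1 else \<kappa>\<^sup>2)"
        by (simp add: \<kappa>_def power2_eq_square flip: exp_add)
      finally have cc: "expectation (\<lambda>\<omega>. cis (\<xi> \<omega> (f n) - \<xi> \<omega> (f m))) = of_real (if n = m then 1 else \<kappa>\<^sup>2)" .
      have id: "integrable M (\<lambda>\<omega>. cis (\<xi> \<omega> (f n) - \<xi> \<omega> (f m)))" by (rule integrable_const_bound[where B=1]) auto
      have im: "integrable M (\<lambda>\<omega>. cnj (cis (\<xi> \<omega> (f m))))" by (rule integrable_const_bound[where B=1]) auto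
      have "Y n \<omega> * cnj (Y m \<omega>) = cis (\<xi> \<omega> (f n) - \<xi> \<omega> (f m)) - of_real \<kappa> * cis (\<xi> \<omega> (f n)) - of_real \<kappa> * cnj (cis (\<xi> \<omega> (f m))) + of_real (\<kappa>\<^sup>2)" for \<omega>
        unfolding Y_def cis_diff_eq by (simp add: algebra_simps power2_eq_square del: cis_cnj)
      then have "expectation (\<lambda>\<omega>. Y n \<omega> * cnj (Y m \<omega>)) = of_real (if n = m then 1 else \<kappa>\<^sup>2) - of_real \<kappa> * of_real \<kappa> - of_real \<kappa> * cnj (of_real \<kappa>) + of_real (\<kappa>\<^sup>2)"
        using ic[of n] id im by (simp add: cc ce prob_space del: cnj.simps complex_cnj_complex_of_real cis_cnj)
      then show ?thesis by (simp add: power2_eq_square)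
    qed
    define a where "a = expectation (\<lambda>\<omega>. indicator G (\<xi> \<omega>) * Y 0 \<omega>)"
    have Gi[measurable]: "(\<lambda>\<omega>. indicator G (\<xi> \<omega>) :: complex) \<in> borel_measurable M" by measurable
    have iGc: "integrable M (\<lambda>\<omega>. indicator G (\<xi> \<omega>) * cis (\<xi> \<omega> (f n)))" for n
      by (rule integrable_const_bound[where B=1]) (auto simp: norm_mult indicator_def)
    have iG: "integrable M (\<lambda>\<omega>. indicator G (\<xi> \<omega>) :: complex)"
      by (rule integrable_const_bound[where B=1]) (auto simp: indicator_def)
    have iGY: "integrable M (\<lambda>\<omega>. indicator G (\<xi> \<omega>) * Y n \<omega>)" for n
      by (rule integrable_const_bound[where B=2]) (use Yb in \<open>auto simp: norm_mult indicator_def\<close>)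
    have EG: "expectation (\<lambda>\<omega>. indicator G (\<xi> \<omega>)) = complex_of_real p"
    proof -
      have "expectation (\<lambda>\<omega>. indicator G (\<xi> \<omega>) :: complex) = expectation (\<lambda>\<omega>. of_real (indicator {\<omega>\<in>space M. \<xi> \<omega> \<in> G} \<omega>))"
        by (rule Bochner_Integration.integral_cong) (auto simp: indicator_def)
      then show ?thesis using Gm by (simp add: p_def)
    qed
    have aY: "expectation (\<lambda>\<omega>. indicator G (\<xi> \<omega>) * Y n \<omega>) = expectation (\<lambda>\<omega>. indicator G (\<xi> \<omega>) * cis (\<xi> \<omega> \<phi>)) - of_real p * of_real \<kappa>" for n
    proof -
      have "expectation (\<lambda>\<omega>. indicator G (\<xi> \<omega>) * Y n \<omega>) = expectation (\<lambda>\<omega>. indicator G (\<xi> \<omega>) * cis (\<xi> \<omega> (f n)) - indicator G (\<xi> \<omega>) * of_real \<kappa>)"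
        by (simp add: Y_def right_diff_distrib)
      also have "\<dots> = expectation (\<lambda>\<omega>. indicator G (\<xi> \<omega>) * cis (\<xi> \<omega> (f n))) - of_real p * of_real \<kappa>"
        by (subst Bochner_Integration.integral_diff) (use iGc iG EG in auto)
      also have "expectation (\<lambda>\<omega>. indicator G (\<xi> \<omega>) * cis (\<xi> \<omega> (f n))) = expectation (\<lambda>\<omega>. indicator G (\<xi> \<omega>) * cis (\<xi> \<omega> \<phi>))"
        unfolding f_def[abs_def] by (rule same[symmetric])
      finally show ?thesis .
    qed
    (* Bessel's inequality: the indicator of the event has the same inner product a with each of the
       orthogonal variables Y n. *)
    have bound: "real N * (cmod a)\<^sup>2 \<le> 1" for N
    proof (cases "N = 0")
      case False
      define S where "S \<omega> = (\<Sum>n<N. Y n \<omega>)" for \<omega>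
      have Sm[measurable]: "S \<in> borel_measurable M" unfolding S_def by measurable
      have Sb: "cmod (S \<omega>) \<le> 2 * real N" for \<omega>
        unfolding S_def using sum_norm_le[of "{..<N}" "\<lambda>n. Y n \<omega>" "\<lambda>_. 2"] Yb by (simp add: mult.commute)
      have iS: "integrable M (\<lambda>\<omega>. cmod (S \<omega>))" by (rule integrable_const_bound[where B="2 * real N"]) (use Sb in auto)
      have iS2: "integrable M (\<lambda>\<omega>. (cmod (S \<omega>))\<^sup>2)"
        by (rule integrable_const_bound[where B="(2 * real N)\<^sup>2"]) (use power_mono[OF Sb norm_ge_zero, of _ 2] in auto)
      have "complex_of_real (expectation (\<lambda>\<omega>. (cmod (S \<omega>))\<^sup>2)) = expectation (\<lambda>\<omega>. S \<omega> * cnj (S \<omega>))"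
        by (simp only: complex_norm_square[symmetric] integral_complex_of_real)
      also have "\<dots> = expectation (\<lambda>\<omega>. \<Sum>n<N. \<Sum>m<N. Y n \<omega> * cnj (Y m \<omega>))"
        by (simp add: S_def sum_product)
      also have "\<dots> = (\<Sum>n<N. \<Sum>m<N. expectation (\<lambda>\<omega>. Y n \<omega> * cnj (Y m \<omega>)))"
        using iYY by simp
      also have "\<dots> = (\<Sum>n<N. of_real (1 - \<kappa>\<^sup>2))" by (simp add: cov)
      also have "\<dots> = of_real (real N * (1 - \<kappa>\<^sup>2))" by simp
      finally have ES: "expectation (\<lambda>\<omega>. (cmod (S \<omega>))\<^sup>2) = real N * (1 - \<kappa>\<^sup>2)" by (simp only: of_real_eq_iff)
      have "of_nat N * a = (\<Sum>n<N. expectation (\<lambda>\<omega>. indicator G (\<xi> \<omega>) * Y n \<omega>))" by (simp add: a_def aY)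
      also have "\<dots> = expectation (\<lambda>\<omega>. indicator G (\<xi> \<omega>) * S \<omega>)"
        unfolding S_def sum_distrib_left by (rule Bochner_Integration.integral_sum[symmetric]) (rule iGY)
      finally have "real N * cmod a = cmod (expectation (\<lambda>\<omega>. indicator G (\<xi> \<omega>) * S \<omega>))"
        by (metis norm_mult norm_of_nat)
      also have "\<dots> \<le> expectation (\<lambda>\<omega>. cmod (indicator G (\<xi> \<omega>) * S \<omega>))" by (rule integral_norm_bound)
      also have "\<dots> \<le> expectation (\<lambda>\<omega>. cmod (S \<omega>))"
      proof (rule integral_mono[OF _ iS])
        show "integrable M (\<lambda>\<omega>. cmod (indicator G (\<xi> \<omega>) * S \<omega>))"
          by (rule Bochner_Integration.integrable_bound[OF iS]) (auto simp: norm_mult indicator_def)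
      qed (auto simp: norm_mult indicator_def)
      finally have 1: "real N * cmod a \<le> expectation (\<lambda>\<omega>. cmod (S \<omega>))" .
      have "0 \<le> variance (\<lambda>\<omega>. cmod (S \<omega>))" by (rule variance_positive)
      also have "\<dots> = expectation (\<lambda>\<omega>. (cmod (S \<omega>))\<^sup>2) - (expectation (\<lambda>\<omega>. cmod (S \<omega>)))\<^sup>2"
        by (rule variance_eq[OF iS iS2])
      finally have 2: "(expectation (\<lambda>\<omega>. cmod (S \<omega>)))\<^sup>2 \<le> real N * (1 - \<kappa>\<^sup>2)" by (simp add: ES)
      have "(real N * cmod a)\<^sup>2 \<le> (expectation (\<lambda>\<omega>. cmod (S \<omega>)))\<^sup>2" by (rule power_mono[OF 1]) simp
      also have "\<dots> \<le> real N * (1 - \<kappa>\<^sup>2)" by (rule 2)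
      also have "\<dots> \<le> real N * 1" by (intro mult_left_mono) auto
      finally have "real N * (real N * (cmod a)\<^sup>2) \<le> real N * 1" by (simp add: power2_eq_square mult_ac)
      then show ?thesis using False by simp
    qed simp
    have "a = 0"
    proof (rule ccontr)
      assume "a \<noteq> 0"
      then have "0 < (cmod a)\<^sup>2" by simp
      then obtain N where "1 < real N * (cmod a)\<^sup>2" using reals_Archimedean3 by blast
      then show False using bound[of N] by simp
    qed
    then show ?thesis using aY[of 0] by (simp add: a_def \<kappa>_def)
  qed
  have p01: "0 \<le> p" by (simp add: p_def)
  (* The law of the noise restricted to the event, and p times the law of the noise. *)
  define \<mu> where "\<mu> = distr (density M (\<lambda>\<omega>. ennreal (indicator G (\<xi> \<omega>)))) dspace \<xi>"
  define \<nu> where "\<nu> = distr (density M (\<lambda>\<omega>. ennreal p)) dspace \<xi>"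
  have em\<mu>: "emeasure \<mu> A = (\<integral>\<^sup>+\<omega>. ennreal (indicator G (\<xi> \<omega>)) * indicator A (\<xi> \<omega>) \<partial>M)" if [measurable]: "A \<in> sets dspace" for A
    unfolding \<mu>_def by (simp add: emeasure_distr emeasure_density) (auto intro!: nn_integral_cong simp: indicator_def)
  have em\<nu>: "emeasure \<nu> A = (\<integral>\<^sup>+\<omega>. ennreal p * indicator A (\<xi> \<omega>) \<partial>M)" if [measurable]: "A \<in> sets dspace" for A
    unfolding \<nu>_def by (simp add: emeasure_distr emeasure_density) (auto intro!: nn_integral_cong simp: indicator_def)
  have "\<mu> = \<nu>"
  proof (rule dspace_measure_unique)
    show "finite_measure \<mu>"
    proof (rule finite_measureI)
      have "emeasure \<mu> (space dspace) \<le> (\<integral>\<^sup>+\<omega>. 1 \<partial>M)"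
        unfolding em\<mu>[OF sets.top] by (intro nn_integral_mono) (auto simp: indicator_def)
      then show "emeasure \<mu> (space \<mu>) \<noteq> \<infinity>" by (simp add: \<mu>_def emeasure_space_1 top_unique) (auto simp: top_unique)
    qed
    show "finite_measure \<nu>"
    proof (rule finite_measureI)
      have "emeasure \<nu> (space dspace) \<le> (\<integral>\<^sup>+\<omega>. ennreal p \<partial>M)"
        unfolding em\<nu>[OF sets.top] by (intro nn_integral_mono) (auto simp: indicator_def)
      then show "emeasure \<nu> (space \<nu>) \<noteq> \<infinity>" by (simp add: \<nu>_def emeasure_space_1 top_unique) (auto simp: top_unique)
    qed
    show "sets \<mu> = sets dspace" "sets \<nu> = sets dspace" by (auto simp: \<mu>_def \<nu>_def)
    fix \<phi> :: "real^'n \<Rightarrow> real" assume \<phi>: "test_function \<phi>"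
    have [measurable]: "(\<lambda>T. T \<phi>) \<in> borel_measurable dspace" using \<phi> by measurable
    have [measurable]: "(\<lambda>\<omega>. \<xi> \<omega> \<phi>) \<in> borel_measurable M" by (rule D(2)[OF \<phi>])
    have "(LINT T|\<mu>. cis (T \<phi>)) = expectation (\<lambda>\<omega>. (indicator G (\<xi> \<omega>) :: real) *\<^sub>R cis (\<xi> \<omega> \<phi>))"
      unfolding \<mu>_def by (simp add: integral_distr integral_density)
    also have "\<dots> = of_real p * of_real (exp (- ip \<phi> \<phi> / 2))"
      unfolding key[OF \<phi>, symmetric] by (rule Bochner_Integration.integral_cong) (auto simp: indicator_def)
    also have "\<dots> = (LINT T|\<nu>. cis (T \<phi>))"
      unfolding \<nu>_def using p01 by (simp add: integral_distr integral_density white_noise_char[OF wn \<phi>] scaleR_conv_of_real)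
    finally show "(LINT T|\<mu>. cis (T \<phi>)) = (LINT T|\<nu>. cis (T \<phi>))" .
  qed
  then have "emeasure \<mu> G = emeasure \<nu> G" by simp
  moreover have "emeasure \<mu> G = ennreal p"
  proof -
    have "emeasure \<mu> G = (\<integral>\<^sup>+\<omega>. indicator {\<omega>\<in>space M. \<xi> \<omega> \<in> G} \<omega> \<partial>M)"
      unfolding em\<mu>[OF G] by (intro nn_integral_cong) (auto simp: indicator_def)
    then show ?thesis using Gm by (simp add: p_def emeasure_eq_measure)
  qed
  moreover have "emeasure \<nu> G = ennreal (p * p)"
  proof -
    have "emeasure \<nu> G = (\<integral>\<^sup>+\<omega>. ennreal p * indicator {\<omega>\<in>space M. \<xi> \<omega> \<in> G} \<omega> \<partial>M)"
      unfolding em\<nu>[OF G] by (intro nn_integral_cong) (auto simp: indicator_def)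
    then show ?thesis using Gm p01 by (simp add: nn_integral_cmult p_def emeasure_eq_measure ennreal_mult)
  qed
  ultimately have "p = p * p" using p01 by simp
  then show ?thesis unfolding p_def[symmetric] by (metis mult_cancel_right1)
qed

text \<open>Cameron-Martin: tilting the measure by \<open>exp (\<xi>(h) - \<parallel>h\<parallel>\<^sup>2 / 2)\<close> turns \<open>\<xi> - h\<close> into a white noise.
  The characteristic functional under the tilted measure is computed by splitting a test function
  into its component along \<open>h\<close> and an orthogonal one, on which the noise is independent of \<open>\<xi>(h)\<close>.\<close>

lemma (in prob_space) cameron_martin_char:
  assumes wn: "white_noise M \<xi>" and h: "test_function h"
  shows "integrable M (\<lambda>\<omega>. exp (\<xi> \<omega> h - ip h h / 2))"
    and "\<And>\<phi>. test_function \<phi> \<Longrightarrow> expectation (\<lambda>\<omega>. exp (\<xi> \<omega> h - ip h h / 2) *\<^sub>R cis (\<xi> \<omega> \<phi>))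
      = cis (ip h \<phi>) * of_real (exp (- ip \<phi> \<phi> / 2))"
proof -
  note D = white_noiseD[OF wn]
  define v where "v = ip h h"
  define X where "X \<omega> = \<xi> \<omega> h" for \<omega>
  have Xm[measurable]: "X \<in> borel_measurable M" unfolding X_def by (rule D(2)[OF h])
  note mom = centred_gaussian_moments[OF D(3)[OF h] D(4)[OF h, symmetric], folded v_def X_def]
  have v0: "0 \<le> v" unfolding v_def by (intro Bochner_Integration.integral_nonneg) simp
  have "integrable M (\<lambda>\<omega>. exp (X \<omega> - v / 2)) \<and> (\<forall>\<phi>. test_function \<phi> \<longrightarrow>
    expectation (\<lambda>\<omega>. exp (X \<omega> - v / 2) *\<^sub>R cis (\<xi> \<omega> \<phi>)) = cis (ip h \<phi>) * of_real (exp (- ip \<phi> \<phi> / 2)))"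
  proof (cases "v = 0")
    case True
    have X0: "AE \<omega> in M. X \<omega> = 0" by (rule mom(5)[OF True])
    have 1: "integrable M (\<lambda>\<omega>. exp (X \<omega> - v / 2))"
      by (subst integrable_cong_AE[where g="\<lambda>_. 1"]) (use X0 True in auto)
    have "AE x in lborel. h x * h x = 0"
      using integral_nonneg_eq_0_iff_AE[OF ip_integrable[OF h h]] True by (simp add: v_def)
    then have h0: "AE x in lborel. h x = 0" by simp
    have "expectation (\<lambda>\<omega>. exp (X \<omega> - v / 2) *\<^sub>R cis (\<xi> \<omega> \<phi>)) = cis (ip h \<phi>) * of_real (exp (- ip \<phi> \<phi> / 2))"
      if \<phi>: "test_function \<phi>" for \<phi>
    proof -
      have [measurable]: "(\<lambda>\<omega>. \<xi> \<omega> \<phi>) \<in> borel_measurable M" by (rule D(2)[OF \<phi>])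
      have "ip h \<phi> = (LINT x|(lborel::(real^'b) measure). 0)"
        by (rule integral_cong_AE) (use h0 test_measurable[OF \<phi>] test_measurable[OF h] in auto)
      moreover have "expectation (\<lambda>\<omega>. exp (X \<omega> - v / 2) *\<^sub>R cis (\<xi> \<omega> \<phi>)) = expectation (\<lambda>\<omega>. cis (\<xi> \<omega> \<phi>))"
        by (rule integral_cong_AE) (use X0 True in auto)
      ultimately show ?thesis using white_noise_char[OF wn \<phi>] by simp
    qed
    then show ?thesis using 1 by blast
  next
    case False
    then have v: "0 < v" using v0 by simp
    define \<sigma> where "\<sigma> = sqrt v"
    have \<sigma>: "0 < \<sigma>" "\<sigma>\<^sup>2 = v" using v by (auto simp: \<sigma>_def)
    have DX: "distributed M lborel X (normal_density 0 \<sigma>)" using mom(6)[OF v] by (simp add: \<sigma>_def)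
    have dX: "distr M borel X = density lborel (normal_density 0 \<sigma>)"
      using distributed_distr_eq_density[OF DX] by (simp cong: distr_cong)
    have int: "expectation (\<lambda>\<omega>. g (X \<omega>)) = (LINT x|lborel. normal_density 0 \<sigma> x *\<^sub>R g x)"
      "integrable M (\<lambda>\<omega>. g (X \<omega>)) \<longleftrightarrow> integrable lborel (\<lambda>x. normal_density 0 \<sigma> x *\<^sub>R g x)"
      if [measurable]: "g \<in> borel_measurable borel" for g :: "real \<Rightarrow> 'c::{banach, second_countable_topology}"
    proof -
      have "expectation (\<lambda>\<omega>. g (X \<omega>)) = (LINT x|distr M borel X. g x)" by (simp add: integral_distr)
      also have "\<dots> = (LINT x|lborel. normal_density 0 \<sigma> x *\<^sub>R g x)" unfolding dX by (simp add: integral_density)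
      finally show "expectation (\<lambda>\<omega>. g (X \<omega>)) = (LINT x|lborel. normal_density 0 \<sigma> x *\<^sub>R g x)" .
      have "integrable M (\<lambda>\<omega>. g (X \<omega>)) \<longleftrightarrow> integrable (distr M borel X) g" by (simp add: integrable_distr_eq)
      also have "\<dots> \<longleftrightarrow> integrable lborel (\<lambda>x. normal_density 0 \<sigma> x *\<^sub>R g x)" unfolding dX by (simp add: integrable_density)
      finally show "integrable M (\<lambda>\<omega>. g (X \<omega>)) \<longleftrightarrow> integrable lborel (\<lambda>x. normal_density 0 \<sigma> x *\<^sub>R g x)" .
    qed
    have nd: "normal_density 0 \<sigma> x * exp (x - v / 2) = normal_density v \<sigma> x" for x
    proof -
      have "exp (- x\<^sup>2 / (2 * v)) * exp (x - v / 2) = exp (- (x - v)\<^sup>2 / (2 * v))"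
        unfolding exp_add[symmetric] using v by (simp add: field_simps power2_eq_square)
      then show ?thesis by (simp add: normal_density_def \<sigma>(2))
    qed
    have nds: "normal_density v \<sigma> (x + v) = normal_density 0 \<sigma> x" for x
      by (simp add: normal_density_def)
    have iW: "integrable M (\<lambda>\<omega>. exp (X \<omega> - v / 2))"
      using int(2)[of "\<lambda>x. exp (x - v / 2)"] nd integrable_normal_density[OF \<sigma>(1)] by simp
    have lin: "\<xi> \<omega> (\<lambda>x. s * h x + t * \<psi> x) = s * X \<omega> + t * \<xi> \<omega> \<psi>" if "\<omega> \<in> space M" "test_function \<psi>" for s t \<omega> \<psi>
      unfolding X_def by (rule distribution_linear[OF D(1)[OF that(1)] h that(2)])
    have joint: "expectation (\<lambda>\<omega>. cis (s * X \<omega> + t * \<xi> \<omega> \<psi>)) = of_real (exp (- (s\<^sup>2 * v + 2 * s * t * ip h \<psi> + t\<^sup>2 * ip \<psi> \<psi>) / 2))"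
      if \<psi>: "test_function \<psi>" for s t \<psi>
    proof -
      have "expectation (\<lambda>\<omega>. cis (s * X \<omega> + t * \<xi> \<omega> \<psi>)) = expectation (\<lambda>\<omega>. cis (\<xi> \<omega> (\<lambda>x. s * h x + t * \<psi> x)))"
        by (rule Bochner_Integration.integral_cong) (use lin \<psi> in auto)
      also have "\<dots> = of_real (exp (- (s\<^sup>2 * v + 2 * s * t * ip h \<psi> + t\<^sup>2 * ip \<psi> \<psi>) / 2))"
        unfolding white_noise_char[OF wn test_lincomb[OF h \<psi>]] ip_lincomb_self[OF h \<psi>] v_def ..
      finally show ?thesis .
    qed
    have tilt: "expectation (\<lambda>\<omega>. exp (X \<omega> - v / 2) *\<^sub>R cis (s * X \<omega>)) = cis (s * v) * of_real (exp (- s\<^sup>2 * v / 2))" for s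
    proof -
      have "expectation (\<lambda>\<omega>. exp (X \<omega> - v / 2) *\<^sub>R cis (s * X \<omega>)) = (LINT x|lborel. normal_density v \<sigma> x *\<^sub>R cis (s * x))"
        by (subst int(1)[of "\<lambda>x. exp (x - v / 2) *\<^sub>R cis (s * x)"]) (auto simp: nd)
      also have "\<dots> = (LINT x|lborel. normal_density v \<sigma> (x + v) *\<^sub>R cis (s * (x + v)))"
        by (rule lborel_integral_translate[symmetric]) measurable
      also have "\<dots> = (LINT x|lborel. cis (s * v) * (normal_density 0 \<sigma> x *\<^sub>R cis (s * x)))"
        unfolding nds by (simp add: distrib_left cis_mult[symmetric] mult_ac)
      also have "\<dots> = cis (s * v) * expectation (\<lambda>\<omega>. cis (s * X \<omega>))"
      proof -
        have "(\<lambda>x. cis (s * x)) \<in> borel_measurable borel" by measurable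
        from int(1)[OF this] show ?thesis by (simp only: integral_mult_right_zero)
      qed
      also have "expectation (\<lambda>\<omega>. cis (s * X \<omega>)) = of_real (exp (- s\<^sup>2 * v / 2))"
        using joint[OF h, of s 0] by simp
      finally show ?thesis .
    qed
    have "expectation (\<lambda>\<omega>. exp (X \<omega> - v / 2) *\<^sub>R cis (\<xi> \<omega> \<phi>)) = cis (ip h \<phi>) * of_real (exp (- ip \<phi> \<phi> / 2))"
      if \<phi>: "test_function \<phi>" for \<phi>
    proof -
      (* a h is the projection of \<phi> to the span of h, and \<psi> is the remainder. *)
      define a where "a = ip h \<phi> / v"
      define \<psi> where "\<psi> x = (- a) * h x + 1 * \<phi> x" for x
      have \<psi>: "test_function \<psi>" unfolding \<psi>_def by (rule test_lincomb[OF h \<phi>])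
      have o: "ip h \<psi> = 0" unfolding \<psi>_def ip_lincomb(2)[OF h \<phi> h] using v by (simp add: a_def v_def)
      have p\<psi>: "ip \<psi> \<psi> = ip \<phi> \<phi> - a\<^sup>2 * v"
        unfolding \<psi>_def ip_lincomb_self[OF h \<phi>] using v by (simp add: a_def v_def power2_eq_square field_simps)
      define Z where "Z \<omega> = \<xi> \<omega> \<psi>" for \<omega>
      have Zm[measurable]: "Z \<in> borel_measurable M" unfolding Z_def by (rule D(2)[OF \<psi>])
      have split: "\<xi> \<omega> \<phi> = a * X \<omega> + Z \<omega>" if "\<omega> \<in> space M" for \<omega>
        unfolding Z_def \<psi>_def lin[OF that \<phi>] by simp
      define \<kappa> where "\<kappa> = exp (- ip \<psi> \<psi> / 2)"
      have jt: "expectation (\<lambda>\<omega>. cis (s * X \<omega> + t * Z \<omega>)) = of_real (exp (- s\<^sup>2 * v / 2) * exp (- t\<^sup>2 * ip \<psi> \<psi> / 2))" for s t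
        unfolding Z_def joint[OF \<psi>] o exp_add[symmetric] by (simp add: field_simps)
      have ic: "integrable M (\<lambda>\<omega>. cis (s * X \<omega> + t * Z \<omega>))" for s t
        by (rule integrable_const_bound[where B=1]) auto
      have comb: "expectation (\<lambda>\<omega>. cis (s * X \<omega> + 0 * Z \<omega>) + b * cis (s * X \<omega> + 1 * Z \<omega>) + c * cis (s * X \<omega> + (-1) * Z \<omega>))
        = of_real (exp (- s\<^sup>2 * v / 2)) * (1 + (b + c) * of_real \<kappa>)" for s b c
      proof -
        define F where "F t \<omega> = cis (s * X \<omega> + t * Z \<omega>)" for t \<omega>
        have "integrable M (F t)" "expectation (F t) = of_real (exp (- s\<^sup>2 * v / 2) * exp (- t\<^sup>2 * ip \<psi> \<psi> / 2))" for t
          unfolding F_def by (rule ic jt)+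
        then have "expectation (\<lambda>\<omega>. F 0 \<omega> + b * F 1 \<omega> + c * F (-1) \<omega>) = of_real (exp (- s\<^sup>2 * v / 2)) * (1 + (b + c) * of_real \<kappa>)"
          by (simp add: \<kappa>_def algebra_simps)
        then show ?thesis unfolding F_def .
      qed
      define g where "g x = exp (x - v / 2) *\<^sub>R cis (a * x)" for x
      have gm[measurable]: "g \<in> borel_measurable borel" unfolding g_def by measurable
      have gX: "integrable M (\<lambda>\<omega>. g (X \<omega>))"
        by (rule Bochner_Integration.integrable_bound[OF iW]) (auto simp: g_def)
      have Eg: "expectation (\<lambda>\<omega>. g (X \<omega>)) = cis (a * v) * of_real (exp (- a\<^sup>2 * v / 2))"
        unfolding g_def by (rule tilt)
      (* The independence of X and Z, for functions of Z with non-negative weights 1 + cos and 1 + sin: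
         both sides have the same Fourier transform in X, by the formula for the joint one. *)
      have c: "expectation (\<lambda>\<omega>. (1 + cos (Z \<omega>)) *\<^sub>R g (X \<omega>)) = expectation (\<lambda>\<omega>. (1 + \<kappa>) *\<^sub>R g (X \<omega>))"
      proof (rule weighted_char_unique[OF Xm Xm _ _ _ _ _ gm])
        show "integrable M (\<lambda>\<omega>. 1 + cos (Z \<omega>))"
          by (rule integrable_const_bound[where B=2]) (auto intro!: order_trans[OF abs_triangle_ineq])
        show "0 \<le> 1 + cos (Z \<omega>)" for \<omega> using cos_ge_minus_one[of "Z \<omega>"] by linarith
        show "0 \<le> 1 + \<kappa>" by (simp add: \<kappa>_def)
        fix s
        have eq: "of_real (1 + cos (Z \<omega>)) * cis (s * X \<omega>) = cis (s * X \<omega> + 0 * Z \<omega>) + (1/2) * cis (s * X \<omega> + 1 * Z \<omega>) + (1/2) * cis (s * X \<omega> + (-1) * Z \<omega>)" for \<omega>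
          by (simp add: complex_eq_iff cos_add sin_add cos_diff sin_diff algebra_simps add_divide_distrib diff_divide_distrib)
        show "expectation (\<lambda>\<omega>. of_real (1 + cos (Z \<omega>)) * cis (s * X \<omega>)) = expectation (\<lambda>\<omega>. of_real (1 + \<kappa>) * cis (s * X \<omega>))"
          unfolding eq comb using jt[of s 0] by simp
      qed auto
      have sn: "expectation (\<lambda>\<omega>. (1 + sin (Z \<omega>)) *\<^sub>R g (X \<omega>)) = expectation (\<lambda>\<omega>. 1 *\<^sub>R g (X \<omega>))"
      proof (rule weighted_char_unique[OF Xm Xm _ _ _ _ _ gm])
        show "integrable M (\<lambda>\<omega>. 1 + sin (Z \<omega>))"
          by (rule integrable_const_bound[where B=2]) (auto intro!: order_trans[OF abs_triangle_ineq])
        show "0 \<le> 1 + sin (Z \<omega>)" for \<omega> using sin_ge_minus_one[of "Z \<omega>"] by linarith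
        fix s
        have eq: "of_real (1 + sin (Z \<omega>)) * cis (s * X \<omega>) = cis (s * X \<omega> + 0 * Z \<omega>) + (-\<i>/2) * cis (s * X \<omega> + 1 * Z \<omega>) + (\<i>/2) * cis (s * X \<omega> + (-1) * Z \<omega>)" for \<omega>
          by (simp add: complex_eq_iff cos_add sin_add cos_diff sin_diff algebra_simps add_divide_distrib diff_divide_distrib)
        show "expectation (\<lambda>\<omega>. of_real (1 + sin (Z \<omega>)) * cis (s * X \<omega>)) = expectation (\<lambda>\<omega>. of_real 1 * cis (s * X \<omega>))"
          unfolding eq comb using jt[of s 0] by simp
      qed auto
      have gc: "integrable M (\<lambda>\<omega>. cos (Z \<omega>) *\<^sub>R g (X \<omega>))"
        by (rule Bochner_Integration.integrable_bound[OF gX]) (auto simp: mult_left_le_one_le)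
      have gs: "integrable M (\<lambda>\<omega>. sin (Z \<omega>) *\<^sub>R g (X \<omega>))"
        by (rule Bochner_Integration.integrable_bound[OF gX]) (auto simp: mult_left_le_one_le)
      have c': "expectation (\<lambda>\<omega>. cos (Z \<omega>) *\<^sub>R g (X \<omega>)) = \<kappa> *\<^sub>R expectation (\<lambda>\<omega>. g (X \<omega>))"
        using c gX gc by (simp add: scaleR_add_left)
      have s': "expectation (\<lambda>\<omega>. sin (Z \<omega>) *\<^sub>R g (X \<omega>)) = 0"
        using sn gX gs by (simp add: scaleR_add_left)
      have "expectation (\<lambda>\<omega>. exp (X \<omega> - v / 2) *\<^sub>R cis (\<xi> \<omega> \<phi>)) = expectation (\<lambda>\<omega>. cos (Z \<omega>) *\<^sub>R g (X \<omega>) + \<i> * (sin (Z \<omega>) *\<^sub>R g (X \<omega>)))"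
        by (rule Bochner_Integration.integral_cong)
          (auto simp: split g_def complex_eq_iff cos_add sin_add algebra_simps)
      also have "\<dots> = \<kappa> *\<^sub>R expectation (\<lambda>\<omega>. g (X \<omega>))"
        by (simp only: Bochner_Integration.integral_add[OF gc integrable_mult_right[OF gs]] integral_mult_right_zero c' s' mult_zero_right add_0_right)
      also have "\<dots> = cis (ip h \<phi>) * of_real (exp (- ip \<phi> \<phi> / 2))"
      proof -
        have "\<kappa> * exp (- a\<^sup>2 * v / 2) = exp (- ip \<phi> \<phi> / 2)"
          unfolding \<kappa>_def exp_add[symmetric] by (simp add: p\<psi> field_simps)
        moreover have "a * v = ip h \<phi>" using v by (simp add: a_def)
        ultimately show ?thesis unfolding Eg by (simp add: scaleR_conv_of_real flip: of_real_mult)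
      qed
      finally show ?thesis .
    qed
    then show ?thesis using iW by blast
  qed
  then show "integrable M (\<lambda>\<omega>. exp (\<xi> \<omega> h - ip h h / 2))"
    and "\<And>\<phi>. test_function \<phi> \<Longrightarrow> expectation (\<lambda>\<omega>. exp (\<xi> \<omega> h - ip h h / 2) *\<^sub>R cis (\<xi> \<omega> \<phi>))
      = cis (ip h \<phi>) * of_real (exp (- ip \<phi> \<phi> / 2))"
    by (auto simp: X_def v_def)
qed

text \<open>Under the tilted measure, which has the same null sets, \<open>\<xi> - h\<close> has the law of the white noise.\<close>

theorem (in prob_space) white_noise_shift:
  assumes wn: "white_noise M \<xi>" and h: "test_function h" and G[measurable]: "G \<in> sets dspace"
    and AEG: "AE \<omega> in M. \<xi> \<omega> \<in> G"
  shows "AE \<omega> in M. distn_minus h (\<xi> \<omega>) \<in> G"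
proof -
  note D = white_noiseD[OF wn]
  have \<xi>m[measurable]: "\<xi> \<in> measurable M dspace" by (rule D(5))
  define W where "W \<omega> = exp (\<xi> \<omega> h - ip h h / 2)" for \<omega>
  have iW: "integrable M W" unfolding W_def by (rule cameron_martin_char(1)[OF wn h])
  have Wm[measurable]: "W \<in> borel_measurable M" using iW by auto
  have EW: "expectation W = 1"
  proof -
    have "complex_of_real (expectation W) = expectation (\<lambda>\<omega>. W \<omega> *\<^sub>R cis (\<xi> \<omega> (\<lambda>x. 0)))"
      unfolding integral_complex_of_real[symmetric]
      by (rule Bochner_Integration.integral_cong) (auto simp: distribution_zero[OF D(1)] scaleR_conv_of_real)
    also have "\<dots> = 1" unfolding W_def cameron_martin_char(2)[OF wn h test_zero] by simp
    finally show ?thesis by simp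
  qed
  define Q where "Q = density M (\<lambda>\<omega>. ennreal (W \<omega>))"
  have Q: "prob_space Q"
  proof (rule prob_spaceI)
    have "emeasure Q (space Q) = (\<integral>\<^sup>+\<omega>. ennreal (W \<omega>) \<partial>M)"
      by (auto simp: Q_def emeasure_density intro!: nn_integral_cong)
    also have "\<dots> = 1" using nn_integral_eq_integral[OF iW] by (simp add: EW W_def)
    finally show "emeasure Q (space Q) = 1" .
  qed
  define f where "f \<omega> = distn_minus h (\<xi> \<omega>)" for \<omega>
  have fM[measurable]: "f \<in> measurable M dspace"
  proof (rule measurable_dspaceI)
    show "distribution (f \<omega>)" if "\<omega> \<in> space M" for \<omega> unfolding f_def by (rule distribution_distn_minus[OF D(1)[OF that] h])
    show "(\<lambda>\<omega>. f \<omega> \<phi>) \<in> borel_measurable M" if "test_function \<phi>" for \<phi>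
      unfolding f_def distn_minus_def using D(2)[OF that] by measurable
  qed
  have fQ[measurable]: "f \<in> measurable Q dspace" using fM by (simp add: Q_def)
  have law: "distr Q dspace f = distr M dspace \<xi>"
  proof (rule white_noise_law_unique[OF prob_space_axioms wn Q fQ])
    fix \<phi> :: "real^'b \<Rightarrow> real" assume \<phi>: "test_function \<phi>"
    have [measurable]: "(\<lambda>\<omega>. \<xi> \<omega> \<phi>) \<in> borel_measurable M" by (rule D(2)[OF \<phi>])
    have "(LINT \<omega>|Q. cis (f \<omega> \<phi>)) = expectation (\<lambda>\<omega>. W \<omega> *\<^sub>R cis (f \<omega> \<phi>))"
    proof -
      have "(\<lambda>\<omega>. f \<omega> \<phi>) \<in> borel_measurable M" unfolding f_def distn_minus_def by measurable
      then have 1: "(\<lambda>\<omega>. cis (f \<omega> \<phi>)) \<in> borel_measurable M" by measurable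
      have 2: "AE \<omega> in M. 0 \<le> W \<omega>" by (simp add: W_def)
      show ?thesis unfolding Q_def by (rule integral_density[OF 1 Wm 2])
    qed
    also have "\<dots> = expectation (\<lambda>\<omega>. cis (- ip h \<phi>) * (W \<omega> *\<^sub>R cis (\<xi> \<omega> \<phi>)))"
      by (simp add: f_def distn_minus_def cis_mult)
    also have "\<dots> = cis (- ip h \<phi>) * (cis (ip h \<phi>) * of_real (exp (- ip \<phi> \<phi> / 2)))"
      unfolding integral_mult_right_zero W_def cameron_martin_char(2)[OF wn h \<phi>] ..
    also have "\<dots> = of_real (exp (- ip \<phi> \<phi> / 2))" by (simp add: cis_mult flip: mult.assoc)
    finally show "(LINT \<omega>|Q. cis (f \<omega> \<phi>)) = complex_of_real (exp (- ip \<phi> \<phi> / 2))" .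
  qed
  have GG: "{T \<in> space dspace. T \<in> G} \<in> sets dspace" using sets.sets_into_space[OF G] by (simp add: Collect_conj_eq Int_absorb1)
  have "AE T in distr M dspace \<xi>. T \<in> G" using AEG by (subst AE_distr_iff[OF \<xi>m GG])
  then have "AE T in distr Q dspace f. T \<in> G" unfolding law .
  then have "AE \<omega> in Q. f \<omega> \<in> G" by (subst (asm) AE_distr_iff[OF fQ GG])
  then have "AE \<omega> in M. 0 < ennreal (W \<omega>) \<longrightarrow> f \<omega> \<in> G" unfolding Q_def by (subst (asm) AE_density) auto
  then show ?thesis by (rule AE_mp) (auto simp: W_def f_def)
qed

section \<open>Growth of the mollified noise\<close>

definition distn_conv :: "'n::finite distn \<Rightarrow> (real^'n \<Rightarrow> real) \<Rightarrow> real^'n \<Rightarrow> real" where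
  "distn_conv T \<phi> x = T (\<lambda>y. \<phi> (x - y))"

lemma mollify_eq_distn_conv: "mollify \<rho> \<epsilon> T x = distn_conv T (rescale \<epsilon> \<rho>) x"
  by (simp add: mollify_def distn_conv_def)

lemma pds_reflect:
  "test_function \<phi> \<Longrightarrow> pds is (\<lambda>y. \<phi> (x - y)) y = (-1) ^ length is * pds is \<phi> (x - y)" for \<phi> :: "_ \<Rightarrow> real"
  using pds_affine[OF test_smooth, of \<phi> "is" x "-1"] by simp

lemma distn_conv_diff:
  assumes T: "distribution T" and \<phi>: "test_function \<phi>"
  shows "distn_conv T \<phi> x - distn_conv T \<phi> y = T (\<lambda>w. 1 * \<phi> (x - w) + (-1) * \<phi> (y - w))"
  using distribution_linear[OF T test_reflect[OF \<phi>] test_reflect[OF \<phi>], of 1 x "-1" y] by (simp add: distn_conv_def)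

text \<open>The functions \<open>\<phi> (y - \<cdot>)\<close> with \<open>y\<close> near \<open>x\<close> have their supports in one compact set, where \<open>T\<close> is bounded by
  finitely many derivatives, and these are Lipschitz in \<open>y\<close>.\<close>

lemma distn_conv_continuous:
  fixes T :: "'n::finite distn"
  assumes T: "distribution T" and \<phi>: "test_function \<phi>"
  shows "continuous_on UNIV (distn_conv T \<phi>)"
proof (rule continuous_at_imp_continuous_on, rule ballI)
  fix x :: "real^'n"
  obtain r where r: "0 < r" "\<And>x. norm x > r \<Longrightarrow> \<phi> x = 0" using test_radius[OF \<phi>] by metis
  define K where "K = cball (0::real^'n) (norm x + 1 + r)"
  obtain A m where A: "\<And>\<phi> B. test_function \<phi> \<Longrightarrow> support \<phi> \<subseteq> K \<Longrightarrow>
        (\<forall>is x. length is \<le> m \<longrightarrow> \<bar>pds is \<phi> x\<bar> \<le> B) \<Longrightarrow> \<bar>T \<phi>\<bar> \<le> A * B"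
    using T unfolding distribution_def by (metis K_def compact_cball)
  have "\<forall>is. \<exists>L>0. \<forall>x y. \<bar>pds is \<phi> x - pds is \<phi> y\<bar> \<le> L * norm (x - y)"
    using test_Lipschitz[OF test_pds[OF \<phi>]] by (metis real_norm_def)
  then obtain L where L: "\<And>is. 0 < L is" "\<And>is x y. \<bar>pds is \<phi> x - pds is \<phi> y\<bar> \<le> L is * norm (x - y)" by metis
  define I where "I = {is :: 'n list. length is \<le> m}"
  have fI: "finite I" unfolding I_def using finite_lists_length_le[of "UNIV :: 'n set" m] by simp
  define L' where "L' = (\<Sum>is\<in>I. L is)"
  have LL: "L is \<le> L'" if "length is \<le> m" for "is"
    unfolding L'_def by (rule member_le_sum) (use that fI L(1) in \<open>auto simp: I_def less_imp_le\<close>)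
  have bound: "\<bar>distn_conv T \<phi> y - distn_conv T \<phi> x\<bar> \<le> A * L' * norm (y - x)" if y: "norm (y - x) \<le> 1" for y
  proof -
    let ?\<psi> = "\<lambda>w. 1 * \<phi> (y - w) + (-1) * \<phi> (x - w)"
    have "\<bar>T ?\<psi>\<bar> \<le> A * (L' * norm (y - x))"
    proof (rule A)
      show "test_function ?\<psi>" by (intro test_lincomb test_reflect \<phi>)
      show "support ?\<psi> \<subseteq> K"
      proof (rule support_subsetI)
        fix w assume "w \<notin> K"
        then have w: "norm w > norm x + 1 + r" by (simp add: K_def)
        have "norm w \<le> norm (x - w) + norm x" using norm_triangle_ineq4[of x "x - w"] by simp
        moreover have "norm w \<le> norm (y - w) + norm (y - x) + norm x"
          using norm_triangle_ineq4[of y "y - w"] norm_triangle_ineq[of "y - x" x] by simp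
        ultimately have "norm (x - w) > r" "norm (y - w) > r" using w y r(1) by linarith+
        then show "?\<psi> w = 0" using r(2) by simp
      qed (simp add: K_def)
      show "\<forall>is w. length is \<le> m \<longrightarrow> \<bar>pds is ?\<psi> w\<bar> \<le> L' * norm (y - x)"
      proof (intro allI impI)
        fix "is" :: "'n list" and w assume l: "length is \<le> m"
        have s1: "smooth_on UNIV (\<lambda>w. 1 * \<phi> (y - w))" and s2: "smooth_on UNIV (\<lambda>w. (-1) * \<phi> (x - w))"
          by (intro test_smooth test_cmult test_reflect \<phi>)+
        have "pds is ?\<psi> w = pds is (\<lambda>w. 1 * \<phi> (y - w)) w + pds is (\<lambda>w. (-1) * \<phi> (x - w)) w"
          unfolding pds_add[OF s1 s2] ..
        also have "pds is (\<lambda>w. 1 * \<phi> (y - w)) w = (-1) ^ length is * pds is \<phi> (y - w)"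
          using pds_reflect[OF \<phi>] by simp
        also have "pds is (\<lambda>w. (-1) * \<phi> (x - w)) w = - ((-1) ^ length is * pds is \<phi> (x - w))"
          using pds_bounded_linear[OF bounded_linear_mult_right[of "-1::real"] test_smooth[OF test_reflect[OF \<phi>, of x]], of "is"]
          by (simp add: fun_eq_iff pds_reflect[OF \<phi>])
        finally have "\<bar>pds is ?\<psi> w\<bar> = \<bar>pds is \<phi> (y - w) - pds is \<phi> (x - w)\<bar>"
          by (simp add: abs_mult power_abs flip: right_diff_distrib)
        also have "\<dots> \<le> L is * norm (y - x)" using L(2)[of "is" "y - w" "x - w"] by simp
        also have "\<dots> \<le> L' * norm (y - x)" by (intro mult_right_mono LL l) simp
        finally show "\<bar>pds is ?\<psi> w\<bar> \<le> L' * norm (y - x)" .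
      qed
    qed
    then show ?thesis unfolding distn_conv_diff[OF T \<phi>] by (simp only: mult.assoc)
  qed
  have "(\<lambda>y. distn_conv T \<phi> y - distn_conv T \<phi> x) \<midarrow>x\<rightarrow> 0"
  proof (rule Lim_null_comparison)
    show "\<forall>\<^sub>F y in at x. norm (distn_conv T \<phi> y - distn_conv T \<phi> x) \<le> A * L' * norm (y - x)"
      unfolding eventually_at using bound by (intro exI[of _ 1]) (auto simp: dist_norm)
    have "((\<lambda>y. A * L' * norm (y - x)) \<longlongrightarrow> A * L' * norm (x - x)) (at x)" by (intro tendsto_intros)
    then show "((\<lambda>y. A * L' * norm (y - x)) \<longlongrightarrow> 0) (at x)" by simp
  qed
  then show "isCont (distn_conv T \<phi>) x" by (simp add: isCont_def LIM_zero_iff)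
qed

text \<open>Dyadic chaining: \<open>V x\<close> is reached from a point of the integer grid by increments between
  neighbouring grid points of successive scales. An increment \<open>a\<close> is split as \<open>\<bar>a\<bar> \<le> t + a\<^sup>4 / t\<^sup>3\<close>: the
  thresholds \<open>t\<close> add up to a multiple of the radius \<open>R\<close>, while the second terms are replaced by their sum
  over all grid points, which no longer depends on \<open>x\<close>.\<close>

definition dyadic_floor :: "nat \<Rightarrow> real^'n::finite \<Rightarrow> real^'n" where
  "dyadic_floor n x = (\<chi> i. of_int \<lfloor>2^n * x $ i\<rfloor> / 2^n)"

definition dyadic_grid :: "nat \<Rightarrow> nat \<Rightarrow> (real^'n::finite) set" where
  "dyadic_grid n R = (\<lambda>k. \<chi> i. of_int (k i) / 2^n) ` (PiE UNIV (\<lambda>_. {- (2^n * int R)..2^n * int R}))"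

lemma finite_dyadic_grid: "finite (dyadic_grid n R :: (real^'n::finite) set)"
  unfolding dyadic_grid_def by (intro finite_imageI finite_PiE) auto

lemma card_dyadic_grid: "real (card (dyadic_grid n R :: (real^'n::finite) set)) \<le> (2 * 2^n * real R + 1) ^ CARD('n)"
proof -
  have "card (dyadic_grid n R :: (real^'n) set) \<le> card (PiE (UNIV :: 'n set) (\<lambda>_. {- (2^n * int R)..2^n * int R}))"
    unfolding dyadic_grid_def by (rule card_image_le) (intro finite_PiE; simp)
  also have "\<dots> = nat (2 * 2^n * int R + 1) ^ CARD('n)" by (simp add: card_PiE algebra_simps)
  finally have "real (card (dyadic_grid n R :: (real^'n) set)) \<le> real (nat (2 * 2^n * int R + 1)) ^ CARD('n)"
    by (metis of_nat_le_iff of_nat_power)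
  also have "real (nat (2 * 2^n * int R + 1)) = 2 * 2^n * real R + 1"
    by (subst of_nat_nat) (auto simp: add_nonneg_nonneg)
  finally show ?thesis .
qed

lemma dyadic_floor_in_grid:
  assumes "norm x \<le> real R" shows "dyadic_floor n x \<in> dyadic_grid n R"
proof -
  have "\<lfloor>2^n * x $ i\<rfloor> \<in> {- (2^n * int R)..2^n * int R}" for i
  proof -
    have "\<bar>x $ i\<bar> \<le> real R" using component_le_norm_cart[of x i] assms by linarith
    then have "\<bar>2^n * x $ i\<bar> \<le> 2^n * real R" by (simp add: abs_mult)
    then have "- (2^n * real R) \<le> 2^n * x $ i" "2^n * x $ i \<le> 2^n * real R" by linarith+
    then have "real_of_int (- (2^n * int R)) \<le> 2^n * x $ i" "2^n * x $ i \<le> real_of_int (2^n * int R)" by simp_all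
    then show ?thesis by (simp only: atLeastAtMost_iff le_floor_iff floor_le_iff simp_thms)
  qed
  then show ?thesis unfolding dyadic_grid_def dyadic_floor_def
    by (intro image_eqI[of _ _ "\<lambda>i. \<lfloor>2^n * x $ i\<rfloor>"]) auto
qed

lemma dyadic_floor_Suc: "dyadic_floor n (dyadic_floor (Suc n) x) = dyadic_floor n x"
proof -
  have "\<lfloor>2^n * (real_of_int \<lfloor>2^Suc n * y\<rfloor> / 2^Suc n)\<rfloor> = \<lfloor>2^n * y\<rfloor>" for y :: real
  proof -
    define k where "k = \<lfloor>2^n * y\<rfloor>"
    define l where "l = \<lfloor>2^Suc n * y\<rfloor>"
    have "of_int k \<le> 2^n * y" "2^n * y < of_int k + 1" by (auto simp: k_def)
    then have "of_int (2 * k) \<le> 2^Suc n * y" "2^Suc n * y < of_int (2 * k + 2)" by auto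
    then have "2 * k \<le> l" "l < 2 * k + 2" unfolding l_def by (simp_all only: le_floor_iff floor_less_iff)
    then have "of_int (2 * k) \<le> real_of_int l" "real_of_int l < of_int (2 * k + 2)" by (simp_all only: of_int_le_iff of_int_less_iff)
    moreover have "2^n * (real_of_int l / 2^Suc n) = real_of_int l / 2" by simp
    ultimately have "\<lfloor>2^n * (real_of_int l / 2^Suc n)\<rfloor> = k" by (simp add: floor_eq_iff)
    then show ?thesis by (simp only: k_def l_def)
  qed
  then show ?thesis by (simp add: dyadic_floor_def vec_eq_iff del: power_Suc)
qed

lemma dyadic_floor_dist: "norm (x - dyadic_floor n x) \<le> real CARD('n) / 2^n" for x :: "real^'n::finite"
proof -
  have "\<bar>(x - dyadic_floor n x) $ i\<bar> \<le> 1 / 2^n" for i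
  proof -
    have "of_int \<lfloor>2^n * x $ i\<rfloor> \<le> 2^n * x $ i" "2^n * x $ i < of_int \<lfloor>2^n * x $ i\<rfloor> + 1" by auto
    then have "of_int \<lfloor>2^n * x $ i\<rfloor> / 2^n \<le> x $ i" "x $ i \<le> (of_int \<lfloor>2^n * x $ i\<rfloor> + 1) / 2^n"
      by (simp_all add: field_simps)
    then show ?thesis by (simp add: dyadic_floor_def add_divide_distrib abs_le_iff)
  qed
  then have "norm (x - dyadic_floor n x) \<le> (\<Sum>i\<in>(UNIV::'n set). 1 / 2^n)"
    by (intro order_trans[OF norm_le_l1_cart] sum_mono)
  then show ?thesis by simp
qed

definition chain_sum :: "nat \<Rightarrow> (real^'n::finite \<Rightarrow> real) \<Rightarrow> ennreal" where
  "chain_sum R V = (\<Sum>p\<in>dyadic_grid 0 R. ennreal ((V p)^4 / real R ^ 3))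
     + (\<Sum>n. \<Sum>p\<in>dyadic_grid (Suc n) R. ennreal ((V p - V (dyadic_floor n p))^4 / (real R * (4/5)^n) ^ 3))"

lemma abs_le_quartic:
  fixes a t :: real assumes t: "0 < t" shows "\<bar>a\<bar> \<le> t + a^4 / t^3"
proof (cases "\<bar>a\<bar> \<le> t")
  case True
  then show ?thesis using t by (intro order_trans[OF True]) simp
next
  case False
  then have "t^3 \<le> \<bar>a\<bar>^3" using t by (intro power_mono) auto
  then have "\<bar>a\<bar> * t^3 \<le> \<bar>a\<bar> * \<bar>a\<bar>^3" by (intro mult_left_mono) auto
  also have "\<dots> = a^4" by (simp add: power4_eq_xxxx power3_eq_cube abs_mult_self_eq flip: mult.assoc)
  finally have "\<bar>a\<bar> \<le> a^4 / t^3" using t by (simp add: field_simps)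
  then show ?thesis using t by linarith
qed

lemma ennreal_le_add:
  "a \<le> b + c \<Longrightarrow> 0 \<le> b \<Longrightarrow> 0 \<le> c \<Longrightarrow> ennreal a \<le> ennreal b + ennreal c"
  by (metis ennreal_leI ennreal_plus)

lemma sum_const_ennreal: "0 \<le> c \<Longrightarrow> (\<Sum>p\<in>A. ennreal c) = ennreal (real (card A) * c)"
  by (simp add: ennreal_of_nat_eq_real_of_nat ennreal_mult)

lemma chaining_bound:
  fixes V :: "real^'n::finite \<Rightarrow> real"
  assumes V: "continuous_on UNIV V" and R: "0 < R" and x: "norm x \<le> real R"
  shows "ennreal \<bar>V x\<bar> \<le> ennreal (6 * real R) + chain_sum R V"
proof -
  let ?p = "\<lambda>n. dyadic_floor n x"
  define t where "t n = (\<Sum>p\<in>dyadic_grid (Suc n) R. ennreal ((V p - V (dyadic_floor n p))^4 / (real R * (4/5)^n) ^ 3))" for n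
  define b where "b = (\<Sum>p\<in>dyadic_grid 0 R. ennreal ((V p)^4 / real R ^ 3))"
  have inc: "ennreal \<bar>V (?p (Suc n)) - V (?p n)\<bar> \<le> ennreal (real R * (4/5)^n) + t n" for n
  proof -
    let ?q = "?p (Suc n)"
    have "\<bar>V ?q - V (?p n)\<bar> \<le> real R * (4/5)^n + (V ?q - V (?p n))^4 / (real R * (4/5)^n) ^ 3"
      by (rule abs_le_quartic) (use R in simp)
    then have "ennreal \<bar>V ?q - V (?p n)\<bar> \<le> ennreal (real R * (4/5)^n) + ennreal ((V ?q - V (?p n))^4 / (real R * (4/5)^n) ^ 3)"
      by (rule ennreal_le_add) (use R in auto)
    also have "ennreal ((V ?q - V (?p n))^4 / (real R * (4/5)^n) ^ 3) \<le> t n"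
      unfolding t_def
      using member_le_sum[OF dyadic_floor_in_grid[OF x, of "Suc n"] _ finite_dyadic_grid,
          of "\<lambda>p. ennreal ((V p - V (dyadic_floor n p))^4 / (real R * (4/5)^n) ^ 3)"]
      by (simp add: dyadic_floor_Suc)
    finally show ?thesis by (simp add: add_left_mono)
  qed
  have start: "ennreal \<bar>V (?p 0)\<bar> \<le> ennreal (real R) + b"
  proof -
    have "\<bar>V (?p 0)\<bar> \<le> real R + (V (?p 0))^4 / real R ^ 3"
      by (rule abs_le_quartic) (use R in simp)
    then have "ennreal \<bar>V (?p 0)\<bar> \<le> ennreal (real R) + ennreal ((V (?p 0))^4 / real R ^ 3)"
      by (rule ennreal_le_add) (use R in auto)
    also have "ennreal ((V (?p 0))^4 / real R ^ 3) \<le> b"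
      unfolding b_def
      by (rule member_le_sum[OF dyadic_floor_in_grid[OF x] _ finite_dyadic_grid]) simp
    finally show ?thesis by (simp add: add_left_mono)
  qed
  have fin: "ennreal \<bar>V (?p N)\<bar> \<le> ennreal (real R + (\<Sum>n<N. real R * (4/5)^n)) + (b + (\<Sum>n<N. t n))" for N
  proof (induction N)
    case 0
    then show ?case using start by simp
  next
    case (Suc N)
    have "ennreal \<bar>V (?p (Suc N))\<bar> \<le> ennreal \<bar>V (?p N)\<bar> + ennreal \<bar>V (?p (Suc N)) - V (?p N)\<bar>"
      by (rule ennreal_le_add) (use R in auto)
    also have "\<dots> \<le> (ennreal (real R + (\<Sum>n<N. real R * (4/5)^n)) + (b + (\<Sum>n<N. t n))) + (ennreal (real R * (4/5)^N) + t N)"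
      by (rule add_mono[OF Suc.IH inc])
    also have "\<dots> = (ennreal (real R + (\<Sum>n<N. real R * (4/5)^n)) + ennreal (real R * (4/5)^N)) + (b + (\<Sum>n<Suc N. t n))"
      by (simp add: ac_simps)
    also have "ennreal (real R + (\<Sum>n<N. real R * (4/5)^n)) + ennreal (real R * (4/5)^N) = ennreal (real R + (\<Sum>n<Suc N. real R * (4/5)^n))"
      by (subst ennreal_plus[symmetric]) (auto intro!: add_nonneg_nonneg sum_nonneg simp: add.assoc)
    finally show ?case .
  qed
  have geo: "real R + (\<Sum>n<N. real R * (4/5)^n) \<le> 6 * real R" for N
  proof -
    have "(\<Sum>n<N. (4/5::real)^n) \<le> 5"
      using sum_gp_strict[of "4/5::real" N] by simp
    then have "real R * (\<Sum>n<N. (4/5::real)^n) \<le> real R * 5" by (intro mult_left_mono) auto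
    then show ?thesis by (simp add: sum_distrib_left)
  qed
  have all: "ennreal \<bar>V (?p N)\<bar> \<le> ennreal (6 * real R) + chain_sum R V" for N
  proof -
    have "(\<Sum>n<N. t n) \<le> (\<Sum>n. t n)" by (rule sum_le_suminf) auto
    then have "b + (\<Sum>n<N. t n) \<le> chain_sum R V"
      unfolding chain_sum_def b_def[symmetric] t_def[symmetric] by (rule add_left_mono)
    then show ?thesis
      using fin[of N] add_mono[OF ennreal_leI[OF geo[of N]]] by (meson order_trans)
  qed
  have "?p \<longlonglongrightarrow> x"
  proof -
    have "(\<lambda>n. real CARD('n) * (1/2)^n) \<longlonglongrightarrow> real CARD('n) * 0"
      by (intro tendsto_intros LIMSEQ_power_zero) simp
    then have "(\<lambda>n. ?p n - x) \<longlonglongrightarrow> 0"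
      by (intro Lim_null_comparison[of "\<lambda>n. ?p n - x" "\<lambda>n. real CARD('n) * (1/2)^n"] always_eventually)
        (use dyadic_floor_dist[of x] in \<open>auto simp: norm_minus_commute power_divide\<close>)
    then show ?thesis by (simp add: LIM_zero_iff)
  qed
  then have "(\<lambda>n. V (?p n)) \<longlonglongrightarrow> V x"
    using V continuous_on_tendsto_compose[of UNIV V] by auto
  then have "(\<lambda>n. ennreal \<bar>V (?p n)\<bar>) \<longlonglongrightarrow> ennreal \<bar>V x\<bar>"
    by (intro tendsto_ennrealI tendsto_rabs)
  then show ?thesis by (rule LIMSEQ_le_const2) (use all in blast)
qed

text \<open>The difference of the two shifted functions is at most \<open>L \<parallel>a - b\<parallel>\<close> and vanishes off two balls.\<close>

lemma increment_variance:
  fixes \<phi> :: "real^'n::finite \<Rightarrow> real"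
  assumes \<phi>: "test_function \<phi>"
  obtains C where "0 \<le> C" "\<And>a b. ip (\<lambda>w. 1 * \<phi> (a - w) + (-1) * \<phi> (b - w)) (\<lambda>w. 1 * \<phi> (a - w) + (-1) * \<phi> (b - w)) \<le> C * (norm (a - b))\<^sup>2"
proof -
  obtain r where r: "0 < r" "\<And>x. norm x > r \<Longrightarrow> \<phi> x = 0" using test_radius[OF \<phi>] by metis
  obtain L where L: "0 < L" "\<And>x y. \<bar>\<phi> x - \<phi> y\<bar> \<le> L * norm (x - y)" using test_Lipschitz[OF \<phi>] by (metis real_norm_def)
  define v where "v = measure lborel (cball (0::real^'n) r)"
  have vol: "measure lborel (cball a r) = v" for a :: "real^'n"
    using content_cball[of r a] content_cball[of r "0::real^'n"] r(1) by (simp add: v_def)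
  show ?thesis
  proof (rule that[of "L\<^sup>2 * (2 * v)"])
    show "0 \<le> L\<^sup>2 * (2 * v)" by (simp add: v_def)
    fix a b :: "real^'n"
    let ?\<psi> = "\<lambda>w. 1 * \<phi> (a - w) + (-1) * \<phi> (b - w)"
    let ?c = "(L * norm (a - b))\<^sup>2"
    have iball: "integrable lborel (\<lambda>w. indicator (cball x r) w :: real)" for x :: "real^'n"
      using emeasure_lborel_cball_finite[of x r] by (intro integrable_real_indicator) auto
    have "ip ?\<psi> ?\<psi> \<le> (LINT w|lborel. ?c * (indicator (cball a r) w + indicator (cball b r) w))"
    proof (rule integral_mono)
      show "integrable lborel (\<lambda>w. ?\<psi> w * ?\<psi> w)" by (intro ip_integrable test_lincomb test_reflect \<phi>)
      show "integrable lborel (\<lambda>w. ?c * (indicator (cball a r) w + indicator (cball b r) w))"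
        by (intro integrable_mult_right Bochner_Integration.integrable_add iball)
      fix w
      have "\<bar>?\<psi> w\<bar> \<le> L * norm (a - b)" using L(2)[of "a - w" "b - w"] by simp
      then have sq: "?\<psi> w * ?\<psi> w \<le> ?c"
        by (metis abs_ge_zero abs_le_square_iff abs_of_nonneg order_trans power2_eq_square)
      show "?\<psi> w * ?\<psi> w \<le> ?c * (indicator (cball a r) w + indicator (cball b r) w)"
      proof (cases "dist a w \<le> r \<or> dist b w \<le> r")
        case True
        then have "1 \<le> (indicator (cball a r) w + indicator (cball b r) w :: real)" by (auto simp: indicator_def)
        then have "?c * 1 \<le> ?c * (indicator (cball a r) w + indicator (cball b r) w)" by (intro mult_left_mono) auto
        then show ?thesis using sq by linarith
      next
        case False
        then have "\<phi> (a - w) = 0" "\<phi> (b - w) = 0" using r(2) by (auto simp: dist_norm)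
        then show ?thesis by simp
      qed
    qed
    also have "\<dots> = ?c * (v + v)"
      using iball by (simp add: vol)
    finally show "ip ?\<psi> ?\<psi> \<le> L\<^sup>2 * (2 * v) * (norm (a - b))\<^sup>2"
      by (simp add: power_mult_distrib mult_ac)
  qed
qed

text \<open>The choice of the thresholds \<open>t\<^sub>n = R (4/5)\<^sup>n\<close>: in dimension at most three there are \<open>O(8\<^sup>n R\<^sup>3)\<close> grid points at
  scale \<open>2\<^sup>-\<^sup>n\<close>, the fourth moment of an increment of the mollified noise is
  \<open>O(16\<^sup>-\<^sup>n)\<close>, and \<open>8 / (16 (4/5)\<^sup>3) = 125/128 < 1\<close>. The powers of \<open>R\<close> cancel, so that the bound is uniform
  in \<open>R\<close>.\<close>

lemma (in prob_space) chain_sum_expectation: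
  fixes \<xi> :: "'a \<Rightarrow> 'n::finite distn"
  assumes wn: "white_noise M \<xi>" and \<phi>: "test_function \<phi>" and dim: "CARD('n) \<le> 3"
  obtains C where "\<And>R. 0 < R \<Longrightarrow> (\<integral>\<^sup>+\<omega>. chain_sum R (distn_conv (\<xi> \<omega>) \<phi>) \<partial>M) \<le> ennreal C"
    "\<And>R. (\<lambda>\<omega>. chain_sum R (distn_conv (\<xi> \<omega>) \<phi>)) \<in> borel_measurable M"
proof -
  note D = white_noiseD[OF wn]
  define V where "V \<omega> x = distn_conv (\<xi> \<omega>) \<phi> x" for \<omega> x
  have Vm[measurable]: "(\<lambda>\<omega>. V \<omega> x) \<in> borel_measurable M" for x
    unfolding V_def distn_conv_def by (rule D(2)[OF test_reflect[OF \<phi>]])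
  obtain C where C: "0 \<le> C" "\<And>a b. ip (\<lambda>w. 1 * \<phi> (a - w) + (-1) * \<phi> (b - w)) (\<lambda>w. 1 * \<phi> (a - w) + (-1) * \<phi> (b - w)) \<le> C * (norm (a - b))\<^sup>2"
    using increment_variance[OF \<phi>] by blast
  define v where "v = ip \<phi> \<phi>"
  have four: "(\<integral>\<^sup>+\<omega>. ennreal ((\<xi> \<omega> \<psi>)^4 / t) \<partial>M) = ennreal (3 * (ip \<psi> \<psi>)\<^sup>2 / t)" if \<psi>: "test_function \<psi>" and t: "0 < t" for \<psi> t
  proof -
    note mom = centred_gaussian_moments[OF D(3)[OF \<psi>] D(4)[OF \<psi>, symmetric]]
    have "(\<integral>\<^sup>+\<omega>. ennreal ((\<xi> \<omega> \<psi>)^4 / t) \<partial>M) = ennreal (expectation (\<lambda>\<omega>. (\<xi> \<omega> \<psi>)^4 / t))"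
      by (rule nn_integral_eq_integral) (use mom(3) t in auto)
    then show ?thesis using mom(4) by simp
  qed
  have point: "(\<integral>\<^sup>+\<omega>. ennreal ((V \<omega> p)^4 / t) \<partial>M) \<le> ennreal (3 * v\<^sup>2 / t)" if t: "0 < t" for p t
  proof -
    have "ip (\<lambda>y. \<phi> (p - y)) (\<lambda>y. \<phi> (p - y)) = v"
      unfolding v_def using lborel_integral_reflect[of "\<lambda>x. \<phi> x * \<phi> x" p] test_measurable[OF \<phi>] by simp
    then show ?thesis unfolding V_def distn_conv_def using four[OF test_reflect[OF \<phi>] t, of p] by simp
  qed
  have incr: "(\<integral>\<^sup>+\<omega>. ennreal ((V \<omega> p - V \<omega> q)^4 / t) \<partial>M) \<le> ennreal (3 * (C * (norm (p - q))\<^sup>2)\<^sup>2 / t)" if t: "0 < t" for p q t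
  proof -
    let ?\<psi> = "\<lambda>w. 1 * \<phi> (p - w) + (-1) * \<phi> (q - w)"
    have \<psi>: "test_function ?\<psi>" by (intro test_lincomb test_reflect \<phi>)
    have "(\<integral>\<^sup>+\<omega>. ennreal ((V \<omega> p - V \<omega> q)^4 / t) \<partial>M) = (\<integral>\<^sup>+\<omega>. ennreal ((\<xi> \<omega> ?\<psi>)^4 / t) \<partial>M)"
      by (rule nn_integral_cong) (simp only: V_def distn_conv_diff[OF D(1) \<phi>])
    also have "\<dots> = ennreal (3 * (ip ?\<psi> ?\<psi>)\<^sup>2 / t)" by (rule four[OF \<psi> t])
    also have "\<dots> \<le> ennreal (3 * (C * (norm (p - q))\<^sup>2)\<^sup>2 / t)"
    proof (intro ennreal_leI divide_right_mono mult_left_mono power_mono)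
      show "ip ?\<psi> ?\<psi> \<le> C * (norm (p - q))\<^sup>2" by (rule C(2))
      show "0 \<le> ip ?\<psi> ?\<psi>" by (intro Bochner_Integration.integral_nonneg) simp
    qed (use t in auto)
    finally show ?thesis .
  qed
  define E where "E = 3 * v\<^sup>2 * 27"
  define F where "F = 3 * C\<^sup>2 * real CARD('n) ^ 4 * 512"
  have F0: "0 \<le> F" by (simp add: F_def)
  have card3: "real (card (dyadic_grid n R :: (real^'n) set)) \<le> (2 * 2^n * real R + 1) ^ 3" for n R
  proof -
    have "(2 * 2^n * real R + 1) ^ CARD('n) \<le> (2 * 2^n * real R + 1) ^ 3"
      by (rule power_increasing[OF dim]) simp
    then show ?thesis using card_dyadic_grid[of n R, where 'n='n] by linarith
  qed
  have "(\<integral>\<^sup>+\<omega>. chain_sum R (V \<omega>) \<partial>M) \<le> ennreal (E + F * 128 / 3)" if R: "0 < R" for R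
  proof -
    have R1: "1 \<le> real R" using R by simp
    have "(\<integral>\<^sup>+\<omega>. chain_sum R (V \<omega>) \<partial>M) = (\<Sum>p\<in>dyadic_grid 0 R. \<integral>\<^sup>+\<omega>. ennreal ((V \<omega> p)^4 / real R ^ 3) \<partial>M)
       + (\<Sum>n. \<Sum>p\<in>dyadic_grid (Suc n) R. \<integral>\<^sup>+\<omega>. ennreal ((V \<omega> p - V \<omega> (dyadic_floor n p))^4 / (real R * (4/5)^n) ^ 3) \<partial>M)"
      unfolding chain_sum_def by (simp add: nn_integral_add nn_integral_suminf nn_integral_sum del: sum_ennreal)
    also have "\<dots> \<le> ennreal E + (\<Sum>n. ennreal (F * (125/128)^n))"
    proof (intro add_mono suminf_le)
      have "(\<Sum>p\<in>(dyadic_grid 0 R :: (real^'n) set). \<integral>\<^sup>+\<omega>. ennreal ((V \<omega> p)^4 / real R ^ 3) \<partial>M) \<le> (\<Sum>p\<in>(dyadic_grid 0 R :: (real^'n) set). ennreal (3 * v\<^sup>2 / real R ^ 3))"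
        by (intro sum_mono point) (use R in simp)
      also have "\<dots> = ennreal (real (card (dyadic_grid 0 R :: (real^'n) set)) * (3 * v\<^sup>2 / real R ^ 3))"
        by (rule sum_const_ennreal) simp
      also have "\<dots> \<le> ennreal E"
      proof (rule ennreal_leI)
        have "(2 * real R + 1) ^ 3 \<le> (3 * real R) ^ 3" using R1 by (intro power_mono) auto
        then have "real (card (dyadic_grid 0 R :: (real^'n) set)) \<le> 27 * real R ^ 3"
          using card3[of 0 R] by (simp add: power_mult_distrib)
        then have "real (card (dyadic_grid 0 R :: (real^'n) set)) * (3 * v\<^sup>2 / real R ^ 3) \<le> 27 * real R ^ 3 * (3 * v\<^sup>2 / real R ^ 3)"
          by (intro mult_right_mono) auto
        also have "\<dots> = E" using R by (simp add: E_def)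
        finally show "real (card (dyadic_grid 0 R :: (real^'n) set)) * (3 * v\<^sup>2 / real R ^ 3) \<le> E" .
      qed
      finally show "(\<Sum>p\<in>(dyadic_grid 0 R :: (real^'n) set). \<integral>\<^sup>+\<omega>. ennreal ((V \<omega> p)^4 / real R ^ 3) \<partial>M) \<le> ennreal E" .
      fix n
      define t where "t = (real R * (4/5)^n) ^ 3"
      have t: "0 < t" using R by (simp add: t_def)
      define d where "d = real CARD('n) / 2^n"
      have "(\<Sum>p\<in>(dyadic_grid (Suc n) R :: (real^'n) set). \<integral>\<^sup>+\<omega>. ennreal ((V \<omega> p - V \<omega> (dyadic_floor n p))^4 / t) \<partial>M)
         \<le> (\<Sum>p\<in>(dyadic_grid (Suc n) R :: (real^'n) set). ennreal (3 * (C * d\<^sup>2)\<^sup>2 / t))"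
      proof (rule sum_mono)
        fix p :: "real^'n"
        have "(\<integral>\<^sup>+\<omega>. ennreal ((V \<omega> p - V \<omega> (dyadic_floor n p))^4 / t) \<partial>M) \<le> ennreal (3 * (C * (norm (p - dyadic_floor n p))\<^sup>2)\<^sup>2 / t)"
          by (rule incr[OF t])
        also have "\<dots> \<le> ennreal (3 * (C * d\<^sup>2)\<^sup>2 / t)"
          unfolding d_def using t C(1)
          by (intro ennreal_leI divide_right_mono mult_left_mono power_mono dyadic_floor_dist) auto
        finally show "(\<integral>\<^sup>+\<omega>. ennreal ((V \<omega> p - V \<omega> (dyadic_floor n p))^4 / t) \<partial>M) \<le> ennreal (3 * (C * d\<^sup>2)\<^sup>2 / t)" .
      qed
      also have "\<dots> = ennreal (real (card (dyadic_grid (Suc n) R :: (real^'n) set)) * (3 * (C * d\<^sup>2)\<^sup>2 / t))"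
        using t by (intro sum_const_ennreal) simp
      also have "\<dots> \<le> ennreal (F * (125/128)^n)"
      proof (rule ennreal_leI)
        have "1 \<le> (2::real) ^ n" by simp
        then have "1 * 1 \<le> 2^n * real R" using R1 by (intro mult_mono) auto
        moreover have "2 * 2^Suc n * real R = 4 * (2^n * real R)" "8 * 2^n * real R = 8 * (2^n * real R)" by simp_all
        ultimately have "2 * 2^Suc n * real R + 1 \<le> 8 * 2^n * real R" by linarith
        then have "(2 * 2^Suc n * real R + 1) ^ 3 \<le> (8 * 2^n * real R) ^ 3" by (rule power_mono) simp
        then have "real (card (dyadic_grid (Suc n) R :: (real^'n) set)) \<le> (8 * 2^n * real R) ^ 3"
          using card3[of "Suc n" R] by linarith
        then have "real (card (dyadic_grid (Suc n) R :: (real^'n) set)) * (3 * (C * d\<^sup>2)\<^sup>2 / t) \<le> (8 * 2^n * real R) ^ 3 * (3 * (C * d\<^sup>2)\<^sup>2 / t)"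
          using t by (intro mult_right_mono) auto
        also have "\<dots> = F * (125/128)^n"
        proof -
          have t': "t = real R ^ 3 * (64/125)^n"
            by (simp add: t_def power_mult_distrib power3_eq_cube flip: power_mult_distrib)
          have d': "(d\<^sup>2)\<^sup>2 = real CARD('n)^4 / 16^n"
            by (simp add: d_def power_divide power2_eq_square power4_eq_xxxx flip: power_mult_distrib)
          have e: "(8 * 2^n * real R) ^ 3 = 512 * 8^n * real R ^ 3"
            by (simp add: power_mult_distrib power3_eq_cube flip: power_mult_distrib)
          have g: "(125/128::real)^n = 8^n / (16^n * (64/125)^n)"
            by (simp flip: power_mult_distrib power_divide)
          show ?thesis unfolding e power_mult_distrib[of C] d' t' F_def g using R by (simp add: field_simps)
        qed
        finally show "real (card (dyadic_grid (Suc n) R :: (real^'n) set)) * (3 * (C * d\<^sup>2)\<^sup>2 / t) \<le> F * (125/128)^n" .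
      qed
      finally show "(\<Sum>p\<in>(dyadic_grid (Suc n) R :: (real^'n) set). \<integral>\<^sup>+\<omega>. ennreal ((V \<omega> p - V \<omega> (dyadic_floor n p))^4 / (real R * (4/5)^n) ^ 3) \<partial>M)
        \<le> ennreal (F * (125/128)^n)" unfolding t_def .
    qed auto
    also have "(\<Sum>n. ennreal (F * (125/128)^n)) = ennreal (\<Sum>n. F * (125/128)^n)"
      using F0 by (intro suminf_ennreal2 summable_mult summable_geometric) auto
    also have "(\<Sum>n. F * (125/128)^n) = F * 128 / 3"
      by (subst suminf_mult) (auto simp: suminf_geometric)
    also have "ennreal E + ennreal (F * 128 / 3) = ennreal (E + F * 128 / 3)"
      using F0 by (intro ennreal_plus[symmetric]) (auto simp: E_def)
    finally show ?thesis .
  qed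
  moreover have "(\<lambda>\<omega>. chain_sum R (V \<omega>)) \<in> borel_measurable M" for R
    unfolding chain_sum_def by measurable
  moreover have "V \<omega> = distn_conv (\<xi> \<omega>) \<phi>" for \<omega> by (rule ext) (simp add: V_def)
  ultimately show ?thesis using that by auto
qed

text \<open>The chain sums over the balls of radius \<open>2\<^sup>k\<close> have bounded expectations, so with the weights \<open>2\<^sup>-\<^sup>k\<close> they
  are almost surely summable. Hence the mollified noise grows at most linearly.\<close>

theorem (in prob_space) growth_white_noise:
  fixes \<xi> :: "'a \<Rightarrow> 'n::finite distn"
  assumes wn: "white_noise M \<xi>" and \<phi>: "test_function \<phi>" and dim: "CARD('n) \<le> 3"
  shows "AE \<omega> in M. \<forall>c. subquadratic_growth (\<lambda>x. distn_conv (\<xi> \<omega>) \<phi> x + c)"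
proof -
  obtain C where C: "\<And>R. 0 < R \<Longrightarrow> (\<integral>\<^sup>+\<omega>. chain_sum R (distn_conv (\<xi> \<omega>) \<phi>) \<partial>M) \<le> ennreal C"
    and [measurable]: "\<And>R. (\<lambda>\<omega>. chain_sum R (distn_conv (\<xi> \<omega>) \<phi>)) \<in> borel_measurable M"
    using chain_sum_expectation[OF assms] by blast
  define S where "S \<omega> = (\<Sum>k. ennreal ((1/2)^k) * chain_sum (2^k) (distn_conv (\<xi> \<omega>) \<phi>))" for \<omega>
  have Sm: "S \<in> borel_measurable M" unfolding S_def by measurable
  have "(\<integral>\<^sup>+\<omega>. S \<omega> \<partial>M) = (\<Sum>k. ennreal ((1/2)^k) * (\<integral>\<^sup>+\<omega>. chain_sum (2^k) (distn_conv (\<xi> \<omega>) \<phi>) \<partial>M))"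
    unfolding S_def by (subst nn_integral_suminf) (auto simp: nn_integral_cmult)
  also have "\<dots> \<le> (\<Sum>k. ennreal ((1/2)^k) * ennreal C)"
    by (intro suminf_le mult_left_mono C) auto
  also have "\<dots> = (\<Sum>k. ennreal ((1/2)^k)) * ennreal C" by simp
  also have "(\<Sum>k. ennreal ((1/2)^k)) = ennreal (\<Sum>k. (1/2)^k)"
    by (rule suminf_ennreal2) (auto intro: summable_geometric)
  also have "ennreal (\<Sum>k. (1/2)^k) * ennreal C < \<infinity>" by (simp add: ennreal_mult_less_top)
  finally have "AE \<omega> in M. S \<omega> \<noteq> \<infinity>" by (intro nn_integral_PInf_AE[OF Sm]) auto
  then show ?thesis
  proof (rule AE_mp, intro AE_I2 impI allI)
    fix \<omega> c assume \<omega>: "\<omega> \<in> space M" and "S \<omega> \<noteq> \<infinity>"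
    then obtain m where m: "S \<omega> = ennreal m" "0 \<le> m" by (metis ennreal_cases infinity_ennreal_def)
    let ?V = "distn_conv (\<xi> \<omega>) \<phi>"
    have cont: "continuous_on UNIV ?V" by (rule distn_conv_continuous[OF white_noiseD(1)[OF wn \<omega>] \<phi>])
    have bound: "\<bar>?V x\<bar> \<le> (6 + m) * 2^k" if x: "norm x \<le> 2^k" for k x
    proof -
      have "ennreal ((1/2)^k) * chain_sum (2^k) ?V \<le> ennreal m"
        unfolding m(1)[symmetric] S_def by (rule ennreal_suminf_term)
      then have "ennreal (2^k) * (ennreal ((1/2)^k) * chain_sum (2^k) ?V) \<le> ennreal (2^k) * ennreal m"
        by (rule mult_left_mono) simp
      also have "ennreal (2^k) * (ennreal ((1/2)^k) * chain_sum (2^k) ?V) = chain_sum (2^k) ?V"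
        by (simp add: mult.assoc[symmetric] ennreal_mult[symmetric] power_mult_distrib[symmetric])
      finally have "chain_sum (2^k) ?V \<le> ennreal (2^k * m)" using m(2) by (simp add: ennreal_mult)
      moreover have "ennreal \<bar>?V x\<bar> \<le> ennreal (6 * real (2^k)) + chain_sum (2^k) ?V"
        by (rule chaining_bound[OF cont]) (use x in simp_all)
      ultimately have "ennreal \<bar>?V x\<bar> \<le> ennreal (6 * real (2^k)) + ennreal (2^k * m)"
        by (meson add_left_mono order_trans)
      also have "\<dots> = ennreal ((6 + m) * 2^k)"
        using m(2) by (subst ennreal_plus[symmetric]) (auto simp: algebra_simps)
      finally show ?thesis using m(2) by (simp add: ennreal_le_iff)
    qed
    show "subquadratic_growth (\<lambda>x. ?V x + c)"
      unfolding subquadratic_growth_def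
    proof (intro allI impI)
      fix s R0 :: real assume s: "1 \<le> s"
      define B where "B = max (max R0 1) (s\<^sup>2 * (4 * (6 + m) + \<bar>c\<bar>))"
      obtain k where k: "4 * B < 2^k" using real_arch_pow[of 2 "4 * B"] by auto
      define R :: real where "R = 2^k / 4"
      have RB: "B \<le> R" using k by (simp add: R_def)
      show "\<exists>R\<ge>R0. \<forall>x. norm x \<le> 4 * R \<longrightarrow> \<bar>?V x + c\<bar> \<le> R\<^sup>2 / s\<^sup>2"
      proof (intro exI[of _ R] conjI allI impI)
        show "R0 \<le> R" using RB by (simp add: B_def)
        fix x :: "real^'n" assume "norm x \<le> 4 * R"
        then have "\<bar>?V x\<bar> \<le> (6 + m) * 2^k" by (intro bound) (simp add: R_def)
        then have "\<bar>?V x\<bar> \<le> (6 + m) * (4 * R)" by (simp add: R_def)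
        moreover have "\<bar>c\<bar> * 1 \<le> \<bar>c\<bar> * R" using RB by (intro mult_left_mono) (auto simp: B_def)
        ultimately have "\<bar>?V x + c\<bar> \<le> (4 * (6 + m) + \<bar>c\<bar>) * R"
          by (simp add: algebra_simps)
        also have "\<dots> \<le> R / s\<^sup>2 * R"
        proof (rule mult_right_mono)
          have "s\<^sup>2 * (4 * (6 + m) + \<bar>c\<bar>) \<le> R" using RB by (simp add: B_def)
          then show "4 * (6 + m) + \<bar>c\<bar> \<le> R / s\<^sup>2" using s by (simp add: field_simps)
        qed (simp add: R_def)
        finally show "\<bar>?V x + c\<bar> \<le> R\<^sup>2 / s\<^sup>2" by (simp add: power2_eq_square)
      qed
    qed
  qed
qed

section \<open>A measurable substitute for the norm of the resolvent\<close>

text \<open>For an operator \<open>A\<close> that is essentially self-adjoint on the test functions and \<open>Im z = 1\<close>, the infimum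
  below is \<open>\<parallel>(A - z)\<^sup>-\<^sup>1 f\<parallel>\<close>. Indeed \<open>\<phi> = (A - z)\<^sup>-\<^sup>1 (f + e)\<close> with the error \<open>e = (A - z) \<phi> - f\<close>, and the
  resolvent is a contraction, so that \<open>\<parallel>\<phi>\<parallel> + \<parallel>e\<parallel> \<ge> \<parallel>(A - z)\<^sup>-\<^sup>1 f\<parallel>\<close>.\<close>

definition resolvent_norm :: "(real^'n::finite \<Rightarrow> real) \<Rightarrow> complex \<Rightarrow> (real^'n) L2 \<Rightarrow> real" where
  "resolvent_norm V z f = (INF \<phi>\<in>{\<phi>. test_function \<phi>}.
     norm (abs_L2 \<phi>) + norm (abs_L2 (schro V \<phi>) - scaleC z (abs_L2 \<phi>) - f))"

lemma INF_le_real: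
  fixes F :: "'i \<Rightarrow> real"
  assumes "\<And>i. 0 \<le> F i" "i \<in> I" shows "(INF i\<in>I. F i) \<le> F i"
  by (rule cINF_lower) (use assms in \<open>auto intro: bdd_belowI[of _ 0]\<close>)

lemma resolvent_norm_le:
  "test_function \<phi> \<Longrightarrow> resolvent_norm V z f \<le> norm (abs_L2 \<phi>) + norm (abs_L2 (schro V \<phi>) - scaleC z (abs_L2 \<phi>) - f)"
  unfolding resolvent_norm_def by (rule INF_le_real) auto

lemma resolvent_norm_greatest:
  assumes "\<And>\<phi>. test_function \<phi> \<Longrightarrow> b \<le> norm (abs_L2 \<phi>) + norm (abs_L2 (schro V \<phi>) - scaleC z (abs_L2 \<phi>) - f)"
  shows "b \<le> resolvent_norm V z f"
  unfolding resolvent_norm_def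
proof (rule cINF_greatest)
  show "{\<phi> :: real^'a \<Rightarrow> complex. test_function \<phi>} \<noteq> {}" using test_zero by blast
qed (use assms in auto)

lemma resolvent_norm_Lipschitz:
  "resolvent_norm V z f \<le> resolvent_norm V z g + norm (f - g)"
proof -
  have "resolvent_norm V z f - norm (f - g) \<le> resolvent_norm V z g"
  proof (rule resolvent_norm_greatest)
    fix \<phi> :: "real^'a \<Rightarrow> complex" assume \<phi>: "test_function \<phi>"
    let ?a = "abs_L2 (schro V \<phi>) - scaleC z (abs_L2 \<phi>)"
    have "norm (?a - f) \<le> norm (?a - g) + norm (f - g)"
      using norm_triangle_ineq4[of "?a - g" "f - g"] by simp
    then show "resolvent_norm V z f - norm (f - g) \<le> norm (abs_L2 \<phi>) + norm (?a - g)"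
      using resolvent_norm_le[OF \<phi>, of V z f] by linarith
  qed
  then show ?thesis by linarith
qed

lemma schro_translate:
  assumes "test_function \<phi>"
  shows "schro (\<lambda>x. V (x - c)) (\<lambda>x. \<phi> (x - c)) = (\<lambda>x. schro V \<phi> (x - c))"
  using laplacian_affine[OF test_smooth[OF assms], of "-c" 1] by (simp add: schro_def fun_eq_iff)

lemma translate_L2_diff: "translate_L2 c (f - g) = translate_L2 c f - translate_L2 c g"
proof -
  obtain f' g' where fg: "square_integrable f'" "f = abs_L2 f'" "square_integrable g'" "g = abs_L2 g'"
    using L2_obtain_function by metis
  note t = square_integrable_translate[OF fg(1), of c] square_integrable_translate[OF fg(3), of c]
  have "f - g = abs_L2 (\<lambda>x. f' x - g' x)" unfolding fg(2,4) by (rule abs_L2_diff[OF fg(1,3), symmetric])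
  then have "translate_L2 c (f - g) = abs_L2 (\<lambda>x. f' (x - c) - g' (x - c))"
    using translate_L2_abs[OF square_integrable_minus[OF fg(1,3)], of c] by metis
  also have "\<dots> = abs_L2 (\<lambda>x. f' (x - c)) - abs_L2 (\<lambda>x. g' (x - c))" by (rule abs_L2_diff[OF t])
  also have "\<dots> = translate_L2 c f - translate_L2 c g"
    unfolding fg(2,4) translate_L2_abs[OF fg(1)] translate_L2_abs[OF fg(3)] ..
  finally show ?thesis .
qed

lemma translate_L2_scaleC: "translate_L2 c (scaleC a f) = scaleC a (translate_L2 c f)"
proof -
  obtain f' where f: "square_integrable f'" "f = abs_L2 f'" using L2_obtain_function by metis
  have "scaleC a f = abs_L2 (\<lambda>x. a * f' x)" unfolding f(2) by (rule abs_L2_scaleC[OF f(1), symmetric])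
  then have "translate_L2 c (scaleC a f) = abs_L2 (\<lambda>x. a * f' (x - c))"
    using translate_L2_abs[OF square_integrable_mult[OF f(1)], of c a] by metis
  also have "\<dots> = scaleC a (abs_L2 (\<lambda>x. f' (x - c)))"
    by (rule abs_L2_scaleC[OF square_integrable_translate[OF f(1)]])
  also have "\<dots> = scaleC a (translate_L2 c f)" unfolding f(2) translate_L2_abs[OF f(1)] ..
  finally show ?thesis .
qed

lemma resolvent_norm_translate_le:
  assumes V: "continuous_on UNIV V"
  shows "resolvent_norm (\<lambda>x. V (x - c)) z (translate_L2 c f) \<le> resolvent_norm V z f"
proof (rule resolvent_norm_greatest)
  fix \<phi> :: "real^'a \<Rightarrow> complex" assume \<phi>: "test_function \<phi>"
  have eq: "abs_L2 (schro (\<lambda>x. V (x - c)) (\<lambda>x. \<phi> (x - c))) - scaleC z (abs_L2 (\<lambda>x. \<phi> (x - c))) - translate_L2 c f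
      = translate_L2 c (abs_L2 (schro V \<phi>) - scaleC z (abs_L2 \<phi>) - f)"
    by (simp add: schro_translate[OF \<phi>] translate_L2_diff translate_L2_scaleC translate_L2_abs
        test_square_integrable \<phi> schro_square_integrable V)
  have "norm (abs_L2 (\<lambda>x. \<phi> (x - c))) = norm (abs_L2 \<phi>)"
    using norm_translate_L2[of c "abs_L2 \<phi>"] by (simp add: translate_L2_abs test_square_integrable \<phi>)
  then show "resolvent_norm (\<lambda>x. V (x - c)) z (translate_L2 c f) \<le> norm (abs_L2 \<phi>) + norm (abs_L2 (schro V \<phi>) - scaleC z (abs_L2 \<phi>) - f)"
    using resolvent_norm_le[OF test_translate[OF \<phi>, of c], of "\<lambda>x. V (x - c)" z "translate_L2 c f"]
    by (simp add: eq norm_translate_L2)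
qed

lemma schro_lower_bound:
  assumes V: "continuous_on UNIV V" and \<phi>: "test_function \<phi>"
  shows "\<bar>Im z\<bar> * norm (abs_L2 \<phi>) \<le> norm (abs_L2 (schro V \<phi>) - scaleC z (abs_L2 \<phi>))"
  by (rule symmetric_op_lower_bound[OF symmetric_schrodinger[OF V]]) (use \<phi> in \<open>auto simp: schrodinger_eq\<close>)

lemma schro_diff:
  assumes "test_function \<phi>" "test_function \<psi>"
  shows "schro V (\<lambda>x. \<phi> x - \<psi> x) = (\<lambda>x. schro V \<phi> x - schro V \<psi> x)"
  using schro_add[OF assms(1) test_cmult[OF assms(2), of "-1"], of V] schro_cmult[OF assms(2), of V "-1"] by simp

text \<open>The functions \<open>\<phi>\<^sub>j\<close> are competitors in the infimum. Conversely a competitor with error \<open>e\<close> differs from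
  \<open>\<phi>\<^sub>j\<close> by at most \<open>\<parallel>e\<parallel>\<close> plus the error of \<open>\<phi>\<^sub>j\<close>, since symmetric operators satisfy \<open>\<parallel>(A - z) \<phi>\<parallel> \<ge> \<parallel>\<phi>\<parallel>\<close>.\<close>

lemma resolvent_norm_tendsto:
  fixes V :: "nat \<Rightarrow> real^'n::finite \<Rightarrow> real"
  assumes V: "\<And>j. continuous_on UNIV (V j)" and \<phi>: "\<And>j. test_function (\<phi> j)" and z: "Im z = 1"
    and u: "(\<lambda>j. abs_L2 (\<phi> j)) \<longlonglongrightarrow> u" and v: "(\<lambda>j. abs_L2 (schro (V j) (\<phi> j))) \<longlonglongrightarrow> v"
  shows "(\<lambda>j. resolvent_norm (V j) z (v - scaleC z u)) \<longlonglongrightarrow> norm u"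
proof -
  define f where "f = v - scaleC z u"
  define d where "d j = norm (abs_L2 (schro (V j) (\<phi> j)) - scaleC z (abs_L2 (\<phi> j)) - f)" for j
  have "(\<lambda>j. abs_L2 (schro (V j) (\<phi> j)) - scaleC z (abs_L2 (\<phi> j)) - f) \<longlonglongrightarrow> v - scaleC z u - f"
    by (intro tendsto_intros u v)
  then have d0: "d \<longlonglongrightarrow> 0" unfolding d_def f_def by (auto intro: tendsto_norm_zero)
  have nu: "(\<lambda>j. norm (abs_L2 (\<phi> j))) \<longlonglongrightarrow> norm u" by (intro tendsto_intros u)
  show ?thesis
    unfolding f_def[symmetric]
  proof (rule tendsto_sandwich)
    show "\<forall>\<^sub>F j in sequentially. resolvent_norm (V j) z f \<le> norm (abs_L2 (\<phi> j)) + d j"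
      unfolding d_def by (intro always_eventually allI resolvent_norm_le \<phi>)
    show "\<forall>\<^sub>F j in sequentially. norm (abs_L2 (\<phi> j)) - d j \<le> resolvent_norm (V j) z f"
    proof (intro always_eventually allI resolvent_norm_greatest)
      fix j and \<psi> :: "real^'n \<Rightarrow> complex" assume \<psi>: "test_function \<psi>"
      let ?A = "\<lambda>\<phi>. abs_L2 (schro (V j) \<phi>) - scaleC z (abs_L2 \<phi>)"
      have t: "test_function (\<lambda>x. \<psi> x - \<phi> j x)" by (rule test_diff[OF \<psi> \<phi>])
      have eq: "?A (\<lambda>x. \<psi> x - \<phi> j x) = (?A \<psi> - f) - (?A (\<phi> j) - f)"
        by (simp add: schro_diff \<psi> \<phi> abs_L2_diff test_square_integrable schro_square_integrable V scaleC_diff_right)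
      have "norm (abs_L2 (\<lambda>x. \<psi> x - \<phi> j x)) \<le> norm (?A (\<lambda>x. \<psi> x - \<phi> j x))"
        using schro_lower_bound[OF V t, of z] z by simp
      also have "\<dots> \<le> norm (?A \<psi> - f) + d j" unfolding eq d_def by (rule norm_triangle_ineq4)
      finally have "norm (abs_L2 \<psi> - abs_L2 (\<phi> j)) \<le> norm (?A \<psi> - f) + d j"
        by (simp add: abs_L2_diff test_square_integrable \<psi> \<phi>)
      then show "norm (abs_L2 (\<phi> j)) - d j \<le> norm (abs_L2 \<psi>) + norm (?A \<psi> - f)"
        using norm_triangle_ineq2[of "abs_L2 (\<phi> j)" "abs_L2 \<psi>"] norm_minus_commute[of "abs_L2 (\<phi> j)" "abs_L2 \<psi>"]
        by linarith
    qed
    show "(\<lambda>j. norm (abs_L2 (\<phi> j)) + d j) \<longlonglongrightarrow> norm u" using tendsto_add[OF nu d0] by simp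
    show "(\<lambda>j. norm (abs_L2 (\<phi> j)) - d j) \<longlonglongrightarrow> norm u" using tendsto_diff[OF nu d0] by simp
  qed
qed

lemma abs_L2_schro:
  assumes V: "continuous_on UNIV V" and \<phi>: "test_function \<phi>" "\<And>x. norm x > R \<Longrightarrow> \<phi> x = 0"
  shows "abs_L2 (schro V \<phi>) = mult_L2 (\<lambda>x. indicator (cball 0 R) x * V x) (abs_L2 \<phi>) - abs_L2 (laplacian \<phi>)"
proof -
  obtain B where B: "0 \<le> B" "\<And>x. norm x \<le> R \<Longrightarrow> norm (V x) \<le> B" using bounded_on_cball[OF V] by metis
  let ?W = "\<lambda>x. indicator (cball 0 R) x * V x"
  have Wm: "?W \<in> borel_measurable borel"
    using borel_measurable_continuous_onI[OF V]
    by (intro borel_measurable_times borel_measurable_indicator) auto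
  have Wb: "\<bar>?W x\<bar> \<le> B" for x using B by (auto simp: indicator_def)
  have eq: "schro V \<phi> = (\<lambda>x. of_real (?W x) * \<phi> x - laplacian \<phi> x)"
    using \<phi>(2) by (auto simp: schro_def fun_eq_iff indicator_def)
  note s = test_square_integrable[OF \<phi>(1)]
  show ?thesis
    unfolding eq mult_L2_abs[OF s Wm Wb]
    by (rule abs_L2_diff[OF square_integrable_bounded_mult(1)[OF s Wm Wb] test_square_integrable[OF test_laplacian[OF \<phi>(1)]]])
qed

text \<open>One countable set of test functions is a core for all continuous potentials at once, since on a ball
  the graph norm is controlled by \<open>\<parallel>\<phi>\<parallel> + \<parallel>\<Delta> \<phi>\<parallel>\<close>, and pairs of square integrable functions form a
  separable space.\<close>

lemma countable_core:
  "\<exists>D :: (real^'n::finite \<Rightarrow> complex) set. countable D \<and> (\<forall>\<phi>\<in>D. test_function \<phi>) \<and>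
    (\<forall>V \<phi> e. continuous_on UNIV V \<longrightarrow> test_function \<phi> \<longrightarrow> 0 < e \<longrightarrow>
      (\<exists>\<psi>\<in>D. norm (abs_L2 \<psi> - abs_L2 \<phi>) < e \<and> norm (abs_L2 (schro V \<psi>) - abs_L2 (schro V \<phi>)) < e))"
proof -
  obtain D0 :: "(real^'n) L2 set" where D0: "countable D0" "closure D0 = UNIV" using L2_separable by auto
  define E where "E n = {\<phi> :: real^'n \<Rightarrow> complex. test_function \<phi> \<and> (\<forall>x. norm x > real n \<longrightarrow> \<phi> x = 0)}" for n
  define g where "g \<phi> = (abs_L2 \<phi>, abs_L2 (laplacian \<phi>))" for \<phi> :: "real^'n \<Rightarrow> complex"
  have "\<exists>C\<subseteq>g ` E n. countable C \<and> g ` E n \<subseteq> closure C" for n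
    by (rule countable_dense_subset[of "D0 \<times> D0"]) (use D0 in \<open>auto simp: closure_Times\<close>)
  then obtain C where C: "\<And>n. C n \<subseteq> g ` E n" "\<And>n. countable (C n)" "\<And>n. g ` E n \<subseteq> closure (C n)" by metis
  define D where "D = (\<Union>n. inv_into (E n) g ` C n)"
  have inv: "inv_into (E n) g c \<in> E n" "g (inv_into (E n) g c) = c" if "c \<in> C n" for c n
  proof -
    have c: "c \<in> g ` E n" using C(1) that by blast
    show "inv_into (E n) g c \<in> E n" "g (inv_into (E n) g c) = c"
      by (rule inv_into_into[OF c], rule f_inv_into_f[OF c])
  qed
  have "countable D" unfolding D_def using C(2) by auto
  moreover have "\<forall>\<phi>\<in>D. test_function \<phi>" using inv(1) by (auto simp: D_def E_def)
  moreover have "\<exists>\<psi>\<in>D. norm (abs_L2 \<psi> - abs_L2 \<phi>) < e \<and> norm (abs_L2 (schro V \<psi>) - abs_L2 (schro V \<phi>)) < e"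
    if V: "continuous_on UNIV V" and \<phi>: "test_function \<phi>" and e: "0 < e" for V \<phi> e
  proof -
    obtain r where r: "\<And>x. norm x > r \<Longrightarrow> \<phi> x = 0" using test_radius[OF \<phi>] by metis
    obtain n where n: "r \<le> real n" using real_arch_simple by blast
    have \<phi>n: "\<phi> \<in> E n" using \<phi> r n by (auto simp: E_def)
    obtain B where B: "0 \<le> B" "\<And>x. norm x \<le> real n \<Longrightarrow> norm (V x) \<le> B" using bounded_on_cball[OF V] by metis
    define d where "d = e / (B + 2)"
    have d: "0 < d" using e B by (simp add: d_def)
    have "g \<phi> \<in> closure (C n)" using C(3) \<phi>n by blast
    then obtain c where c: "c \<in> C n" "dist c (g \<phi>) < d" using d by (auto simp: closure_approachable)
    define \<psi> where "\<psi> = inv_into (E n) g c"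
    have \<psi>: "\<psi> \<in> E n" "g \<psi> = c" using inv[OF c(1)] by (auto simp: \<psi>_def)
    have \<psi>t: "test_function \<psi>" using \<psi> by (simp add: E_def)
    have 1: "norm (abs_L2 \<psi> - abs_L2 \<phi>) < d"
      using dist_fst_le[of c "g \<phi>"] c(2) by (simp add: \<psi>(2)[symmetric] g_def dist_norm)
    have 2: "norm (abs_L2 (laplacian \<psi>) - abs_L2 (laplacian \<phi>)) < d"
      using dist_snd_le[of c "g \<phi>"] c(2) by (simp add: \<psi>(2)[symmetric] g_def dist_norm)
    let ?W = "\<lambda>x. indicator (cball 0 (real n)) x * V x"
    have Wm: "?W \<in> borel_measurable borel"
      using borel_measurable_continuous_onI[OF V]
      by (intro borel_measurable_times borel_measurable_indicator) auto
    have Wb: "\<bar>?W x\<bar> \<le> B" for x using B by (auto simp: indicator_def)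
    have eq: "abs_L2 (schro V \<psi>) - abs_L2 (schro V \<phi>) = mult_L2 ?W (abs_L2 \<psi> - abs_L2 \<phi>) - (abs_L2 (laplacian \<psi>) - abs_L2 (laplacian \<phi>))"
    proof -
      have \<phi>0: "\<phi> x = 0" if "norm x > real n" for x using \<phi>n that by (simp add: E_def)
      have \<psi>0: "\<psi> x = 0" if "norm x > real n" for x using \<psi>(1) that by (simp add: E_def)
      have rearrange: "(a - b) - (c - d) = (a - c) - (b - d)" for a b c d :: "(real^'n) L2" by simp
      have 1: "abs_L2 (schro V \<phi>) = mult_L2 ?W (abs_L2 \<phi>) - abs_L2 (laplacian \<phi>)"
        by (rule abs_L2_schro[OF V \<phi>]) (rule \<phi>0)
      have 2: "abs_L2 (schro V \<psi>) = mult_L2 ?W (abs_L2 \<psi>) - abs_L2 (laplacian \<psi>)"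
        by (rule abs_L2_schro[OF V \<psi>t]) (rule \<psi>0)
      show ?thesis unfolding 1 2 mult_L2_diff[OF Wm Wb] by (rule rearrange)
    qed
    have "norm (abs_L2 (schro V \<psi>) - abs_L2 (schro V \<phi>)) \<le> norm (mult_L2 ?W (abs_L2 \<psi> - abs_L2 \<phi>)) + norm (abs_L2 (laplacian \<psi>) - abs_L2 (laplacian \<phi>))"
      unfolding eq by (rule norm_triangle_ineq4)
    also have "\<dots> \<le> B * d + d"
      using norm_mult_L2[OF Wm Wb, of "abs_L2 \<psi> - abs_L2 \<phi>"] mult_left_mono[OF less_imp_le[OF 1] B(1)] 2 by linarith
    also have "\<dots> < e"
    proof -
      have "(B + 2) * d = e" using B(1) by (simp add: d_def)
      then show ?thesis using d by (simp add: algebra_simps)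
    qed
    finally have 3: "norm (abs_L2 (schro V \<psi>) - abs_L2 (schro V \<phi>)) < e" .
    have "1 * d \<le> (B + 2) * d" using B(1) d by (intro mult_right_mono) auto
    then have "d \<le> e" using B(1) by (simp add: d_def)
    then have "norm (abs_L2 \<psi> - abs_L2 \<phi>) < e" using 1 by linarith
    moreover have "\<psi> \<in> D" unfolding D_def \<psi>_def using c(1) by blast
    ultimately show ?thesis using 3 by blast
  qed
  ultimately show ?thesis by blast
qed

lemma resolvent_norm_countable:
  fixes D :: "(real^'n::finite \<Rightarrow> complex) set"
  assumes D: "\<And>\<phi>. \<phi> \<in> D \<Longrightarrow> test_function \<phi>"
    and core: "\<And>\<phi> e. test_function \<phi> \<Longrightarrow> 0 < e \<Longrightarrow>
      (\<exists>\<psi>\<in>D. norm (abs_L2 \<psi> - abs_L2 \<phi>) < e \<and> norm (abs_L2 (schro V \<psi>) - abs_L2 (schro V \<phi>)) < e)"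
  shows "resolvent_norm V z f < t \<longleftrightarrow> (\<exists>\<phi>\<in>D. norm (abs_L2 \<phi>) + norm (abs_L2 (schro V \<phi>) - scaleC z (abs_L2 \<phi>) - f) < t)"
proof
  assume "\<exists>\<phi>\<in>D. norm (abs_L2 \<phi>) + norm (abs_L2 (schro V \<phi>) - scaleC z (abs_L2 \<phi>) - f) < t"
  then show "resolvent_norm V z f < t" using resolvent_norm_le D le_less_trans by blast
next
  assume "resolvent_norm V z f < t"
  then have "\<not> (\<forall>\<phi>. test_function \<phi> \<longrightarrow> t \<le> norm (abs_L2 \<phi>) + norm (abs_L2 (schro V \<phi>) - scaleC z (abs_L2 \<phi>) - f))"
    using resolvent_norm_greatest[of t V z f] by auto
  then obtain \<phi> where \<phi>: "test_function \<phi>" "norm (abs_L2 \<phi>) + norm (abs_L2 (schro V \<phi>) - scaleC z (abs_L2 \<phi>) - f) < t"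
    by (auto simp: not_le)
  define e where "e = (t - (norm (abs_L2 \<phi>) + norm (abs_L2 (schro V \<phi>) - scaleC z (abs_L2 \<phi>) - f))) / (cmod z + 2)"
  have zp: "0 < cmod z + 2" by (simp add: add_nonneg_pos)
  have e: "0 < e" unfolding e_def using \<phi>(2) zp by (intro divide_pos_pos) auto
  obtain \<psi> where \<psi>: "\<psi> \<in> D" "norm (abs_L2 \<psi> - abs_L2 \<phi>) < e" "norm (abs_L2 (schro V \<psi>) - abs_L2 (schro V \<phi>)) < e"
    using core[OF \<phi>(1) e] by blast
  let ?A = "\<lambda>\<phi>. abs_L2 (schro V \<phi>) - scaleC z (abs_L2 \<phi>) - f"
  have "norm (abs_L2 \<psi>) \<le> norm (abs_L2 \<phi>) + norm (abs_L2 \<psi> - abs_L2 \<phi>)" using norm_triangle_sub by blast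
  moreover have "norm (?A \<psi>) \<le> norm (?A \<phi>) + norm (abs_L2 (schro V \<psi>) - abs_L2 (schro V \<phi>)) + cmod z * norm (abs_L2 \<psi> - abs_L2 \<phi>)"
  proof -
    have eq: "?A \<psi> = ?A \<phi> + (abs_L2 (schro V \<psi>) - abs_L2 (schro V \<phi>)) - scaleC z (abs_L2 \<psi> - abs_L2 \<phi>)"
      by (simp add: scaleC_diff_right)
    have "norm (?A \<psi>) \<le> norm (?A \<phi> + (abs_L2 (schro V \<psi>) - abs_L2 (schro V \<phi>))) + norm (scaleC z (abs_L2 \<psi> - abs_L2 \<phi>))"
      unfolding eq by (rule norm_triangle_ineq4)
    also have "\<dots> \<le> norm (?A \<phi>) + norm (abs_L2 (schro V \<psi>) - abs_L2 (schro V \<phi>)) + cmod z * norm (abs_L2 \<psi> - abs_L2 \<phi>)"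
      by (intro add_mono norm_triangle_ineq) (simp add: norm_scaleC)
    finally show ?thesis .
  qed
  moreover have "cmod z * norm (abs_L2 \<psi> - abs_L2 \<phi>) \<le> cmod z * e" using \<psi>(2) by (intro mult_left_mono) auto
  ultimately have "norm (abs_L2 \<psi>) + norm (?A \<psi>) < norm (abs_L2 \<phi>) + norm (?A \<phi>) + (cmod z + 2) * e"
    using \<psi>(2,3) by (simp add: algebra_simps)
  also have "\<dots> = t" using zp by (simp add: e_def)
  finally show "\<exists>\<phi>\<in>D. norm (abs_L2 \<phi>) + norm (?A \<phi>) < t" using \<psi>(1) by blast
qed

section \<open>Measurability in the noise\<close>

text \<open>By continuity in \<open>x\<close>, the value at \<open>x\<close> is a limit of values at dyadic points, of which there are countably
  many.\<close>

lemma distn_conv_joint_measurable: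
  fixes \<phi> :: "real^'n::finite \<Rightarrow> real"
  assumes \<phi>: "test_function \<phi>"
  shows "(\<lambda>(T, x). distn_conv T \<phi> x) \<in> borel_measurable (dspace \<Otimes>\<^sub>M borel)"
proof -
  define h where "h n p = distn_conv (fst p) \<phi> (dyadic_floor n (snd p))" for n and p :: "'n distn \<times> (real^'n)"
  have ev: "(\<lambda>T. distn_conv T \<phi> x) \<in> borel_measurable dspace" for x
    unfolding distn_conv_def by (rule eval_measurable[OF test_reflect[OF \<phi>]])
  have hm: "h n \<in> borel_measurable (dspace \<Otimes>\<^sub>M borel)" for n
  proof -
    define k where "k p = (\<lambda>i. \<lfloor>2^n * snd p $ i\<rfloor>)" for p :: "'n distn \<times> (real^'n)"
    have eq: "h n = (\<lambda>p :: 'n distn \<times> (real^'n). distn_conv (fst p) \<phi> (vec_lambda (\<lambda>i. of_int (k p i) / 2^n)))"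
      by (simp add: h_def k_def dyadic_floor_def fun_eq_iff)
    have nth: "(\<lambda>x :: real^'n. x $ i) \<in> borel_measurable borel" for i
      by (intro borel_measurable_continuous_onI continuous_intros)
    have ki: "(\<lambda>p. k p i) \<in> measurable (dspace \<Otimes>\<^sub>M borel) (count_space UNIV)" for i
      unfolding k_def using measurable_compose[OF measurable_snd nth[of i]] by measurable
    have km: "k \<in> measurable (dspace \<Otimes>\<^sub>M borel) (count_space UNIV)"
      unfolding measurable_count_space_eq2_countable
    proof (intro conjI ballI)
      fix a :: "'n \<Rightarrow> int"
      have "k -` {a} \<inter> space (dspace \<Otimes>\<^sub>M borel) = {p\<in>space (dspace \<Otimes>\<^sub>M borel). \<forall>i\<in>UNIV. k p i = a i}"
        by (auto simp: fun_eq_iff)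
      also have "\<dots> \<in> sets (dspace \<Otimes>\<^sub>M borel)"
      proof (rule sets.sets_Collect_finite_All)
        show "{p\<in>space (dspace \<Otimes>\<^sub>M borel). k p i = a i} \<in> sets (dspace \<Otimes>\<^sub>M borel)" for i
          using measurable_sets[OF ki[of i], of "{a i}"] by (simp add: vimage_def Int_def conj_commute)
      qed simp
      finally show "k -` {a} \<inter> space (dspace \<Otimes>\<^sub>M borel) \<in> sets (dspace \<Otimes>\<^sub>M borel)" .
    qed simp
    show ?thesis
      unfolding eq
      by (rule measurable_compose_countable[OF _ km]) (rule measurable_compose[OF measurable_fst ev])
  qed
  have "(\<lambda>p. distn_conv (fst p) \<phi> (snd p)) \<in> borel_measurable (dspace \<Otimes>\<^sub>M borel)"
  proof (rule borel_measurable_LIMSEQ_metric[OF hm])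
    fix p assume "p \<in> space ((dspace :: 'n distn measure) \<Otimes>\<^sub>M (borel :: (real^'n) measure))"
    then have T: "distribution (fst p)" by (auto simp: space_pair_measure)
    have "(\<lambda>n. real CARD('n) * (1/2)^n) \<longlonglongrightarrow> real CARD('n) * 0"
      by (intro tendsto_intros LIMSEQ_power_zero) simp
    then have "(\<lambda>n. dyadic_floor n (snd p) - snd p) \<longlonglongrightarrow> 0"
      by (intro Lim_null_comparison[of "\<lambda>n. dyadic_floor n (snd p) - snd p" "\<lambda>n. real CARD('n) * (1/2)^n"] always_eventually)
        (use dyadic_floor_dist[of "snd p"] in \<open>auto simp: norm_minus_commute power_divide\<close>)
    then have "(\<lambda>n. dyadic_floor n (snd p)) \<longlonglongrightarrow> snd p" by (simp add: LIM_zero_iff)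
    then show "(\<lambda>n. h n p) \<longlonglongrightarrow> distn_conv (fst p) \<phi> (snd p)"
      unfolding h_def using continuous_on_tendsto_compose[OF distn_conv_continuous[OF T \<phi>]] by auto
  qed
  then show ?thesis by (simp add: case_prod_beta)
qed

lemma resolvent_norm_measurable:
  fixes \<phi> :: "real^'n::finite \<Rightarrow> real"
  assumes \<phi>: "test_function \<phi>"
  shows "(\<lambda>T. resolvent_norm (\<lambda>x. distn_conv T \<phi> x + c) z f) \<in> borel_measurable dspace"
proof -
  obtain D :: "(real^'n \<Rightarrow> complex) set" where D: "countable D" "\<And>\<phi>. \<phi> \<in> D \<Longrightarrow> test_function \<phi>"
    "\<And>V \<phi> e. continuous_on UNIV V \<Longrightarrow> test_function \<phi> \<Longrightarrow> 0 < e \<Longrightarrow>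
      (\<exists>\<psi>\<in>D. norm (abs_L2 \<psi> - abs_L2 \<phi>) < e \<and> norm (abs_L2 (schro V \<psi>) - abs_L2 (schro V \<phi>)) < e)"
    using countable_core by metis
  obtain f' where f': "square_integrable f'" "f = abs_L2 f'" using L2_obtain_function by metis
  have f'm: "f' \<in> borel_measurable borel" using f' by (simp add: square_integrable_def)
  let ?V = "\<lambda>T x. distn_conv T \<phi> x + c"
  have cV: "continuous_on UNIV (?V T)" if "distribution T" for T
    by (intro continuous_intros distn_conv_continuous[OF that \<phi>])
  have m: "(\<lambda>T. norm (abs_L2 (schro (?V T) \<psi>) - scaleC z (abs_L2 \<psi>) - f)) \<in> borel_measurable dspace"
    if \<psi>: "test_function \<psi>" for \<psi>
  proof -
    have eq: "norm (abs_L2 (schro (?V T) \<psi>) - scaleC z (abs_L2 \<psi>) - f) = sqrt (LINT x|lborel. (cmod (schro (?V T) \<psi> x - z * \<psi> x - f' x))\<^sup>2)"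
      if T: "distribution T" for T
    proof -
      note s = schro_square_integrable[OF cV[OF T] \<psi>] square_integrable_mult[OF test_square_integrable[OF \<psi>], of z]
      have "abs_L2 (\<lambda>x. schro (?V T) \<psi> x - z * \<psi> x - f' x) = abs_L2 (schro (?V T) \<psi>) - scaleC z (abs_L2 \<psi>) - f"
        unfolding f'(2) abs_L2_diff[OF square_integrable_minus[OF s] f'(1)] abs_L2_diff[OF s]
          abs_L2_scaleC[OF test_square_integrable[OF \<psi>]] ..
      then have "(norm (abs_L2 (schro (?V T) \<psi>) - scaleC z (abs_L2 \<psi>) - f))\<^sup>2 = (LINT x|lborel. (cmod (schro (?V T) \<psi> x - z * \<psi> x - f' x))\<^sup>2)"
        using norm_abs_L2_sq[OF square_integrable_minus[OF square_integrable_minus[OF s] f'(1)]] by simp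
      then show ?thesis by (rule real_sqrt_unique[OF _ norm_ge_zero, symmetric])
    qed
    have \<psi>m: "\<psi> \<in> borel_measurable borel" "laplacian \<psi> \<in> borel_measurable borel"
      by (rule test_measurable[OF \<psi>], rule test_measurable[OF test_laplacian[OF \<psi>]])
    note [measurable] = measurable_compose[OF measurable_snd \<psi>m(1)] measurable_compose[OF measurable_snd \<psi>m(2)]
      measurable_compose[OF measurable_snd f'm] distn_conv_joint_measurable[OF \<phi>]
    have dm: "(\<lambda>p. distn_conv (fst p) \<phi> (snd p)) \<in> borel_measurable (dspace \<Otimes>\<^sub>M borel)"
      using distn_conv_joint_measurable[OF \<phi>] by (simp add: case_prod_beta)
    have "(\<lambda>p. (cmod (schro (?V (fst p)) \<psi> (snd p) - z * \<psi> (snd p) - f' (snd p)))\<^sup>2) \<in> borel_measurable (dspace \<Otimes>\<^sub>M borel)"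
      unfolding schro_def using dm by measurable
    then have "(\<lambda>(T, x). (cmod (schro (?V T) \<psi> x - z * \<psi> x - f' x))\<^sup>2) \<in> borel_measurable (dspace \<Otimes>\<^sub>M lborel)"
      by (simp add: case_prod_beta cong: measurable_cong_sets sets_pair_measure_cong)
    then have "(\<lambda>T. LINT x|lborel. (cmod (schro (?V T) \<psi> x - z * \<psi> x - f' x))\<^sup>2) \<in> borel_measurable dspace"
      by (rule lborel.borel_measurable_lebesgue_integral)
    then have "(\<lambda>T. sqrt (LINT x|lborel. (cmod (schro (?V T) \<psi> x - z * \<psi> x - f' x))\<^sup>2)) \<in> borel_measurable dspace"
      by measurable
    then show ?thesis
      by (rule measurable_cong[THEN iffD1, rotated]) (use eq in simp)
  qed
  show ?thesis
    unfolding borel_measurable_iff_less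
  proof
    fix t
    have "{T\<in>space dspace. resolvent_norm (?V T) z f < t}
      = {T\<in>space dspace. \<exists>\<psi>\<in>D. norm (abs_L2 \<psi>) + norm (abs_L2 (schro (?V T) \<psi>) - scaleC z (abs_L2 \<psi>) - f) < t}"
      using resolvent_norm_countable[OF D(2) D(3)[OF cV]] by auto
    also have "\<dots> \<in> sets dspace"
    proof (rule sets.sets_Collect_countable_Ex'[OF _ D(1)])
      fix \<psi> assume "\<psi> \<in> D"
      note [measurable] = m[OF D(2)[OF this]]
      show "{T\<in>space dspace. norm (abs_L2 \<psi>) + norm (abs_L2 (schro (?V T) \<psi>) - scaleC z (abs_L2 \<psi>) - f) < t} \<in> sets dspace"
        by measurable
    qed
    finally show "{T\<in>space dspace. resolvent_norm (?V T) z f < t} \<in> sets dspace" .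
  qed
qed

section \<open>Spectral gaps and graph limits\<close>

definition gap :: "real \<Rightarrow> real \<Rightarrow> 'a::euclidean_space op \<Rightarrow> bool" where
  "gap E r H \<longleftrightarrow> (\<forall>(u, v)\<in>H. r * norm u \<le> norm (v - E *\<^sub>R u))"

text \<open>One inclusion suffices for the sequel: the graph of \<open>H\<close> is contained in the limit of the graphs on test
  functions. For self-adjoint \<open>H\<close> it implies convergence of the resolvents.\<close>

definition graph_limit :: "(nat \<Rightarrow> real^'n::finite \<Rightarrow> real) \<Rightarrow> (real^'n) op \<Rightarrow> bool" where
  "graph_limit V H \<longleftrightarrow> (\<forall>(u, v)\<in>H. \<exists>\<phi>. (\<forall>j. test_function (\<phi> j)) \<and>
     (\<lambda>j. abs_L2 (\<phi> j)) \<longlonglongrightarrow> u \<and> (\<lambda>j. abs_L2 (schro (V j) (\<phi> j))) \<longlonglongrightarrow> v)"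

text \<open>The gap of the limit, seen from the approximating operators through their resolvents at \<open>E + \<i>\<close>; see
  \<open>gap_iff_resolvent\<close>.\<close>

definition asymptotic_gap :: "real \<Rightarrow> real \<Rightarrow> (nat \<Rightarrow> real^'n::finite \<Rightarrow> real) \<Rightarrow> bool" where
  "asymptotic_gap E r V \<longleftrightarrow> (\<forall>f e. 0 < e \<longrightarrow>
     (\<forall>\<^sub>F j in sequentially. resolvent_norm (V j) (Complex E 1) f * sqrt (r\<^sup>2 + 1) \<le> norm f + e))"

lemma gap_iff_resolvent:
  assumes "symmetric_op H" "(u, v) \<in> H" "0 \<le> r"
  shows "r * norm u \<le> norm (v - E *\<^sub>R u) \<longleftrightarrow> norm u * sqrt (r\<^sup>2 + 1) \<le> norm (v - scaleC (Complex E 1) u)"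
proof -
  have sq: "(norm (v - scaleC (Complex E 1) u))\<^sup>2 = (norm (v - E *\<^sub>R u))\<^sup>2 + (norm u)\<^sup>2"
    using symmetric_op_norm_sq[OF assms(1,2), of "Complex E 1"] by simp
  have "r * norm u \<le> norm (v - E *\<^sub>R u) \<longleftrightarrow> (r * norm u)\<^sup>2 \<le> (norm (v - E *\<^sub>R u))\<^sup>2"
    using assms(3) by (simp add: power2_le_iff_abs_le)
  also have "\<dots> \<longleftrightarrow> (norm u * sqrt (r\<^sup>2 + 1))\<^sup>2 \<le> (norm (v - scaleC (Complex E 1) u))\<^sup>2"
    unfolding sq by (simp add: power_mult_distrib algebra_simps)
  also have "\<dots> \<longleftrightarrow> norm u * sqrt (r\<^sup>2 + 1) \<le> norm (v - scaleC (Complex E 1) u)"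
    by (simp add: power2_le_iff_abs_le abs_mult)
  finally show ?thesis .
qed

lemma graph_limit_resolvent_norm:
  assumes gl: "graph_limit V H" and V: "\<And>j. continuous_on UNIV (V j)" and uv: "(u, v) \<in> H"
  shows "(\<lambda>j. resolvent_norm (V j) (Complex E 1) (v - scaleC (Complex E 1) u)) \<longlonglongrightarrow> norm u"
proof -
  obtain \<phi> where \<phi>: "\<And>j. test_function (\<phi> j)"
    "(\<lambda>j. abs_L2 (\<phi> j)) \<longlonglongrightarrow> u" "(\<lambda>j. abs_L2 (schro (V j) (\<phi> j))) \<longlonglongrightarrow> v"
    using gl uv unfolding graph_limit_def by blast
  show ?thesis by (rule resolvent_norm_tendsto[OF V \<phi>(1) _ \<phi>(2,3)]) simp
qed

lemma asymptotic_gap_imp_gap: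
  assumes gl: "graph_limit V H" and V: "\<And>j. continuous_on UNIV (V j)" and H: "symmetric_op H"
    and r: "0 \<le> r" and ag: "asymptotic_gap E r V"
  shows "gap E r H"
  unfolding gap_def
proof safe
  fix u v assume uv: "(u, v) \<in> H"
  let ?f = "v - scaleC (Complex E 1) u"
  have "norm u * sqrt (r\<^sup>2 + 1) \<le> norm ?f"
  proof (rule field_le_epsilon)
    fix e :: real assume "0 < e"
    then have "\<forall>\<^sub>F j in sequentially. resolvent_norm (V j) (Complex E 1) ?f * sqrt (r\<^sup>2 + 1) \<le> norm ?f + e"
      using ag by (auto simp: asymptotic_gap_def)
    then show "norm u * sqrt (r\<^sup>2 + 1) \<le> norm ?f + e"
      by (rule tendsto_upperbound[OF tendsto_mult_right[OF graph_limit_resolvent_norm[OF gl V uv]]]) simp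
  qed
  then show "r * norm u \<le> norm (v - E *\<^sub>R u)" using gap_iff_resolvent[OF H uv r] by simp
qed

lemma gap_imp_asymptotic_gap:
  assumes gl: "graph_limit V H" and V: "\<And>j. continuous_on UNIV (V j)" and H: "self_adjoint H"
    and r: "0 \<le> r" and gap: "gap E r H"
  shows "asymptotic_gap E r V"
  unfolding asymptotic_gap_def
proof (intro allI impI)
  fix f and e :: real assume e: "0 < e"
  let ?z = "Complex E 1"
  obtain u where u: "(u, f + scaleC ?z u) \<in> H" using self_adjoint_range_nonreal[OF H, of ?z f] by auto
  have "r * norm u \<le> norm (f + scaleC ?z u - E *\<^sub>R u)" using gap u by (auto simp: gap_def)
  then have le: "norm u * sqrt (r\<^sup>2 + 1) \<le> norm f"
    using gap_iff_resolvent[OF self_adjointD(3)[OF H] u r] by simp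
  have "(\<lambda>j. resolvent_norm (V j) ?z f * sqrt (r\<^sup>2 + 1)) \<longlonglongrightarrow> norm u * sqrt (r\<^sup>2 + 1)"
    using tendsto_mult_right[OF graph_limit_resolvent_norm[OF gl V u, of E], of "sqrt (r\<^sup>2 + 1)"] by simp
  from order_tendstoD(2)[OF this, of "norm f + e"] le e
  show "\<forall>\<^sub>F j in sequentially. resolvent_norm (V j) ?z f * sqrt (r\<^sup>2 + 1) \<le> norm f + e"
    by (auto elim!: eventually_mono)
qed

lemma asymptotic_gap_dense:
  fixes V :: "nat \<Rightarrow> real^'n::finite \<Rightarrow> real"
  assumes D: "closure D = UNIV"
    and ev: "\<And>f k. f \<in> D \<Longrightarrow> \<forall>\<^sub>F j in sequentially.
      resolvent_norm (V j) (Complex E 1) f * sqrt (r\<^sup>2 + 1) \<le> norm f + inverse (real (Suc k))"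
  shows "asymptotic_gap E r V"
  unfolding asymptotic_gap_def
proof (intro allI impI)
  fix f :: "(real^'n) L2" and e :: real assume e: "0 < e"
  define s where "s = sqrt (r\<^sup>2 + 1)"
  have s: "0 \<le> s" by (simp add: s_def)
  define d where "d = e / (2 * (1 + s))"
  have d: "0 < d" using e s by (simp add: d_def add_pos_nonneg)
  have "0 < 2 * (1 + s)" using s by simp
  then have "2 * (1 + s) \<noteq> 0" by (rule less_imp_neq[THEN not_sym])
  from nonzero_eq_divide_eq[OF this, of d e] have "d * (2 * (1 + s)) = e" unfolding d_def by blast
  then have ds: "(1 + s) * d = e / 2" by (simp add: algebra_simps)
  have "f \<in> closure D" using D by simp
  then obtain g where g: "g \<in> D" "norm (g - f) < d" using d by (auto simp: closure_approachable dist_norm)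
  obtain k where k: "inverse (real (Suc k)) < e / 2" using e reals_Archimedean[of "e / 2"] by auto
  from ev[OF g(1), of k]
  show "\<forall>\<^sub>F j in sequentially. resolvent_norm (V j) (Complex E 1) f * sqrt (r\<^sup>2 + 1) \<le> norm f + e"
    unfolding s_def[symmetric]
  proof eventually_elim
    case (elim j)
    have fg: "norm (f - g) < d" using g(2) by (simp add: norm_minus_commute)
    have "resolvent_norm (V j) (Complex E 1) f * s \<le> (resolvent_norm (V j) (Complex E 1) g + d) * s"
      using resolvent_norm_Lipschitz[of "V j" "Complex E 1" f g] fg s by (intro mult_right_mono) auto
    also have "\<dots> = resolvent_norm (V j) (Complex E 1) g * s + s * d" by (simp add: algebra_simps)
    also have "\<dots> \<le> norm g + e / 2 + s * d" using elim k by linarith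
    also have "norm g \<le> norm f + d" using g(2) norm_triangle_sub[of g f] by linarith
    finally show ?case using ds by (simp add: algebra_simps)
  qed
qed

lemma translate_L2_inverse: "translate_L2 c (translate_L2 (- c) f) = f"
proof -
  obtain f' where f: "square_integrable f'" "f = abs_L2 f'" using L2_obtain_function by metis
  show ?thesis
    unfolding f(2) translate_L2_abs[OF f(1)] translate_L2_abs[OF square_integrable_translate[OF f(1)]] by simp
qed

lemma asymptotic_gap_translate:
  assumes V: "\<And>j. continuous_on UNIV (V j)" and ag: "asymptotic_gap E r V"
  shows "asymptotic_gap E r (\<lambda>j x. V j (x - c))"
  unfolding asymptotic_gap_def
proof (intro allI impI)
  fix f and e :: real assume e: "0 < e"
  let ?z = "Complex E 1" and ?g = "translate_L2 (- c) f"
  have "\<forall>\<^sub>F j in sequentially. resolvent_norm (V j) ?z ?g * sqrt (r\<^sup>2 + 1) \<le> norm ?g + e"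
    using ag e by (auto simp: asymptotic_gap_def)
  then show "\<forall>\<^sub>F j in sequentially. resolvent_norm (\<lambda>x. V j (x - c)) ?z f * sqrt (r\<^sup>2 + 1) \<le> norm f + e"
  proof eventually_elim
    case (elim j)
    have "resolvent_norm (\<lambda>x. V j (x - c)) ?z f \<le> resolvent_norm (V j) ?z ?g"
      using resolvent_norm_translate_le[OF V[of j], of c ?z ?g] by (simp add: translate_L2_inverse)
    then have "resolvent_norm (\<lambda>x. V j (x - c)) ?z f * sqrt (r\<^sup>2 + 1) \<le> resolvent_norm (V j) ?z ?g * sqrt (r\<^sup>2 + 1)"
      by (intro mult_right_mono) auto
    then show ?case using elim by (simp add: norm_translate_L2)
  qed
qed

text \<open>At a real point \<open>l\<close> of the resolvent set the inverse is bounded by some \<open>m\<close>, so there is a gap of radius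
  \<open>1 / (2 m)\<close> around each rational at distance less than \<open>1 / (2 m)\<close> from \<open>l\<close>.\<close>

lemma spectrum_eq_Reals:
  fixes H :: "'a::euclidean_space op"
  assumes H: "self_adjoint H" and no_gap: "\<And>p q. 0 < q \<Longrightarrow> \<not> gap (real_of_rat p) (real_of_rat q) H"
  shows "spectrum H = \<real>"
proof
  show "\<real> \<subseteq> spectrum H"
  proof (rule ccontr)
    assume "\<not> \<real> \<subseteq> spectrum H"
    then obtain l :: real where "of_real l \<in> resolvent_set H"
      by (auto simp: spectrum_def elim!: Reals_cases)
    then obtain B where B: "\<And>u f. (u, f + scaleC (of_real l) u) \<in> H \<Longrightarrow> norm u \<le> B * norm f"
      by (auto simp: resolvent_set_def)
    define m where "m = max B 1"
    have m: "0 < m" "1 \<le> m" "B \<le> m" by (auto simp: m_def)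
    obtain q where q: "0 < real_of_rat q" "real_of_rat q < 1 / (2 * m)"
      using of_rat_dense[of 0 "1 / (2 * m)"] m by auto
    obtain p where p: "l < real_of_rat p" "real_of_rat p < l + 1 / (2 * m)"
      using of_rat_dense[of l "l + 1 / (2 * m)"] m by auto
    have "gap (real_of_rat p) (real_of_rat q) H"
      unfolding gap_def
    proof safe
      fix u v assume uv: "(u, v) \<in> H"
      have "norm u \<le> B * norm (v - l *\<^sub>R u)" by (rule B) (simp add: scaleC_simps uv)
      also have "\<dots> \<le> m * norm (v - l *\<^sub>R u)" using m by (intro mult_right_mono) auto
      finally have 1: "norm u / m \<le> norm (v - l *\<^sub>R u)" using m by (simp add: field_simps)
      have "norm (v - l *\<^sub>R u) \<le> norm (v - real_of_rat p *\<^sub>R u) + norm ((real_of_rat p - l) *\<^sub>R u)"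
        using norm_triangle_ineq[of "v - real_of_rat p *\<^sub>R u" "(real_of_rat p - l) *\<^sub>R u"]
        by (simp add: algebra_simps)
      also have "norm ((real_of_rat p - l) *\<^sub>R u) \<le> 1 / (2 * m) * norm u"
        unfolding norm_scaleR using p by (intro mult_right_mono) auto
      finally have 2: "norm u / m \<le> norm (v - real_of_rat p *\<^sub>R u) + 1 / (2 * m) * norm u" using 1 by linarith
      have "real_of_rat q * norm u \<le> 1 / (2 * m) * norm u" using q by (intro mult_right_mono) auto
      also have "\<dots> = norm u / m - 1 / (2 * m) * norm u" using m by (simp add: field_simps)
      finally show "real_of_rat q * norm u \<le> norm (v - real_of_rat p *\<^sub>R u)" using 2 by linarith
    qed
    then show False using no_gap[of q p] q by simp
  qed
qed (rule spectrum_self_adjoint_subset[OF H])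

section \<open>Perturbing the noise by a smooth function\<close>

lemma graph_limit_perturb:
  fixes V W :: "nat \<Rightarrow> real^'n::finite \<Rightarrow> real"
  assumes gl: "graph_limit V H" and V: "\<And>j. continuous_on UNIV (V j)"
    and h: "continuous_on UNIV h" "\<And>x. \<bar>h x\<bar> \<le> B" and W: "\<And>j. continuous_on UNIV (W j)"
    and Wh: "\<And>j x. \<bar>W j x - h x\<bar> \<le> d j" and d: "d \<longlonglongrightarrow> 0"
  shows "graph_limit (\<lambda>j x. V j x - W j x) ((\<lambda>(u, v). (u, v - mult_L2 h u)) ` H)"
  unfolding graph_limit_def
proof safe
  fix u v assume "(u, v) \<in> H"
  then obtain \<phi> where \<phi>: "\<And>j. test_function (\<phi> j)" "(\<lambda>j. abs_L2 (\<phi> j)) \<longlonglongrightarrow> u" "(\<lambda>j. abs_L2 (schro (V j) (\<phi> j))) \<longlonglongrightarrow> v"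
    using gl unfolding graph_limit_def by blast
  have hm: "h \<in> borel_measurable borel" by (rule borel_measurable_continuous_onI[OF h(1)])
  let ?D = "\<lambda>j x. W j x - h x"
  have Dm: "?D j \<in> borel_measurable borel" for j
    by (intro borel_measurable_continuous_onI continuous_intros W h)
  note s = test_square_integrable[OF \<phi>(1)]
  have eq: "abs_L2 (schro (\<lambda>x. V j x - W j x) (\<phi> j))
      = abs_L2 (schro (V j) (\<phi> j)) - mult_L2 h (abs_L2 (\<phi> j)) - mult_L2 (?D j) (abs_L2 (\<phi> j))" for j
  proof -
    note sV = schro_square_integrable[OF V \<phi>(1), of j j]
    note sh = square_integrable_bounded_mult(1)[OF s hm h(2), of j]
    note sD = square_integrable_bounded_mult(1)[OF s Dm Wh, of j j]
    have "schro (\<lambda>x. V j x - W j x) (\<phi> j) = (\<lambda>x. schro (V j) (\<phi> j) x - of_real (h x) * \<phi> j x - of_real (?D j x) * \<phi> j x)"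
      by (simp add: schro_def fun_eq_iff algebra_simps)
    then show ?thesis
      unfolding mult_L2_abs[OF s hm h(2)] mult_L2_abs[OF s Dm Wh]
      by (simp only: abs_L2_diff[OF square_integrable_minus[OF sV sh] sD] abs_L2_diff[OF sV sh])
  qed
  have "(\<lambda>j. mult_L2 (?D j) (abs_L2 (\<phi> j))) \<longlonglongrightarrow> 0"
  proof (rule Lim_null_comparison[OF always_eventually])
    show "\<forall>j. norm (mult_L2 (?D j) (abs_L2 (\<phi> j))) \<le> d j * norm (abs_L2 (\<phi> j))"
      by (intro allI norm_mult_L2 Dm Wh)
    show "(\<lambda>j. d j * norm (abs_L2 (\<phi> j))) \<longlonglongrightarrow> 0"
      using tendsto_mult[OF d tendsto_norm[OF \<phi>(2)]] by simp
  qed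
  from tendsto_diff[OF tendsto_diff[OF \<phi>(3) tendsto_mult_L2[OF hm h(2) \<phi>(2)]] this]
  have "(\<lambda>j. abs_L2 (schro (\<lambda>x. V j x - W j x) (\<phi> j))) \<longlonglongrightarrow> v - mult_L2 h u" by (simp add: eq)
  then show "\<exists>\<phi>. (\<forall>j. test_function (\<phi> j)) \<and> (\<lambda>j. abs_L2 (\<phi> j)) \<longlonglongrightarrow> u \<and>
      (\<lambda>j. abs_L2 (schro (\<lambda>x. V j x - W j x) (\<phi> j))) \<longlonglongrightarrow> v - mult_L2 h u"
    using \<phi>(1,2) by blast
qed

lemma symmetric_op_perturb:
  assumes H: "symmetric_op H" and h: "h \<in> borel_measurable borel" "\<And>x. \<bar>h x\<bar> \<le> B"
  shows "symmetric_op ((\<lambda>(u, v). (u, v - mult_L2 h u)) ` H)"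
proof -
  have diff: "cinner (a - b) c = cinner a c - cinner b c" "cinner c (a - b) = cinner c a - cinner c b" for a b c :: "'a L2"
    using cinner_add_left[of "a - b" b c] cinner_add_right[of c "a - b" b] by simp_all
  show ?thesis
    using H unfolding symmetric_op_def by (fastforce simp: diff cinner_mult_L2[OF h])
qed

lemma conv_mollifier_close:
  fixes h :: "real^'n::finite \<Rightarrow> real"
  assumes \<rho>: "mollifier \<rho>" and h: "test_function h" and L: "\<And>x y. norm (h x - h y) \<le> L * norm (x - y)" "0 < L"
    and d: "0 < \<delta>"
  shows "\<bar>conv h (rescale \<delta> \<rho>) x - h x\<bar> \<le> L * \<delta> * (LINT y|lborel. \<bar>\<rho> y\<bar>)"
proof -
  note m = mollifier_rescale[OF \<rho> d]
  let ?r = "\<lambda>y. rescale \<delta> \<rho> (x - y)"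
  have t: "test_function ?r" by (rule test_reflect[OF m(1)])
  have tm: "rescale \<delta> \<rho> \<in> borel_measurable borel" by (rule test_measurable[OF m(1)])
  have i: "integrable lborel ?r" by (rule test_integrable[OF t])
  have ih: "integrable lborel (\<lambda>y. ?r y * h y)"
  proof -
    obtain R where "\<And>y. norm y > R \<Longrightarrow> h y = 0" using test_radius[OF h] by metis
    then show ?thesis
      by (intro integrable_continuous_support[of _ R] continuous_intros test_continuous t h) auto
  qed
  have one: "(LINT y|lborel. ?r y) = 1" using lborel_integral_reflect[OF tm, of x] m(3) by simp
  have "conv h (rescale \<delta> \<rho>) x - h x = (LINT y|lborel. ?r y * h y) - (LINT y|lborel. ?r y * h x)"
    by (simp add: conv_def one)
  also have "\<dots> = (LINT y|lborel. ?r y * h y - ?r y * h x)"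
    using i ih by simp
  finally have eq: "conv h (rescale \<delta> \<rho>) x - h x = (LINT y|lborel. ?r y * h y - ?r y * h x)" .
  have le: "\<bar>?r y * h y - ?r y * h x\<bar> \<le> L * \<delta> * \<bar>?r y\<bar>" for y
  proof (cases "norm (x - y) \<le> \<delta>")
    case True
    have "\<bar>h y - h x\<bar> \<le> L * norm (x - y)" using L(1)[of y x] by (simp add: norm_minus_commute)
    also have "\<dots> \<le> L * \<delta>" using True L(2) by simp
    finally have "\<bar>?r y\<bar> * \<bar>h y - h x\<bar> \<le> \<bar>?r y\<bar> * (L * \<delta>)" by (intro mult_left_mono) auto
    moreover have "?r y * h y - ?r y * h x = ?r y * (h y - h x)" by (simp add: algebra_simps)
    ultimately show ?thesis by (simp add: abs_mult mult.commute)
  qed (use m(2)[of "x - y"] in simp)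
  have "\<bar>conv h (rescale \<delta> \<rho>) x - h x\<bar> \<le> (LINT y|lborel. \<bar>?r y * h y - ?r y * h x\<bar>)"
    unfolding eq using integral_norm_bound[of lborel "\<lambda>y. ?r y * h y - ?r y * h x"] by simp
  also have "\<dots> \<le> (LINT y|lborel. L * \<delta> * \<bar>?r y\<bar>)"
    by (intro integral_mono le) (use i ih in auto)
  also have "\<dots> = L * \<delta> * (LINT y|lborel. \<bar>?r y\<bar>)" by simp
  also have "(LINT y|lborel. \<bar>?r y\<bar>) = (LINT y|lborel. \<bar>rescale \<delta> \<rho> y\<bar>)"
    using lborel_integral_reflect[of "\<lambda>y. \<bar>rescale \<delta> \<rho> y\<bar>" x] tm by simp
  finally show ?thesis by (simp add: m(4))
qed

lemma distn_conv_distn_minus: "distn_conv (distn_minus h T) \<phi> x = distn_conv T \<phi> x - conv h \<phi> x"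
  by (simp add: distn_conv_def distn_minus_def conv_def mult.commute)

lemma distn_conv_distn_translate: "distn_conv (distn_translate c T) \<phi> x = distn_conv T \<phi> (x - c)"
  by (simp add: distn_conv_def distn_translate_def algebra_simps)

text \<open>As \<open>m\<close> grows, the perturbation tends to the constant \<open>q\<close> boundedly, hence strongly as a multiplication
  operator.\<close>

lemma gap_perturb_const:
  fixes H :: "(real^'n::finite) op"
  assumes \<eta>: "test_function \<eta>" "\<And>x. norm x \<le> 1 \<Longrightarrow> \<eta> x = 1"
    and gaps: "\<And>m::nat. gap E r ((\<lambda>(u, v). (u, v - mult_L2 (\<lambda>x. q * \<eta> ((1 / real (Suc m)) *\<^sub>R x)) u)) ` H)"
    and uv: "(u, v) \<in> H"
  shows "r * norm u \<le> norm (v - (E + q) *\<^sub>R u)"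
proof -
  let ?h = "\<lambda>m x. q * \<eta> ((1 / real (Suc m)) *\<^sub>R x)"
  obtain B where B: "0 < B" "\<And>x. norm (\<eta> x) \<le> B" using test_bounded[OF \<eta>(1)] by metis
  have hB: "\<bar>?h m x\<bar> \<le> \<bar>q\<bar> * B" for m and x :: "real^'n" using B(2) by (simp add: abs_mult mult_left_mono)
  have \<eta>m: "\<eta> \<in> borel_measurable borel" by (rule test_measurable[OF \<eta>(1)])
  have hm: "?h m \<in> borel_measurable borel" for m
    by (intro borel_measurable_times measurable_compose[OF _ \<eta>m]) auto
  obtain f :: "real^'n \<Rightarrow> complex" where f: "square_integrable f" "u = abs_L2 f" using L2_obtain_function by metis
  have fm: "f \<in> borel_measurable borel" and fi: "integrable lborel (\<lambda>x. (cmod (f x))\<^sup>2)"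
    using f(1) by (auto simp: square_integrable_def)
  have lim: "(\<lambda>m. abs_L2 (\<lambda>x. of_real (?h m x) * f x)) \<longlonglongrightarrow> abs_L2 (\<lambda>x. of_real q * f x)"
  proof (rule L2_dominated_convergence(3))
    show "(\<lambda>x. of_real (?h m x) * f x) \<in> borel_measurable borel" for m
      using hm[of m] fm by measurable
    show "(\<lambda>x. of_real q * f x) \<in> borel_measurable borel"
      by (intro borel_measurable_times fm) auto
    show "(\<lambda>x. \<bar>q\<bar> * B * cmod (f x)) \<in> borel_measurable borel"
      using fm by measurable
    show "integrable lborel (\<lambda>x. (\<bar>q\<bar> * B * cmod (f x))\<^sup>2)"
      using fi by (simp add: power_mult_distrib)
    show "cmod (of_real (?h m x) * f x) \<le> \<bar>q\<bar> * B * cmod (f x)" for m and x :: "real^'n"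
      using mult_right_mono[OF hB[of m x], of "cmod (f x)"] by (simp only: norm_mult norm_of_real) simp
    show "AE x in lborel. (\<lambda>m. of_real (?h m x) * f x) \<longlonglongrightarrow> of_real q * f x"
    proof (rule AE_I2)
      fix x :: "real^'n"
      obtain k :: nat where k: "norm x \<le> real k" using real_arch_simple by blast
      have "\<forall>\<^sub>F m in sequentially. of_real (?h m x) * f x = of_real q * f x"
        using eventually_ge_at_top[of k]
      proof eventually_elim
        case (elim m)
        have "norm x \<le> real (Suc m)" using k elim by linarith
        then have "norm ((1 / real (Suc m)) *\<^sub>R x) \<le> 1" by (simp add: divide_simps)
        then show ?case using \<eta>(2) by simp
      qed
      then show "(\<lambda>m. of_real (?h m x) * f x) \<longlonglongrightarrow> of_real q * f x" by (rule tendsto_eventually)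
    qed
  qed
  have eq: "mult_L2 (?h m) u = abs_L2 (\<lambda>x. of_real (?h m x) * f x)" for m
    unfolding f(2) by (rule mult_L2_abs[OF f(1) hm hB])
  have "(\<lambda>m. mult_L2 (?h m) u) \<longlonglongrightarrow> q *\<^sub>R u"
    unfolding eq using lim by (simp add: abs_L2_scaleC f scaleC_simps(5)[symmetric])
  then have "(\<lambda>m. norm (v - mult_L2 (?h m) u - E *\<^sub>R u)) \<longlonglongrightarrow> norm (v - q *\<^sub>R u - E *\<^sub>R u)"
    by (intro tendsto_intros)
  moreover have "r * norm u \<le> norm (v - mult_L2 (?h m) u - E *\<^sub>R u)" for m
    using gaps[of m] uv by (force simp: gap_def)
  ultimately have "r * norm u \<le> norm (v - q *\<^sub>R u - E *\<^sub>R u)"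
    by (intro LIMSEQ_le_const) auto
  then show ?thesis by (simp add: algebra_simps)
qed

section \<open>Extracting a good sequence of mollifications\<close>

text \<open>Choose \<open>e\<^sub>j\<close> such that the first \<open>j\<close> variables are within \<open>1 / (j + 1)\<close> of their limits up to outer probability
  \<open>2\<^sup>-\<^sup>j\<close>, and apply the Borel-Cantelli lemma to measurable hulls of the exceptional sets.\<close>

lemma (in prob_space) tendsto_in_probability_extract:
  fixes X :: "nat \<Rightarrow> real \<Rightarrow> 'a \<Rightarrow> 'b::metric_space"
  assumes conv: "\<And>k. tendsto_in_probability M (X k) (Y k) (at_right 0)"
  obtains e where "\<And>j. 0 < e j" "\<And>j. e j < inverse (real (Suc j))"
    "AE \<omega> in M. \<forall>k. (\<lambda>j. X k (e j) \<omega>) \<longlonglongrightarrow> Y k \<omega>"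
proof -
  define B where "B k \<epsilon> \<delta> = {\<omega>\<in>space M. dist (X k \<epsilon> \<omega>) (Y k \<omega>) > \<delta>}" for k \<epsilon> \<delta>
  define P where "P j \<epsilon> \<longleftrightarrow> \<epsilon> \<in> {0<..<inverse (real (Suc j))} \<and>
    (\<forall>k\<in>{..j}. outer_measure_of M (B k \<epsilon> (inverse (real (Suc j)))) < ennreal ((1/2)^j))" for j \<epsilon>
  have "\<exists>\<epsilon>. \<epsilon> \<in> {0<..<inverse (real (Suc j))} \<and>
      (\<forall>k\<in>{..j}. outer_measure_of M (B k \<epsilon> (inverse (real (Suc j)))) < ennreal ((1/2)^j))" for j
  proof -
    have "\<forall>\<^sub>F \<epsilon> in at_right 0. outer_measure_of M (B k \<epsilon> (inverse (real (Suc j)))) < ennreal ((1/2)^j)" for k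
    proof (rule order_tendstoD(2))
      have "0 < inverse (real (Suc j))" by simp
      then show "((\<lambda>\<epsilon>. outer_measure_of M (B k \<epsilon> (inverse (real (Suc j))))) \<longlongrightarrow> 0) (at_right 0)"
        using conv[of k] unfolding tendsto_in_probability_def B_def by blast
    qed simp
    then have "\<forall>\<^sub>F \<epsilon> in at_right 0. \<forall>k\<in>{..j}. outer_measure_of M (B k \<epsilon> (inverse (real (Suc j)))) < ennreal ((1/2)^j)"
      by (intro eventually_ball_finite) auto
    then have "\<forall>\<^sub>F \<epsilon> in at_right 0. \<epsilon> \<in> {0<..<inverse (real (Suc j))} \<and>
        (\<forall>k\<in>{..j}. outer_measure_of M (B k \<epsilon> (inverse (real (Suc j)))) < ennreal ((1/2)^j))"
      by (intro eventually_conj eventually_at_right_real) auto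
    then show ?thesis by (rule eventually_happens'[rotated]) simp
  qed
  then have "\<forall>j. \<exists>\<epsilon>. P j \<epsilon>" unfolding P_def by blast
  then obtain e where "\<And>j. P j (e j)" unfolding choice_iff by blast
  then have e: "e j \<in> {0<..<inverse (real (Suc j))}"
    "k \<le> j \<Longrightarrow> outer_measure_of M (B k (e j) (inverse (real (Suc j)))) < ennreal ((1/2)^j)" for j k
    unfolding P_def by blast+
  have "AE \<omega> in M. (\<lambda>j. X k (e j) \<omega>) \<longlonglongrightarrow> Y k \<omega>" for k
  proof -
    have "\<exists>E\<in>sets M. B k (e j) (inverse (real (Suc j))) \<subseteq> E \<and>
        outer_measure_of M (B k (e j) (inverse (real (Suc j)))) = emeasure M E" for j
      by (rule outer_measure_of_attain) (auto simp: B_def)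
    then obtain E where E: "\<And>j. E j \<in> sets M" "\<And>j. B k (e j) (inverse (real (Suc j))) \<subseteq> E j"
      "\<And>j. outer_measure_of M (B k (e j) (inverse (real (Suc j)))) = emeasure M (E j)" by metis
    define A where "A j = (if k \<le> j then E j else {})" for j
    have A: "A j \<in> sets M" for j using E(1) by (simp add: A_def)
    have "measure M (A j) \<le> (1/2)^j" for j
    proof (cases "k \<le> j")
      case True
      then have "A j = E j" by (simp add: A_def)
      then have "emeasure M (A j) < ennreal ((1/2)^j)"
        using e(2)[OF True] unfolding E(3) by simp
      then have "ennreal (measure M (A j)) \<le> ennreal ((1/2)^j)"
        by (subst emeasure_eq_measure[symmetric]) (rule less_imp_le)
      then show ?thesis by (subst (asm) ennreal_le_iff) simp_all
    qed (simp add: A_def)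
    then have "summable (\<lambda>j. measure M (A j))"
      by (intro summable_comparison_test'[OF summable_geometric[of "1/2 :: real"]]) auto
    then have "AE \<omega> in M. eventually (\<lambda>j. \<omega> \<in> space M - A j) sequentially"
      by (intro borel_cantelli_AE1 A) (simp add: emeasure_eq_measure)
    then show ?thesis
    proof eventually_elim
      case (elim \<omega>)
      have "\<forall>\<^sub>F j in sequentially. dist (X k (e j) \<omega>) (Y k \<omega>) \<le> inverse (real (Suc j))"
        using elim eventually_ge_at_top[of k]
      proof eventually_elim
        case (elim j)
        then have "\<omega> \<notin> B k (e j) (inverse (real (Suc j)))" using E(2)[of j] by (auto simp: A_def)
        then show ?case using elim by (auto simp: B_def not_less)
      qed
      then have "(\<lambda>j. dist (X k (e j) \<omega>) (Y k \<omega>)) \<longlonglongrightarrow> 0"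
        by (intro tendsto_sandwich[OF always_eventually _ tendsto_const LIMSEQ_inverse_real_of_nat]) auto
      then show ?case by (rule tendsto_dist_iff[THEN iffD2])
    qed
  qed
  then have "AE \<omega> in M. \<forall>k. (\<lambda>j. X k (e j) \<omega>) \<longlonglongrightarrow> Y k \<omega>" by (simp add: AE_all_countable)
  then show ?thesis
    by (rule that[rotated 2]) (use e(1) in \<open>auto simp only: greaterThanLessThan_iff\<close>)
qed

lemma resolvent_mem:
  assumes H: "self_adjoint H" and z: "Im z \<noteq> 0"
  shows "(resolvent H z f, f + scaleC z (resolvent H z f)) \<in> H"
proof -
  obtain u where u: "(u, f + scaleC z u) \<in> H" using self_adjoint_range_nonreal[OF H z] by blast
  show ?thesis using resolvent_eq[OF self_adjointD(1,3)[OF H] z u] u by simp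
qed

lemma resolvent_contraction:
  assumes H: "self_adjoint H" and z: "\<bar>Im z\<bar> = 1"
  shows "norm (resolvent H z f - resolvent H z g) \<le> norm (f - g)"
proof -
  have nz: "Im z \<noteq> 0" using z by auto
  have "(resolvent H z f - resolvent H z g, f + scaleC z (resolvent H z f) - (g + scaleC z (resolvent H z g))) \<in> H"
    by (rule linear_operator_diff[OF self_adjointD(1)[OF H] resolvent_mem[OF H nz] resolvent_mem[OF H nz]])
  from symmetric_op_lower_bound[OF self_adjointD(3)[OF H] this, of z] z
  show ?thesis by (simp add: scaleC_diff_right algebra_simps)
qed

lemma resolvent_tendsto_dense:
  assumes H: "self_adjoint H" "\<And>j. self_adjoint (A j)" and z: "\<bar>Im z\<bar> = 1" and D: "closure D = UNIV"
    and lim: "\<And>f. f \<in> D \<Longrightarrow> (\<lambda>j::nat. resolvent (A j) z f) \<longlonglongrightarrow> resolvent H z f"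
  shows "(\<lambda>j. resolvent (A j) z f) \<longlonglongrightarrow> resolvent H z f"
proof (rule tendstoI)
  fix e :: real assume "0 < e"
  then have e: "0 < e / 3" by simp
  have "f \<in> closure D" using D by simp
  then obtain g where g: "g \<in> D" "dist g f < e / 3" using e unfolding closure_approachable by blast
  from tendstoD[OF lim[OF g(1)] e]
  show "\<forall>\<^sub>F j in sequentially. dist (resolvent (A j) z f) (resolvent H z f) < e"
  proof eventually_elim
    case (elim j)
    have "dist (resolvent (A j) z f) (resolvent (A j) z g) < e / 3"
      using resolvent_contraction[OF H(2)[of j] z, of f g] g(2) by (simp add: dist_norm norm_minus_commute)
    moreover have "dist (resolvent H z g) (resolvent H z f) < e / 3"
      using resolvent_contraction[OF H(1) z, of g f] g(2) by (simp add: dist_norm)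
    ultimately show ?case
      using elim dist_triangle[of "resolvent (A j) z f" "resolvent H z f" "resolvent (A j) z g"]
        dist_triangle[of "resolvent (A j) z g" "resolvent H z f" "resolvent H z g"] by linarith
  qed
qed

text \<open>If \<open>f = (H - z) u\<close>, then the vectors \<open>u\<^sub>j = (A\<^sub>j - z)\<^sup>-\<^sup>1 f\<close> satisfy \<open>u\<^sub>j \<rightarrow> u\<close> and \<open>A\<^sub>j u\<^sub>j = f + z u\<^sub>j \<rightarrow> H u\<close>, and each
  point of the graph of \<open>A\<^sub>j\<close>, a closure, is approximated by test functions.\<close>

lemma graph_limit_if_resolvents_tendsto:
  fixes V :: "nat \<Rightarrow> real^'n::finite \<Rightarrow> real"
  assumes A: "\<And>j. essentially_self_adjoint (schrodinger (V j))" and H: "self_adjoint H" and z: "Im z \<noteq> 0"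
    and lim: "\<And>f. (\<lambda>j. resolvent (closure (schrodinger (V j))) z f) \<longlonglongrightarrow> resolvent H z f"
  shows "graph_limit V H"
  unfolding graph_limit_def
proof safe
  fix u v assume uv: "(u, v) \<in> H"
  define f where "f = v - scaleC z u"
  have u: "resolvent H z f = u"
    by (rule resolvent_eq[OF self_adjointD(1,3)[OF H] z]) (simp add: f_def uv)
  define p where "p j = (resolvent (closure (schrodinger (V j))) z f, f + scaleC z (resolvent (closure (schrodinger (V j))) z f))" for j
  have p: "p \<longlonglongrightarrow> (u, v)"
  proof -
    have "p \<longlonglongrightarrow> (u, f + scaleC z u)"
      unfolding p_def u[symmetric] by (intro tendsto_intros lim)
    then show ?thesis by (simp add: f_def)
  qed
  have "\<exists>\<phi>. test_function \<phi> \<and> dist (abs_L2 \<phi>, abs_L2 (schro (V j) \<phi>)) (p j) < inverse (real (Suc j))" for j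
  proof -
    have sa: "self_adjoint (closure (schrodinger (V j)))" using A[of j] by (simp add: essentially_self_adjoint_def)
    have pc: "p j \<in> closure (schrodinger (V j))" unfolding p_def by (rule resolvent_mem[OF sa z])
    have "0 < inverse (real (Suc j))" by simp
    then obtain y where "y \<in> schrodinger (V j)" "dist y (p j) < inverse (real (Suc j))"
      using pc unfolding closure_approachable by blast
    then show ?thesis by (auto simp: schrodinger_eq)
  qed
  then obtain \<phi> where \<phi>: "\<And>j. test_function (\<phi> j)"
    "\<And>j. dist (abs_L2 (\<phi> j), abs_L2 (schro (V j) (\<phi> j))) (p j) < inverse (real (Suc j))" by metis
  have "(\<lambda>j. dist (abs_L2 (\<phi> j), abs_L2 (schro (V j) (\<phi> j))) (p j)) \<longlonglongrightarrow> 0"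
    using \<phi>(2) by (intro tendsto_sandwich[OF always_eventually always_eventually tendsto_const LIMSEQ_inverse_real_of_nat])
      (auto intro: less_imp_le)
  then have "(\<lambda>j. (abs_L2 (\<phi> j), abs_L2 (schro (V j) (\<phi> j)))) \<longlonglongrightarrow> (u, v)"
    by (intro Lim_transform[OF p]) (simp only: dist_norm tendsto_norm_zero_iff)
  from tendsto_fst[OF this] tendsto_snd[OF this]
  show "\<exists>\<phi>. (\<forall>j. test_function (\<phi> j)) \<and> (\<lambda>j. abs_L2 (\<phi> j)) \<longlonglongrightarrow> u \<and> (\<lambda>j. abs_L2 (schro (V j) (\<phi> j))) \<longlonglongrightarrow> v"
    using \<phi>(1) by auto
qed

section \<open>The spectrum of the limit\<close>

definition mollified_potential ::
    "(real^'n::finite \<Rightarrow> real) \<Rightarrow> (real \<Rightarrow> real) \<Rightarrow> (nat \<Rightarrow> real) \<Rightarrow> 'n distn \<Rightarrow> nat \<Rightarrow> real^'n \<Rightarrow> real" where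
  "mollified_potential \<rho> C e T j x = distn_conv T (rescale (e j) \<rho>) x + C (e j)"

lemma mollified_potential_continuous:
  assumes "mollifier \<rho>" "0 < e j" "distribution T"
  shows "continuous_on UNIV (mollified_potential \<rho> C e T j)"
proof -
  have "mollified_potential \<rho> C e T j = (\<lambda>x. distn_conv T (rescale (e j) \<rho>) x + C (e j))"
    by (simp add: mollified_potential_def fun_eq_iff)
  then show ?thesis
    using distn_conv_continuous[OF assms(3) mollifier_rescale(1)[OF assms(1,2)]]
    by (auto intro!: continuous_intros)
qed

definition gap_event ::
    "real \<Rightarrow> real \<Rightarrow> (real^'n::finite \<Rightarrow> real) \<Rightarrow> (real \<Rightarrow> real) \<Rightarrow> (nat \<Rightarrow> real) \<Rightarrow> 'n distn set" where
  "gap_event E r \<rho> C e = {T. distribution T \<and> asymptotic_gap E r (mollified_potential \<rho> C e T)}"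

text \<open>By \<open>asymptotic_gap_dense\<close> countably many conditions on resolvent norms suffice.\<close>

lemma gap_event_measurable:
  fixes \<rho> :: "real^'n::finite \<Rightarrow> real"
  assumes \<rho>: "mollifier \<rho>" and e: "\<And>j. 0 < e j"
  shows "gap_event E r \<rho> C e \<in> sets dspace"
proof -
  obtain D :: "(real^'n) L2 set" where D: "countable D" "closure D = UNIV" using L2_separable by auto
  let ?P = "\<lambda>T f k j. resolvent_norm (mollified_potential \<rho> C e T j) (Complex E 1) f * sqrt (r\<^sup>2 + 1) \<le> norm f + inverse (real (Suc k))"
  have "gap_event E r \<rho> C e = {T\<in>space dspace. \<forall>f\<in>D. \<forall>k. \<exists>J. \<forall>j\<in>{J..}. ?P T f k j}"
  proof (intro set_eqI iffI)
    fix T assume "T \<in> gap_event E r \<rho> C e"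
    then have "distribution T" "\<forall>\<^sub>F j in sequentially. ?P T f k j" for f k
      by (simp_all add: gap_event_def asymptotic_gap_def del: of_nat_Suc)
    then show "T \<in> {T\<in>space dspace. \<forall>f\<in>D. \<forall>k. \<exists>J. \<forall>j\<in>{J..}. ?P T f k j}"
      by (simp add: eventually_sequentially Ball_def del: of_nat_Suc)
  next
    fix T assume T: "T \<in> {T\<in>space dspace. \<forall>f\<in>D. \<forall>k. \<exists>J. \<forall>j\<in>{J..}. ?P T f k j}"
    have "asymptotic_gap E r (mollified_potential \<rho> C e T)"
      by (rule asymptotic_gap_dense[OF D(2)]) (use T in \<open>simp add: eventually_sequentially Ball_def del: of_nat_Suc\<close>)
    then show "T \<in> gap_event E r \<rho> C e" using T by (simp add: gap_event_def)
  qed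
  also have "\<dots> \<in> sets dspace"
  proof (intro sets.sets_Collect_countable_All'[OF _ D(1)] sets.sets_Collect_countable_All
      sets.sets_Collect_countable_Ex sets.sets_Collect_countable_All')
    fix f k J j
    have "(\<lambda>T. resolvent_norm (\<lambda>x. distn_conv T (rescale (e j) \<rho>) x + C (e j)) (Complex E 1) f) \<in> borel_measurable dspace"
      by (rule resolvent_norm_measurable[OF mollifier_rescale(1)[OF \<rho> e]])
    then have [measurable]: "(\<lambda>T. resolvent_norm (mollified_potential \<rho> C e T j) (Complex E 1) f) \<in> borel_measurable dspace"
      unfolding mollified_potential_def .
    show "{T\<in>space dspace. ?P T f k j} \<in> sets dspace" by measurable
  qed auto
  finally show ?thesis .
qed

lemma gap_event_translation:
  assumes \<rho>: "mollifier \<rho>" and e: "\<And>j. 0 < e j" and T: "distribution T"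
  shows "distn_translate c T \<in> gap_event E r \<rho> C e \<longleftrightarrow> T \<in> gap_event E r \<rho> C e"
proof -
  have cont: "continuous_on UNIV (mollified_potential \<rho> C e S j)" if "distribution S" for S j
    by (rule mollified_potential_continuous[OF \<rho> e that])
  have tr: "mollified_potential \<rho> C e (distn_translate c T) = (\<lambda>j x. mollified_potential \<rho> C e T j (x - c))"
    by (simp add: fun_eq_iff mollified_potential_def distn_conv_distn_translate)
  then have inv: "mollified_potential \<rho> C e T = (\<lambda>j x. mollified_potential \<rho> C e (distn_translate c T) j (x - (- c)))"
    by (simp add: fun_eq_iff)
  have "asymptotic_gap E r (mollified_potential \<rho> C e T) \<longleftrightarrow> asymptotic_gap E r (mollified_potential \<rho> C e (distn_translate c T))"
  proof
    assume "asymptotic_gap E r (mollified_potential \<rho> C e T)"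
    then show "asymptotic_gap E r (mollified_potential \<rho> C e (distn_translate c T))"
      unfolding tr by (rule asymptotic_gap_translate[OF cont[OF T]])
  next
    assume "asymptotic_gap E r (mollified_potential \<rho> C e (distn_translate c T))"
    from asymptotic_gap_translate[OF cont[OF distribution_distn_translate[OF T]] this, of "- c"]
    show "asymptotic_gap E r (mollified_potential \<rho> C e T)" using inv by simp
  qed
  then show ?thesis using T distribution_distn_translate[OF T] by (simp add: gap_event_def)
qed

text \<open>Subtracting \<open>h\<close> from the noise subtracts the mollifications of \<open>h\<close> from the potentials, and these converge
  uniformly; so the limiting operator becomes \<open>H - h\<close>.\<close>

lemma gap_after_perturbation:
  fixes \<rho> h :: "real^'n::finite \<Rightarrow> real"
  assumes \<rho>: "mollifier \<rho>" and e: "\<And>j. 0 < e j" "e \<longlonglongrightarrow> 0" and T: "distribution T" and h: "test_function h"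
    and H: "symmetric_op H" and gl: "graph_limit (mollified_potential \<rho> C e T) H"
    and r: "0 \<le> r" and mem: "distn_minus h T \<in> gap_event E r \<rho> C e"
  shows "gap E r ((\<lambda>(u, v). (u, v - mult_L2 h u)) ` H)"
proof -
  note t = mollifier_rescale(1)[OF \<rho> e(1)]
  obtain B where B: "\<And>x. \<bar>h x\<bar> \<le> B" using test_bounded[OF h] by (metis real_norm_def)
  obtain L where L: "0 < L" "\<And>x y. norm (h x - h y) \<le> L * norm (x - y)" using test_Lipschitz[OF h] by metis
  have hc: "continuous_on UNIV h" by (rule test_continuous[OF h])
  define W where "W j = conv h (rescale (e j) \<rho>)" for j
  have eq: "mollified_potential \<rho> C e (distn_minus h T) = (\<lambda>j x. mollified_potential \<rho> C e T j x - W j x)"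
    by (simp add: fun_eq_iff mollified_potential_def distn_conv_distn_minus W_def)
  have Wc: "continuous_on UNIV (W j)" for j
  proof -
    have "loc_integrable h"
      unfolding loc_integrable_def
      by (intro conjI allI integrable_mult_indicator test_integrable[OF h] test_measurable[OF h]) simp
    from smooth_continuous[OF smooth_conv[OF this t]] show ?thesis unfolding W_def by simp
  qed
  have Wh: "\<bar>W j x - h x\<bar> \<le> L * e j * (LINT y|lborel. \<bar>\<rho> y\<bar>)" for j x
    unfolding W_def by (rule conv_mollifier_close[OF \<rho> h L(2,1) e(1)])
  have lim: "(\<lambda>j. L * e j * (LINT y|lborel. \<bar>\<rho> y\<bar>)) \<longlonglongrightarrow> 0"
    using tendsto_mult_right[OF tendsto_mult_left[OF e(2), of L], of "LINT y|lborel. \<bar>\<rho> y\<bar>"] by simp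
  have cT: "continuous_on UNIV (mollified_potential \<rho> C e T j)" for j
    by (rule mollified_potential_continuous[OF \<rho> e(1) T])
  show ?thesis
  proof (rule asymptotic_gap_imp_gap)
    show "graph_limit (\<lambda>j x. mollified_potential \<rho> C e T j x - W j x) ((\<lambda>(u, v). (u, v - mult_L2 h u)) ` H)"
      by (rule graph_limit_perturb[OF gl cT hc B Wc Wh lim])
    show "continuous_on UNIV (\<lambda>x. mollified_potential \<rho> C e T j x - W j x)" for j
      by (intro continuous_intros cT Wc)
    show "symmetric_op ((\<lambda>(u, v). (u, v - mult_L2 h u)) ` H)"
      by (rule symmetric_op_perturb[OF H borel_measurable_continuous_onI[OF hc] B])
    show "asymptotic_gap E r (\<lambda>j x. mollified_potential \<rho> C e T j x - W j x)"
      using mem by (simp add: gap_event_def eq)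
  qed (rule r)
qed

text \<open>The gaps pass to the constants \<open>q\<close> by \<open>gap_perturb_const\<close>. So \<open>H\<close> has a gap at a dense set of real
  numbers, with the same \<open>r\<close>, hence at all of them; and then the whole space is trivial, which is absurd.\<close>

lemma no_gap_under_all_perturbations:
  fixes H :: "(real^'n::finite) op"
  assumes H: "self_adjoint H" and r: "0 < r" and \<rho>: "mollifier (\<rho> :: real^'n \<Rightarrow> real)"
    and \<eta>: "test_function \<eta>" "\<And>x. norm x \<le> 1 \<Longrightarrow> \<eta> x = 1"
    and gaps: "\<And>q (m::nat). gap E r ((\<lambda>(u, v). (u, v - mult_L2 (\<lambda>x. real_of_rat q * \<eta> ((1 / real (Suc m)) *\<^sub>R x)) u)) ` H)"
  shows False
proof -
  have low: "r * norm u \<le> norm (v - l *\<^sub>R u)" if uv: "(u, v) \<in> H" for u v and l :: real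
  proof (rule field_le_epsilon)
    fix d :: real assume d: "0 < d"
    define d' where "d' = d / (norm u + 1)"
    have d': "0 < d'" using d by (simp add: d'_def add_nonneg_pos)
    obtain q where q: "l - E < real_of_rat q" "real_of_rat q < l - E + d'"
      using of_rat_dense[of "l - E" "l - E + d'"] d' by auto
    have "r * norm u \<le> norm (v - (E + real_of_rat q) *\<^sub>R u)"
      by (rule gap_perturb_const[OF \<eta> gaps uv])
    also have "\<dots> \<le> norm (v - l *\<^sub>R u) + norm ((E + real_of_rat q - l) *\<^sub>R u)"
      using norm_triangle_ineq4[of "v - l *\<^sub>R u" "(E + real_of_rat q - l) *\<^sub>R u"] by (simp add: algebra_simps)
    also have "norm ((E + real_of_rat q - l) *\<^sub>R u) \<le> d' * (norm u + 1)"
      unfolding norm_scaleR using q d' by (intro mult_mono) auto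
    also have "\<dots> = d" by (simp add: d'_def add_nonneg_eq_0_iff)
    finally show "r * norm u \<le> norm (v - l *\<^sub>R u) + d" by simp
  qed
  have zero: "f = 0" for f :: "(real^'n) L2"
    by (rule self_adjoint_not_bounded_below_everywhere[OF H r low])
  have \<rho>t: "test_function \<rho>" and \<rho>1: "(LINT x|lborel. \<rho> x) = 1" using \<rho> by (auto simp: mollifier_def)
  let ?c = "\<lambda>x. complex_of_real (\<rho> x)"
  have sq: "square_integrable ?c"
  proof -
    obtain R where "\<And>x. norm x > R \<Longrightarrow> \<rho> x = 0" using test_radius[OF \<rho>t] by metis
    then show ?thesis
      by (intro square_integrable_continuous_support[of _ R] continuous_intros test_continuous[OF \<rho>t]) auto
  qed
  have "abs_L2 ?c = abs_L2 (\<lambda>x. 0)" using zero by metis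
  then have "AE x in lborel. ?c x = 0" using abs_L2_eq_iff[OF sq square_integrable_zero] by simp
  then have "AE x in lborel. \<rho> x = 0" by simp
  then have "(LINT x|lborel. \<rho> x) = 0" by (rule integral_eq_zero_AE)
  then show False using \<rho>1 by simp
qed

theorem theorem2:
  fixes M :: "'w measure"
    and \<xi> :: "'w \<Rightarrow> 'n::finite distn"
    and \<rho> :: "real^'n \<Rightarrow> real"
    and C :: "real \<Rightarrow> real"
    and H :: "'w \<Rightarrow> (real^'n) op"
  assumes "prob_space M"
    and "CARD('n) \<in> {2, 3}"
    and "white_noise M \<xi>"
    and "mollifier \<rho>"
    and "renormalisation_constant M \<xi> \<rho> C"
    and "AE \<omega> in M. self_adjoint (H \<omega>)"
    and "strong_resolvent_limit_in_probability M
           (\<lambda>\<epsilon> \<omega>. self_adjoint_extension (schrodinger (\<lambda>x. mollify \<rho> \<epsilon> (\<xi> \<omega>) x + C \<epsilon>)))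
           H (at_right 0)"
  shows "AE \<omega> in M. spectrum (H \<omega>) = \<real>"
proof -
  interpret prob_space M by (rule assms(1))
  note wn = \<open>white_noise M \<xi>\<close> and \<rho> = \<open>mollifier \<rho>\<close>
  define A where "A \<epsilon> \<omega> = schrodinger (\<lambda>x. mollify \<rho> \<epsilon> (\<xi> \<omega>) x + C \<epsilon>)" for \<epsilon> \<omega>
  obtain D :: "(real^'n) L2 set" where D: "countable D" "closure D = UNIV" using L2_separable by auto
  have "D \<noteq> {}" using D(2) by auto
  have rangeD: "range (from_nat_into D) = D" by (rule range_from_nat_into[OF \<open>D \<noteq> {}\<close> D(1)])
  obtain e where e: "\<And>j. 0 < e j" "\<And>j. e j < inverse (real (Suc j))"
    and lim: "AE \<omega> in M. \<forall>k. (\<lambda>j. resolvent (self_adjoint_extension (A (e j) \<omega>)) \<i> (from_nat_into D k))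
      \<longlonglongrightarrow> resolvent (H \<omega>) \<i> (from_nat_into D k)"
  proof (rule tendsto_in_probability_extract[of "\<lambda>k \<epsilon> \<omega>. resolvent (self_adjoint_extension (A \<epsilon> \<omega>)) \<i> (from_nat_into D k)"
        "\<lambda>k \<omega>. resolvent (H \<omega>) \<i> (from_nat_into D k)"])
    have "\<i> \<notin> \<real>" by (simp add: complex_is_Real_iff)
    then show "tendsto_in_probability M (\<lambda>\<epsilon> \<omega>. resolvent (self_adjoint_extension (A \<epsilon> \<omega>)) \<i> (from_nat_into D k))
        (\<lambda>\<omega>. resolvent (H \<omega>) \<i> (from_nat_into D k)) (at_right 0)" for k
      using assms(7) unfolding strong_resolvent_limit_in_probability_def A_def by blast
  qed blast
  have e0: "e \<longlonglongrightarrow> 0"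
    by (rule tendsto_sandwich[OF always_eventually always_eventually tendsto_const LIMSEQ_inverse_real_of_nat])
      (use e in \<open>auto intro: less_imp_le simp only:\<close>)
  let ?V = "\<lambda>\<omega>. mollified_potential \<rho> C e (\<xi> \<omega>)"
  have dist: "distribution (\<xi> \<omega>)" if "\<omega> \<in> space M" for \<omega> using white_noiseD(1)[OF wn that] .
  have Vc: "continuous_on UNIV (?V \<omega> j)" if "\<omega> \<in> space M" for \<omega> j
    by (rule mollified_potential_continuous[OF \<rho> e(1) dist[OF that]])
  have A_eq: "A (e j) \<omega> = schrodinger (?V \<omega> j)" for j \<omega>
  proof -
    have "(\<lambda>x. mollify \<rho> (e j) (\<xi> \<omega>) x + C (e j)) = ?V \<omega> j"
      by (simp add: fun_eq_iff mollified_potential_def mollify_eq_distn_conv)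
    then show ?thesis by (simp add: A_def)
  qed
  have "AE \<omega> in M. \<forall>j. \<forall>c. subquadratic_growth (\<lambda>x. distn_conv (\<xi> \<omega>) (rescale (e j) \<rho>) x + c)"
    unfolding AE_all_countable
    using growth_white_noise[OF wn mollifier_rescale(1)[OF \<rho> e(1)]] assms(2) by auto
  then have esa: "AE \<omega> in M. \<forall>j. essentially_self_adjoint (schrodinger (?V \<omega> j))"
    using AE_space
  proof eventually_elim
    case (elim \<omega>)
    have "subquadratic_growth (?V \<omega> j)" for j
    proof -
      have "?V \<omega> j = (\<lambda>x. distn_conv (\<xi> \<omega>) (rescale (e j) \<rho>) x + C (e j))" by (simp add: fun_eq_iff mollified_potential_def)
      then show ?thesis using elim by simp
    qed
    then show ?case using essentially_self_adjoint_schrodinger[OF \<rho> Vc[OF elim(2)]] by blast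
  qed
  have gl: "AE \<omega> in M. graph_limit (?V \<omega>) (H \<omega>)"
    using lim esa assms(6)
  proof eventually_elim
    case (elim \<omega>)
    have sa: "self_adjoint (closure (schrodinger (?V \<omega> j)))" for j
      using elim(2) by (simp add: essentially_self_adjoint_def)
    have "(\<lambda>j. resolvent (closure (schrodinger (?V \<omega> j))) \<i> f) \<longlonglongrightarrow> resolvent (H \<omega>) \<i> f" for f
    proof (rule resolvent_tendsto_dense[OF elim(3) sa _ D(2)])
      fix f assume "f \<in> D"
      then obtain k where "f = from_nat_into D k" using rangeD by blast
      then show "(\<lambda>j. resolvent (closure (schrodinger (?V \<omega> j))) \<i> f) \<longlonglongrightarrow> resolvent (H \<omega>) \<i> f"
        using elim(1) elim(2) by (simp add: A_eq self_adjoint_extension_eq)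
    qed simp
    then show ?case using elim(2,3) by (intro graph_limit_if_resolvents_tendsto[where z = \<i>]) auto
  qed
  (* Zero-one law and Cameron-Martin shift, for a fixed rational centre p and radius q. *)
  have "AE \<omega> in M. \<not> gap (real_of_rat p) (real_of_rat q) (H \<omega>)" if q: "0 < q" for p q
  proof -
    define G where "G = gap_event (real_of_rat p) (real_of_rat q) \<rho> C e"
    have G: "G \<in> sets dspace" unfolding G_def by (rule gap_event_measurable[OF \<rho> e(1)])
    have qr: "0 < real_of_rat q" using q by simp
    obtain \<eta> :: "real^'n \<Rightarrow> real" where \<eta>: "test_function \<eta>" "\<And>x. norm x \<le> 1 \<Longrightarrow> \<eta> x = 1"
      using cutoff_exists[OF \<rho>] by metis
    have meas: "{\<omega>\<in>space M. \<xi> \<omega> \<in> G} \<in> events"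
      using measurable_sets[OF white_noiseD(5)[OF wn] G] by (simp add: vimage_def Int_def conj_commute)
    have "prob {\<omega>\<in>space M. \<xi> \<omega> \<in> G} \<noteq> 1"
    proof
      assume "prob {\<omega>\<in>space M. \<xi> \<omega> \<in> G} = 1"
      then have AEG: "AE \<omega> in M. \<xi> \<omega> \<in> G" using AE_in_set_eq_1[OF meas] by (auto elim: eventually_mono)
      (* Countably many shifts: the rational constants s, cut off at radius m + 1. *)
      let ?h = "\<lambda>(s::rat) (m::nat) x. real_of_rat s * \<eta> ((1 / real (Suc m)) *\<^sub>R x)"
      have ht: "test_function (?h s m)" for s m
        using test_cmult[OF test_affine[OF \<eta>(1), of "1 / real (Suc m)" 0], of "real_of_rat s"] by simp
      have "AE \<omega> in M. \<forall>s m. distn_minus (?h s m) (\<xi> \<omega>) \<in> G"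
        unfolding AE_all_countable by (intro allI white_noise_shift[OF wn ht G AEG])
      then have "AE \<omega> in M. False"
        using gl assms(6) AE_space
      proof eventually_elim
        case (elim \<omega>)
        have gaps: "gap (real_of_rat p) (real_of_rat q) ((\<lambda>(u, v). (u, v - mult_L2 (?h s m) u)) ` H \<omega>)" for s m
          using elim(1) by (intro gap_after_perturbation[OF \<rho> e(1) e0 dist[OF elim(4)] ht self_adjointD(3)[OF elim(3)] elim(2)])
            (use qr in \<open>auto simp: G_def\<close>)
        show ?case by (rule no_gap_under_all_perturbations[OF elim(3) qr \<rho> \<eta> gaps])
      qed
      then show False by simp
    qed
    moreover have "prob {\<omega>\<in>space M. \<xi> \<omega> \<in> G} = 0 \<or> prob {\<omega>\<in>space M. \<xi> \<omega> \<in> G} = 1"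
      by (rule white_noise_zero_one[OF wn G]) (simp only: G_def gap_event_translation[OF \<rho> e(1)])
    ultimately have "AE \<omega> in M. \<xi> \<omega> \<notin> G"
      using prob_eq_0[OF meas] by (auto elim: AE_mp)
    then show ?thesis
      using gl assms(6) AE_space
    proof eventually_elim
      case (elim \<omega>)
      show ?case
      proof
        assume "gap (real_of_rat p) (real_of_rat q) (H \<omega>)"
        from gap_imp_asymptotic_gap[OF elim(2) Vc[OF elim(4)] elim(3) less_imp_le[OF qr] this]
        show False using elim(1) dist[OF elim(4)] by (simp add: G_def gap_event_def)
      qed
    qed
  qed
  then have "AE \<omega> in M. \<forall>p q. 0 < q \<longrightarrow> \<not> gap (real_of_rat p) (real_of_rat q) (H \<omega>)"
    unfolding AE_all_countable by (simp add: AE_all_countable)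
  then show ?thesis
    using assms(6)
  proof eventually_elim
    case (elim \<omega>)
    then show ?case by (intro spectrum_eq_Reals) auto
  qed
qed

end
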